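(* Consider a sequence of generalized Jackson networks satisfying all the assumptions listed in the context. Let $M>0$ be a constant such that, for all $\theta\in\mathbb{R}^d$ with $\|\theta\|\le M$, all $n\ge1$, $i\in\mathcal{E}$, $j\in\mathcal{J}$, the equations $$e^{\theta_i}\,\mathbb{E}\big(e^{\eta\,\min(T_{e,i}^{(n)},1/r_n)}\big)=1,\qquad t_j(\theta)\,\mathbb{E}\big(e^{\zeta\,\min(T_{s,j}^{(n)},1/r_n)}\big)=1$$ have finite real solutions $\eta=\eta_i^{(n)}(\theta_i)$ and $\zeta=\zeta_j^{(n)}(\theta)$, where $t_j(\theta)=e^{-\theta_j}\big(\sum_{k\in\mathcal{J}}p_{jk}e^{\theta_k}+p_{j0}\big)$. For $j\in\mathcal{J}$ and $\theta\in\mathbb{R}^d$ with $\theta\le0$ define $$\varphi^{(n)}(\theta)=\mathbb{E}\big[e^{\langle\theta,Z^{(n)}(\infty)\rangle}\big],\qquad \varphi_j^{(n)}(\theta)=\mathbb{E}\big[e^{\langle\theta,Z^{(n)}(\infty)\rangle}\,\big|\,Z_j^{(n)}(\infty)=0\big],$$ $$\gamma(\theta)=\tfrac12\langle\theta,\Sigma\theta\rangle-\langle Rb,\theta\rangle,\qquad \gamma_j(\theta)=\langle R^{(j)},\theta\rangle,$$ where $R^{(j)}$ is the $j$th column of $R$, and let $$\epsilon^{(n)}(\theta)=\gamma(\theta)\varphi^{(n)}(\theta)+\sum_{j\in\mathcal{J}}b_j\gamma_j(\theta)\varphi_j^{(n)}(\theta),\qquad n\ge1,\ \theta\le0.$$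 Then $$\lim_{n\to\infty}\ \sup_{\theta<0,\ 0<\|\theta\|\le M}\frac{|\epsilon^{(n)}(\theta)|}{\|\theta\|}=0.$$
   Context: Inequalities between vectors are componentwise; $\|\cdot\|$ is the Euclidean norm on $\mathbb{R}^d$, $\langle\cdot,\cdot\rangle$ the Euclidean inner product. Networks. Let $d\ge1$, $\mathcal{J}=\{1,\dots,d\}$, $\mathcal{E}\subset\mathcal{J}$. The routing matrix $P=(p_{ij})_{i,j\in\mathcal{J}}$ is nonnegative with row sums at most $1$, does not depend on $n$, and $I-P$ is invertible with $(I-P)^{-1}=\sum_{k\ge0}P^k$; $p_{i0}=1-\sum_j p_{ij}$. The $n$th generalized Jackson network has $d$ single-server FIFO stations. External customers arrive at station $i\in\mathcal{E}$ according to a renewal process with i.i.d. nonnegative interarrival times distributed as $T_{e,i}^{(n)}$, with mean $1/\lambda_{e,i}^{(n)}\in(0,\infty)$ and finite variance $(\sigma_{e,i}^{(n)})^2$; there are no external arrivals at stations outside $\mathcal{E}$ (convention: $\lambda_{e,i}^{(n)}=0=\sigma_{e,i}^{(n)}$, and likewise for the limits, for $i\notin\mathcal{E}$). Service times at station $j\in\mathcal{J}$ are i.i.d. nonnegative, distributed as $T_{s,j}^{(n)}$, with mean $1/\lambda_{s,j}^{(n)}\in(0,\infty)$ and finite variance $(\sigma_{s,j}^{(n)})^2$. A customer completing service at $i$ goes to $j$ with probability $p_{ij}$ and leaves the network with probability $p_{i0}$. All interarrival times, service times and routing decisions are independent. The vector of total arrival rates is $\lambda_a^{(n)}=(I-P^{T})^{-1}\lambda_e^{(n)}$,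 where ${}^T$ is transpose. Markov process. $X^{(n)}(t)=(L^{(n)}(t),R_e^{(n)}(t),R_s^{(n)}(t))\in\mathbb{Z}_+^d\times\mathbb{R}_+^{d}\times\mathbb{R}_+^{d}$, where $L_i^{(n)}(t)$ is the number of customers at station $i$ (including the one in service), $R_{e,i}^{(n)}(t)$ is the residual time to the next external arrival at $i$ ($0$ if $i\notin\mathcal{E}$), and $R_{s,i}^{(n)}(t)$ is the residual service time at $i$, set equal to the service time of the next customer to be served at $i$ if the station is empty. $X^{(n)}(\infty)=(L^{(n)}(\infty),R_e^{(n)}(\infty),R_s^{(n)}(\infty))$ denotes a random vector with the stationary distribution of $X^{(n)}$, and $Z^{(n)}(\infty)=r_nL^{(n)}(\infty)$. Assumptions. (i) There exist $b\in\mathbb{R}^d$ with all components positive and positive numbers $r_n\to0$ with $\lambda_s^{(n)}-\lambda_a^{(n)}=r_nb$ for all $n$. (ii) Each $X^{(n)}$ is positive Harris recurrent. (iii) For $i\in\mathcal{E}$: $\sigma_{e,i}^{(n)}\to\sigma_{e,i}<\infty$, $\lambda_{e,i}^{(n)}\to\lambda_{e,i}\in(0,\infty)$; for $j\in\mathcal{J}$: $\sigma_{s,j}^{(n)}\to\sigma_{s,j}<\infty$. (iv) $\{(T_{e,i}^{(n)})^2\}_{n\ge1}$ ($i\in\mathcal{E}$) and $\{(T_{s,j}^{(n)})^2\}_{n\ge1}$ ($j\in\mathcal{J}$) are uniformly integrable. (v) $\Sigma$ below is positive definite. Limit data. $\lambda_{s}:=\lim_n\lambda_{s}^{(n)}=\lim_n\lambda_a^{(n)}=(I-P^T)^{-1}\lambda_e$,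 $R=I-P^T$, and, with $\delta_{ij}$ the Kronecker delta, $$\Sigma_{ij}=\sum_{k\in\mathcal{J}}\lambda_{s,k}\big[p_{ki}(\delta_{ij}-p_{kj})+\lambda_{s,k}^2\sigma_{s,k}^2(p_{ki}-\delta_{ki})(p_{kj}-\delta_{kj})\big]+\lambda_{e,i}^3\sigma_{e,i}^2\delta_{ij}.$$ *)

theory Defs
  imports "HOL-Probability.Probability"
begin

text \<open>
  Stations are the elements of a finite type \<^typ>\<open>'d\<close>, so vectors of \<open>R^d\<close> are
  \<^typ>\<open>real^'d\<close>. A network is given by the set \<open>E\<close> of stations with external
  arrivals, the routing matrix \<open>P\<close>, and the laws \<open>Te i\<close> (interarrival times, relevant for
  \<open>i \<in> E\<close> only) and \<open>Ts j\<close> (service times). A state \<open>(l, u, v)\<close> consists of the numbers of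
  customers, the residual interarrival times and the residual service times.
\<close>

section \<open>Primitive data\<close>

definition time_law :: "real measure \<Rightarrow> bool" where
  "time_law \<mu> \<longleftrightarrow> prob_space \<mu> \<and> sets \<mu> = sets borel \<and> (AE x in \<mu>. 0 \<le> x) \<and>
     integrable \<mu> (\<lambda>x. x) \<and> 0 < (\<integral>x. x \<partial>\<mu>) \<and> integrable \<mu> (\<lambda>x. x\<^sup>2)"

definition law_rate :: "real measure \<Rightarrow> real" where
  "law_rate \<mu> = 1 / (\<integral>x. x \<partial>\<mu>)"

definition law_sd :: "real measure \<Rightarrow> real" where
  "law_sd \<mu> = sqrt (\<integral>x. (x - (\<integral>y. y \<partial>\<mu>))\<^sup>2 \<partial>\<mu>)"

definition ext_rate :: "'d::finite set \<Rightarrow> ('d \<Rightarrow> real measure) \<Rightarrow> real^'d" where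
  "ext_rate E Te = (\<chi> i. if i \<in> E then law_rate (Te i) else 0)"

definition ext_sd :: "'d::finite set \<Rightarrow> ('d \<Rightarrow> real measure) \<Rightarrow> real^'d" where
  "ext_sd E Te = (\<chi> i. if i \<in> E then law_sd (Te i) else 0)"

definition svc_rate :: "('d::finite \<Rightarrow> real measure) \<Rightarrow> real^'d" where
  "svc_rate Ts = (\<chi> j. law_rate (Ts j))"

definition svc_sd :: "('d::finite \<Rightarrow> real measure) \<Rightarrow> real^'d" where
  "svc_sd Ts = (\<chi> j. law_sd (Ts j))"

definition exit_prob :: "real^'d^'d \<Rightarrow> 'd::finite \<Rightarrow> real" where
  "exit_prob P i = 1 - (\<Sum>j\<in>UNIV. P $ i $ j)"

text \<open>Powers are iterated matrix products: \<open>P ^ k\<close> on this type would be entrywise.\<close>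

definition routing_matrix :: "real^'d^'d::finite \<Rightarrow> bool" where
  "routing_matrix P \<longleftrightarrow> (\<forall>i j. 0 \<le> P $ i $ j) \<and> (\<forall>i. (\<Sum>j\<in>UNIV. P $ i $ j) \<le> 1) \<and>
     invertible (mat 1 - P) \<and> (\<lambda>k. (((**) P) ^^ k) (mat 1)) sums matrix_inv (mat 1 - P)"

definition total_rate ::
    "'d::finite set \<Rightarrow> real^'d^'d \<Rightarrow> ('d \<Rightarrow> real measure) \<Rightarrow> real^'d" where
  "total_rate E P Te = matrix_inv (mat 1 - transpose P) *v ext_rate E Te"

text \<open>Uniform integrability of \<open>f(T\<^sub>n)\<close> where \<open>T\<^sub>n\<close> has law \<open>\<mu> n\<close>.\<close>

definition unif_integrable :: "(nat \<Rightarrow> real measure) \<Rightarrow> (real \<Rightarrow> real) \<Rightarrow> bool" where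
  "unif_integrable \<mu> f \<longleftrightarrow> (\<forall>n. f \<in> borel_measurable (\<mu> n)) \<and>
     ((\<lambda>K. SUP n. \<integral>\<^sup>+x. ennreal \<bar>f x\<bar> * indicator {x. K \<le> \<bar>f x\<bar>} x \<partial>\<mu> n) \<longlongrightarrow> 0) at_top"

section \<open>The Markov process of a network\<close>

type_synonym 'd state = "(nat^'d) \<times> (real^'d) \<times> (real^'d)"

definition state_algebra :: "'d::finite state measure" where
  "state_algebra = count_space UNIV \<Otimes>\<^sub>M (borel \<Otimes>\<^sub>M borel)"

definition state_space :: "'d::finite set \<Rightarrow> 'd state set" where
  "state_space E = {(l, u, v). (\<forall>i. 0 \<le> u $ i \<and> 0 \<le> v $ i) \<and> (\<forall>i. i \<notin> E \<longrightarrow> u $ i = 0)}"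

text \<open>
  Sample points \<open>(U, V, \<Phi>)\<close>: \<open>U (i, k)\<close> is the interarrival time that starts with the \<open>k\<close>-th
  external arrival at \<open>i\<close> after time 0, \<open>V (j, k)\<close> the service time that starts to be
  recorded with the \<open>k\<close>-th departure from \<open>j\<close>, and \<open>\<Phi> (j, k)\<close> the destination of the
  \<open>k\<close>-th customer departing from \<open>j\<close> (\<open>None\<close>: leaves the network), counting from \<open>k = 0\<close>.
  All coordinates are independent.
\<close>

type_synonym 'd sample = "('d \<times> nat \<Rightarrow> real) \<times> ('d \<times> nat \<Rightarrow> real) \<times> ('d \<times> nat \<Rightarrow> 'd option)"

definition routing_pmf :: "real^'d^'d \<Rightarrow> 'd::finite \<Rightarrow> 'd option pmf" where
  "routing_pmf P j = embed_pmf (\<lambda>dest. case dest of None \<Rightarrow> exit_prob P j | Some k \<Rightarrow> P $ j $ k)"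

definition sample_measure ::
    "'d::finite set \<Rightarrow> real^'d^'d \<Rightarrow> ('d \<Rightarrow> real measure) \<Rightarrow> ('d \<Rightarrow> real measure) \<Rightarrow> 'd sample measure"
  where
  "sample_measure E P Te Ts =
     PiM (E \<times> UNIV) (\<lambda>(i, k). Te i) \<Otimes>\<^sub>M
     (PiM UNIV (\<lambda>(j, k). Ts j) \<Otimes>\<^sub>M PiM UNIV (\<lambda>(j, k). measure_pmf (routing_pmf P j)))"

text \<open>Arrival clocks always run; the service clock of a station runs only while it is nonempty.\<close>

fun running_clocks :: "'d::finite set \<Rightarrow> 'd state \<Rightarrow> real set" where
  "running_clocks E (l, u, v) = {u $ i | i. i \<in> E} \<union> {v $ i | i. 0 < l $ i}"

text \<open>
  If no clock runs (\<open>E = {}\<close> and an empty network) nothing can ever happen again, and the value 1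
  only lets time pass.
\<close>

definition time_to_event :: "'d::finite set \<Rightarrow> 'd state \<Rightarrow> real" where
  "time_to_event E x = (if running_clocks E x = {} then 1 else Min (running_clocks E x))"

fun run_clocks :: "'d::finite set \<Rightarrow> real \<Rightarrow> 'd state \<Rightarrow> 'd state" where
  "run_clocks E h (l, u, v) =
     (l, \<chi> i. if i \<in> E then u $ i - h else u $ i, \<chi> i. if 0 < l $ i then v $ i - h else v $ i)"

text \<open>
  A configuration records the time of the last event, the state just after it, and the numbers of
  external arrivals and of departures so far at each station. In one step, all running clocks
  that expire first are processed together. Since every station consumes its own sequences, the
  state reached once all events at a given time are processed does not depend on their order; events
  that become due at the same time (because of a time equal to 0) follow in later steps of length 0.
\<close>

type_synonym 'd config = "real \<times> 'd state \<times> ('d \<Rightarrow> nat) \<times> ('d \<Rightarrow> nat)"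

fun event_step :: "'d::finite set \<Rightarrow> 'd sample \<Rightarrow> 'd config \<Rightarrow> 'd config" where
  "event_step E (U, V, \<Phi>) (s, (l, u, v), a, c) =
     (let h = time_to_event E (l, u, v);
          A = {i \<in> E. u $ i = h};
          D = {j. 0 < l $ j \<and> v $ j = h};
          (_, u', v') = run_clocks E h (l, u, v)
      in (s + h,
          (\<chi> i. l $ i - (if i \<in> D then 1 else 0) + (if i \<in> A then 1 else 0)
                 + card {j \<in> D. \<Phi> (j, c j) = Some i},
           \<chi> i. if i \<in> A then U (i, a i) else u' $ i,
           \<chi> i. if i \<in> D then V (i, c i) else v' $ i),
          \<lambda>i. if i \<in> A then Suc (a i) else a i,
          \<lambda>i. if i \<in> D then Suc (c i) else c i))"

definition event_config ::
    "'d::finite set \<Rightarrow> 'd sample \<Rightarrow> 'd state \<Rightarrow> nat \<Rightarrow> 'd config" where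
  "event_config E \<omega> x m = (event_step E \<omega> ^^ m) (0, x, \<lambda>_. 0, \<lambda>_. 0)"

text \<open>
  \<open>process E x t \<omega>\<close> is \<open>X(t)\<close> started from \<open>x\<close>, after all events up to and including time \<open>t\<close>
  (right-continuous; in particular clocks that are due in \<open>x\<close> fire at time 0). The greatest index
  exists for almost all \<open>\<omega>\<close>, since the means of the time laws are positive.
\<close>

definition process :: "'d::finite set \<Rightarrow> 'd state \<Rightarrow> real \<Rightarrow> 'd sample \<Rightarrow> 'd state" where
  "process E x t \<omega> =
     (let m = (GREATEST m. fst (event_config E \<omega> x m) \<le> t);
          (s, y, _) = event_config E \<omega> x m
      in run_clocks E (t - s) y)"

definition transition ::
    "'d::finite set \<Rightarrow> real^'d^'d \<Rightarrow> ('d \<Rightarrow> real measure) \<Rightarrow> ('d \<Rightarrow> real measure)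
      \<Rightarrow> real \<Rightarrow> 'd state \<Rightarrow> 'd state measure" where
  "transition E P Te Ts t x = distr (sample_measure E P Te Ts) state_algebra (process E x t)"

definition stationary ::
    "'d::finite set \<Rightarrow> real^'d^'d \<Rightarrow> ('d \<Rightarrow> real measure) \<Rightarrow> ('d \<Rightarrow> real measure)
      \<Rightarrow> 'd state measure \<Rightarrow> bool" where
  "stationary E P Te Ts \<pi> \<longleftrightarrow>
     prob_space \<pi> \<and> sets \<pi> = sets state_algebra \<and> (AE x in \<pi>. x \<in> state_space E) \<and>
     (\<forall>t\<ge>0. \<forall>B\<in>sets state_algebra. (\<integral>\<^sup>+x. emeasure (transition E P Te Ts t x) B \<partial>\<pi>) = emeasure \<pi> B)"

text \<open>
  Harris recurrence: for some nontrivial sigma-finite measure \<open>\<psi>\<close>, every \<open>\<psi>\<close>-positive set is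
  almost surely occupied for an infinite amount of time, from every initial state. The invariant
  measure is then unique up to multiples, and the process is positive if it is finite.
\<close>

definition harris_recurrent ::
    "'d::finite set \<Rightarrow> real^'d^'d \<Rightarrow> ('d \<Rightarrow> real measure) \<Rightarrow> ('d \<Rightarrow> real measure) \<Rightarrow> bool" where
  "harris_recurrent E P Te Ts \<longleftrightarrow>
     (\<exists>\<psi>. sigma_finite_measure \<psi> \<and> sets \<psi> = sets (restrict_space state_algebra (state_space E)) \<and>
        emeasure \<psi> (state_space E) \<noteq> 0 \<and>
        (\<forall>B\<in>sets \<psi>. 0 < emeasure \<psi> B \<longrightarrow>
           (\<forall>x\<in>state_space E. AE \<omega> in sample_measure E P Te Ts.
              (\<integral>\<^sup>+t. indicator {0..} t * indicator B (process E x t \<omega>) \<partial>lborel) = \<infinity>)))"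

definition positive_harris_recurrent ::
    "'d::finite set \<Rightarrow> real^'d^'d \<Rightarrow> ('d \<Rightarrow> real measure) \<Rightarrow> ('d \<Rightarrow> real measure) \<Rightarrow> bool" where
  "positive_harris_recurrent E P Te Ts \<longleftrightarrow>
     harris_recurrent E P Te Ts \<and> (\<exists>\<pi>. stationary E P Te Ts \<pi>)"

section \<open>Limit data and transforms\<close>

definition kdelta :: "'d \<Rightarrow> 'd \<Rightarrow> real" where
  "kdelta i j = (if i = j then 1 else 0)"

definition reflection :: "real^'d^'d \<Rightarrow> real^'d^'d::finite" where
  "reflection P = mat 1 - transpose P"

definition covariance ::
    "real^'d^'d \<Rightarrow> real^'d \<Rightarrow> real^'d \<Rightarrow> real^'d \<Rightarrow> real^'d \<Rightarrow> real^'d^'d::finite" where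
  "covariance P lamE sigE lamS sigS = (\<chi> i j.
     (\<Sum>k\<in>UNIV. lamS $ k * (P $ k $ i * (kdelta i j - P $ k $ j)
         + (lamS $ k)\<^sup>2 * (sigS $ k)\<^sup>2 * (P $ k $ i - kdelta k i) * (P $ k $ j - kdelta k j)))
     + (lamE $ i) ^ 3 * (sigE $ i)\<^sup>2 * kdelta i j)"

definition t_fun :: "real^'d^'d \<Rightarrow> 'd::finite \<Rightarrow> real^'d \<Rightarrow> real" where
  "t_fun P j \<theta> = exp (- \<theta> $ j) * ((\<Sum>k\<in>UNIV. P $ j $ k * exp (\<theta> $ k)) + exit_prob P j)"

definition scaled_queue :: "real \<Rightarrow> 'd::finite state \<Rightarrow> real^'d" where
  "scaled_queue r x = (\<chi> i. r * real (fst x $ i))"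

definition phi :: "real \<Rightarrow> 'd::finite state measure \<Rightarrow> real^'d \<Rightarrow> real" where
  "phi r \<pi> \<theta> = (\<integral>x. exp (\<theta> \<bullet> scaled_queue r x) \<partial>\<pi>)"

text \<open>\<^term>\<open>uniform_measure \<pi> A\<close> is \<open>\<pi>\<close> conditioned on the event \<open>A\<close>.\<close>

definition phi_cond :: "real \<Rightarrow> 'd::finite state measure \<Rightarrow> 'd \<Rightarrow> real^'d \<Rightarrow> real" where
  "phi_cond r \<pi> j \<theta> =
     (\<integral>x. exp (\<theta> \<bullet> scaled_queue r x) \<partial>uniform_measure \<pi> {x. scaled_queue r x $ j = 0})"

definition gamma :: "real^'d^'d \<Rightarrow> real^'d^'d \<Rightarrow> real^'d \<Rightarrow> real^'d::finite \<Rightarrow> real" where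
  "gamma S R b \<theta> = 1/2 * (\<theta> \<bullet> (S *v \<theta>)) - (R *v b) \<bullet> \<theta>"

definition gamma_bdry :: "real^'d^'d \<Rightarrow> 'd::finite \<Rightarrow> real^'d \<Rightarrow> real" where
  "gamma_bdry R j \<theta> = column j R \<bullet> \<theta>"

definition eps ::
    "real^'d^'d \<Rightarrow> real^'d^'d \<Rightarrow> real^'d \<Rightarrow> real \<Rightarrow> 'd state measure \<Rightarrow> real^'d::finite \<Rightarrow> real" where
  "eps S R b r \<pi> \<theta> = gamma S R b \<theta> * phi r \<pi> \<theta>
     + (\<Sum>j\<in>UNIV. b $ j * gamma_bdry R j \<theta> * phi_cond r \<pi> j \<theta>)"

end

(*
  Apply the basic adjoint relation of the stationary process to
  exp (<tau, L> + sum_i eta_i min(R_e,i, 1/r) + sum_j zeta_j min(R_s,j, 1/r)) with tau = r theta. For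
  the roots eta_i = eta_i(tau_i) and zeta_j = zeta_j(tau), a firing clock leaves the conditional
  expectation of this function unchanged, so only its drift along the running clocks remains:
  up to truncation errors, (sum_i eta_i + sum_j zeta_j) E[F] = sum_j zeta_j E[F; L_j = 0]. Uniform
  integrability of the squares gives the expansion of the roots, sum_i eta_i + sum_j zeta_j =
  - r^2 gamma(theta) + o(r^2 |theta|) and zeta_j = r lambda_j gamma_j(theta) + O(r^2 |theta|), and
  P(L_j = 0) = r b_j / lambda_j with lambda_j the service rate at j. It remains to replace F by
  exp <tau, L>. The truncated residual times are uniformly integrable under the stationary laws, so
  their expectations over {L_j = 0} vanish in the limit; the frozen service clock of an idle station
  carries a fresh service time that is independent of the station being idle. The estimates
  hold along every sequence theta_n with 0 < |theta_n| <= M, which gives uniformity in theta.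
*)

theory Submission
  imports Defs "HOL-Library.Landau_Symbols"
begin

section \<open>Product measures\<close>

text \<open>The process is given pathwise, as a function of three families of independent entries,
  so its Markov property has to be proved. Resampling does this: entries not yet read may be
  exchanged for those of an independent copy without changing the law. Expectations are never
  differentiated in time; averaging over an independent exponential time turns the adjoint relation
  into a resolvent identity for bounded functions. Truncating the clocks at 1/r serves the same end:
  the roots are O(r), so the exponents stay bounded. Errors are measured against r^2 |theta|, where
  |theta| may itself vanish. Each root has order r |theta|, but their sum is one order smaller: the
  linear terms cancel by the traffic equation up to the drift r b, provided that the prelimit rates
  are kept in them. An initial residual service time need not be fresh; it is washed out because
  every station serves infinitely many customers. This holds because every station is reachable from
  external arrivals, which is extracted from the positive definiteness of the covariance
  matrix.\<close>

lemma measurable_resample: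
  "(\<lambda>(x, y) i. if i \<in> J then y i else x i) \<in> PiM I M \<Otimes>\<^sub>M PiM I M \<rightarrow>\<^sub>M PiM I M"
  unfolding split_beta'
proof (rule measurable_PiM_single')
  fix i assume i: "i \<in> I"
  show "(\<lambda>\<omega>. if i \<in> J then snd \<omega> i else fst \<omega> i) \<in> PiM I M \<Otimes>\<^sub>M PiM I M \<rightarrow>\<^sub>M M i"
    using i by (cases "i \<in> J") simp_all
qed (auto simp: space_pair_measure space_PiM PiE_def extensional_def Pi_iff)

text \<open>Under the resampling map a cylinder over L pulls back to a rectangle: the factors
  indexed by \<open>L - J\<close> constrain the old point and those indexed by
  \<open>L \<inter> J\<close> the new one. The two measures multiply to the product over all of
  L.\<close>

lemma PiM_resample:
  assumes M: "\<And>i. i \<in> I \<Longrightarrow> prob_space (M i)"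
  shows "distr (PiM I M \<Otimes>\<^sub>M PiM I M) (PiM I M) (\<lambda>(x, y) i. if i \<in> J then y i else x i) = PiM I M"
    (is "distr _ _ ?f = _")
proof (rule measure_eqI_PiM_infinite[symmetric, OF refl])
  interpret P: prob_space "PiM I M" using M by (rule prob_space_PiM)
  show "finite_measure (PiM I M)" by unfold_locales
  fix A L assume L: "finite L" "L \<subseteq> I" and A: "\<And>i. i \<in> L \<Longrightarrow> A i \<in> sets (M i)"
  let ?X = "\<lambda>L. prod_emb I M L (Pi\<^sub>E L A)"
  have X: "?X L' \<in> sets (PiM I M)" if "L' \<subseteq> L" for L'
    using that L A by (intro sets_PiM_I) (auto dest: finite_subset)
  have e: "emeasure (PiM I M) (?X L') = (\<Prod>i\<in>L'. emeasure (M i) (A i))" if "L' \<subseteq> L" for L'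
    using that L A by (intro emeasure_PiM_emb M) (auto dest: finite_subset)
  have "emeasure (PiM I M) (?X L) = emeasure (PiM I M) (?X (L - J)) * emeasure (PiM I M) (?X (L \<inter> J))"
    using L by (simp add: e prod.Int_Diff[of L _ J] mult.commute)
  also have "\<dots> = emeasure (PiM I M \<Otimes>\<^sub>M PiM I M) (?X (L - J) \<times> ?X (L \<inter> J))"
    by (intro P.emeasure_pair_measure_Times[symmetric] X) auto
  also have "?X (L - J) \<times> ?X (L \<inter> J) = ?f -` ?X L \<inter> space (PiM I M \<Otimes>\<^sub>M PiM I M)"
    using L by (auto simp: prod_emb_def space_pair_measure space_PiM PiE_iff extensional_def subset_iff
        split: if_splits)
  finally show "emeasure (PiM I M) (?X L) = emeasure (distr (PiM I M \<Otimes>\<^sub>M PiM I M) (PiM I M) ?f) (?X L)"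
    using X[of L] by (simp add: emeasure_distr measurable_resample)
qed simp

lemma nn_integral_pair_mult:
  assumes "sigma_finite_measure N" and [measurable]: "u \<in> borel_measurable M" "v \<in> borel_measurable N"
  shows "(\<integral>\<^sup>+z. u (fst z) * v (snd z) \<partial>(M \<Otimes>\<^sub>M N)) = (\<integral>\<^sup>+x. u x \<partial>M) * (\<integral>\<^sup>+y. v y \<partial>N)"
proof -
  interpret sigma_finite_measure N by fact
  show ?thesis
    by (subst nn_integral_fst[symmetric]) (simp_all add: nn_integral_cmult nn_integral_multc)
qed

text \<open>Reduces resampling of a whole sample point to resampling of each of its three families.
  On a rectangle the four independent arguments separate, and the integral is the product of the two
  given identities.\<close>

lemma distr_pair_pair:
  assumes "prob_space M" "prob_space N"
    and f[measurable]: "(\<lambda>(x, y). f x y) \<in> M \<Otimes>\<^sub>M M \<rightarrow>\<^sub>M M"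
    and g[measurable]: "(\<lambda>(x, y). g x y) \<in> N \<Otimes>\<^sub>M N \<rightarrow>\<^sub>M N"
    and df: "distr (M \<Otimes>\<^sub>M M) M (\<lambda>(x, y). f x y) = M"
    and dg: "distr (N \<Otimes>\<^sub>M N) N (\<lambda>(x, y). g x y) = N"
  shows "distr ((M \<Otimes>\<^sub>M N) \<Otimes>\<^sub>M (M \<Otimes>\<^sub>M N)) (M \<Otimes>\<^sub>M N)
     (\<lambda>(x, y). (f (fst x) (fst y), g (snd x) (snd y))) = M \<Otimes>\<^sub>M N"
    (is "distr ?Q _ ?F = _")
proof (rule pair_measure_eqI[symmetric])
  interpret M: prob_space M by fact
  interpret N: prob_space N by fact
  interpret MN: pair_prob_space M N ..
  show "sigma_finite_measure M" "sigma_finite_measure N" by unfold_locales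
  show "sets (M \<Otimes>\<^sub>M N) = sets (distr ?Q (M \<Otimes>\<^sub>M N) ?F)" by simp
  have f'[measurable]: "(\<lambda>z. f (p z) (q z)) \<in> K \<rightarrow>\<^sub>M M"
    if "p \<in> K \<rightarrow>\<^sub>M M" "q \<in> K \<rightarrow>\<^sub>M M" for p q and K :: "'z measure"
    using measurable_compose[OF measurable_Pair[OF that] f] by simp
  have g'[measurable]: "(\<lambda>z. g (p z) (q z)) \<in> K \<rightarrow>\<^sub>M N"
    if "p \<in> K \<rightarrow>\<^sub>M N" "q \<in> K \<rightarrow>\<^sub>M N" for p q and K :: "'z measure"
    using measurable_compose[OF measurable_Pair[OF that] g] by simp
  have F: "?F \<in> ?Q \<rightarrow>\<^sub>M M \<Otimes>\<^sub>M N" unfolding split_beta' by measurable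
  fix A B assume A[measurable]: "A \<in> sets M" and B[measurable]: "B \<in> sets N"
  have eA: "emeasure M A = (\<integral>\<^sup>+x. \<integral>\<^sup>+y. indicator A (f x y) \<partial>M \<partial>M)"
  proof -
    have "emeasure M A = emeasure (distr (M \<Otimes>\<^sub>M M) M (\<lambda>(x, y). f x y)) A" by (simp add: df)
    also have "\<dots> = (\<integral>\<^sup>+z. indicator A (f (fst z) (snd z)) \<partial>(M \<Otimes>\<^sub>M M))"
      by (subst nn_integral_indicator[symmetric], simp, subst nn_integral_distr) (simp_all add: split_beta')
    finally show ?thesis by (subst (asm) M.nn_integral_fst[symmetric]) simp_all
  qed
  have eB: "emeasure N B = (\<integral>\<^sup>+x. \<integral>\<^sup>+y. indicator B (g x y) \<partial>N \<partial>N)"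
  proof -
    have "emeasure N B = emeasure (distr (N \<Otimes>\<^sub>M N) N (\<lambda>(x, y). g x y)) B" by (simp add: dg)
    also have "\<dots> = (\<integral>\<^sup>+z. indicator B (g (fst z) (snd z)) \<partial>(N \<Otimes>\<^sub>M N))"
      by (subst nn_integral_indicator[symmetric], simp, subst nn_integral_distr) (simp_all add: split_beta')
    finally show ?thesis by (subst (asm) N.nn_integral_fst[symmetric]) simp_all
  qed
  have "emeasure (distr ?Q (M \<Otimes>\<^sub>M N) ?F) (A \<times> B)
      = (\<integral>\<^sup>+z. indicator (A \<times> B) (?F z) \<partial>?Q)"
    by (subst nn_integral_indicator[symmetric], simp, subst nn_integral_distr) (simp_all add: F)
  also have "\<dots> = (\<integral>\<^sup>+x. \<integral>\<^sup>+y. indicator A (f (fst x) (fst y)) * indicator B (g (snd x) (snd y))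
      \<partial>(M \<Otimes>\<^sub>M N) \<partial>(M \<Otimes>\<^sub>M N))"
    by (subst MN.nn_integral_fst[symmetric]) (simp_all add: split_beta' indicator_times)
  also have "\<dots> = (\<integral>\<^sup>+x. (\<integral>\<^sup>+y. indicator A (f (fst x) y) \<partial>M) * (\<integral>\<^sup>+y. indicator B (g (snd x) y) \<partial>N)
      \<partial>(M \<Otimes>\<^sub>M N))"
  proof (rule nn_integral_cong)
    fix x assume "x \<in> space (M \<Otimes>\<^sub>M N)"
    then have [simp]: "fst x \<in> space M" "snd x \<in> space N" by (auto simp: space_pair_measure)
    show "(\<integral>\<^sup>+y. indicator A (f (fst x) (fst y)) * indicator B (g (snd x) (snd y)) \<partial>(M \<Otimes>\<^sub>M N))
       = (\<integral>\<^sup>+y. indicator A (f (fst x) y) \<partial>M) * (\<integral>\<^sup>+y. indicator B (g (snd x) y) \<partial>N)"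
      by (rule nn_integral_pair_mult[where u="\<lambda>y. indicator A (f (fst x) y)" and v="\<lambda>y. indicator B (g (snd x) y)"])
        (simp_all add: N.sigma_finite_measure_axioms)
  qed
  also have "\<dots> = emeasure M A * emeasure N B"
    unfolding eA eB
    by (rule nn_integral_pair_mult[where u="\<lambda>x. \<integral>\<^sup>+y. indicator A (f x y) \<partial>M" and v="\<lambda>x. \<integral>\<^sup>+y. indicator B (g x y) \<partial>N"])
        (simp_all add: N.sigma_finite_measure_axioms)
  finally show "emeasure M A * emeasure N B = emeasure (distr ?Q (M \<Otimes>\<^sub>M N) ?F) (A \<times> B)" ..
qed

text \<open>For a sum \<open>S\<^sub>n\<close> of n i.i.d. terms, \<open>E exp (- S\<^sub>n)\<close> is the n-th power of a number less than 1.\<close>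

lemma AE_PiM_sum_unbounded:
  fixes g :: "'b \<Rightarrow> real"
  assumes M: "\<And>i. i \<in> I \<Longrightarrow> prob_space (M i)" and p: "inj p" "\<And>n::nat. p n \<in> I" "\<And>n. M (p n) = \<nu>"
    and g[measurable]: "g \<in> borel_measurable \<nu>" and g0: "AE x in \<nu>. 0 \<le> g x"
    and q: "\<not> (AE x in \<nu>. g x = 0)"
  shows "AE x in PiM I M. \<forall>C. \<exists>n. C < (\<Sum>k<n. g (x (p k)))"
proof -
  interpret P: prob_space "PiM I M" using M by (rule prob_space_PiM)
  interpret \<nu>: prob_space \<nu> using M[OF p(2), of 0] p(3)[of 0] by simp
  have [measurable]: "(\<lambda>x. x (p k)) \<in> PiM I M \<rightarrow>\<^sub>M \<nu>" for k
    using measurable_component_singleton[OF p(2)[of k], of M] p(3)[of k] by simp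
  have int: "integrable \<nu> (\<lambda>x. exp (- g x))"
    by (rule \<nu>.integrable_const_bound[where B=1]) (use g0 in auto)
  define Q where "Q = (\<integral>x. exp (- g x) \<partial>\<nu>)"
  have Q0: "0 \<le> Q" unfolding Q_def by simp
  have Q1: "Q < 1"
  proof -
    have "Q \<le> (\<integral>x. 1 \<partial>\<nu>)" unfolding Q_def
      by (rule integral_mono_AE) (use g0 int in auto)
    moreover have "Q \<noteq> 1"
    proof
      assume "Q = 1"
      then have "(\<integral>x. 1 - exp (- g x) \<partial>\<nu>) = 0" using int by (simp add: Q_def \<nu>.prob_space)
      then have "AE x in \<nu>. 1 - exp (- g x) = 0"
        by (subst (asm) integral_nonneg_eq_0_iff_AE) (use g0 int in auto)
      with q show False by simp
    qed
    ultimately show ?thesis by (simp add: \<nu>.prob_space)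
  qed
  have E: "(\<integral>x. exp (- (\<Sum>k<n. g (x (p k)))) \<partial>PiM I M) = Q ^ n" for n
  proof -
    interpret F: product_sigma_finite "\<lambda>_::nat. \<nu>" by standard
    have "PiM {..<n} (\<lambda>_. \<nu>) = distr (PiM I M) (PiM {..<n} (\<lambda>_. \<nu>)) (\<lambda>\<omega>. \<lambda>k\<in>{..<n}. \<omega> (p k))"
      using distr_PiM_reindex[of I M p "{..<n}", OF M inj_on_subset[OF p(1)]] p by auto
    moreover have "(\<integral>x. exp (- (\<Sum>k<n. g (x (p k)))) \<partial>PiM I M)
      = (\<integral>x. (\<Prod>k<n. exp (- g (x k))) \<partial>distr (PiM I M) (PiM {..<n} (\<lambda>_. \<nu>)) (\<lambda>\<omega>. \<lambda>k\<in>{..<n}. \<omega> (p k)))"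
      by (subst integral_distr) (auto simp: exp_sum[symmetric] sum_negf)
    ultimately show ?thesis
      using F.product_integral_prod[of "{..<n}" "\<lambda>_ x. exp (- g x)"] int by (simp add: Q_def)
  qed
  have intn: "integrable (PiM I M) (\<lambda>x. exp (- (\<Sum>k<n. g (x (p k)))))" for n
  proof (rule P.integrable_const_bound[where B=1])
    have "AE x in PiM I M. \<forall>k. 0 \<le> g (x (p k))"
      unfolding AE_all_countable
    proof
      fix k
      have "AE x in M (p k). 0 \<le> g x" unfolding p(3) by (rule g0)
      with M p(2) show "AE x in PiM I M. 0 \<le> g (x (p k))" by (rule AE_PiM_component)
    qed
    then show "AE x in PiM I M. norm (exp (- (\<Sum>k<n. g (x (p k))))) \<le> 1"
      by eventually_elim (simp add: sum_nonneg)
  qed measurable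
  have *: "AE x in PiM I M. \<exists>n. C < (\<Sum>k<n. g (x (p k)))" for C
  proof -
    let ?B = "{x \<in> space (PiM I M). \<forall>n. (\<Sum>k<n. g (x (p k))) \<le> C}"
    have B[measurable]: "?B \<in> sets (PiM I M)" by measurable
    \<comment> \<open>Markov's inequality for \<open>exp (- S)\<close>, where S is the n-th partial
      sum; on \<open>?B\<close> it is at most C.\<close>
    have "P.prob ?B \<le> exp C * Q ^ n" for n
    proof -
      have "P.prob ?B = (\<integral>x. indicator ?B x \<partial>PiM I M)" using P.emeasure_finite by simp
      also have "\<dots> \<le> (\<integral>x. exp C * exp (- (\<Sum>k<n. g (x (p k)))) \<partial>PiM I M)"
      proof (rule integral_mono)
        show "integrable (PiM I M) (indicator ?B :: _ \<Rightarrow> real)" by (rule integrable_real_indicator[OF B]) (simp add: P.emeasure_eq_measure)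
        show "integrable (PiM I M) (\<lambda>x. exp C * exp (- (\<Sum>k<n. g (x (p k)))))" using intn by simp
        show "indicator ?B x \<le> exp C * exp (- (\<Sum>k<n. g (x (p k))))" for x
          by (auto simp: indicator_def exp_add[symmetric])
      qed
      finally show ?thesis using E by simp
    qed
    moreover have "(\<lambda>n. exp C * Q ^ n) \<longlonglongrightarrow> 0"
      using LIMSEQ_realpow_zero[OF Q0 Q1] by (intro tendsto_mult_right_zero)
    ultimately have "P.prob ?B \<le> 0" using LIMSEQ_le_const by blast
    then have "?B \<in> null_sets (PiM I M)" using B by (simp add: P.emeasure_eq_measure null_sets_def measure_le_0_iff)
    then show ?thesis by (rule AE_I') (auto simp: not_less)
  qed
  have "AE x in PiM I M. \<forall>m::nat. \<exists>n. real m < (\<Sum>k<n. g (x (p k)))"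
    unfolding AE_all_countable using * by blast
  then show ?thesis
  proof eventually_elim
    case (elim x)
    show ?case
    proof
      fix C :: real
      obtain m :: nat where "C \<le> real m" using real_arch_simple by blast
      with elim show "\<exists>n. C < (\<Sum>k<n. g (x (p k)))" by (meson le_less_trans)
    qed
  qed
qed

section \<open>Vectors over a finite index type\<close>

lemma borel_measurable_vec_lambda:
  fixes f :: "'n::finite \<Rightarrow> 'a \<Rightarrow> real"
  assumes [measurable]: "\<And>i. f i \<in> borel_measurable M"
  shows "(\<lambda>x. \<chi> i. f i x) \<in> borel_measurable M"
proof -
  have "(\<chi> i. f i x) = (\<Sum>i\<in>UNIV. f i x *\<^sub>R axis i 1)" for x
    by (simp add: vec_eq_iff axis_def if_distrib cong: if_cong)
  then show ?thesis by simp
qed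

lemma borel_measurable_vec_nth[measurable (raw)]:
  "f \<in> borel_measurable M \<Longrightarrow> (\<lambda>x. (f x :: real^'n::finite) $ i) \<in> borel_measurable M"
  by (rule borel_measurable_continuous_on[OF _ ]) (auto intro!: continuous_intros)

section \<open>Measurability of the network process\<close>

lemma measurable_countable_combine:
  fixes h :: "'x::countable \<Rightarrow> 'y::countable \<Rightarrow> 'z"
  assumes "f \<in> M \<rightarrow>\<^sub>M count_space UNIV" "g \<in> M \<rightarrow>\<^sub>M count_space UNIV"
  shows "(\<lambda>x. h (f x) (g x)) \<in> M \<rightarrow>\<^sub>M count_space UNIV"
  by (rule measurable_compose_countable[OF _ assms(1)], rule measurable_compose_countable[OF _ assms(2)]) simp

lemma measurable_countableI:
  fixes f :: "'a \<Rightarrow> 'b::countable"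
  assumes "\<And>a. f -` {a} \<inter> space M \<in> sets M"
  shows "f \<in> M \<rightarrow>\<^sub>M count_space UNIV"
  using assms by (simp add: measurable_count_space_eq2_countable)

lemma measurable_vec_count_space:
  fixes f :: "'a \<Rightarrow> nat^'d::finite"
  assumes [measurable]: "\<And>i. (\<lambda>x. f x $ i) \<in> M \<rightarrow>\<^sub>M count_space UNIV"
  shows "f \<in> M \<rightarrow>\<^sub>M count_space UNIV"
proof (rule measurable_countableI)
  fix a :: "nat^'d"
  have "f -` {a} \<inter> space M = {x \<in> space M. \<forall>i. f x $ i = a $ i}" by (auto simp: vec_eq_iff)
  also have "\<dots> \<in> sets M" by measurable
  finally show "f -` {a} \<inter> space M \<in> sets M" .
qed

lemma measurable_fun_count_space:
  fixes f :: "'a \<Rightarrow> 'd::finite \<Rightarrow> nat"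
  assumes [measurable]: "\<And>i. (\<lambda>x. f x i) \<in> M \<rightarrow>\<^sub>M count_space UNIV"
  shows "f \<in> M \<rightarrow>\<^sub>M count_space UNIV"
proof (rule measurable_countableI)
  fix a :: "'d \<Rightarrow> nat"
  have "f -` {a} \<inter> space M = {x \<in> space M. \<forall>i. f x i = a i}" by (auto simp: fun_eq_iff)
  also have "\<dots> \<in> sets M" by measurable
  finally show "f -` {a} \<inter> space M \<in> sets M" .
qed

lemma measurable_Collect_count_space:
  fixes Q :: "'d::finite \<Rightarrow> 'a \<Rightarrow> bool"
  assumes [measurable]: "\<And>i. Measurable.pred M (Q i)"
  shows "(\<lambda>x. {i. Q i x}) \<in> M \<rightarrow>\<^sub>M count_space UNIV"
proof (subst measurable_count_space_eq2, simp, intro conjI ballI)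
  fix a :: "'d set"
  have "(\<lambda>x. {i. Q i x}) -` {a} \<inter> space M = {x \<in> space M. \<forall>i. Q i x \<longleftrightarrow> i \<in> a}" by auto
  also have "\<dots> \<in> sets M" by measurable
  finally show "(\<lambda>x. {i. Q i x}) -` {a} \<inter> space M \<in> sets M" .
qed auto

lemma measurable_Greatest_nat:
  assumes [measurable]: "\<And>i::nat. Measurable.pred M (Q i)"
  shows "(\<lambda>x. GREATEST i. Q i x) \<in> M \<rightarrow>\<^sub>M count_space UNIV"
proof (rule measurable_countableI)
  fix a :: nat
  \<comment> \<open>Without a greatest index, \<open>GREATEST\<close> unfolds to \<open>THE\<close>
    of the empty predicate: one fixed number that does not depend on x. Naming it describes the
    level sets by countable quantifiers also where no greatest index exists.\<close>
  define e :: nat where "e = (THE x. False)"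
  have *: "(GREATEST i. Q i x) = a \<longleftrightarrow>
     (if \<exists>m. Q m x \<and> (\<forall>k. Q k x \<longrightarrow> k \<le> m) then Q a x \<and> (\<forall>k. Q k x \<longrightarrow> k \<le> a) else a = e)" for x
  proof (cases "\<exists>m. Q m x \<and> (\<forall>k. Q k x \<longrightarrow> k \<le> m)")
    case True
    then obtain m where m: "Q m x" "\<And>k. Q k x \<Longrightarrow> k \<le> m" by blast
    have "(GREATEST i. Q i x) = m" using m by (intro Greatest_equality) auto
    then show ?thesis using m True by (auto intro: antisym)
  next
    case False
    then have "(\<lambda>m. Q m x \<and> (\<forall>k. Q k x \<longrightarrow> k \<le> m)) = (\<lambda>_. False)" by (intro ext) blast
    then have "(GREATEST i. Q i x) = e" unfolding Greatest_def e_def by simp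
    with False show ?thesis by auto
  qed
  have "(\<lambda>x. GREATEST i. Q i x) -` {a} \<inter> space M = {x \<in> space M.
     (if \<exists>m. Q m x \<and> (\<forall>k. Q k x \<longrightarrow> k \<le> m) then Q a x \<and> (\<forall>k. Q k x \<longrightarrow> k \<le> a) else a = e)}"
    unfolding vimage_def Int_def mem_Collect_eq singleton_iff * by (rule Collect_cong) (rule conj_commute)
  also have "\<dots> \<in> sets M" by measurable
  finally show "(\<lambda>x. GREATEST i. Q i x) -` {a} \<inter> space M \<in> sets M" .
qed

section \<open>Measurability of a single event\<close>

definition config_algebra :: "'d::finite config measure" where
  "config_algebra = borel \<Otimes>\<^sub>M (state_algebra \<Otimes>\<^sub>M (count_space UNIV \<Otimes>\<^sub>M count_space UNIV))"

lemma space_state_algebra[simp]: "space state_algebra = UNIV"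
  by (simp add: state_algebra_def space_pair_measure)

context
  fixes f :: "'a \<Rightarrow> 'd::finite state" and M :: "'a measure"
  assumes f: "f \<in> M \<rightarrow>\<^sub>M state_algebra"
begin

lemma measurable_state_queues[measurable (raw)]: "(\<lambda>x. fst (f x)) \<in> M \<rightarrow>\<^sub>M count_space UNIV"
  using f unfolding state_algebra_def by measurable

lemma measurable_state_queue[measurable (raw)]: "(\<lambda>x. fst (f x) $ i) \<in> M \<rightarrow>\<^sub>M count_space UNIV"
  by (rule measurable_compose[OF measurable_state_queues]) simp

lemma measurable_state_arrival[measurable (raw)]: "(\<lambda>x. fst (snd (f x)) $ i) \<in> borel_measurable M"
  using f unfolding state_algebra_def by measurable

lemma measurable_state_service[measurable (raw)]: "(\<lambda>x. snd (snd (f x)) $ i) \<in> borel_measurable M"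
  using f unfolding state_algebra_def by measurable

lemma measurable_time_to_event[measurable (raw)]: "(\<lambda>x. time_to_event E (f x)) \<in> borel_measurable M"
proof -
  define F where "F = (\<lambda>(k :: 'd + 'd) x. case k of Inl i \<Rightarrow> fst (snd (f x)) $ i | Inr i \<Rightarrow> snd (snd (f x)) $ i)"
  have [measurable]: "F k \<in> borel_measurable M" for k unfolding F_def by (cases k; simp; measurable)
  \<comment> \<open>For a fixed queue vector the minimum runs over a fixed finite set of clocks,
    hence is measurable in x. Queue vectors form a countable type, so the actual vector may be
    substituted afterwards.\<close>
  define T where "T = (\<lambda>(l::nat^'d) x. if E = {} \<and> (\<forall>i. l $ i = 0) then 1
      else Min ((\<lambda>k. F k x) ` (Inl ` E \<union> Inr ` {i. 0 < l $ i})))"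
  have [measurable]: "T l \<in> borel_measurable M" for l
    unfolding T_def by measurable
  have "(\<lambda>x. T (fst (f x)) x) \<in> borel_measurable M"
    by (rule measurable_compose_countable) measurable
  moreover have "T (fst (f x)) x = time_to_event E (f x)" for x
  proof -
    obtain l u v where x: "f x = (l, u, v)" by (cases "f x") auto
    have "running_clocks E (l, u, v) = (\<lambda>k. F k x) ` (Inl ` E \<union> Inr ` {i. 0 < l $ i})"
      by (auto simp: image_Un image_image F_def x)
    then show ?thesis by (auto simp: time_to_event_def T_def x)
  qed
  ultimately show ?thesis by simp
qed

end

lemma measurable_stateI:
  fixes l :: "'a \<Rightarrow> nat^'d::finite"
  assumes "\<And>i. (\<lambda>x. l x $ i) \<in> M \<rightarrow>\<^sub>M count_space UNIV"
    "\<And>i. u i \<in> borel_measurable M" "\<And>i. v i \<in> borel_measurable M"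
  shows "(\<lambda>x. (l x, \<chi> i. u i x, \<chi> i. v i x)) \<in> M \<rightarrow>\<^sub>M state_algebra"
  unfolding state_algebra_def using assms
  by (intro measurable_Pair borel_measurable_vec_lambda measurable_vec_count_space)

lemma run_clocks_eq:
  "run_clocks E h x = (fst x, \<chi> i. fst (snd x) $ i - (if i \<in> E then h else 0),
     \<chi> i. snd (snd x) $ i - (if 0 < fst x $ i then h else 0))"
  by (cases x rule: prod_cases3) (auto simp: vec_eq_iff)

lemma measurable_run_clocks[measurable (raw)]:
  assumes [measurable]: "f \<in> M \<rightarrow>\<^sub>M state_algebra" "h \<in> borel_measurable M"
  shows "(\<lambda>x. run_clocks E (h x) (f x)) \<in> M \<rightarrow>\<^sub>M state_algebra"
  unfolding run_clocks_eq by (intro measurable_stateI) measurable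

definition arrival_due :: "'d::finite set \<Rightarrow> 'd state \<Rightarrow> 'd set" where
  "arrival_due E x = {i. i \<in> E \<and> fst (snd x) $ i = time_to_event E x}"

definition service_due :: "'d::finite set \<Rightarrow> 'd state \<Rightarrow> 'd set" where
  "service_due E x = {i. 0 < fst x $ i \<and> snd (snd x) $ i = time_to_event E x}"

lemma measurable_arrival_due[measurable (raw)]:
  assumes [measurable]: "f \<in> M \<rightarrow>\<^sub>M state_algebra"
  shows "(\<lambda>x. arrival_due E (f x)) \<in> M \<rightarrow>\<^sub>M count_space UNIV"
  unfolding arrival_due_def by (rule measurable_Collect_count_space) measurable

lemma measurable_service_due[measurable (raw)]:
  assumes [measurable]: "f \<in> M \<rightarrow>\<^sub>M state_algebra"
  shows "(\<lambda>x. service_due E (f x)) \<in> M \<rightarrow>\<^sub>M count_space UNIV"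
  unfolding service_due_def by (rule measurable_Collect_count_space) measurable

text \<open>The update made by \<open>event_step\<close> after the clocks have run. The entries that
  are read become arguments, which separates the random input from the state and makes expectations
  over one event computable.\<close>

definition fire :: "'d::finite set \<Rightarrow> 'd set \<Rightarrow> ('d \<Rightarrow> real) \<Rightarrow> ('d \<Rightarrow> real) \<Rightarrow> ('d \<Rightarrow> 'd option) \<Rightarrow>
    'd state \<Rightarrow> 'd state" where
  "fire A D U V \<Phi> x =
     (\<chi> i. fst x $ i - (if i \<in> D then 1 else 0) + (if i \<in> A then 1 else 0) + card {j \<in> D. \<Phi> j = Some i},
      \<chi> i. if i \<in> A then U i else fst (snd x) $ i,
      \<chi> i. if i \<in> D then V i else snd (snd x) $ i)"

lemma event_step_eq:
  "event_step E \<omega> z = (let x = fst (snd z); a = fst (snd (snd z)); c = snd (snd (snd z));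
       h = time_to_event E x; A = arrival_due E x; D = service_due E x
     in (fst z + h, fire A D (\<lambda>i. fst \<omega> (i, a i)) (\<lambda>j. fst (snd \<omega>) (j, c j)) (\<lambda>j. snd (snd \<omega>) (j, c j))
           (run_clocks E h x),
         \<lambda>i. if i \<in> A then Suc (a i) else a i, \<lambda>j. if j \<in> D then Suc (c j) else c j))"
proof -
  obtain s l u v a c where z: "z = (s, (l, u, v), a, c)" by (metis prod.exhaust)
  obtain U V \<Phi> where w: "\<omega> = (U, V, \<Phi>)" by (metis prod.exhaust)
  show ?thesis
    by (simp add: z w Let_def fire_def arrival_due_def service_due_def vec_eq_iff)
qed

text \<open>The interarrival family is a product over \<open>E \<times> UNIV\<close>, so its
  coordinates are measurable for stations in E only; since \<open>A x \<subseteq> E\<close>, no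
  others are read.\<close>

lemma measurable_fire:
  assumes [measurable]: "A \<in> M \<rightarrow>\<^sub>M count_space UNIV" "D \<in> M \<rightarrow>\<^sub>M count_space UNIV"
    "f \<in> M \<rightarrow>\<^sub>M state_algebra" "\<And>i. V i \<in> borel_measurable M"
    and U: "\<And>i. i \<in> E \<Longrightarrow> U i \<in> borel_measurable M" and A: "\<And>x. A x \<subseteq> E"
    and [measurable]: "\<And>i. \<Phi> i \<in> M \<rightarrow>\<^sub>M count_space UNIV"
  shows "(\<lambda>x. fire (A x) (D x) (\<lambda>i. U i x) (\<lambda>i. V i x) (\<lambda>i. \<Phi> i x) (f x)) \<in> M \<rightarrow>\<^sub>M state_algebra"
  unfolding fire_def
proof (rule measurable_stateI)
  fix i
  have a: "Measurable.pred M (\<lambda>x. i \<in> A x)" for i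
    by (rule measurable_compose[OF assms(1)]) simp
  have d[measurable]: "Measurable.pred M (\<lambda>x. i \<in> D x)" for i
    by (rule measurable_compose[OF assms(2)]) simp
  note [measurable] = a
  have 1: "(\<lambda>x. card {j. j \<in> D x \<and> \<Phi> j x = Some i}) \<in> M \<rightarrow>\<^sub>M count_space UNIV"
    by (rule measurable_compose[OF measurable_Collect_count_space]) measurable
  have 2: "(\<lambda>x. fst (f x) $ i - (if i \<in> D x then 1 else 0) + (if i \<in> A x then 1 else 0)) \<in> M \<rightarrow>\<^sub>M count_space UNIV"
    by (rule measurable_countable_combine[where h="\<lambda>l (d, a). l - (if d then 1 else 0) + (if a then 1 else 0)" and
          f="\<lambda>x. fst (f x) $ i" and g="\<lambda>x. (i \<in> D x, i \<in> A x)", unfolded split_conv])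
       (rule measurable_state_queue[OF assms(3)], rule measurable_countable_combine[where h="Pair", OF d a])
  show "(\<lambda>x. (\<chi> i. fst (f x) $ i - (if i \<in> D x then 1 else 0) + (if i \<in> A x then 1 else 0)
      + card {j \<in> D x. \<Phi> j x = Some i}) $ i) \<in> M \<rightarrow>\<^sub>M count_space UNIV"
    unfolding vec_lambda_beta by (rule measurable_countable_combine[OF 2 1, where h="(+)"])
  show "(\<lambda>x. if i \<in> A x then U i x else fst (snd (f x)) $ i) \<in> borel_measurable M"
  proof (cases "i \<in> E")
    case True
    show ?thesis by (intro measurable_If U[OF True] measurable_state_arrival[OF assms(3)] predE a)
  next
    case False
    then have "i \<notin> A x" for x using A by auto
    then show ?thesis using measurable_state_arrival[OF assms(3)] by simp
  qed
  show "(\<lambda>x. if i \<in> D x then V i x else snd (snd (f x)) $ i) \<in> borel_measurable M"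
    by (intro measurable_If assms(4) measurable_state_service[OF assms(3)] predE d)
qed

text \<open>With E nonempty some clock runs in every state, so the default value of
  \<open>time_to_event\<close> never occurs. In the main proof this follows from positive
  definiteness of the covariance matrix.\<close>

locale jackson =
  fixes E :: "'d::finite set" and P :: "real^'d^'d" and Te Ts :: "'d \<Rightarrow> real measure"
  assumes routing: "routing_matrix P"
    and Te: "\<And>i. i \<in> E \<Longrightarrow> time_law (Te i)"
    and Ts: "\<And>j. time_law (Ts j)"
    and E_nonempty: "E \<noteq> {}"
begin

abbreviation "\<mu> \<equiv> sample_measure E P Te Ts"

lemma Te_prob: "i \<in> E \<Longrightarrow> prob_space (Te i)" and Ts_prob: "prob_space (Ts j)"
  using Te Ts by (auto simp: time_law_def)

lemma sets_Te[measurable_cong]: "i \<in> E \<Longrightarrow> sets (Te i) = sets borel"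
  and sets_Ts[measurable_cong]: "sets (Ts j) = sets borel"
  using Te Ts by (auto simp: time_law_def)

lemma prob_space_U: "prob_space (PiM (E \<times> UNIV) (\<lambda>(i, k::nat). Te i))"
  by (intro prob_space_PiM) (auto simp: Te_prob)

lemma prob_space_V: "prob_space (PiM UNIV (\<lambda>(j, k::nat). Ts j))"
  by (intro prob_space_PiM) (auto simp: Ts_prob)

lemma prob_space_\<Phi>: "prob_space (PiM UNIV (\<lambda>(j, k::nat). measure_pmf (routing_pmf P j)))"
  by (intro prob_space_PiM) (auto simp: measure_pmf.prob_space_axioms)

lemma prob_space_V\<Phi>: "prob_space (PiM UNIV (\<lambda>(j, k::nat). Ts j) \<Otimes>\<^sub>M
    PiM UNIV (\<lambda>(j, k::nat). measure_pmf (routing_pmf P j)))"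
proof -
  interpret V: prob_space "PiM UNIV (\<lambda>(j, k::nat). Ts j)" by (rule prob_space_V)
  interpret \<Phi>: prob_space "PiM UNIV (\<lambda>(j, k::nat). measure_pmf (routing_pmf P j))" by (rule prob_space_\<Phi>)
  interpret pair_prob_space "PiM UNIV (\<lambda>(j, k::nat). Ts j)" "PiM UNIV (\<lambda>(j, k::nat). measure_pmf (routing_pmf P j))" ..
  show ?thesis by unfold_locales
qed

lemma prob_space_\<mu>: "prob_space \<mu>"
proof -
  interpret U: prob_space "PiM (E \<times> UNIV) (\<lambda>(i, k::nat). Te i)" by (rule prob_space_U)
  interpret V\<Phi>: prob_space "PiM UNIV (\<lambda>(j, k::nat). Ts j) \<Otimes>\<^sub>M
    PiM UNIV (\<lambda>(j, k::nat). measure_pmf (routing_pmf P j))" by (rule prob_space_V\<Phi>)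
  interpret pair_prob_space "PiM (E \<times> UNIV) (\<lambda>(i, k::nat). Te i)"
    "PiM UNIV (\<lambda>(j, k::nat). Ts j) \<Otimes>\<^sub>M PiM UNIV (\<lambda>(j, k::nat). measure_pmf (routing_pmf P j))" ..
  show ?thesis unfolding sample_measure_def by unfold_locales
qed

sublocale \<mu>: prob_space \<mu> by (rule prob_space_\<mu>)

context
  fixes w :: "'a \<Rightarrow> 'd sample" and M :: "'a measure"
  assumes w: "w \<in> M \<rightarrow>\<^sub>M \<mu>"
begin

lemma measurable_sample_U: "i \<in> E \<Longrightarrow> (\<lambda>x. fst (w x) (i, k)) \<in> borel_measurable M"
proof -
  assume i: "i \<in> E"
  have "(\<lambda>x. fst (w x)) \<in> M \<rightarrow>\<^sub>M PiM (E \<times> UNIV) (\<lambda>(i, k). Te i)"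
    using w unfolding sample_measure_def by measurable
  from measurable_compose[OF this measurable_component_singleton[of "(i, k)"]] i
  show ?thesis by (simp add: measurable_cong_sets[OF refl sets_Te[OF i]])
qed

lemma measurable_sample_V[measurable (raw)]: "(\<lambda>x. fst (snd (w x)) (i, k)) \<in> borel_measurable M"
proof -
  have "(\<lambda>x. fst (snd (w x))) \<in> M \<rightarrow>\<^sub>M PiM UNIV (\<lambda>(i, k). Ts i)"
    using w unfolding sample_measure_def by measurable
  from measurable_compose[OF this measurable_component_singleton[of "(i, k)"]]
  show ?thesis by (simp add: measurable_cong_sets[OF refl sets_Ts])
qed

lemma measurable_sample_\<Phi>[measurable (raw)]: "(\<lambda>x. snd (snd (w x)) (i, k)) \<in> M \<rightarrow>\<^sub>M count_space UNIV"
proof -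
  have "(\<lambda>x. snd (snd (w x))) \<in> M \<rightarrow>\<^sub>M PiM UNIV (\<lambda>(j, k). measure_pmf (routing_pmf P j))"
    using w unfolding sample_measure_def by measurable
  from measurable_compose[OF this measurable_component_singleton[of "(i, k)"]]
  show ?thesis by (simp add: measurable_cong_sets[OF refl sets_measure_pmf_count_space])
qed

end

context
  fixes f :: "'a \<Rightarrow> 'd config" and M :: "'a measure"
  assumes f: "f \<in> M \<rightarrow>\<^sub>M config_algebra"
begin

lemma measurable_config_time[measurable (raw)]: "(\<lambda>x. fst (f x)) \<in> borel_measurable M"
  using f unfolding config_algebra_def by measurable

lemma measurable_config_state[measurable (raw)]: "(\<lambda>x. fst (snd (f x))) \<in> M \<rightarrow>\<^sub>M state_algebra"
  using f unfolding config_algebra_def by measurable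

lemma measurable_config_arrivals[measurable (raw)]: "(\<lambda>x. fst (snd (snd (f x)))) \<in> M \<rightarrow>\<^sub>M count_space UNIV"
  using f unfolding config_algebra_def by measurable

lemma measurable_config_departures[measurable (raw)]: "(\<lambda>x. snd (snd (snd (f x)))) \<in> M \<rightarrow>\<^sub>M count_space UNIV"
  using f unfolding config_algebra_def by measurable

lemma measurable_config_departure[measurable (raw)]: "(\<lambda>x. snd (snd (snd (f x))) i) \<in> M \<rightarrow>\<^sub>M count_space UNIV"
  by (rule measurable_compose[OF measurable_config_departures]) simp

lemma measurable_config_arrival[measurable (raw)]: "(\<lambda>x. fst (snd (snd (f x))) i) \<in> M \<rightarrow>\<^sub>M count_space UNIV"
  by (rule measurable_compose[OF measurable_config_arrivals]) simp

end

lemma measurable_event_step[measurable (raw)]: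
  assumes w[measurable]: "w \<in> M \<rightarrow>\<^sub>M \<mu>" and f[measurable]: "f \<in> M \<rightarrow>\<^sub>M config_algebra"
  shows "(\<lambda>x. event_step E (w x) (f x)) \<in> M \<rightarrow>\<^sub>M config_algebra"
proof -
  define x where "x = (\<lambda>z. fst (snd (f z)))"
  define a where "a = (\<lambda>z. fst (snd (snd (f z))))"
  define c where "c = (\<lambda>z. snd (snd (snd (f z))))"
  have [measurable]: "x \<in> M \<rightarrow>\<^sub>M state_algebra" unfolding x_def by measurable
  have a[measurable]: "(\<lambda>z. a z i) \<in> M \<rightarrow>\<^sub>M count_space UNIV" for i unfolding a_def by measurable
  have c[measurable]: "(\<lambda>z. c z i) \<in> M \<rightarrow>\<^sub>M count_space UNIV" for i unfolding c_def by measurable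
  have 1: "(\<lambda>z. fire (arrival_due E (x z)) (service_due E (x z)) (\<lambda>i. fst (w z) (i, a z i))
      (\<lambda>j. fst (snd (w z)) (j, c z j)) (\<lambda>j. snd (snd (w z)) (j, c z j))
           (run_clocks E (time_to_event E (x z)) (x z))) \<in> M \<rightarrow>\<^sub>M state_algebra"
  proof (rule measurable_fire[where E=E])
    show "(\<lambda>z. fst (snd (w z)) (i, c z i)) \<in> borel_measurable M" for i
      by (rule measurable_compose_countable[where f="\<lambda>k z. fst (snd (w z)) (i, k)"]) measurable
    show "(\<lambda>z. fst (w z) (i, a z i)) \<in> borel_measurable M" if "i \<in> E" for i
      by (rule measurable_compose_countable[where f="\<lambda>k z. fst (w z) (i, k)"])
        (use that measurable_sample_U[OF w] in measurable)
    show "(\<lambda>z. snd (snd (w z)) (i, c z i)) \<in> M \<rightarrow>\<^sub>M count_space UNIV" for i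
      by (rule measurable_compose_countable[where f="\<lambda>k z. snd (snd (w z)) (i, k)"]) measurable
  qed (auto simp: arrival_due_def[of E] intro!: measurable_arrival_due[unfolded arrival_due_def] measurable_service_due
      measurable_run_clocks measurable_time_to_event)
  have ad[measurable]: "Measurable.pred M (\<lambda>z. i \<in> arrival_due E (x z))" for i
    by (rule measurable_compose[OF measurable_arrival_due]) simp_all
  have sd[measurable]: "Measurable.pred M (\<lambda>z. i \<in> service_due E (x z))" for i
    by (rule measurable_compose[OF measurable_service_due]) simp_all
  have 2: "(\<lambda>z i. if i \<in> arrival_due E (x z) then Suc (a z i) else a z i) \<in> M \<rightarrow>\<^sub>M count_space UNIV"
    by (rule measurable_fun_count_space) measurable
  have 3: "(\<lambda>z i. if i \<in> service_due E (x z) then Suc (c z i) else c z i) \<in> M \<rightarrow>\<^sub>M count_space UNIV"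
    by (rule measurable_fun_count_space) measurable
  have "(\<lambda>z. (fst (f z) + time_to_event E (x z), fire (arrival_due E (x z)) (service_due E (x z)) (\<lambda>i. fst (w z) (i, a z i))
      (\<lambda>j. fst (snd (w z)) (j, c z j)) (\<lambda>j. snd (snd (w z)) (j, c z j))
           (run_clocks E (time_to_event E (x z)) (x z)),
       \<lambda>i. if i \<in> arrival_due E (x z) then Suc (a z i) else a z i,
       \<lambda>i. if i \<in> service_due E (x z) then Suc (c z i) else c z i)) \<in> M \<rightarrow>\<^sub>M config_algebra"
    unfolding config_algebra_def by (intro measurable_Pair 1 2 3) measurable
  then show ?thesis unfolding event_step_eq Let_def x_def a_def c_def .
qed

lemma measurable_event_config[measurable (raw)]:
  assumes [measurable]: "w \<in> M \<rightarrow>\<^sub>M \<mu>" "x \<in> M \<rightarrow>\<^sub>M state_algebra"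
  shows "(\<lambda>z. event_config E (w z) (x z) m) \<in> M \<rightarrow>\<^sub>M config_algebra"
proof (induction m)
  case 0
  show ?case unfolding event_config_def config_algebra_def by simp
next
  case (Suc m)
  note [measurable] = Suc
  have "event_config E (w z) (x z) (Suc m) = event_step E (w z) (event_config E (w z) (x z) m)" for z
    by (simp add: event_config_def)
  then show ?case by simp
qed

text \<open>Initial state and time may vary along with the sample point: Fubini will be applied
  jointly to the stationary law, the sample and an exponential time.\<close>

lemma measurable_process[measurable (raw)]:
  assumes [measurable]: "w \<in> M \<rightarrow>\<^sub>M \<mu>" "x \<in> M \<rightarrow>\<^sub>M state_algebra" "t \<in> borel_measurable M"
  shows "(\<lambda>z. process E (x z) (t z) (w z)) \<in> M \<rightarrow>\<^sub>M state_algebra"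
proof -
  have "(\<lambda>z. GREATEST m. fst (event_config E (w z) (x z) m) \<le> t z) \<in> M \<rightarrow>\<^sub>M count_space UNIV"
    by (rule measurable_Greatest_nat) measurable
  then have "(\<lambda>z. event_config E (w z) (x z) (GREATEST m. fst (event_config E (w z) (x z) m) \<le> t z)) \<in> M \<rightarrow>\<^sub>M config_algebra"
    by (rule measurable_compose_countable[rotated]) measurable
  then have [measurable]: "(\<lambda>z. event_config E (w z) (x z) (GREATEST m. fst (event_config E (w z) (x z) m) \<le> t z)) \<in> M \<rightarrow>\<^sub>M config_algebra" .
  show ?thesis unfolding process_def Let_def split_beta' by measurable
qed

end

section \<open>Resampling and the Markov property of the event chain\<close>

lemma event_config_0[simp]: "event_config E \<omega> x 0 = (0, x, \<lambda>_. 0, \<lambda>_. 0)"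
  by (simp add: event_config_def)

lemma event_config_Suc: "event_config E \<omega> x (Suc m) = event_step E \<omega> (event_config E \<omega> x m)"
  by (simp add: event_config_def)

definition event_time :: "'d::finite set \<Rightarrow> 'd sample \<Rightarrow> 'd state \<Rightarrow> nat \<Rightarrow> real" where
  "event_time E \<omega> x m = fst (event_config E \<omega> x m)"

definition event_state :: "'d::finite set \<Rightarrow> 'd sample \<Rightarrow> 'd state \<Rightarrow> nat \<Rightarrow> 'd state" where
  "event_state E \<omega> x m = fst (snd (event_config E \<omega> x m))"

definition arrivals :: "'d::finite set \<Rightarrow> 'd sample \<Rightarrow> 'd state \<Rightarrow> nat \<Rightarrow> 'd \<Rightarrow> nat" where
  "arrivals E \<omega> x m = fst (snd (snd (event_config E \<omega> x m)))"

definition departures :: "'d::finite set \<Rightarrow> 'd sample \<Rightarrow> 'd state \<Rightarrow> nat \<Rightarrow> 'd \<Rightarrow> nat" where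
  "departures E \<omega> x m = snd (snd (snd (event_config E \<omega> x m)))"

lemma event_config_split:
  "event_config E \<omega> x m = (event_time E \<omega> x m, event_state E \<omega> x m, arrivals E \<omega> x m, departures E \<omega> x m)"
  by (simp add: event_time_def event_state_def arrivals_def departures_def)

lemma event_time_0[simp]: "event_time E \<omega> x 0 = 0"
  and event_state_0[simp]: "event_state E \<omega> x 0 = x"
  and arrivals_0[simp]: "arrivals E \<omega> x 0 = (\<lambda>_. 0)"
  and departures_0[simp]: "departures E \<omega> x 0 = (\<lambda>_. 0)"
  by (simp_all add: event_time_def event_state_def arrivals_def departures_def)

lemma event_time_Suc:
  "event_time E \<omega> x (Suc m) = event_time E \<omega> x m + time_to_event E (event_state E \<omega> x m)"
  and event_state_Suc:
  "event_state E \<omega> x (Suc m) =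
     fire (arrival_due E (event_state E \<omega> x m)) (service_due E (event_state E \<omega> x m))
       (\<lambda>i. fst \<omega> (i, arrivals E \<omega> x m i))
       (\<lambda>j. fst (snd \<omega>) (j, departures E \<omega> x m j))
       (\<lambda>j. snd (snd \<omega>) (j, departures E \<omega> x m j))
       (run_clocks E (time_to_event E (event_state E \<omega> x m)) (event_state E \<omega> x m))"
  and arrivals_Suc:
  "arrivals E \<omega> x (Suc m) i = arrivals E \<omega> x m i + (if i \<in> arrival_due E (event_state E \<omega> x m) then 1 else 0)"
  and departures_Suc:
  "departures E \<omega> x (Suc m) j = departures E \<omega> x m j + (if j \<in> service_due E (event_state E \<omega> x m) then 1 else 0)"
  by (simp_all add: event_time_def event_state_def arrivals_def departures_def event_config_Suc
      event_step_eq Let_def)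

lemma arrivals_le: "arrivals E \<omega> x m i \<le> m"
  by (induction m) (auto simp: arrivals_Suc)

lemma departures_le: "departures E \<omega> x m i \<le> m"
  by (induction m) (auto simp: departures_Suc)

lemma arrivals_mono: "m \<le> m' \<Longrightarrow> arrivals E \<omega> x m i \<le> arrivals E \<omega> x m' i"
  by (induction rule: dec_induct) (auto simp: arrivals_Suc)

lemma departures_mono: "m \<le> m' \<Longrightarrow> departures E \<omega> x m i \<le> departures E \<omega> x m' i"
  by (induction rule: dec_induct) (auto simp: departures_Suc)

text \<open>A step reads entries at the current counters only and then advances exactly those
  counters, so after m steps every entry read has an index below its counter. All resampling
  arguments rest on this.\<close>

lemma event_config_local:
  assumes "\<And>i k. i \<in> E \<Longrightarrow> k < arrivals E \<omega> x m i \<Longrightarrow> fst \<omega>' (i, k) = fst \<omega> (i, k)"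
    and "\<And>i k. k < departures E \<omega> x m i \<Longrightarrow> fst (snd \<omega>') (i, k) = fst (snd \<omega>) (i, k)"
    and "\<And>i k. k < departures E \<omega> x m i \<Longrightarrow> snd (snd \<omega>') (i, k) = snd (snd \<omega>) (i, k)"
  shows "event_config E \<omega>' x m = event_config E \<omega> x m"
  using assms
proof (induction m)
  case (Suc m)
  define y where "y = event_state E \<omega> x m"
  have IH: "event_config E \<omega>' x m = event_config E \<omega> x m"
    using Suc.prems by (intro Suc.IH) (auto simp: arrivals_Suc departures_Suc)
  have e: "event_time E \<omega>' x m = event_time E \<omega> x m" "event_state E \<omega>' x m = y"
    "arrivals E \<omega>' x m = arrivals E \<omega> x m" "departures E \<omega>' x m = departures E \<omega> x m"
    using IH by (simp_all add: event_time_def event_state_def arrivals_def departures_def y_def)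
  have U: "fst \<omega>' (i, arrivals E \<omega> x m i) = fst \<omega> (i, arrivals E \<omega> x m i)" if "i \<in> arrival_due E y" for i
    using that by (intro Suc.prems(1)) (auto simp: arrivals_Suc y_def arrival_due_def)
  have V: "fst (snd \<omega>') (i, departures E \<omega> x m i) = fst (snd \<omega>) (i, departures E \<omega> x m i)"
    "snd (snd \<omega>') (i, departures E \<omega> x m i) = snd (snd \<omega>) (i, departures E \<omega> x m i)"
    if "i \<in> service_due E y" for i
    using that by (auto intro!: Suc.prems(2,3) simp: departures_Suc y_def)
  have "{j \<in> service_due E y. snd (snd \<omega>') (j, departures E \<omega> x m j) = Some i} =
      {j \<in> service_due E y. snd (snd \<omega>) (j, departures E \<omega> x m j) = Some i}" for i
    using V by auto
  then show ?case
    unfolding event_config_Suc event_step_eq Let_def IH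
    using U V unfolding event_state_def arrivals_def departures_def y_def
    by (auto simp: fire_def vec_eq_iff)
qed simp

definition resample :: "('d \<times> nat) set \<Rightarrow> ('d \<times> nat) set \<Rightarrow> ('d \<times> nat) set \<Rightarrow> 'd sample \<Rightarrow> 'd sample \<Rightarrow> 'd sample"
  where "resample J1 J2 J3 \<omega> \<omega>' = (\<lambda>p. if p \<in> J1 then fst \<omega>' p else fst \<omega> p,
     \<lambda>p. if p \<in> J2 then fst (snd \<omega>') p else fst (snd \<omega>) p,
     \<lambda>p. if p \<in> J3 then snd (snd \<omega>') p else snd (snd \<omega>) p)"

lemma integrable_bounded:
  assumes "prob_space M" "f \<in> borel_measurable M" "\<And>x. \<bar>f x\<bar> \<le> (B::real)"
  shows "integrable M f"
proof -
  interpret prob_space M by fact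
  show ?thesis by (rule integrable_const_bound[where B=B]) (use assms in auto)
qed

lemma abs_integral_le_bound:
  assumes "prob_space M" "\<And>x. \<bar>f x\<bar> \<le> (B::real)"
  shows "\<bar>\<integral>x. f x \<partial>M\<bar> \<le> B"
proof -
  interpret prob_space M by fact
  have "0 \<le> B" using assms(2)[of undefined] by simp
  show ?thesis
  proof (cases "integrable M f")
    case True
    then have "\<bar>\<integral>x. f x \<partial>M\<bar> \<le> (\<integral>x. \<bar>f x\<bar> \<partial>M)" using integral_abs_bound[of M f] by simp
    also have "\<dots> \<le> (\<integral>x. B \<partial>M)" by (rule integral_mono) (use True assms in auto)
    finally show ?thesis by (simp add: prob_space)
  qed (simp add: not_integrable_integral_eq \<open>0 \<le> B\<close>)
qed

context jackson
begin

lemma distr_resample: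
  "(\<lambda>(\<omega>, \<omega>'). resample J1 J2 J3 \<omega> \<omega>') \<in> \<mu> \<Otimes>\<^sub>M \<mu> \<rightarrow>\<^sub>M \<mu>" (is "?f \<in> _")
  "distr (\<mu> \<Otimes>\<^sub>M \<mu>) \<mu> (\<lambda>(\<omega>, \<omega>'). resample J1 J2 J3 \<omega> \<omega>') = \<mu>"
proof -
  let ?U = "PiM (E \<times> UNIV) (\<lambda>(i, k::nat). Te i)" and ?V = "PiM UNIV (\<lambda>(j, k::nat). Ts j)"
    and ?\<Phi> = "PiM UNIV (\<lambda>(j, k::nat). measure_pmf (routing_pmf P j))"
  let ?r = "\<lambda>J x y i. if i \<in> J then y i else x i"
  have m2: "(\<lambda>(x, y). (?r J2 (fst x) (fst y), ?r J3 (snd x) (snd y))) \<in> (?V \<Otimes>\<^sub>M ?\<Phi>) \<Otimes>\<^sub>M (?V \<Otimes>\<^sub>M ?\<Phi>) \<rightarrow>\<^sub>M ?V \<Otimes>\<^sub>M ?\<Phi>"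
    unfolding split_beta'
    by (intro measurable_Pair measurable_compose[OF _ measurable_resample[unfolded split_beta'],
          where f="\<lambda>x. (fst (fst x), fst (snd x))", simplified fst_conv snd_conv]
          measurable_compose[OF _ measurable_resample[unfolded split_beta'],
          where f="\<lambda>x. (snd (fst x), snd (snd x))", simplified fst_conv snd_conv]) measurable
  have d2: "distr ((?V \<Otimes>\<^sub>M ?\<Phi>) \<Otimes>\<^sub>M (?V \<Otimes>\<^sub>M ?\<Phi>)) (?V \<Otimes>\<^sub>M ?\<Phi>)
      (\<lambda>(x, y). (?r J2 (fst x) (fst y), ?r J3 (snd x) (snd y))) = ?V \<Otimes>\<^sub>M ?\<Phi>"
    by (rule distr_pair_pair[OF prob_space_V prob_space_\<Phi>])
      (auto intro!: measurable_resample PiM_resample Ts_prob measure_pmf.prob_space_axioms)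
  have "?f = (\<lambda>(x, y). (?r J1 (fst x) (fst y), (\<lambda>x y. (?r J2 (fst x) (fst y), ?r J3 (snd x) (snd y))) (snd x) (snd y)))"
    by (auto simp: resample_def fun_eq_iff)
  moreover have "(\<lambda>(x, y). (?r J1 (fst x) (fst y), (\<lambda>x y. (?r J2 (fst x) (fst y), ?r J3 (snd x) (snd y))) (snd x) (snd y)))
      \<in> \<mu> \<Otimes>\<^sub>M \<mu> \<rightarrow>\<^sub>M \<mu>"
    unfolding sample_measure_def split_beta'
    by (intro measurable_Pair measurable_compose[OF _ measurable_resample[unfolded split_beta'],
          where f="\<lambda>x. (fst (fst x), fst (snd x))", simplified fst_conv snd_conv]
          measurable_compose[OF _ measurable_resample[unfolded split_beta'],
          where f="\<lambda>x. (fst (snd (fst x)), fst (snd (snd x)))", simplified fst_conv snd_conv]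
          measurable_compose[OF _ measurable_resample[unfolded split_beta'],
          where f="\<lambda>x. (snd (snd (fst x)), snd (snd (snd x)))", simplified fst_conv snd_conv]) measurable
  moreover have "distr (\<mu> \<Otimes>\<^sub>M \<mu>) \<mu>
     (\<lambda>(x, y). (?r J1 (fst x) (fst y), (\<lambda>x y. (?r J2 (fst x) (fst y), ?r J3 (snd x) (snd y))) (snd x) (snd y))) = \<mu>"
    unfolding sample_measure_def
    by (rule distr_pair_pair[OF prob_space_U prob_space_V\<Phi> _ m2 _ d2])
      (auto intro!: measurable_resample PiM_resample Te_prob)
  ultimately show "?f \<in> \<mu> \<Otimes>\<^sub>M \<mu> \<rightarrow>\<^sub>M \<mu>" "distr (\<mu> \<Otimes>\<^sub>M \<mu>) \<mu> ?f = \<mu>" by simp_all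
qed

lemma measurable_resample_sample[measurable (raw)]:
  assumes "f \<in> M \<rightarrow>\<^sub>M \<mu>" "g \<in> M \<rightarrow>\<^sub>M \<mu>"
  shows "(\<lambda>x. resample J1 J2 J3 (f x) (g x)) \<in> M \<rightarrow>\<^sub>M \<mu>"
  using measurable_compose[OF measurable_Pair[OF assms] distr_resample(1)] by simp

lemma integral_resample:
  fixes F :: "'d sample \<Rightarrow> real"
  assumes F[measurable]: "F \<in> borel_measurable \<mu>" and B: "\<And>\<omega>. \<bar>F \<omega>\<bar> \<le> B"
  shows "(\<integral>\<omega>. F \<omega> \<partial>\<mu>) = (\<integral>\<omega>. \<integral>\<omega>'. F (resample J1 J2 J3 \<omega> \<omega>') \<partial>\<mu> \<partial>\<mu>)"
proof -
  interpret pair_prob_space \<mu> \<mu> ..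
  have "(\<integral>\<omega>. F \<omega> \<partial>\<mu>) = (\<integral>\<omega>. F \<omega> \<partial>distr (\<mu> \<Otimes>\<^sub>M \<mu>) \<mu> (\<lambda>(\<omega>, \<omega>'). resample J1 J2 J3 \<omega> \<omega>'))"
    by (simp only: distr_resample(2))
  also have "\<dots> = (\<integral>(\<omega>, \<omega>'). F (resample J1 J2 J3 \<omega> \<omega>') \<partial>(\<mu> \<Otimes>\<^sub>M \<mu>))"
    by (subst integral_distr[OF distr_resample(1) F]) (simp add: split_beta')
  also have "\<dots> = (\<integral>\<omega>. \<integral>\<omega>'. F (resample J1 J2 J3 \<omega> \<omega>') \<partial>\<mu> \<partial>\<mu>)"
    by (rule integral_fst'[symmetric, where f="\<lambda>(\<omega>, \<omega>'). F (resample J1 J2 J3 \<omega> \<omega>')", simplified])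
      (rule integrable_bounded[where B=B], auto simp: split_beta' B P.prob_space_axioms)
  finally show ?thesis .
qed

text \<open>The Markov property of the event chain. The next step reads entries that the first m
  steps have not touched, so they may come from an independent sample point. Which entries these are
  depends on the counters, whence the decomposition by counter values.\<close>

lemma integral_event_config_Suc:
  fixes F :: "'d config \<Rightarrow> real"
  assumes F[measurable]: "F \<in> borel_measurable config_algebra" and B: "\<And>z. \<bar>F z\<bar> \<le> B"
  shows "(\<integral>\<omega>. F (event_config E \<omega> x (Suc m)) \<partial>\<mu>) =
     (\<integral>\<omega>. (\<integral>\<omega>'. F (event_step E \<omega>' (event_config E \<omega> x m)) \<partial>\<mu>) \<partial>\<mu>)"
proof -
  \<comment> \<open>After m steps no counter exceeds m, so finitely many counter values partition
    the sample space and sum and integral can be exchanged freely.\<close>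
  define S where "S = (UNIV :: 'd set) \<rightarrow>\<^sub>E {..m}"
  have S[simp]: "finite S" unfolding S_def by (intro finite_PiE) auto
  define N where "N = (\<lambda>\<omega>. (arrivals E \<omega> x m, departures E \<omega> x m))"
  have x[measurable]: "(\<lambda>_. x) \<in> M \<rightarrow>\<^sub>M state_algebra" for M :: "'z measure" by simp
  have NS: "N \<omega> \<in> S \<times> S" for \<omega>
    by (auto simp: N_def S_def arrivals_le departures_le)
  have [measurable]: "(\<lambda>z. event_config E (w z) x m) \<in> M \<rightarrow>\<^sub>M config_algebra" if "w \<in> M \<rightarrow>\<^sub>M \<mu>" for w and M :: "'z measure"
    using that by measurable
  have "(\<lambda>\<omega>. arrivals E \<omega> x m) \<in> \<mu> \<rightarrow>\<^sub>M count_space UNIV" "(\<lambda>\<omega>. departures E \<omega> x m) \<in> \<mu> \<rightarrow>\<^sub>M count_space UNIV"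
    unfolding arrivals_def departures_def by measurable
  then have [measurable]: "N \<in> \<mu> \<rightarrow>\<^sub>M count_space UNIV"
    unfolding N_def by (rule measurable_countable_combine)
  have N[measurable]: "Measurable.pred \<mu> (\<lambda>\<omega>. N \<omega> = p)" for p by measurable
  have B': "\<bar>if b then F z else 0\<bar> \<le> B" for b z using B[of z] by (auto intro: order_trans[OF abs_ge_zero])
  define K where "K = (\<lambda>z. \<integral>\<omega>'. F (event_step E \<omega>' z) \<partial>\<mu>)"
  have Km[measurable]: "K \<in> borel_measurable config_algebra"
    unfolding K_def by measurable
  have KB: "\<bar>K z\<bar> \<le> B" for z unfolding K_def by (rule abs_integral_le_bound[OF prob_space_\<mu>]) (rule B)
  have KB': "\<bar>if b then K z else 0\<bar> \<le> B" for b z using KB[of z] by (auto intro: order_trans[OF abs_ge_zero])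
  have one: "(\<integral>\<omega>. (if N \<omega> = p then F (event_config E \<omega> x (Suc m)) else 0) \<partial>\<mu>) =
      (\<integral>\<omega>. (if N \<omega> = p then K (event_config E \<omega> x m) else 0) \<partial>\<mu>)" for p
  proof -
    obtain \<alpha> \<gamma> where p: "p = (\<alpha>, \<gamma>)" by (cases p)
    \<comment> \<open>Exchanges exactly the entries that step m + 1 may read when the counters are
      \<open>\<alpha>\<close> and \<open>\<gamma>\<close>.\<close>
    define \<rho> where "\<rho> = resample (range (\<lambda>i. (i, \<alpha> i))) (range (\<lambda>i. (i, \<gamma> i))) (range (\<lambda>i. (i, \<gamma> i)))"
    \<comment> \<open>The alternative matters: whichever of the two samples has the counters p, its
      first m steps ignore the exchanged entries. Hence the event \<open>N \<omega> = p\<close> is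
      invariant under \<open>\<rho>\<close> in both directions.\<close>
    have loc: "event_config E (\<rho> \<omega> \<omega>') x m = event_config E \<omega> x m" if "N \<omega> = p \<or> N (\<rho> \<omega> \<omega>') = p" for \<omega> \<omega>'
    proof (cases "N \<omega> = p")
      case True
      show ?thesis
        by (rule event_config_local) (use True in \<open>auto simp: N_def p \<rho>_def resample_def\<close>)
    next
      case False
      with that have *: "N (\<rho> \<omega> \<omega>') = p" by simp
      show ?thesis
        by (rule event_config_local[symmetric]) (use * in \<open>auto simp: N_def p \<rho>_def resample_def\<close>)
    qed
    have Neq: "N (\<rho> \<omega> \<omega>') = p \<longleftrightarrow> N \<omega> = p" for \<omega> \<omega>'
      using loc[of \<omega> \<omega>'] by (auto simp: N_def arrivals_def departures_def)
    have step: "event_step E (\<rho> \<omega> \<omega>') (event_config E \<omega> x m) = event_step E \<omega>' (event_config E \<omega> x m)"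
      if "N \<omega> = p" for \<omega> \<omega>'
    proof -
      have "fst (snd (snd (event_config E \<omega> x m))) = \<alpha>" "snd (snd (snd (event_config E \<omega> x m))) = \<gamma>"
        using that by (auto simp: N_def p arrivals_def departures_def)
      then show ?thesis by (simp add: event_step_eq Let_def \<rho>_def resample_def)
    qed
    have "(\<integral>\<omega>. (if N \<omega> = p then F (event_config E \<omega> x (Suc m)) else 0) \<partial>\<mu>) =
       (\<integral>\<omega>. \<integral>\<omega>'. (if N (\<rho> \<omega> \<omega>') = p then F (event_config E (\<rho> \<omega> \<omega>') x (Suc m)) else 0) \<partial>\<mu> \<partial>\<mu>)"
      unfolding \<rho>_def by (rule integral_resample[where B=B]) (measurable, rule B')
    also have "\<dots> = (\<integral>\<omega>. \<integral>\<omega>'. (if N \<omega> = p then F (event_step E \<omega>' (event_config E \<omega> x m)) else 0) \<partial>\<mu> \<partial>\<mu>)"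
      by (intro Bochner_Integration.integral_cong refl) (auto simp: Neq event_config_Suc loc step)
    also have "\<dots> = (\<integral>\<omega>. (if N \<omega> = p then K (event_config E \<omega> x m) else 0) \<partial>\<mu>)"
      by (intro Bochner_Integration.integral_cong refl) (simp add: K_def)
    finally show ?thesis .
  qed
  have sum: "G = (\<Sum>p\<in>S \<times> S. if N \<omega> = p then G else 0)" for G :: real and \<omega>
    using NS[of \<omega>] by (subst sum.delta') auto
  have "(\<integral>\<omega>. F (event_config E \<omega> x (Suc m)) \<partial>\<mu>)
      = (\<integral>\<omega>. (\<Sum>p\<in>S \<times> S. if N \<omega> = p then F (event_config E \<omega> x (Suc m)) else 0) \<partial>\<mu>)"
    by (intro Bochner_Integration.integral_cong refl sum)
  also have "\<dots> = (\<Sum>p\<in>S \<times> S. \<integral>\<omega>. (if N \<omega> = p then F (event_config E \<omega> x (Suc m)) else 0) \<partial>\<mu>)"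
    by (rule Bochner_Integration.integral_sum, rule integrable_bounded[OF prob_space_\<mu>, where B=B])
      (measurable, rule B')
  also have "\<dots> = (\<Sum>p\<in>S \<times> S. \<integral>\<omega>. (if N \<omega> = p then K (event_config E \<omega> x m) else 0) \<partial>\<mu>)"
    by (simp add: one)
  also have "\<dots> = (\<integral>\<omega>. (\<Sum>p\<in>S \<times> S. if N \<omega> = p then K (event_config E \<omega> x m) else 0) \<partial>\<mu>)"
    by (rule Bochner_Integration.integral_sum[symmetric], rule integrable_bounded[OF prob_space_\<mu>, where B=B])
      (measurable, rule KB')
  also have "\<dots> = (\<integral>\<omega>. K (event_config E \<omega> x m) \<partial>\<mu>)"
    by (intro Bochner_Integration.integral_cong refl sum[symmetric])
  finally show ?thesis unfolding K_def .
qed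

end

section \<open>Regular sample points\<close>

lemma state_spaceD:
  assumes "x \<in> state_space E"
  shows "0 \<le> fst (snd x) $ i" "0 \<le> snd (snd x) $ i"
  using assms by (auto simp: state_space_def)

lemma state_spaceI:
  assumes "\<And>i. 0 \<le> fst (snd x) $ i" "\<And>i. 0 \<le> snd (snd x) $ i" "\<And>i. i \<notin> E \<Longrightarrow> fst (snd x) $ i = 0"
  shows "x \<in> state_space E"
  using assms by (cases x rule: prod_cases3) (auto simp: state_space_def)

lemma time_to_event_Min:
  assumes "E \<noteq> {}"
  shows "running_clocks E x \<noteq> {}" "finite (running_clocks E x)" "time_to_event E x = Min (running_clocks E x)"
proof -
  obtain l u v where x: "x = (l, u, v)" by (cases x rule: prod_cases3)
  show 1: "running_clocks E x \<noteq> {}" using assms by (auto simp: x)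
  show "finite (running_clocks E x)" by (simp add: x)
  show "time_to_event E x = Min (running_clocks E x)" using 1 by (simp add: time_to_event_def)
qed

lemma time_to_event_le_arrival: "i \<in> E \<Longrightarrow> time_to_event E x \<le> fst (snd x) $ i"
proof -
  assume i: "i \<in> E"
  then have E: "E \<noteq> {}" by auto
  have "fst (snd x) $ i \<in> running_clocks E x" using i by (cases x rule: prod_cases3) auto
  then show ?thesis using time_to_event_Min[OF E] by simp
qed

lemma time_to_event_le_service: "E \<noteq> {} \<Longrightarrow> 0 < fst x $ i \<Longrightarrow> time_to_event E x \<le> snd (snd x) $ i"
proof -
  assume E: "E \<noteq> {}" and i: "0 < fst x $ i"
  have "snd (snd x) $ i \<in> running_clocks E x" using i by (cases x rule: prod_cases3) auto
  then show ?thesis using time_to_event_Min[OF E] by simp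
qed

lemma some_clock_due:
  assumes "E \<noteq> {}"
  shows "arrival_due E x \<noteq> {} \<or> service_due E x \<noteq> {}"
proof -
  have "time_to_event E x \<in> running_clocks E x" using time_to_event_Min[OF assms] by simp
  then show ?thesis
    by (cases x rule: prod_cases3) (auto simp: arrival_due_def service_due_def)
qed

lemma time_to_event_nonneg:
  assumes "E \<noteq> {}" "x \<in> state_space E"
  shows "0 \<le> time_to_event E x"
proof -
  have "time_to_event E x \<in> running_clocks E x" using time_to_event_Min[OF assms(1)] by simp
  then show ?thesis using assms(2) by (cases x rule: prod_cases3) (auto simp: state_space_def)
qed

lemma run_clocks_state_space:
  assumes "E \<noteq> {}" "x \<in> state_space E" "h \<le> time_to_event E x" "0 \<le> h"
  shows "run_clocks E h x \<in> state_space E"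
proof (rule state_spaceI)
  fix i
  show "0 \<le> fst (snd (run_clocks E h x)) $ i"
    using state_spaceD[OF assms(2)] time_to_event_le_arrival[of i E x] assms(3) by (auto simp: run_clocks_eq)
  show "0 \<le> snd (snd (run_clocks E h x)) $ i"
    using state_spaceD[OF assms(2)] time_to_event_le_service[OF assms(1), of x i] assms(3)
    by (force simp: run_clocks_eq)
  show "fst (snd (run_clocks E h x)) $ i = 0" if "i \<notin> E"
    using that assms(2) by (cases x rule: prod_cases3) (auto simp: run_clocks_eq state_space_def)
qed

text \<open>Divergent sums of the times rule out explosion and keep renewals coming. The last clause
  says that every routing of positive probability is used infinitely often, so that customers spread
  through the network.\<close>

definition regular_sample :: "'d::finite set \<Rightarrow> real^'d^'d \<Rightarrow> 'd sample \<Rightarrow> bool" where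
  "regular_sample E P \<omega> \<longleftrightarrow>
     (\<forall>i\<in>E. \<forall>k. 0 \<le> fst \<omega> (i, k)) \<and> (\<forall>j k. 0 \<le> fst (snd \<omega>) (j, k)) \<and>
     (\<forall>i\<in>E. \<forall>C. \<exists>n. C < (\<Sum>k<n. fst \<omega> (i, k))) \<and>
     (\<forall>j C. \<exists>n. C < (\<Sum>k<n. fst (snd \<omega>) (j, k))) \<and>
     (\<forall>j k. 0 < P $ j $ k \<longrightarrow> (\<forall>C. \<exists>n. C < (\<Sum>q<n. (of_bool (snd (snd \<omega>) (j, q) = Some k) :: real))))"

locale regular_path =
  fixes E :: "'d::finite set" and P :: "real^'d^'d" and \<omega> :: "'d sample" and x :: "'d state"
  assumes E: "E \<noteq> {}" and reg: "regular_sample E P \<omega>" and x: "x \<in> state_space E"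
begin

abbreviation "S \<equiv> event_time E \<omega> x"
abbreviation "Y \<equiv> event_state E \<omega> x"
abbreviation "a \<equiv> arrivals E \<omega> x"
abbreviation "c \<equiv> departures E \<omega> x"
abbreviation "h m \<equiv> time_to_event E (Y m)"
abbreviation "U \<equiv> fst \<omega>"
abbreviation "V \<equiv> fst (snd \<omega>)"

lemma U_nonneg: "i \<in> E \<Longrightarrow> 0 \<le> U (i, k)" and V_nonneg: "0 \<le> V (j, k)"
  using reg by (auto simp: regular_sample_def)

lemma event_state_space: "Y m \<in> state_space E"
proof (induction m)
  case 0
  show ?case using x by simp
next
  case (Suc m)
  have r: "run_clocks E (h m) (Y m) \<in> state_space E"
    by (rule run_clocks_state_space[OF E Suc]) (simp_all add: time_to_event_nonneg[OF E Suc])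
  show ?case unfolding event_state_Suc
  proof (rule state_spaceI, goal_cases)
    case (1 i)
    show ?case using state_spaceD(1)[OF r, of i] U_nonneg[of i] by (auto simp: fire_def arrival_due_def)
  next
    case (2 i)
    show ?case using state_spaceD(2)[OF r, of i] V_nonneg[of i] by (auto simp: fire_def)
  next
    case (3 i)
    then show ?case using r by (auto simp: fire_def arrival_due_def state_space_def split_beta')
  qed
qed

lemma h_nonneg: "0 \<le> h m"
  by (rule time_to_event_nonneg[OF E event_state_space])

lemma S_mono: "m \<le> m' \<Longrightarrow> S m \<le> S m'"
  by (induction rule: dec_induct) (use h_nonneg in \<open>auto simp: event_time_Suc intro: order_trans\<close>)

lemma S_nonneg: "0 \<le> S m"
  using S_mono[of 0 m] by simp

lemma arrival_clock:
  "i \<in> E \<Longrightarrow> fst (snd x) $ i + (\<Sum>k<a m i. U (i, k)) = S m + fst (snd (Y m)) $ i"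
proof (induction m)
  case (Suc m)
  then show ?case
    by (auto simp: event_time_Suc arrivals_Suc event_state_Suc fire_def run_clocks_eq arrival_due_def)
qed simp

lemma service_clock_Suc:
  "(\<Sum>k<c (Suc m) j. V (j, k)) - snd (snd (Y (Suc m))) $ j =
   (\<Sum>k<c m j. V (j, k)) - snd (snd (Y m)) $ j + (if 0 < fst (Y m) $ j then h m else 0)"
  by (auto simp: departures_Suc event_state_Suc fire_def run_clocks_eq service_due_def)

text \<open>Only an inequality, unlike for arrivals: the service clock stands still while its
  station is idle.\<close>

lemma service_clock:
  "snd (snd x) $ j + (\<Sum>k<c m j. V (j, k)) \<le> S m + snd (snd (Y m)) $ j"
proof (induction m)
  case (Suc m)
  then show ?case using service_clock_Suc[of j m] h_nonneg[of m] by (auto simp: event_time_Suc split: if_splits)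
qed simp

text \<open>A clock only decreases between draws. Combined with the balance of elapsed time, this
  shows that all draws except the latest have been used up.\<close>

lemma arrival_clock_le:
  "i \<in> E \<Longrightarrow> fst (snd (Y m)) $ i \<le> (if a m i = 0 then fst (snd x) $ i else U (i, a m i - 1))"
proof (induction m)
  case (Suc m)
  then show ?case using h_nonneg[of m]
    by (auto simp: arrivals_Suc event_state_Suc fire_def run_clocks_eq arrival_due_def)
qed simp

lemma service_clock_le:
  "snd (snd (Y m)) $ j \<le> (if c m j = 0 then snd (snd x) $ j else V (j, c m j - 1))"
proof (induction m)
  case (Suc m)
  then show ?case using h_nonneg[of m]
    by (auto simp: departures_Suc event_state_Suc fire_def run_clocks_eq service_due_def)
qed simp

text \<open>No explosion: if all event times stayed below t, each counter would be bounded in terms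
  of the index at which its partial sums pass t, while every step advances at least one
  counter.\<close>

lemma S_unbounded: "\<exists>m. t < S m"
proof (rule ccontr)
  assume "\<not> (\<exists>m. t < S m)"
  then have t: "S m \<le> t" for m by (auto simp: not_less)
  have "\<forall>i. \<exists>n. i \<in> E \<longrightarrow> t < (\<Sum>k<n. U (i, k))" "\<forall>j. \<exists>n. t < (\<Sum>k<n. V (j, k))"
    using reg by (auto simp: regular_sample_def)
  then obtain p q where p: "\<And>i. i \<in> E \<Longrightarrow> t < (\<Sum>k<p i. U (i, k))" and q: "\<And>j. t < (\<Sum>k<q j. V (j, k))"
    by metis
  have a: "a m i \<le> p i" if i: "i \<in> E" for m i
  proof (rule ccontr)
    assume n: "\<not> a m i \<le> p i"
    \<comment> \<open>The latest draw may still be running, so only the first r of the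
      \<open>Suc r\<close> draws are known to fit into the elapsed time.\<close>
    then obtain r where r: "a m i = Suc r" "p i \<le> r" by (cases "a m i") auto
    have "(\<Sum>k<p i. U (i, k)) \<le> (\<Sum>k<r. U (i, k))"
      using r U_nonneg[OF i] by (intro sum_mono2) auto
    also have "\<dots> \<le> S m"
      using arrival_clock[OF i, of m] arrival_clock_le[OF i, of m] state_spaceD(1)[OF x, of i] by (simp add: r)
    finally show False using p[OF i] t[of m] by simp
  qed
  have c: "c m j \<le> q j" for m j
  proof (rule ccontr)
    assume n: "\<not> c m j \<le> q j"
    then obtain r where r: "c m j = Suc r" "q j \<le> r" by (cases "c m j") auto
    have "(\<Sum>k<q j. V (j, k)) \<le> (\<Sum>k<r. V (j, k))"
      using r V_nonneg by (intro sum_mono2) auto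
    also have "\<dots> \<le> S m"
      using service_clock[of j m] service_clock_le[of m j] state_spaceD(2)[OF x, of j] by (simp add: r)
    finally show False using q[of j] t[of m] by simp
  qed
  have grow: "m \<le> (\<Sum>i\<in>E. a m i) + (\<Sum>j\<in>UNIV. c m j)" for m
  proof (induction m)
    case (Suc m)
    have "(\<Sum>i\<in>E. a (Suc m) i) + (\<Sum>j\<in>UNIV. c (Suc m) j) =
      (\<Sum>i\<in>E. a m i) + (\<Sum>j\<in>UNIV. c m j) + ((\<Sum>i\<in>E. if i \<in> arrival_due E (Y m) then 1 else 0) + (\<Sum>j\<in>UNIV. if j \<in> service_due E (Y m) then 1 else 0))"
      by (simp add: arrivals_Suc departures_Suc sum.distrib)
    moreover have "1 \<le> (\<Sum>i\<in>E. if i \<in> arrival_due E (Y m) then 1 else 0) + (\<Sum>j\<in>UNIV. if j \<in> service_due E (Y m) then 1 else (0::nat))"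
    proof -
      consider i where "i \<in> arrival_due E (Y m)" | j where "j \<in> service_due E (Y m)"
        using some_clock_due[OF E, of "Y m"] by auto
      then show ?thesis
      proof cases
        case 1
        then have "i \<in> E" by (auto simp: arrival_due_def)
        with 1 show ?thesis
          using member_le_sum[of i E "\<lambda>i. if i \<in> arrival_due E (Y m) then 1 else (0::nat)"] by simp
      next
        case 2
        then show ?thesis
          using member_le_sum[of j UNIV "\<lambda>i. if i \<in> service_due E (Y m) then 1 else (0::nat)"] by simp
      qed
    qed
    ultimately show ?case using Suc by simp
  qed simp
  have "(\<Sum>i\<in>E. a m i) + (\<Sum>j\<in>UNIV. c m j) \<le> (\<Sum>i\<in>E. p i) + (\<Sum>j\<in>UNIV. q j)" for m
    using a c by (intro add_mono sum_mono) auto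
  from this[of "Suc ((\<Sum>i\<in>E. p i) + (\<Sum>j\<in>UNIV. q j))"] grow[of "Suc ((\<Sum>i\<in>E. p i) + (\<Sum>j\<in>UNIV. q j))"]
  show False by linarith
qed

lemma S_at_top: "filterlim S at_top sequentially"
  unfolding filterlim_at_top
proof
  fix t
  obtain m where "t < S m" using S_unbounded by blast
  then show "\<forall>\<^sub>F n in sequentially. t \<le> S n"
    using S_mono by (intro eventually_sequentiallyI[of m]) (meson less_le_trans order.strict_implies_order)
qed

lemma process_eq:
  assumes "S m \<le> t" "t < S (Suc m)"
  shows "process E x t \<omega> = run_clocks E (t - S m) (Y m)"
proof -
  have "(GREATEST k. fst (event_config E \<omega> x k) \<le> t) = m"
  proof (rule Greatest_equality)
    show "fst (event_config E \<omega> x m) \<le> t" using assms(1) by (simp add: event_time_def)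
    fix k assume "fst (event_config E \<omega> x k) \<le> t"
    then have "S k < S (Suc m)" using assms(2) by (simp add: event_time_def)
    then show "k \<le> m" using S_mono[of "Suc m" k] by (meson leD not_less_eq_eq)
  qed
  then show ?thesis
    unfolding process_def Let_def by (simp add: event_config_split)
qed

lemma event_index:
  assumes "0 \<le> t"
  obtains m where "S m \<le> t" "t < S (Suc m)"
proof -
  define k where "k = (LEAST k. t < S k)"
  have k: "t < S k" "\<And>m. m < k \<Longrightarrow> \<not> t < S m"
    using LeastI_ex[OF S_unbounded[of t]] unfolding k_def by (auto dest: not_less_Least)
  then have "k \<noteq> 0" using assms k(1) by (metis event_time_0 not_less)
  then obtain m where "k = Suc m" by (cases k) auto
  with k[of ] that[of m] show ?thesis by (metis lessI not_less)
qed

lemma arrivals_unbounded: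
  assumes i: "i \<in> E"
  shows "\<exists>m. n \<le> a m i"
proof (rule ccontr)
  assume "\<not> (\<exists>m. n \<le> a m i)"
  then have le: "a m i \<le> n" for m by (auto simp: not_le intro: less_imp_le)
  obtain m where m: "fst (snd x) $ i + (\<Sum>k<n. U (i, k)) < S m" using S_unbounded by blast
  have "(\<Sum>k<a m i. U (i, k)) \<le> (\<Sum>k<n. U (i, k))"
    using le[of m] U_nonneg[OF i] by (intro sum_mono2) auto
  then show False using m arrival_clock[OF i, of m] state_spaceD(1)[OF event_state_space, of m i] by simp
qed

section \<open>Conservation of customers and unbounded departures\<close>

lemma queue_balance:
  "fst (Y m) $ k + c m k = fst x $ k + (if k \<in> E then a m k else 0)
     + (\<Sum>j\<in>UNIV. card {q. q < c m j \<and> snd (snd \<omega>) (j, q) = Some k})"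
proof (induction m)
  case (Suc m)
  define D where "D = service_due E (Y m)"
  have card: "card {q. q < c (Suc m) j \<and> snd (snd \<omega>) (j, q) = Some k}
     = card {q. q < c m j \<and> snd (snd \<omega>) (j, q) = Some k} + (if j \<in> D \<and> snd (snd \<omega>) (j, c m j) = Some k then 1 else 0)" for j
  proof -
    have *: "{q. q < c (Suc m) j \<and> snd (snd \<omega>) (j, q) = Some k} = {q. q < c m j \<and> snd (snd \<omega>) (j, q) = Some k}
       \<union> (if j \<in> D \<and> snd (snd \<omega>) (j, c m j) = Some k then {c m j} else {})"
      by (auto simp: departures_Suc D_def less_Suc_eq)
    show ?thesis unfolding * by (subst card_Un_disjoint) auto
  qed
  have D: "{j \<in> D. snd (snd \<omega>) (j, c m j) = Some k} = {j \<in> UNIV. j \<in> D \<and> snd (snd \<omega>) (j, c m j) = Some k}" by auto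
  have "(\<Sum>j\<in>UNIV. if j \<in> D \<and> snd (snd \<omega>) (j, c m j) = Some k then 1 else 0)
      = card {j \<in> D. snd (snd \<omega>) (j, c m j) = Some k}"
    unfolding D by (subst sum.inter_filter[symmetric]) auto
  then have "(\<Sum>j\<in>UNIV. card {q. q < c (Suc m) j \<and> snd (snd \<omega>) (j, q) = Some k})
     = (\<Sum>j\<in>UNIV. card {q. q < c m j \<and> snd (snd \<omega>) (j, q) = Some k}) + card {j \<in> D. snd (snd \<omega>) (j, c m j) = Some k}"
    by (simp add: card sum.distrib)
  \<comment> \<open>Makes the truncated subtraction in \<open>fire\<close> exact.\<close>
  moreover have "k \<in> D \<Longrightarrow> 0 < fst (Y m) $ k" by (simp add: D_def service_due_def)
  ultimately show ?case using Suc
    by (auto simp: arrivals_Suc departures_Suc event_state_Suc fire_def run_clocks_eq D_def[symmetric] arrival_due_def)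
qed simp

text \<open>The quantity assumed unbounded is the initial queue plus everything that has entered
  station k. If departures stayed bounded, the station would be busy from some event on, and its
  clock would run through infinite time while consuming only finitely many service times.\<close>

lemma departures_unbounded_if:
  assumes inflow: "\<And>n. \<exists>m. n \<le> fst (Y m) $ k + c m k"
  shows "\<exists>m. n \<le> c m k"
proof (rule ccontr)
  assume "\<not> (\<exists>m. n \<le> c m k)"
  then have le: "c m k \<le> n" for m by (auto simp: not_le intro: less_imp_le)
  obtain m0 where m0: "Suc n \<le> fst (Y m0) $ k + c m0 k" using inflow by blast
  have mono: "fst (Y m) $ k + c m k \<le> fst (Y m') $ k + c m' k" if "m \<le> m'" for m m'
  proof -
    have "card {q. q < c m j \<and> snd (snd \<omega>) (j, q) = Some k} \<le> card {q. q < c m' j \<and> snd (snd \<omega>) (j, q) = Some k}" for j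
      using departures_mono[OF that, of E \<omega> x j] by (intro card_mono) auto
    then show ?thesis unfolding queue_balance
      using arrivals_mono[OF that, of E \<omega> x k] by (intro add_mono sum_mono) auto
  qed
  have pos: "0 < fst (Y m) $ k" if "m0 \<le> m" for m
    using m0 mono[OF that] le[of m] by simp
  have eq: "(\<Sum>q<c m k. V (k, q)) - snd (snd (Y m)) $ k - S m = (\<Sum>q<c m0 k. V (k, q)) - snd (snd (Y m0)) $ k - S m0"
    if "m0 \<le> m" for m
    using that
  proof (induction rule: dec_induct)
    case (step m)
    then show ?case using service_clock_Suc[of k m] pos[of m] by (simp add: event_time_Suc)
  qed simp
  define C where "C = (\<Sum>q<c m0 k. V (k, q)) - snd (snd (Y m0)) $ k - S m0"
  obtain m1 where m1: "(\<Sum>q<n. V (k, q)) - C < S m1" using S_unbounded by blast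
  define m where "m = max m0 m1"
  have "(\<Sum>q<c m k. V (k, q)) \<le> (\<Sum>q<n. V (k, q))"
    using le[of m] V_nonneg by (intro sum_mono2) auto
  moreover have "S m1 \<le> S m" using S_mono by (simp add: m_def)
  moreover have "0 \<le> snd (snd (Y m)) $ k" by (rule state_spaceD[OF event_state_space])
  moreover have "(\<Sum>q<c m k. V (k, q)) - snd (snd (Y m)) $ k - S m = C"
    unfolding C_def by (rule eq) (simp add: m_def)
  ultimately show False using m1 by linarith
qed

lemma departures_unbounded_arrival:
  assumes "k \<in> E"
  shows "\<exists>m. n \<le> c m k"
proof (rule departures_unbounded_if)
  fix n
  obtain m where "n \<le> a m k" using arrivals_unbounded[OF assms] by blast
  then have "n \<le> fst (Y m) $ k + c m k" unfolding queue_balance using assms by simp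
  then show "\<exists>m. n \<le> fst (Y m) $ k + c m k" ..
qed

lemma departures_unbounded_routing:
  assumes j: "\<And>n. \<exists>m. n \<le> c m j" and P: "0 < P $ j $ k"
  shows "\<exists>m. n \<le> c m k"
proof (rule departures_unbounded_if)
  fix n
  obtain r where r: "real n < (\<Sum>q<r. (of_bool (snd (snd \<omega>) (j, q) = Some k) :: real))"
    using reg P unfolding regular_sample_def by blast
  obtain m where m: "r \<le> c m j" using j by blast
  have "(\<Sum>q<r. (of_bool (snd (snd \<omega>) (j, q) = Some k) :: real)) = real (card {q. q < r \<and> snd (snd \<omega>) (j, q) = Some k})"
    by (simp add: of_bool_def sum.If_cases Int_def)
  then have "n \<le> card {q. q < r \<and> snd (snd \<omega>) (j, q) = Some k}" using r by simp
  also have "\<dots> \<le> card {q. q < c m j \<and> snd (snd \<omega>) (j, q) = Some k}" using m by (intro card_mono) auto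
  also have "\<dots> \<le> (\<Sum>j\<in>UNIV. card {q. q < c m j \<and> snd (snd \<omega>) (j, q) = Some k})"
    by (rule member_le_sum) auto
  finally have "n \<le> fst (Y m) $ k + c m k" unfolding queue_balance by simp
  then show "\<exists>m. n \<le> fst (Y m) $ k + c m k" ..
qed

text \<open>The stations with infinitely many departures contain E and are closed under routings of
  positive probability.\<close>

lemma departures_unbounded:
  assumes "\<And>G. E \<subseteq> G \<Longrightarrow> (\<And>j k. j \<in> G \<Longrightarrow> 0 < P $ j $ k \<Longrightarrow> k \<in> G) \<Longrightarrow> G = UNIV"
  shows "\<exists>m. n \<le> c m k"
proof -
  have "{k. \<forall>n. \<exists>m. n \<le> c m k} = UNIV"
    by (rule assms) (auto intro: departures_unbounded_arrival departures_unbounded_routing)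
  then show ?thesis by blast
qed

end

section \<open>Almost every sample point is regular\<close>

lemma pmf_routing:
  assumes "routing_matrix P"
  shows "pmf (routing_pmf P j) d = (case d of None \<Rightarrow> exit_prob P j | Some k \<Rightarrow> P $ j $ k)"
  unfolding routing_pmf_def
proof (rule pmf_embed_pmf)
  show nn: "0 \<le> (case d of None \<Rightarrow> exit_prob P j | Some k \<Rightarrow> P $ j $ k)" for d
    using assms by (auto simp: routing_matrix_def exit_prob_def split: option.split)
  have "(\<integral>\<^sup>+ d. ennreal (case d of None \<Rightarrow> exit_prob P j | Some k \<Rightarrow> P $ j $ k) \<partial>count_space UNIV)
      = ennreal (\<Sum>d\<in>UNIV. case d of None \<Rightarrow> exit_prob P j | Some k \<Rightarrow> P $ j $ k)"
    using nn by (subst nn_integral_count_space_finite) (auto intro!: sum_ennreal)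
  also have "(\<Sum>d\<in>UNIV. case d of None \<Rightarrow> exit_prob P j | Some k \<Rightarrow> P $ j $ k) = 1"
    by (simp add: UNIV_option_conv sum.reindex exit_prob_def)
  finally show "(\<integral>\<^sup>+ d. ennreal (case d of None \<Rightarrow> exit_prob P j | Some k \<Rightarrow> P $ j $ k) \<partial>count_space UNIV) = 1" by simp
qed

lemma time_law_not_AE_0:
  assumes "time_law \<nu>"
  shows "\<not> (AE x in \<nu>. x = 0)"
proof
  assume "AE x in \<nu>. x = 0"
  then have "(\<integral>x. x \<partial>\<nu>) = (\<integral>x. 0 \<partial>\<nu>)"
    using assms by (intro integral_cong_AE) (auto simp: time_law_def)
  then show False using assms by (simp add: time_law_def)
qed

lemma AE_pair_fst:
  assumes "sigma_finite_measure N" "AE x in M. Q x"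
  shows "AE z in M \<Otimes>\<^sub>M N. Q (fst z)"
proof -
  interpret sigma_finite_measure N by fact
  obtain A where A: "A \<in> null_sets M" "{x \<in> space M. \<not> Q x} \<subseteq> A"
    using assms(2) unfolding eventually_ae_filter by blast
  have "A \<times> space N \<in> null_sets (M \<Otimes>\<^sub>M N)"
    using A by (auto simp: null_sets_def emeasure_pair_measure_Times)
  then show ?thesis by (rule AE_I') (use A in \<open>auto simp: space_pair_measure\<close>)
qed

lemma AE_pair_snd:
  assumes "sigma_finite_measure N" "AE x in N. Q x"
  shows "AE z in M \<Otimes>\<^sub>M N. Q (snd z)"
proof -
  interpret sigma_finite_measure N by fact
  obtain A where A: "A \<in> null_sets N" "{x \<in> space N. \<not> Q x} \<subseteq> A"
    using assms(2) unfolding eventually_ae_filter by blast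
  have "space M \<times> A \<in> null_sets (M \<Otimes>\<^sub>M N)"
    using A by (auto simp: null_sets_def emeasure_pair_measure_Times)
  then show ?thesis by (rule AE_I') (use A in \<open>auto simp: space_pair_measure\<close>)
qed

context jackson
begin

lemma AE_sample_U:
  assumes "AE U in PiM (E \<times> UNIV) (\<lambda>(i, k::nat). Te i). Q U"
  shows "AE \<omega> in \<mu>. Q (fst \<omega>)"
  unfolding sample_measure_def
  by (rule AE_pair_fst[OF prob_space_imp_sigma_finite[OF prob_space_V\<Phi>] assms])

lemma AE_sample_V:
  assumes "AE V in PiM UNIV (\<lambda>(j, k::nat). Ts j). Q V"
  shows "AE \<omega> in \<mu>. Q (fst (snd \<omega>))"
  unfolding sample_measure_def
  by (rule AE_pair_snd[OF prob_space_imp_sigma_finite[OF prob_space_V\<Phi>]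
      AE_pair_fst[OF prob_space_imp_sigma_finite[OF prob_space_\<Phi>] assms]])

lemma AE_sample_\<Phi>:
  assumes "AE \<Phi> in PiM UNIV (\<lambda>(j, k::nat). measure_pmf (routing_pmf P j)). Q \<Phi>"
  shows "AE \<omega> in \<mu>. Q (snd (snd \<omega>))"
  unfolding sample_measure_def
  by (rule AE_pair_snd[OF prob_space_imp_sigma_finite[OF prob_space_V\<Phi>]
      AE_pair_snd[OF prob_space_imp_sigma_finite[OF prob_space_\<Phi>] assms]])

lemma AE_regular_sample: "AE \<omega> in \<mu>. regular_sample E P \<omega>"
proof -
  have inj: "inj (\<lambda>k::nat. (i, k))" for i :: 'd by (auto intro: injI)
  have 1: "AE \<omega> in \<mu>. \<forall>i\<in>E. \<forall>k. 0 \<le> fst \<omega> (i, k)"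
  proof (rule AE_sample_U)
    have "AE U in PiM (E \<times> UNIV) (\<lambda>(i, k::nat). Te i). 0 \<le> U (i, k)" if "i \<in> E" for i k
      using AE_PiM_component[of "E \<times> UNIV" "\<lambda>(i, k::nat). Te i" "(i, k)" "\<lambda>x. 0 \<le> x"] that Te Te_prob
      by (auto simp: time_law_def)
    then show "AE U in PiM (E \<times> UNIV) (\<lambda>(i, k::nat). Te i). \<forall>i\<in>E. \<forall>k. 0 \<le> U (i, k)"
      by (simp add: AE_ball_countable AE_all_countable)
  qed
  have 2: "AE \<omega> in \<mu>. \<forall>j k. 0 \<le> fst (snd \<omega>) (j, k)"
  proof (rule AE_sample_V)
    have "AE V in PiM UNIV (\<lambda>(i, k::nat). Ts i). 0 \<le> V (i, k)" for i k
      using AE_PiM_component[of UNIV "\<lambda>(i, k::nat). Ts i" "(i, k)" "\<lambda>x. 0 \<le> x"] Ts Ts_prob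
      by (auto simp: time_law_def)
    then show "AE V in PiM UNIV (\<lambda>(i, k::nat). Ts i). \<forall>i k. 0 \<le> V (i, k)"
      by (simp add: AE_all_countable)
  qed
  have 3: "AE \<omega> in \<mu>. \<forall>i\<in>E. \<forall>C. \<exists>n. C < (\<Sum>k<n. fst \<omega> (i, k))"
  proof (rule AE_sample_U)
    have "AE U in PiM (E \<times> UNIV) (\<lambda>(i, k::nat). Te i). \<forall>C. \<exists>n. C < (\<Sum>k<n. U (i, k))" if "i \<in> E" for i
      using AE_PiM_sum_unbounded[of "E \<times> UNIV" "\<lambda>(i, k::nat). Te i" "\<lambda>k. (i, k)" "Te i" "\<lambda>x. x"] that Te[OF that] Te_prob inj
        time_law_not_AE_0[OF Te[OF that]]
      by (auto simp: time_law_def)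
    then show "AE U in PiM (E \<times> UNIV) (\<lambda>(i, k::nat). Te i). \<forall>i\<in>E. \<forall>C. \<exists>n. C < (\<Sum>k<n. U (i, k))"
      by (simp add: AE_ball_countable)
  qed
  have 4: "AE \<omega> in \<mu>. \<forall>j C. \<exists>n. C < (\<Sum>k<n. fst (snd \<omega>) (j, k))"
  proof (rule AE_sample_V)
    have "AE V in PiM UNIV (\<lambda>(i, k::nat). Ts i). \<forall>C. \<exists>n. C < (\<Sum>k<n. V (i, k))" for i
      using AE_PiM_sum_unbounded[of UNIV "\<lambda>(i, k::nat). Ts i" "\<lambda>k. (i, k)" "Ts i" "\<lambda>x. x"] Ts[of i] Ts_prob inj
        time_law_not_AE_0[OF Ts]
      by (auto simp: time_law_def)
    then show "AE V in PiM UNIV (\<lambda>(i, k::nat). Ts i). \<forall>i C. \<exists>n. C < (\<Sum>k<n. V (i, k))"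
      by (simp add: AE_all_countable)
  qed
  have 5: "AE \<omega> in \<mu>. \<forall>j k. 0 < P $ j $ k \<longrightarrow> (\<forall>C. \<exists>n. C < (\<Sum>q<n. (of_bool (snd (snd \<omega>) (j, q) = Some k) :: real)))"
  proof (rule AE_sample_\<Phi>)
    have "AE \<Phi> in PiM UNIV (\<lambda>(j, q::nat). measure_pmf (routing_pmf P j)).
        0 < P $ j $ k \<longrightarrow> (\<forall>C. \<exists>n. C < (\<Sum>q<n. (of_bool (\<Phi> (j, q) = Some k) :: real)))" for j k
    proof (cases "0 < P $ j $ k")
      case True
      then have "Some k \<in> set_pmf (routing_pmf P j)"
        by (simp add: set_pmf_iff pmf_routing[OF routing])
      then have "\<not> (AE d in measure_pmf (routing_pmf P j). (of_bool (d = Some k) :: real) = 0)"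
        by (auto simp: AE_measure_pmf_iff)
      then show ?thesis
        using AE_PiM_sum_unbounded[of UNIV "\<lambda>(j, q::nat). measure_pmf (routing_pmf P j)" "\<lambda>k. (j, k)"
          "measure_pmf (routing_pmf P j)" "\<lambda>d. of_bool (d = Some k)"] inj
        by (auto simp: measure_pmf.prob_space_axioms)
    qed simp
    then show "AE \<Phi> in PiM UNIV (\<lambda>(j, q::nat). measure_pmf (routing_pmf P j)). \<forall>j k.
        0 < P $ j $ k \<longrightarrow> (\<forall>C. \<exists>n. C < (\<Sum>q<n. (of_bool (\<Phi> (j, q) = Some k) :: real)))"
      by (simp add: AE_all_countable)
  qed
  show ?thesis using 1 2 3 4 5 unfolding regular_sample_def by eventually_elim blast
qed

end

section \<open>The basic adjoint relation\<close>

lemma bounded_convergence: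
  fixes s :: "nat \<Rightarrow> 'a \<Rightarrow> real"
  assumes "prob_space M" "\<And>n. s n \<in> borel_measurable M" "f \<in> borel_measurable M"
    and "AE x in M. (\<lambda>n. s n x) \<longlonglongrightarrow> f x" "\<And>n. AE x in M. \<bar>s n x\<bar> \<le> B"
  shows "(\<lambda>n. \<integral>x. s n x \<partial>M) \<longlonglongrightarrow> (\<integral>x. f x \<partial>M)"
proof -
  interpret prob_space M by fact
  show ?thesis
    by (rule integral_dominated_convergence[where w="\<lambda>_. B"]) (use assms in auto)
qed

context jackson
begin

lemma stationary_facts:
  assumes "stationary E P Te Ts \<pi>"
  shows "prob_space \<pi>" "sets \<pi> = sets state_algebra" "AE x in \<pi>. x \<in> state_space E"
  using assms by (auto simp: stationary_def)

text \<open>Stationarity is an identity for sets; it says that the image of the product of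
  \<open>\<pi>\<close> and the sample law under the process is \<open>\<pi>\<close> again, which
  carries it over to bounded functions.\<close>

lemma integral_stationary:
  fixes g :: "'d state \<Rightarrow> real"
  assumes st: "stationary E P Te Ts \<pi>" and t: "0 \<le> t"
    and g[measurable]: "g \<in> borel_measurable state_algebra" and B: "\<And>x. \<bar>g x\<bar> \<le> B"
  shows "(\<integral>x. \<integral>\<omega>. g (process E x t \<omega>) \<partial>\<mu> \<partial>\<pi>) = (\<integral>x. g x \<partial>\<pi>)"
proof -
  note sf[measurable_cong] = stationary_facts(2)[OF st]
  interpret \<pi>: prob_space \<pi> by (rule stationary_facts(1)[OF st])
  interpret \<pi>\<mu>: pair_prob_space \<pi> \<mu> ..
  have m: "(\<lambda>z. process E (fst z) t (snd z)) \<in> \<pi> \<Otimes>\<^sub>M \<mu> \<rightarrow>\<^sub>M state_algebra"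
    by (rule measurable_process) measurable
  have mx: "(\<lambda>\<omega>. process E x t \<omega>) \<in> \<mu> \<rightarrow>\<^sub>M state_algebra" for x
    by (rule measurable_process) auto
  have "distr (\<pi> \<Otimes>\<^sub>M \<mu>) state_algebra (\<lambda>z. process E (fst z) t (snd z)) = \<pi>"
  proof (rule measure_eqI)
    fix A assume "A \<in> sets (distr (\<pi> \<Otimes>\<^sub>M \<mu>) state_algebra (\<lambda>z. process E (fst z) t (snd z)))"
    then have A[measurable]: "A \<in> sets state_algebra" by simp
    have "emeasure (distr (\<pi> \<Otimes>\<^sub>M \<mu>) state_algebra (\<lambda>z. process E (fst z) t (snd z))) A
        = (\<integral>\<^sup>+z. indicator A (process E (fst z) t (snd z)) \<partial>(\<pi> \<Otimes>\<^sub>M \<mu>))"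
      by (subst nn_integral_indicator[symmetric], simp, subst nn_integral_distr[OF m]) simp_all
    also have "\<dots> = (\<integral>\<^sup>+x. \<integral>\<^sup>+\<omega>. indicator A (process E x t \<omega>) \<partial>\<mu> \<partial>\<pi>)"
      by (subst \<mu>.nn_integral_fst[symmetric]) (use m in \<open>auto intro!: measurable_compose[OF m]\<close>)
    also have "\<dots> = (\<integral>\<^sup>+x. emeasure (transition E P Te Ts t x) A \<partial>\<pi>)"
      unfolding transition_def
      by (intro nn_integral_cong)
        (subst nn_integral_indicator[symmetric], simp, subst nn_integral_distr[OF mx], simp_all)
    also have "\<dots> = emeasure \<pi> A" using st t A by (simp add: stationary_def)
    finally show "emeasure (distr (\<pi> \<Otimes>\<^sub>M \<mu>) state_algebra (\<lambda>z. process E (fst z) t (snd z))) A = emeasure \<pi> A" .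
  qed (simp add: sf)
  then have "(\<integral>x. g x \<partial>\<pi>) = (\<integral>z. g (process E (fst z) t (snd z)) \<partial>(\<pi> \<Otimes>\<^sub>M \<mu>))"
    by (subst integral_distr[OF m g, symmetric]) simp
  also have "\<dots> = (\<integral>x. \<integral>\<omega>. g (process E x t \<omega>) \<partial>\<mu> \<partial>\<pi>)"
    by (subst \<pi>\<mu>.integral_fst'[symmetric])
      (auto intro!: integrable_bounded[OF \<pi>\<mu>.P.prob_space_axioms _ B] measurable_compose[OF m])
  finally show ?thesis ..
qed

lemma regular_pathI:
  "regular_sample E P \<omega> \<Longrightarrow> x \<in> state_space E \<Longrightarrow> regular_path E P \<omega> x"
  by unfold_locales (rule E_nonempty)

end

text \<open>An exponential time of rate 1. Averaging over it replaces the generator by the resolvent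
  at 1, so bounded functions suffice and no expectation has to be differentiated in time.\<close>

definition exp_clock :: "real measure" where
  "exp_clock = density lborel (exponential_density 1)"

lemma prob_space_exp_clock: "prob_space exp_clock"
  unfolding exp_clock_def by (rule prob_space_exponential_density) simp

lemma sets_exp_clock[measurable_cong]: "sets exp_clock = sets borel"
  by (simp add: exp_clock_def)

lemma integral_exp_clock:
  assumes [measurable]: "g \<in> borel_measurable borel"
  shows "(\<integral>s. g s \<partial>exp_clock) = (\<integral>s. indicator {0..} s * (exp (- s) * g s) \<partial>lborel)"
  unfolding exp_clock_def
  by (subst integral_density)
    (auto intro!: Bochner_Integration.integral_cong simp: exponential_density_def indicator_def)

lemma AE_exp_clock_nonneg: "AE s in exp_clock. 0 \<le> s"
  unfolding exp_clock_def by (subst AE_density) (auto simp: exponential_density_def)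

context regular_path
begin

text \<open>Between events the derivative of \<open>exp (- s) * f (X s)\<close> is
  \<open>exp (- s) * (D - f)\<close>. The fundamental theorem on each interval leaves the jumps at
  the event times, discounted.\<close>

lemma exp_integral_upto:
  fixes f D :: "'d state \<Rightarrow> real"
  assumes cont: "\<And>y. y \<in> state_space E \<Longrightarrow> continuous_on {0..time_to_event E y} (\<lambda>s. f (run_clocks E s y))"
    and deriv: "\<And>y. y \<in> state_space E \<Longrightarrow> \<exists>F. finite F \<and> (\<forall>s\<in>{0<..<time_to_event E y} - F.
        ((\<lambda>s. f (run_clocks E s y)) has_real_derivative D (run_clocks E s y)) (at s))"
  shows "((\<lambda>s. exp (- s) * (D (process E x s \<omega>) - f (process E x s \<omega>))) has_integral
      (exp (- S N) * f (Y N) - f x -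
        (\<Sum>m<N. exp (- S (Suc m)) * (f (Y (Suc m)) - f (run_clocks E (h m) (Y m)))))) {0..S N}"
proof (induction N)
  case 0
  show ?case by (simp add: has_integral_refl)
next
  case (Suc N)
  let ?G = "\<lambda>s. exp (- s) * (D (process E x s \<omega>) - f (process E x s \<omega>))"
  let ?y = "Y N"
  let ?\<Phi> = "\<lambda>s. exp (- s) * f (run_clocks E (s - S N) ?y)"
  have le: "S N \<le> S (Suc N)" by (rule S_mono) simp
  have hS: "h N = S (Suc N) - S N" by (simp add: event_time_Suc)
  obtain F where F: "finite F" "\<And>s. s \<in> {0<..<h N} - F \<Longrightarrow>
      ((\<lambda>s. f (run_clocks E s ?y)) has_real_derivative D (run_clocks E s ?y)) (at s)"
    using deriv[OF event_state_space[of N]] by blast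
  have "((\<lambda>s. exp (- s) * (D (run_clocks E (s - S N) ?y) - f (run_clocks E (s - S N) ?y))) has_integral
      ?\<Phi> (S (Suc N)) - ?\<Phi> (S N)) {S N..S (Suc N)}"
  proof (rule fundamental_theorem_of_calculus_interior_strong[of "(\<lambda>s. s + S N) ` F"])
    show "finite ((\<lambda>s. s + S N) ` F)" using F by simp
    have "continuous_on {S N..S (Suc N)} (\<lambda>s. f (run_clocks E (s - S N) ?y))"
      by (rule continuous_on_compose2[OF cont[OF event_state_space[of N]]])
        (auto intro!: continuous_intros simp: hS)
    then show "continuous_on {S N..S (Suc N)} ?\<Phi>" by (intro continuous_intros)
    fix s assume s: "s \<in> {S N<..<S (Suc N)} - (\<lambda>s. s + S N) ` F"
    then have s': "s - S N \<in> {0<..<h N} - F" by (auto simp: hS image_iff)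
    have "((\<lambda>s. s - S N) has_real_derivative 1) (at s)" by (auto intro!: derivative_eq_intros)
    from DERIV_chain2[where f="\<lambda>s. f (run_clocks E s ?y)", OF F(2)[OF s'] this]
    have "((\<lambda>s. f (run_clocks E (s - S N) ?y)) has_real_derivative D (run_clocks E (s - S N) ?y)) (at s)" by simp
    then have "(?\<Phi> has_real_derivative exp (- s) * (D (run_clocks E (s - S N) ?y) - f (run_clocks E (s - S N) ?y))) (at s)"
      by (auto intro!: derivative_eq_intros simp: algebra_simps)
    then show "(?\<Phi> has_vector_derivative exp (- s) * (D (run_clocks E (s - S N) ?y) - f (run_clocks E (s - S N) ?y))) (at s)"
      by (simp add: has_real_derivative_iff_has_vector_derivative)
  qed (rule le)
  \<comment> \<open>At the right endpoint the process has already jumped, so the integrand is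
    altered in this single point.\<close>
  then have "(?G has_integral ?\<Phi> (S (Suc N)) - ?\<Phi> (S N)) {S N..S (Suc N)}"
    by (rule has_integral_spike_finite[of "{S (Suc N)}", rotated 2]) (auto simp: process_eq)
  from has_integral_combine[OF S_nonneg le Suc this]
  have "(?G has_integral (exp (- S N) * f (Y N) - f x -
        (\<Sum>m<N. exp (- S (Suc m)) * (f (Y (Suc m)) - f (run_clocks E (h m) (Y m)))))
      + (?\<Phi> (S (Suc N)) - ?\<Phi> (S N))) {0..S (Suc N)}" .
  moreover have "run_clocks E 0 ?y = ?y" by (simp add: run_clocks_eq prod_eq_iff vec_eq_iff)
  ultimately show ?case by (simp add: algebra_simps hS)
qed

text \<open>The discount kills the boundary term \<open>exp (- S N) * f (Y N)\<close>, since event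
  times tend to infinity. The bound, uniform in N, is for the dominated convergence over sample
  points that follows.\<close>

lemma sum_jumps_tendsto:
  fixes f D :: "'d state \<Rightarrow> real"
  assumes cont: "\<And>y. y \<in> state_space E \<Longrightarrow> continuous_on {0..time_to_event E y} (\<lambda>s. f (run_clocks E s y))"
    and deriv: "\<And>y. y \<in> state_space E \<Longrightarrow> \<exists>F. finite F \<and> (\<forall>s\<in>{0<..<time_to_event E y} - F.
        ((\<lambda>s. f (run_clocks E s y)) has_real_derivative D (run_clocks E s y)) (at s))"
    and X[measurable]: "(\<lambda>s. D (process E x s \<omega>)) \<in> borel_measurable borel" "(\<lambda>s. f (process E x s \<omega>)) \<in> borel_measurable borel"
    and B: "\<And>y. \<bar>f y\<bar> \<le> B" "\<And>y. \<bar>D y\<bar> \<le> B"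
  defines "J \<equiv> \<lambda>N. \<Sum>m<N. exp (- S (Suc m)) * (f (Y (Suc m)) - f (run_clocks E (h m) (Y m)))"
  shows "J \<longlonglongrightarrow> - f x - (\<integral>s. D (process E x s \<omega>) - f (process E x s \<omega>) \<partial>exp_clock)" (is "_ \<longlonglongrightarrow> - f x - ?I")
    and "\<bar>J N\<bar> \<le> 4 * B"
proof -
  let ?g = "\<lambda>s. D (process E x s \<omega>) - f (process E x s \<omega>)"
  have gB: "\<bar>?g s\<bar> \<le> 2 * B" for s using B(1)[of "process E x s \<omega>"] B(2)[of "process E x s \<omega>"] by linarith
  interpret c: prob_space exp_clock by (rule prob_space_exp_clock)
  have B0: "0 \<le> B" using B(1)[of undefined] by simp
  have gB': "\<bar>indicator A s * ?g s\<bar> \<le> 2 * B" for s A using gB[of s] B0 by (auto simp: indicator_def)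
  have eq: "(\<integral>s. indicator {0..S N} s * ?g s \<partial>exp_clock) = exp (- S N) * f (Y N) - f x - J N" for N
  proof -
    have "set_integrable lborel {0..S N} (\<lambda>s. exp (- s) * ?g s)"
      unfolding set_integrable_def
    proof (rule Bochner_Integration.integrable_bound[where f="\<lambda>s. indicator {0..S N} s * (2 * B)"])
      show "integrable lborel (\<lambda>s. indicator {0..S N} s * (2 * B))"
        by (intro integrable_mult_left integrable_real_indicator) (auto simp: emeasure_lborel_Icc_eq)
      have "\<bar>exp (- s) * ?g s\<bar> \<le> 2 * B" if "0 \<le> s" for s
      proof -
        have "\<bar>exp (- s) * ?g s\<bar> \<le> 1 * (2 * B)" unfolding abs_mult by (rule mult_mono) (use gB that in auto)
        then show ?thesis by simp
      qed
      then show "AE s in lborel. norm (indicat_real {0..S N} s *\<^sub>R (exp (- s) * ?g s)) \<le> norm (indicat_real {0..S N} s * (2 * B))"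
        using B0 by (intro AE_I2) (auto simp: indicator_def)
    qed measurable
    from set_borel_integral_eq_integral(2)[OF this]
    have "(LINT s:{0..S N}|lborel. exp (- s) * ?g s) = exp (- S N) * f (Y N) - f x - J N"
      using exp_integral_upto[OF cont deriv, of N] unfolding J_def by (simp add: integral_unique)
    moreover have "(\<integral>s. indicator {0..S N} s * ?g s \<partial>exp_clock) = (LINT s:{0..S N}|lborel. exp (- s) * ?g s)"
      unfolding set_lebesgue_integral_def
      by (subst integral_exp_clock) (auto intro!: Bochner_Integration.integral_cong simp: indicator_def)
    ultimately show ?thesis by simp
  qed
  have "(\<lambda>N. \<integral>s. indicator {0..S N} s * ?g s \<partial>exp_clock) \<longlonglongrightarrow> ?I"
  proof (rule bounded_convergence[OF prob_space_exp_clock, where B="2 * B"])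
    show "AE s in exp_clock. (\<lambda>N. indicator {0..S N} s * ?g s) \<longlonglongrightarrow> ?g s"
      using AE_exp_clock_nonneg
    proof eventually_elim
      case (elim s)
      have "\<forall>\<^sub>F N in sequentially. indicator {0..S N} s * ?g s = ?g s"
        using S_at_top[unfolded filterlim_at_top, rule_format, of s] by eventually_elim (use elim in auto)
      then show ?case by (rule tendsto_eventually)
    qed
  qed (use gB' in auto)
  moreover have "(\<lambda>N. exp (- S N) * f (Y N)) \<longlonglongrightarrow> 0"
  proof (rule Lim_null_comparison[where g="\<lambda>N. exp (- S N) * B"])
    show "\<forall>\<^sub>F N in sequentially. norm (exp (- S N) * f (Y N)) \<le> exp (- S N) * B"
      using B(1) by (auto simp: abs_mult)
    have "(\<lambda>N. exp (- S N)) \<longlonglongrightarrow> 0"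
      by (rule filterlim_compose[OF exp_at_bot]) (simp add: filterlim_uminus_at_bot S_at_top)
    then show "(\<lambda>N. exp (- S N) * B) \<longlonglongrightarrow> 0" by (rule tendsto_mult_left_zero)
  qed
  ultimately have "(\<lambda>N. exp (- S N) * f (Y N) - f x - (\<integral>s. indicator {0..S N} s * ?g s \<partial>exp_clock)) \<longlonglongrightarrow> 0 - f x - ?I"
    by (intro tendsto_intros)
  then show "J \<longlonglongrightarrow> - f x - ?I" by (simp add: eq)
  have "\<bar>\<integral>s. indicator {0..S N} s * ?g s \<partial>exp_clock\<bar> \<le> 2 * B"
    by (rule abs_integral_le_bound[OF prob_space_exp_clock gB'])
  moreover have "\<bar>exp (- S N) * f (Y N)\<bar> \<le> 1 * B"
    unfolding abs_mult by (rule mult_mono) (use B S_nonneg in auto)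
  moreover have "\<bar>f x\<bar> \<le> B" by (rule B)
  ultimately show "\<bar>J N\<bar> \<le> 4 * B" using eq[of N] by linarith
qed

end

context jackson
begin

text \<open>By the Markov property of the event chain the jump has conditional mean zero given the
  first m events, and these already determine the time of the next event and with it the
  discount.\<close>

lemma integral_jump_zero:
  fixes f :: "'d state \<Rightarrow> real"
  assumes x: "x \<in> state_space E"
    and f[measurable]: "f \<in> borel_measurable state_algebra" and B: "\<And>y. \<bar>f y\<bar> \<le> B"
    and jump: "\<And>z. fst (snd z) \<in> state_space E \<Longrightarrow> (\<integral>\<omega>'. f (fst (snd (event_step E \<omega>' z))) \<partial>\<mu>)
        = f (run_clocks E (time_to_event E (fst (snd z))) (fst (snd z)))"
  shows "(\<integral>\<omega>. exp (- event_time E \<omega> x (Suc m)) * (f (event_state E \<omega> x (Suc m)) -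
      f (run_clocks E (time_to_event E (event_state E \<omega> x m)) (event_state E \<omega> x m))) \<partial>\<mu>) = 0"
proof -
  \<comment> \<open>The Markov property was stated for functions bounded on all configurations,
    including those with a negative time; along regular paths the maximum changes nothing.\<close>
  define e where "e s = exp (- max 0 (s :: real))" for s
  have e[measurable]: "e \<in> borel_measurable borel" unfolding e_def by measurable
  have e01: "0 \<le> e s" "e s \<le> 1" for s by (auto simp: e_def)
  have eB: "\<bar>e s * f y\<bar> \<le> B" for s y
  proof -
    have "\<bar>e s * f y\<bar> \<le> 1 * B" unfolding abs_mult by (rule mult_mono) (use B e01 in auto)
    then show ?thesis by simp
  qed
  define F where "F = (\<lambda>z::'d config. e (fst z) * f (fst (snd z)))"
  define F' where "F' = (\<lambda>z::'d config. e (fst z + time_to_event E (fst (snd z)))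
      * f (run_clocks E (time_to_event E (fst (snd z))) (fst (snd z))))"
  have id: "(\<lambda>z. z) \<in> config_algebra \<rightarrow>\<^sub>M config_algebra" by simp
  have [measurable]: "(\<lambda>z. fst (snd z)) \<in> (config_algebra :: 'd config measure) \<rightarrow>\<^sub>M state_algebra"
    "(\<lambda>z. fst z) \<in> borel_measurable (config_algebra :: 'd config measure)"
    using measurable_config_state[OF id] measurable_config_time[OF id] by simp_all
  have F[measurable]: "F \<in> borel_measurable config_algebra" unfolding F_def by measurable
  have F'[measurable]: "F' \<in> borel_measurable config_algebra" unfolding F'_def by measurable
  have c[measurable]: "(\<lambda>\<omega>. event_config E \<omega> x m) \<in> \<mu> \<rightarrow>\<^sub>M config_algebra" for m
    by (rule measurable_event_config) auto
  have reg: "AE \<omega> in \<mu>. regular_path E P \<omega> x"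
    using AE_regular_sample by eventually_elim (rule regular_pathI[OF _ x])
  have "(\<integral>\<omega>. F (event_config E \<omega> x (Suc m)) \<partial>\<mu>) = (\<integral>\<omega>. (\<integral>\<omega>'. F (event_step E \<omega>' (event_config E \<omega> x m)) \<partial>\<mu>) \<partial>\<mu>)"
    by (rule integral_event_config_Suc[OF F, where B=B]) (auto simp: F_def eB)
  also have "\<dots> = (\<integral>\<omega>. F' (event_config E \<omega> x m) \<partial>\<mu>)"
  proof (rule integral_cong_AE)
    show "(\<lambda>\<omega>. \<integral>\<omega>'. F (event_step E \<omega>' (event_config E \<omega> x m)) \<partial>\<mu>) \<in> borel_measurable \<mu>"
      by measurable
    show "AE \<omega> in \<mu>. (\<integral>\<omega>'. F (event_step E \<omega>' (event_config E \<omega> x m)) \<partial>\<mu>) = F' (event_config E \<omega> x m)"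
      using reg
    proof eventually_elim
      case (elim \<omega>)
      then interpret regular_path E P \<omega> x .
      have "fst (event_step E \<omega>' z) = fst z + time_to_event E (fst (snd z))" for \<omega>' z
        by (simp add: event_step_eq Let_def)
      then show ?case
        using event_state_space[of m] by (simp add: F_def F'_def jump event_state_def)
    qed
  qed measurable
  finally have eq: "(\<integral>\<omega>. F (event_config E \<omega> x (Suc m)) \<partial>\<mu>) = (\<integral>\<omega>. F' (event_config E \<omega> x m) \<partial>\<mu>)" .
  have "(\<integral>\<omega>. exp (- event_time E \<omega> x (Suc m)) * (f (event_state E \<omega> x (Suc m)) -
      f (run_clocks E (time_to_event E (event_state E \<omega> x m)) (event_state E \<omega> x m))) \<partial>\<mu>)
     = (\<integral>\<omega>. F (event_config E \<omega> x (Suc m)) - F' (event_config E \<omega> x m) \<partial>\<mu>)"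
  proof (rule integral_cong_AE)
    show "AE \<omega> in \<mu>. exp (- event_time E \<omega> x (Suc m)) * (f (event_state E \<omega> x (Suc m)) -
      f (run_clocks E (time_to_event E (event_state E \<omega> x m)) (event_state E \<omega> x m))) =
       F (event_config E \<omega> x (Suc m)) - F' (event_config E \<omega> x m)"
      using reg
    proof eventually_elim
      case (elim \<omega>)
      then interpret regular_path E P \<omega> x .
      show ?case using S_nonneg[of "Suc m"]
        by (simp add: F_def F'_def e_def event_time_Suc[symmetric] event_state_def[symmetric] event_time_def[symmetric]
            algebra_simps max_def)
    qed
    show "(\<lambda>\<omega>. exp (- event_time E \<omega> x (Suc m)) * (f (event_state E \<omega> x (Suc m)) -
      f (run_clocks E (time_to_event E (event_state E \<omega> x m)) (event_state E \<omega> x m)))) \<in> borel_measurable \<mu>"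
      unfolding event_time_def event_state_def by measurable
  qed measurable
  also have "\<dots> = 0"
    using eq by (subst Bochner_Integration.integral_diff)
      (auto intro!: integrable_bounded[OF prob_space_\<mu>, where B=B] simp: F_def F'_def eB F[unfolded F_def] F'[unfolded F'_def])
  finally show ?thesis .
qed

text \<open>The resolvent identity: f is the 1-resolvent of \<open>f - D\<close>. The jumps drop out
  in expectation, and their partial sums are bounded, so the limit may be taken under the
  integral.\<close>

lemma integral_exp_clock_process:
  fixes f D :: "'d state \<Rightarrow> real"
  assumes x: "x \<in> state_space E"
    and [measurable]: "f \<in> borel_measurable state_algebra" "D \<in> borel_measurable state_algebra"
    and B: "\<And>y. \<bar>f y\<bar> \<le> B" "\<And>y. \<bar>D y\<bar> \<le> B"
    and cont: "\<And>y. y \<in> state_space E \<Longrightarrow> continuous_on {0..time_to_event E y} (\<lambda>s. f (run_clocks E s y))"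
    and deriv: "\<And>y. y \<in> state_space E \<Longrightarrow> \<exists>F. finite F \<and> (\<forall>s\<in>{0<..<time_to_event E y} - F.
        ((\<lambda>s. f (run_clocks E s y)) has_real_derivative D (run_clocks E s y)) (at s))"
    and jump: "\<And>z. fst (snd z) \<in> state_space E \<Longrightarrow> (\<integral>\<omega>'. f (fst (snd (event_step E \<omega>' z))) \<partial>\<mu>)
        = f (run_clocks E (time_to_event E (fst (snd z))) (fst (snd z)))"
  shows "(\<integral>\<omega>. \<integral>s. D (process E x s \<omega>) - f (process E x s \<omega>) \<partial>exp_clock \<partial>\<mu>) = - f x"
proof -
  define j where "j m \<omega> = exp (- event_time E \<omega> x (Suc m)) * (f (event_state E \<omega> x (Suc m)) -
      f (run_clocks E (time_to_event E (event_state E \<omega> x m)) (event_state E \<omega> x m)))" for m \<omega>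
  have [measurable]: "(\<lambda>\<omega>. event_config E \<omega> x m) \<in> \<mu> \<rightarrow>\<^sub>M config_algebra" for m
    by (rule measurable_event_config) auto
  have jm[measurable]: "j m \<in> borel_measurable \<mu>" for m
    unfolding j_def event_time_def event_state_def by measurable
  have reg: "AE \<omega> in \<mu>. regular_path E P \<omega> x"
    using AE_regular_sample by eventually_elim (rule regular_pathI[OF _ x])
  have X: "(\<lambda>s. D (process E x s \<omega>)) \<in> borel_measurable borel" "(\<lambda>s. f (process E x s \<omega>)) \<in> borel_measurable borel"
    if "\<omega> \<in> space \<mu>" for \<omega>
    using measurable_compose[OF measurable_process assms(3), of "\<lambda>s. \<omega>" borel "\<lambda>s. x" "\<lambda>s. s"]
      measurable_compose[OF measurable_process assms(2), of "\<lambda>s. \<omega>" borel "\<lambda>s. x" "\<lambda>s. s"] that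
    by (simp_all add: measurable_const)
  have [measurable]: "(\<lambda>z. process E x (snd z) (fst z)) \<in> \<mu> \<Otimes>\<^sub>M exp_clock \<rightarrow>\<^sub>M state_algebra"
    by (rule measurable_process) auto
  interpret c: prob_space exp_clock by (rule prob_space_exp_clock)
  let ?I = "\<lambda>\<omega>. \<integral>s. D (process E x s \<omega>) - f (process E x s \<omega>) \<partial>exp_clock"
  have Im[measurable]: "?I \<in> borel_measurable \<mu>"
    by (rule c.borel_measurable_lebesgue_integral) (simp add: split_beta')
  have gB: "\<bar>D y - f y\<bar> \<le> 2 * B" for y using B(1)[of y] B(2)[of y] by linarith
  have IB: "\<bar>?I \<omega>\<bar> \<le> 2 * B" for \<omega> by (rule abs_integral_le_bound[OF prob_space_exp_clock gB])
  have sp: "AE \<omega> in \<mu>. \<omega> \<in> space \<mu>" by (rule AE_space)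
  have lim: "AE \<omega> in \<mu>. (\<lambda>N. \<Sum>m<N. j m \<omega>) \<longlonglongrightarrow> - f x - ?I \<omega>"
    using reg sp
  proof eventually_elim
    case (elim \<omega>)
    then interpret regular_path E P \<omega> x by simp
    show ?case unfolding j_def by (rule sum_jumps_tendsto(1)[OF cont deriv X[OF elim(2)] B])
  qed
  have bound: "AE \<omega> in \<mu>. \<bar>\<Sum>m<N. j m \<omega>\<bar> \<le> 4 * B" for N
    using reg sp
  proof eventually_elim
    case (elim \<omega>)
    then interpret regular_path E P \<omega> x by simp
    show ?case unfolding j_def by (rule sum_jumps_tendsto(2)[OF cont deriv X[OF elim(2)] B])
  qed
  have "(\<lambda>N. \<integral>\<omega>. (\<Sum>m<N. j m \<omega>) \<partial>\<mu>) \<longlonglongrightarrow> (\<integral>\<omega>. - f x - ?I \<omega> \<partial>\<mu>)"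
    by (rule bounded_convergence[OF prob_space_\<mu> _ _ lim bound]) measurable
  moreover have "(\<integral>\<omega>. (\<Sum>m<N. j m \<omega>) \<partial>\<mu>) = 0" for N
  proof -
    have "integrable \<mu> (j m)" for m
    proof (rule \<mu>.integrable_const_bound[OF _ jm])
      \<comment> \<open>One jump is the difference of two consecutive partial sums, each bounded by
        \<open>4 * B\<close>.\<close>
      show "AE \<omega> in \<mu>. norm (j m \<omega>) \<le> 8 * B"
        using bound[of "Suc m"] bound[of m] by eventually_elim simp
    qed
    then show ?thesis
      using integral_jump_zero[OF x _ B(1) jump] by (simp add: Bochner_Integration.integral_sum j_def[symmetric])
  qed
  ultimately have "(\<lambda>N::nat. 0) \<longlonglongrightarrow> (\<integral>\<omega>. - f x - ?I \<omega> \<partial>\<mu>)" by simp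
  from LIMSEQ_unique[OF this tendsto_const] have "(\<integral>\<omega>. - f x - ?I \<omega> \<partial>\<mu>) = 0" .
  then show ?thesis
    by (subst (asm) Bochner_Integration.integral_diff)
      (auto intro!: integrable_bounded[OF prob_space_\<mu> Im IB] simp: \<mu>.prob_space)
qed

text \<open>Integrate the resolvent identity over \<open>\<pi>\<close>. By Fubini and stationarity
  the left side becomes the integral of \<open>D - f\<close>, the right side is minus that of f, and
  the two integrals of f cancel.\<close>

lemma basic_adjoint_relation:
  fixes f D :: "'d state \<Rightarrow> real"
  assumes st: "stationary E P Te Ts \<pi>"
    and f[measurable]: "f \<in> borel_measurable state_algebra" and D[measurable]: "D \<in> borel_measurable state_algebra"
    and B: "\<And>y. \<bar>f y\<bar> \<le> B" "\<And>y. \<bar>D y\<bar> \<le> B"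
    and cont: "\<And>y. y \<in> state_space E \<Longrightarrow> continuous_on {0..time_to_event E y} (\<lambda>s. f (run_clocks E s y))"
    and deriv: "\<And>y. y \<in> state_space E \<Longrightarrow> \<exists>F. finite F \<and> (\<forall>s\<in>{0<..<time_to_event E y} - F.
        ((\<lambda>s. f (run_clocks E s y)) has_real_derivative D (run_clocks E s y)) (at s))"
    and jump: "\<And>z. fst (snd z) \<in> state_space E \<Longrightarrow> (\<integral>\<omega>'. f (fst (snd (event_step E \<omega>' z))) \<partial>\<mu>)
        = f (run_clocks E (time_to_event E (fst (snd z))) (fst (snd z)))"
  shows "(\<integral>x. D x \<partial>\<pi>) = 0"
proof -
  note sf[measurable_cong] = stationary_facts(2)[OF st]
  interpret \<pi>: prob_space \<pi> by (rule stationary_facts(1)[OF st])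
  interpret c: prob_space exp_clock by (rule prob_space_exp_clock)
  interpret \<mu>c: pair_prob_space \<mu> exp_clock ..
  interpret \<pi>c: pair_prob_space \<pi> exp_clock ..
  define g where "g = (\<lambda>x. D x - f x)"
  have g[measurable]: "g \<in> borel_measurable state_algebra" unfolding g_def by measurable
  have gB: "\<bar>g y\<bar> \<le> 2 * B" for y using B(1)[of y] B(2)[of y] unfolding g_def by linarith
  have X1: "(\<lambda>z. process E x (snd z) (fst z)) \<in> \<mu> \<Otimes>\<^sub>M exp_clock \<rightarrow>\<^sub>M state_algebra" for x
    by (rule measurable_process) auto
  have X2: "(\<lambda>z. process E (fst (fst z)) (snd (fst z)) (snd z)) \<in> (\<pi> \<Otimes>\<^sub>M exp_clock) \<Otimes>\<^sub>M \<mu> \<rightarrow>\<^sub>M state_algebra"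
    by (rule measurable_process) measurable
  have G: "(\<lambda>z. \<integral>\<omega>. g (process E (fst z) (snd z) \<omega>) \<partial>\<mu>) \<in> borel_measurable (\<pi> \<Otimes>\<^sub>M exp_clock)"
    by (rule \<mu>.borel_measurable_lebesgue_integral) (use measurable_compose[OF X2 g] in \<open>simp add: split_beta'\<close>)
  have GB: "\<bar>\<integral>\<omega>. g (process E x s \<omega>) \<partial>\<mu>\<bar> \<le> 2 * B" for x s by (rule abs_integral_le_bound[OF prob_space_\<mu> gB])
  have "(\<integral>x. - f x \<partial>\<pi>) = (\<integral>x. \<integral>\<omega>. \<integral>s. g (process E x s \<omega>) \<partial>exp_clock \<partial>\<mu> \<partial>\<pi>)"
  proof (rule integral_cong_AE)
    \<comment> \<open>The order is exchanged already here to obtain measurability in x from that of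
      the inner expectation in \<open>G\<close>.\<close>
    have "(\<integral>\<omega>. \<integral>s. g (process E x s \<omega>) \<partial>exp_clock \<partial>\<mu>) = (\<integral>s. \<integral>\<omega>. g (process E x s \<omega>) \<partial>\<mu> \<partial>exp_clock)" for x
      by (rule \<mu>c.Fubini_integral[symmetric])
        (auto intro!: integrable_bounded[OF \<mu>c.P.prob_space_axioms, where B="2 * B"] measurable_compose[OF X1 g] gB simp: split_beta')
    then show "(\<lambda>x. \<integral>\<omega>. \<integral>s. g (process E x s \<omega>) \<partial>exp_clock \<partial>\<mu>) \<in> borel_measurable \<pi>"
      using c.borel_measurable_lebesgue_integral[of "\<lambda>x s. \<integral>\<omega>. g (process E x s \<omega>) \<partial>\<mu>" \<pi>] G by (simp add: split_beta')
    show "AE x in \<pi>. - f x = (\<integral>\<omega>. \<integral>s. g (process E x s \<omega>) \<partial>exp_clock \<partial>\<mu>)"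
      using stationary_facts(3)[OF st]
      by eventually_elim (simp add: g_def integral_exp_clock_process[OF _ f D B cont deriv jump])
  qed measurable
  also have "\<dots> = (\<integral>x. \<integral>s. \<integral>\<omega>. g (process E x s \<omega>) \<partial>\<mu> \<partial>exp_clock \<partial>\<pi>)"
    by (intro Bochner_Integration.integral_cong refl \<mu>c.Fubini_integral[symmetric])
      (auto intro!: integrable_bounded[OF \<mu>c.P.prob_space_axioms, where B="2 * B"] measurable_compose[OF X1 g] gB simp: split_beta')
  also have "\<dots> = (\<integral>s. \<integral>x. \<integral>\<omega>. g (process E x s \<omega>) \<partial>\<mu> \<partial>\<pi> \<partial>exp_clock)"
    by (rule \<pi>c.Fubini_integral[symmetric])
      (auto intro!: integrable_bounded[OF \<pi>c.P.prob_space_axioms, where B="2 * B"] G GB simp: split_beta')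
  also have "\<dots> = (\<integral>s. (\<integral>x. g x \<partial>\<pi>) \<partial>exp_clock)"
  proof (rule integral_cong_AE)
    show "(\<lambda>s. \<integral>x. \<integral>\<omega>. g (process E x s \<omega>) \<partial>\<mu> \<partial>\<pi>) \<in> borel_measurable exp_clock"
      by (rule \<pi>.borel_measurable_lebesgue_integral)
        (use measurable_compose[OF measurable_pair_swap' G] in \<open>simp add: split_beta'\<close>)
    show "AE s in exp_clock. (\<integral>x. \<integral>\<omega>. g (process E x s \<omega>) \<partial>\<mu> \<partial>\<pi>) = (\<integral>x. g x \<partial>\<pi>)"
      using AE_exp_clock_nonneg by eventually_elim (rule integral_stationary[OF st _ g gB])
  qed simp
  also have "\<dots> = (\<integral>x. g x \<partial>\<pi>)" by (simp add: c.prob_space)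
  also have "\<dots> = (\<integral>x. D x \<partial>\<pi>) - (\<integral>x. f x \<partial>\<pi>)"
    unfolding g_def by (rule Bochner_Integration.integral_diff; rule integrable_bounded[OF \<pi>.prob_space_axioms])
      (use B in auto)
  finally show ?thesis by simp
qed

end

section \<open>Exponential test functions\<close>

lemma abs_prod_le_power:
  fixes F :: "'i \<Rightarrow> real"
  assumes "\<And>i. i \<in> A \<Longrightarrow> \<bar>F i\<bar> \<le> B"
  shows "\<bar>\<Prod>i\<in>A. F i\<bar> \<le> B ^ card A"
  using prod_mono[of A "\<lambda>i. \<bar>F i\<bar>" "\<lambda>_. B"] assms by (simp add: abs_prod)

lemma integral_PiM_prod:
  fixes F :: "'j \<Rightarrow> 'b \<Rightarrow> real"
  assumes M: "\<And>i. i \<in> I \<Longrightarrow> prob_space (M i)" and J: "finite J" "inj_on p J" "p ` J \<subseteq> I"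
    and F: "\<And>j. j \<in> J \<Longrightarrow> integrable (M (p j)) (F j)"
  shows "(\<integral>x. (\<Prod>j\<in>J. F j (x (p j))) \<partial>PiM I M) = (\<Prod>j\<in>J. \<integral>x. F j x \<partial>M (p j))"
proof -
  \<comment> \<open>The product locale asks for sigma-finite measures at every index; outside J a
    one-point space fills in.\<close>
  define M' where "M' j = (if j \<in> J then M (p j) else count_space {undefined})" for j
  have "prob_space (M' j)" for j
  proof (cases "j \<in> J")
    case True
    then show ?thesis using M[of "p j"] J(3) by (auto simp: M'_def)
  qed (auto simp: M'_def intro!: prob_spaceI)
  then have "sigma_finite_measure (M' j)" for j by (rule prob_space_imp_sigma_finite)
  then interpret product_sigma_finite M' by (simp add: product_sigma_finite_def)
  have eq: "PiM J M' = distr (PiM I M) (PiM J M') (\<lambda>\<omega>. \<lambda>n\<in>J. \<omega> (p n))"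
  proof -
    have "PiM J M' = PiM J (\<lambda>j. M (p j))" by (rule PiM_cong) (auto simp: M'_def)
    moreover have "distr (PiM I M) (PiM J (\<lambda>j. M (p j))) (\<lambda>\<omega>. \<lambda>n\<in>J. \<omega> (p n)) = PiM J (\<lambda>j. M (p j))"
      by (rule distr_PiM_reindex) (use M J in auto)
    ultimately show ?thesis by simp
  qed
  have m: "(\<lambda>\<omega>. \<lambda>n\<in>J. \<omega> (p n)) \<in> PiM I M \<rightarrow>\<^sub>M PiM J M'"
    by (rule measurable_restrict) (use J in \<open>auto simp: M'_def\<close>)
  have Fm: "(\<lambda>x. \<Prod>j\<in>J. F j (x j)) \<in> borel_measurable (PiM J M')"
  proof (rule borel_measurable_prod)
    fix j assume j: "j \<in> J"
    have "F j \<in> borel_measurable (M' j)" using F[OF j] j by (simp add: M'_def)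
    then show "(\<lambda>x. F j (x j)) \<in> borel_measurable (PiM J M')"
      by (rule measurable_compose[OF measurable_component_singleton[OF j]])
  qed
  have "(\<integral>x. (\<Prod>j\<in>J. F j (x (p j))) \<partial>PiM I M) = (\<integral>x. (\<Prod>j\<in>J. F j (x j)) \<partial>PiM J M')"
    by (subst eq, subst integral_distr[OF m Fm]) (auto intro!: Bochner_Integration.integral_cong prod.cong)
  also have "\<dots> = (\<Prod>j\<in>J. \<integral>x. F j x \<partial>M' j)"
    by (rule product_integral_prod) (use J F in \<open>auto simp: M'_def\<close>)
  finally show ?thesis by (simp add: M'_def cong: prod.cong)
qed

lemma integral_pair_mult:
  fixes u :: "'a \<Rightarrow> real" and v :: "'b \<Rightarrow> real"
  assumes M: "prob_space M" and N: "prob_space N" and u[measurable]: "u \<in> borel_measurable M" and v[measurable]: "v \<in> borel_measurable N"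
    and B: "\<And>x. \<bar>u x\<bar> \<le> B" "\<And>y. \<bar>v y\<bar> \<le> B'"
  shows "(\<integral>z. u (fst z) * v (snd z) \<partial>(M \<Otimes>\<^sub>M N)) = (\<integral>x. u x \<partial>M) * (\<integral>y. v y \<partial>N)"
proof -
  interpret M: prob_space M by fact
  interpret N: prob_space N by fact
  interpret pair_prob_space M N ..
  have "\<bar>u x * v y\<bar> \<le> B * B'" for x y
    unfolding abs_mult by (rule mult_mono) (use B order_trans[OF abs_ge_zero B(1)] in auto)
  then have "integrable (M \<Otimes>\<^sub>M N) (\<lambda>z. u (fst z) * v (snd z))"
    by (intro integrable_bounded[OF P.prob_space_axioms]) auto
  from integral_fst'[OF this] show ?thesis by simp
qed

context jackson
begin

lemma integral_sample_prod:
  fixes F G :: "'d \<Rightarrow> real \<Rightarrow> real" and H :: "'d \<Rightarrow> 'd option \<Rightarrow> real"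
  assumes A: "A \<subseteq> E" and m: "\<And>i. F i \<in> borel_measurable borel" "\<And>j. G j \<in> borel_measurable borel"
    and B: "\<And>i x. \<bar>F i x\<bar> \<le> B" "\<And>i x. \<bar>G i x\<bar> \<le> B" "\<And>i x. \<bar>H i x\<bar> \<le> B"
  shows "(\<integral>\<omega>. (\<Prod>i\<in>A. F i (fst \<omega> (i, \<alpha> i))) * ((\<Prod>j\<in>D. G j (fst (snd \<omega>) (j, \<gamma> j))) * (\<Prod>j\<in>D. H j (snd (snd \<omega>) (j, \<gamma> j)))) \<partial>\<mu>)
    = (\<Prod>i\<in>A. \<integral>x. F i x \<partial>Te i) * ((\<Prod>j\<in>D. \<integral>x. G j x \<partial>Ts j) * (\<Prod>j\<in>D. \<integral>x. H j x \<partial>routing_pmf P j))"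
proof -
  let ?U = "PiM (E \<times> UNIV) (\<lambda>(i, k::nat). Te i)" and ?V = "PiM UNIV (\<lambda>(j, k::nat). Ts j)"
    and ?\<Phi> = "PiM UNIV (\<lambda>(j, k::nat). measure_pmf (routing_pmf P j))"
  define u where "u = (\<lambda>U. \<Prod>i\<in>A. F i (U (i, \<alpha> i)))"
  define v where "v = (\<lambda>V. \<Prod>j\<in>D. G j (V (j, \<gamma> j)))"
  define w where "w = (\<lambda>\<Phi>. \<Prod>j\<in>D. H j (\<Phi> (j, \<gamma> j)))"
  have um[measurable]: "u \<in> borel_measurable ?U"
    unfolding u_def
  proof (rule borel_measurable_prod)
    fix i assume i: "i \<in> A"
    then have "F i \<in> borel_measurable (Te i)" using m A sets_Te by (subst measurable_cong_sets[OF sets_Te refl]) auto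
    from measurable_compose[OF measurable_component_singleton[of "(i, \<alpha> i)" "E \<times> UNIV" "\<lambda>(i, k::nat). Te i"]] i A this
    show "(\<lambda>U. F i (U (i, \<alpha> i))) \<in> borel_measurable ?U" by auto
  qed
  have vm[measurable]: "v \<in> borel_measurable ?V"
    unfolding v_def
  proof (rule borel_measurable_prod)
    fix i
    have "G i \<in> borel_measurable (Ts i)" using m by (subst measurable_cong_sets[OF sets_Ts refl]) auto
    from measurable_compose[OF measurable_component_singleton[of "(i, \<gamma> i)" UNIV "\<lambda>(i, k::nat). Ts i"]] this
    show "(\<lambda>U. G i (U (i, \<gamma> i))) \<in> borel_measurable ?V" by auto
  qed
  have wm[measurable]: "w \<in> borel_measurable ?\<Phi>"
    unfolding w_def
  proof (rule borel_measurable_prod)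
    fix i
    have "(\<lambda>\<Phi>. \<Phi> (i, \<gamma> i)) \<in> ?\<Phi> \<rightarrow>\<^sub>M count_space UNIV"
      using measurable_component_singleton[of "(i, \<gamma> i)" UNIV "\<lambda>(i, k::nat). measure_pmf (routing_pmf P i)"]
      by (simp add: measurable_cong_sets[OF refl sets_measure_pmf_count_space])
    then show "(\<lambda>U. H i (U (i, \<gamma> i))) \<in> borel_measurable ?\<Phi>"
      by (rule measurable_compose) simp
  qed
  have uB: "\<bar>u U\<bar> \<le> B ^ card A" and vB: "\<bar>v V\<bar> \<le> B ^ card D" and wB: "\<bar>w \<Phi>\<bar> \<le> B ^ card D" for U V \<Phi>
    unfolding u_def v_def w_def by (rule abs_prod_le_power, rule B)+
  have vwB: "\<bar>v (fst z) * w (snd z)\<bar> \<le> B ^ card D * B ^ card D" for z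
    unfolding abs_mult by (rule mult_mono) (use vB wB order_trans[OF abs_ge_zero vB] in auto)
  have "(\<integral>\<omega>. u (fst \<omega>) * (v (fst (snd \<omega>)) * w (snd (snd \<omega>))) \<partial>\<mu>)
      = (\<integral>U. u U \<partial>?U) * (\<integral>z. v (fst z) * w (snd z) \<partial>(?V \<Otimes>\<^sub>M ?\<Phi>))"
    unfolding sample_measure_def
    by (rule integral_pair_mult[OF prob_space_U prob_space_V\<Phi>, where v="\<lambda>z. v (fst z) * w (snd z)", OF _ _ uB vwB]) measurable
  also have "(\<integral>z. v (fst z) * w (snd z) \<partial>(?V \<Otimes>\<^sub>M ?\<Phi>)) = (\<integral>V. v V \<partial>?V) * (\<integral>\<Phi>. w \<Phi> \<partial>?\<Phi>)"
    by (rule integral_pair_mult[OF prob_space_V prob_space_\<Phi> _ _ vB wB]) measurable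
  also have "(\<integral>U. u U \<partial>?U) = (\<Prod>i\<in>A. \<integral>x. F i x \<partial>Te i)"
    unfolding u_def using A
    by (subst integral_PiM_prod[where p="\<lambda>i. (i, \<alpha> i)"])
      (auto intro!: Te_prob inj_onI integrable_bounded[OF Te_prob _ B(1)] finite_subset[OF A] simp: measurable_cong_sets[OF sets_Te refl] m)
  also have "(\<integral>V. v V \<partial>?V) = (\<Prod>j\<in>D. \<integral>x. G j x \<partial>Ts j)"
    unfolding v_def
    by (subst integral_PiM_prod[where p="\<lambda>i. (i, \<gamma> i)"])
      (auto intro!: Ts_prob inj_onI integrable_bounded[OF Ts_prob _ B(2)] simp: measurable_cong_sets[OF sets_Ts refl] m)
  also have "(\<integral>\<Phi>. w \<Phi> \<partial>?\<Phi>) = (\<Prod>j\<in>D. \<integral>x. H j x \<partial>routing_pmf P j)"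
    unfolding w_def
    by (subst integral_PiM_prod[where p="\<lambda>i. (i, \<gamma> i)"])
      (auto intro!: measure_pmf.prob_space_axioms inj_onI integrable_bounded[OF measure_pmf.prob_space_axioms _ B(3)])
  finally show ?thesis unfolding u_def v_def w_def .
qed

end

definition test_fun :: "'d::finite set \<Rightarrow> real^'d \<Rightarrow> ('d \<Rightarrow> real \<Rightarrow> real) \<Rightarrow> ('d \<Rightarrow> real \<Rightarrow> real) \<Rightarrow> 'd state \<Rightarrow> real" where
  "test_fun E \<theta> \<alpha> \<beta> x = exp ((\<Sum>k\<in>UNIV. \<theta> $ k * real (fst x $ k)) + (\<Sum>i\<in>E. \<alpha> i (fst (snd x) $ i))
     + (\<Sum>j\<in>UNIV. \<beta> j (snd (snd x) $ j)))"

text \<open>Minus the logarithmic derivative of \<open>test_fun\<close> in the direction in which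
  the clocks run, when the primed functions are the derivatives of the clock functions. A frozen
  service clock contributes nothing.\<close>

definition clock_drift :: "'d::finite set \<Rightarrow> ('d \<Rightarrow> real \<Rightarrow> real) \<Rightarrow> ('d \<Rightarrow> real \<Rightarrow> real) \<Rightarrow> 'd state \<Rightarrow> real" where
  "clock_drift E \<alpha>' \<beta>' x = (\<Sum>i\<in>E. \<alpha>' i (fst (snd x) $ i)) + (\<Sum>j\<in>UNIV. if 0 < fst x $ j then \<beta>' j (snd (snd x) $ j) else 0)"

text \<open>Finitely many exceptional points admit the kinks of truncated clock functions; the
  values of \<open>\<alpha>'\<close> there are only required to be bounded. Boundedness on the whole
  line makes the test functions bounded on all states.\<close>

definition clock_fun :: "(real \<Rightarrow> real) \<Rightarrow> (real \<Rightarrow> real) \<Rightarrow> bool" where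
  "clock_fun \<alpha> \<alpha>' \<longleftrightarrow> \<alpha> \<in> borel_measurable borel \<and> \<alpha>' \<in> borel_measurable borel \<and>
     (\<exists>B. \<forall>u. \<bar>\<alpha> u\<bar> \<le> B \<and> \<bar>\<alpha>' u\<bar> \<le> B) \<and> continuous_on {0..} \<alpha> \<and>
     (\<exists>F. finite F \<and> (\<forall>u. 0 < u \<longrightarrow> u \<notin> F \<longrightarrow> (\<alpha> has_real_derivative \<alpha>' u) (at u)))"

lemma test_fun_bound:
  assumes "\<And>k. \<theta> $ k \<le> 0" "\<And>i u. \<bar>\<alpha> i u\<bar> \<le> C" "\<And>j u. \<bar>\<beta> j u\<bar> \<le> C"
  shows "\<bar>test_fun E \<theta> \<alpha> \<beta> (x :: 'd::finite state)\<bar> \<le> exp (2 * (real CARD('d) * C))"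
proof -
  have C: "0 \<le> C" using assms(2)[of undefined undefined] by simp
  have "(\<Sum>k\<in>UNIV. \<theta> $ k * real (fst x $ k)) \<le> 0"
    using assms(1) by (intro sum_nonpos) (auto simp: mult_nonpos_nonneg)
  moreover have "(\<Sum>i\<in>E. \<alpha> i (fst (snd x) $ i)) \<le> (\<Sum>i\<in>E. C)"
    using assms(2) by (intro sum_mono) (auto simp: abs_le_iff)
  moreover have "(\<Sum>i\<in>E. C) \<le> real CARD('d) * C"
    using C by (simp add: card_mono mult_right_mono)
  moreover have "(\<Sum>j\<in>UNIV. \<beta> j (snd (snd x) $ j)) \<le> (\<Sum>j\<in>(UNIV::'d set). C)"
    using assms(3) by (intro sum_mono) (auto simp: abs_le_iff)
  ultimately show ?thesis by (simp add: test_fun_def)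
qed

lemma clock_drift_bound:
  assumes "\<And>i u. \<bar>\<alpha>' i u\<bar> \<le> C" "\<And>j u. \<bar>\<beta>' j u\<bar> \<le> C"
  shows "\<bar>clock_drift E \<alpha>' \<beta>' (x :: 'd::finite state)\<bar> \<le> 2 * (real CARD('d) * C)"
proof -
  have C: "0 \<le> C" using assms(1)[of undefined undefined] by simp
  have "\<bar>\<Sum>i\<in>E. \<alpha>' i (fst (snd x) $ i)\<bar> \<le> (\<Sum>i\<in>E. C)"
    using assms(1) by (intro order_trans[OF sum_abs] sum_mono) auto
  moreover have "(\<Sum>i\<in>E. C) \<le> real CARD('d) * C"
    using C by (simp add: card_mono mult_right_mono)
  moreover have "\<bar>\<Sum>j\<in>UNIV. if 0 < fst x $ j then \<beta>' j (snd (snd x) $ j) else 0\<bar> \<le> (\<Sum>j\<in>(UNIV::'d set). C)"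
    using assms(2) C by (intro order_trans[OF sum_abs] sum_mono) auto
  ultimately show ?thesis unfolding clock_drift_def by (simp add: abs_le_iff)
qed

lemma measurable_test_fun:
  assumes [measurable]: "\<And>i. \<alpha> i \<in> borel_measurable borel" "\<And>j. \<beta> j \<in> borel_measurable borel"
  shows "test_fun E \<theta> \<alpha> \<beta> \<in> borel_measurable state_algebra"
proof -
  have id[measurable]: "(\<lambda>x. x) \<in> state_algebra \<rightarrow>\<^sub>M state_algebra" by simp
  note [measurable] = measurable_state_queue[OF id] measurable_state_arrival[OF id] measurable_state_service[OF id]
  show ?thesis unfolding test_fun_def[abs_def] by measurable
qed

lemma measurable_clock_drift:
  assumes [measurable]: "\<And>i. \<alpha>' i \<in> borel_measurable borel" "\<And>j. \<beta>' j \<in> borel_measurable borel"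
  shows "clock_drift E \<alpha>' \<beta>' \<in> borel_measurable state_algebra"
proof -
  have id[measurable]: "(\<lambda>x. x) \<in> state_algebra \<rightarrow>\<^sub>M state_algebra" by simp
  note [measurable] = measurable_state_queue[OF id] measurable_state_arrival[OF id] measurable_state_service[OF id]
  show ?thesis unfolding clock_drift_def[abs_def] by measurable
qed

text \<open>A firing clock stands at 0 and jumps to its new value, which multiplies the test
  function by one factor per fired clock. In this product form the independence of the entries
  applies, however many clocks fire together.\<close>

lemma test_fun_fire:
  assumes A: "A \<subseteq> E" and D: "\<And>j. j \<in> D \<Longrightarrow> 0 < fst y $ j"
    and u: "\<And>i. i \<in> A \<Longrightarrow> fst (snd y) $ i = 0" and v: "\<And>j. j \<in> D \<Longrightarrow> snd (snd y) $ j = 0"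
  shows "test_fun E \<theta> \<alpha> \<beta> (fire A D U V \<Phi> y) = test_fun E \<theta> \<alpha> \<beta> y *
     ((\<Prod>i\<in>A. exp (\<theta> $ i - \<alpha> i 0 + \<alpha> i (U i))) *
      ((\<Prod>j\<in>D. exp (- \<theta> $ j - \<beta> j 0 + \<beta> j (V j))) * (\<Prod>j\<in>D. exp (case \<Phi> j of None \<Rightarrow> 0 | Some k \<Rightarrow> \<theta> $ k))))"
proof -
  have card: "real (card {j \<in> D. \<Phi> j = Some k}) = (\<Sum>j\<in>D. of_bool (\<Phi> j = Some k))" for k
    by (subst sum_of_bool_eq) (auto simp: Int_def)
  have "(\<Sum>k\<in>UNIV. \<theta> $ k * real (card {j \<in> D. \<Phi> j = Some k})) = (\<Sum>j\<in>D. \<Sum>k\<in>UNIV. \<theta> $ k * of_bool (\<Phi> j = Some k))"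
    unfolding card sum_distrib_left by (rule sum.swap)
  also have "\<dots> = (\<Sum>j\<in>D. case \<Phi> j of None \<Rightarrow> 0 | Some k \<Rightarrow> \<theta> $ k)"
    by (intro sum.cong refl) (auto split: option.split simp: of_bool_def if_distrib cong: if_cong)
  finally have r: "(\<Sum>k\<in>UNIV. \<theta> $ k * real (card {j \<in> D. \<Phi> j = Some k})) = (\<Sum>j\<in>D. case \<Phi> j of None \<Rightarrow> 0 | Some k \<Rightarrow> \<theta> $ k)" .
  have i: "(\<Sum>k\<in>UNIV. \<theta> $ k * (if k \<in> X then 1 else 0)) = (\<Sum>k\<in>X. \<theta> $ k)" for X :: "'a set"
    by (simp add: if_distrib sum.If_cases cong: if_cong)
  have q: "real (fst y $ k - (if k \<in> D then 1 else 0) + (if k \<in> A then 1 else 0) + n)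
      = real (fst y $ k) - (if k \<in> D then 1 else 0) + (if k \<in> A then 1 else 0) + real n" for k n
    using D[of k] by (auto simp: of_nat_diff)
  have l: "(\<Sum>k\<in>UNIV. \<theta> $ k * real (fst (fire A D U V \<Phi> y) $ k)) = (\<Sum>k\<in>UNIV. \<theta> $ k * real (fst y $ k))
      - (\<Sum>j\<in>D. \<theta> $ j) + (\<Sum>i\<in>A. \<theta> $ i) + (\<Sum>j\<in>D. case \<Phi> j of None \<Rightarrow> 0 | Some k \<Rightarrow> \<theta> $ k)"
    unfolding fire_def fst_conv vec_lambda_beta q r[symmetric] i[symmetric]
    by (simp add: algebra_simps sum.distrib sum_subtractf)
  have al: "(\<Sum>i\<in>E. \<alpha> i (fst (snd (fire A D U V \<Phi> y)) $ i)) = (\<Sum>i\<in>E. \<alpha> i (fst (snd y) $ i)) + (\<Sum>i\<in>A. \<alpha> i (U i) - \<alpha> i 0)"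
  proof -
    have "(\<Sum>i\<in>E. \<alpha> i (fst (snd (fire A D U V \<Phi> y)) $ i))
        = (\<Sum>i\<in>E. \<alpha> i (fst (snd y) $ i) + (if i \<in> A then \<alpha> i (U i) - \<alpha> i 0 else 0))"
      by (intro sum.cong refl) (auto simp: fire_def u)
    also have "\<dots> = (\<Sum>i\<in>E. \<alpha> i (fst (snd y) $ i)) + (\<Sum>i\<in>E. if i \<in> A then \<alpha> i (U i) - \<alpha> i 0 else 0)"
      by (rule sum.distrib)
    also have "(\<Sum>i\<in>E. if i \<in> A then \<alpha> i (U i) - \<alpha> i 0 else 0) = (\<Sum>i\<in>A. \<alpha> i (U i) - \<alpha> i 0)"
      using A by (simp add: sum.If_cases Int_absorb1)
    finally show ?thesis .
  qed
  have be: "(\<Sum>i\<in>UNIV. \<beta> i (snd (snd (fire A D U V \<Phi> y)) $ i)) = (\<Sum>i\<in>UNIV. \<beta> i (snd (snd y) $ i)) + (\<Sum>i\<in>D. \<beta> i (V i) - \<beta> i 0)"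
  proof -
    have "(\<Sum>i\<in>UNIV. \<beta> i (snd (snd (fire A D U V \<Phi> y)) $ i))
        = (\<Sum>i\<in>UNIV. \<beta> i (snd (snd y) $ i) + (if i \<in> D then \<beta> i (V i) - \<beta> i 0 else 0))"
      by (intro sum.cong refl) (auto simp: fire_def v)
    also have "\<dots> = (\<Sum>i\<in>UNIV. \<beta> i (snd (snd y) $ i)) + (\<Sum>i\<in>UNIV. if i \<in> D then \<beta> i (V i) - \<beta> i 0 else 0)"
      by (rule sum.distrib)
    also have "(\<Sum>i\<in>UNIV. if i \<in> D then \<beta> i (V i) - \<beta> i 0 else 0) = (\<Sum>i\<in>D. \<beta> i (V i) - \<beta> i 0)"
      by (simp add: sum.If_cases)
    finally show ?thesis .
  qed
  show ?thesis
    unfolding test_fun_def l al be exp_sum[OF finite, symmetric] exp_add[symmetric]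
    by (simp add: sum.distrib sum_subtractf sum_negf)
qed

context jackson
begin

lemma integral_routing_exp:
  "exp (- \<theta> $ j) * (\<integral>d. exp (case d of None \<Rightarrow> 0 | Some k \<Rightarrow> \<theta> $ k) \<partial>routing_pmf P j) = t_fun P j \<theta>"
proof -
  have "(\<integral>d. exp (case d of None \<Rightarrow> 0 | Some k \<Rightarrow> \<theta> $ k) \<partial>routing_pmf P j)
     = (\<Sum>d\<in>UNIV. exp (case d of None \<Rightarrow> 0 | Some k \<Rightarrow> \<theta> $ k) * pmf (routing_pmf P j) d)"
    by (rule integral_measure_pmf_real) auto
  also have "\<dots> = (\<Sum>k\<in>UNIV. P $ j $ k * exp (\<theta> $ k)) + exit_prob P j"
    by (simp add: UNIV_option_conv sum.reindex pmf_routing[OF routing] mult.commute)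
  finally show ?thesis by (simp add: t_fun_def)
qed

text \<open>The factors of the fired clocks are independent. By \<open>ja\<close> each arrival
  factor has mean 1, and by \<open>js\<close> so has the product of a service factor with its
  routing factor.\<close>

lemma integral_test_fun_event_step:
  assumes \<theta>: "\<And>k. \<theta> $ k \<le> 0" and y: "y = fst (snd z)" and m: "\<And>i. \<alpha> i \<in> borel_measurable borel" "\<And>j. \<beta> j \<in> borel_measurable borel"
    and C: "\<And>i u. \<bar>\<alpha> i u\<bar> \<le> C" "\<And>j u. \<bar>\<beta> j u\<bar> \<le> C"
    and ja: "\<And>i. i \<in> E \<Longrightarrow> exp (\<theta> $ i) * (\<integral>u. exp (\<alpha> i u) \<partial>Te i) = exp (\<alpha> i 0)"
    and js: "\<And>j. t_fun P j \<theta> * (\<integral>v. exp (\<beta> j v) \<partial>Ts j) = exp (\<beta> j 0)"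
  shows "(\<integral>\<omega>. test_fun E \<theta> \<alpha> \<beta> (fst (snd (event_step E \<omega> z))) \<partial>\<mu>) = test_fun E \<theta> \<alpha> \<beta> (run_clocks E (time_to_event E y) y)"
proof -
  define y' where "y' = run_clocks E (time_to_event E y) y"
  define A where "A = arrival_due E y"
  define D where "D = service_due E y"
  obtain a c where ac: "a = fst (snd (snd z))" "c = snd (snd (snd z))" by blast
  have step: "fst (snd (event_step E \<omega> z)) = fire A D (\<lambda>i. fst \<omega> (i, a i)) (\<lambda>j. fst (snd \<omega>) (j, c j)) (\<lambda>j. snd (snd \<omega>) (j, c j)) y'" for \<omega>
    by (simp add: event_step_eq Let_def A_def D_def y'_def y ac)
  have A: "A \<subseteq> E" by (auto simp: A_def arrival_due_def)
  define F where "F i u = exp (\<theta> $ i - \<alpha> i 0 + \<alpha> i u)" for i u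
  define G where "G j v = exp (- \<theta> $ j - \<beta> j 0 + \<beta> j v)" for j v
  define H :: "'d \<Rightarrow> 'd option \<Rightarrow> real" where "H j d = exp (case d of None \<Rightarrow> 0 | Some k \<Rightarrow> \<theta> $ k)" for j d
  have Fm: "F i \<in> borel_measurable borel" and Gm: "G i \<in> borel_measurable borel" for i
    using m unfolding F_def[abs_def] G_def[abs_def] by measurable
  define B where "B = exp (2 * C + norm \<theta>)"
  have C0: "0 \<le> C" using C(1)[of undefined undefined] by simp
  have nt: "\<theta> $ k \<le> norm \<theta>" "- \<theta> $ k \<le> norm \<theta>" for k
    using component_le_norm_cart[of \<theta> k] by linarith+
  have FB: "\<bar>F i u\<bar> \<le> B" for i u
    using C(1)[of i u] C(1)[of i 0] nt[of i] by (auto simp: F_def B_def)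
  have GB: "\<bar>G i u\<bar> \<le> B" for i u
    using C(2)[of i u] C(2)[of i 0] nt[of i] by (auto simp: G_def B_def)
  have HB: "\<bar>H i d\<bar> \<le> B" for i d
    using C0 nt by (auto simp: H_def B_def split: option.split intro: order_trans[OF nt(1)])
  have "(\<integral>\<omega>. test_fun E \<theta> \<alpha> \<beta> (fst (snd (event_step E \<omega> z))) \<partial>\<mu>) = (\<integral>\<omega>. test_fun E \<theta> \<alpha> \<beta> y' *
     ((\<Prod>i\<in>A. F i (fst \<omega> (i, a i))) * ((\<Prod>j\<in>D. G j (fst (snd \<omega>) (j, c j))) * (\<Prod>j\<in>D. H j (snd (snd \<omega>) (j, c j))))) \<partial>\<mu>)"
    unfolding step F_def G_def H_def
    by (intro Bochner_Integration.integral_cong refl test_fun_fire)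
      (auto simp: A_def D_def y'_def run_clocks_eq arrival_due_def service_due_def)
  also have "\<dots> = test_fun E \<theta> \<alpha> \<beta> y' * ((\<Prod>i\<in>A. \<integral>x. F i x \<partial>Te i) * ((\<Prod>j\<in>D. \<integral>x. G j x \<partial>Ts j) * (\<Prod>j\<in>D. \<integral>x. H j x \<partial>routing_pmf P j)))"
    by (subst integral_mult_right_zero, subst integral_sample_prod[OF A Fm Gm FB GB HB]) (rule refl)
  also have "(\<Prod>i\<in>A. \<integral>x. F i x \<partial>Te i) = 1"
  proof (rule prod.neutral, rule ballI)
    fix i assume "i \<in> A"
    then have i: "i \<in> E" using A by auto
    have "(\<integral>x. F i x \<partial>Te i) = exp (- \<alpha> i 0) * (exp (\<theta> $ i) * (\<integral>x. exp (\<alpha> i x) \<partial>Te i))"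
      unfolding F_def exp_add exp_diff by (simp add: exp_minus field_simps)
    then show "(\<integral>x. F i x \<partial>Te i) = 1" by (simp add: ja[OF i] exp_minus)
  qed
  also have "(\<Prod>j\<in>D. \<integral>x. G j x \<partial>Ts j) * (\<Prod>j\<in>D. \<integral>x. H j x \<partial>routing_pmf P j) = 1"
    unfolding prod.distrib[symmetric]
  proof (rule prod.neutral, rule ballI)
    fix j
    have "(\<integral>x. G j x \<partial>Ts j) * (\<integral>x. H j x \<partial>routing_pmf P j)
      = exp (- \<beta> j 0) * (exp (- \<theta> $ j) * (\<integral>x. H j x \<partial>routing_pmf P j)) * (\<integral>x. exp (\<beta> j x) \<partial>Ts j)"
      unfolding G_def exp_add exp_diff by (simp add: exp_minus field_simps)
    also have "exp (- \<theta> $ j) * (\<integral>x. H j x \<partial>routing_pmf P j) = t_fun P j \<theta>"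
      unfolding H_def by (rule integral_routing_exp)
    finally show "(\<integral>x. G j x \<partial>Ts j) * (\<integral>x. H j x \<partial>routing_pmf P j) = 1"
      using js[of j] by (simp add: exp_minus mult.assoc)
  qed
  finally show ?thesis by (simp add: y'_def)
qed

lemma exponential_adjoint_relation:
  assumes st: "stationary E P Te Ts \<pi>" and \<theta>: "\<And>k. \<theta> $ k \<le> 0"
    and \<alpha>: "\<And>i. clock_fun (\<alpha> i) (\<alpha>' i)" and \<beta>: "\<And>j. clock_fun (\<beta> j) (\<beta>' j)"
    and ja: "\<And>i. i \<in> E \<Longrightarrow> exp (\<theta> $ i) * (\<integral>u. exp (\<alpha> i u) \<partial>Te i) = exp (\<alpha> i 0)"
    and js: "\<And>j. t_fun P j \<theta> * (\<integral>v. exp (\<beta> j v) \<partial>Ts j) = exp (\<beta> j 0)"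
  shows "(\<integral>x. test_fun E \<theta> \<alpha> \<beta> x * clock_drift E \<alpha>' \<beta>' x \<partial>\<pi>) = 0"
proof -
  have m: "\<alpha> i \<in> borel_measurable borel" "\<beta> i \<in> borel_measurable borel"
    "\<alpha>' i \<in> borel_measurable borel" "\<beta>' i \<in> borel_measurable borel" for i
    using \<alpha> \<beta> by (auto simp: clock_fun_def)
  have "\<exists>C. \<forall>i u. \<bar>\<alpha> i u\<bar> \<le> C \<and> \<bar>\<alpha>' i u\<bar> \<le> C" "\<exists>C. \<forall>i u. \<bar>\<beta> i u\<bar> \<le> C \<and> \<bar>\<beta>' i u\<bar> \<le> C"
  proof -
    have *: "\<exists>C. \<forall>i u. \<bar>f i u\<bar> \<le> C \<and> \<bar>f' i u\<bar> \<le> C" if f: "\<And>i::'d. clock_fun (f i) (f' i)" for f f'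
    proof -
      have "\<forall>i. \<exists>B. \<forall>u. \<bar>f i u\<bar> \<le> B \<and> \<bar>f' i u\<bar> \<le> B" using f by (auto simp: clock_fun_def)
      then obtain B where B: "\<And>i u. \<bar>f i u\<bar> \<le> B i \<and> \<bar>f' i u\<bar> \<le> B i" by metis
      have "B i \<le> Max (range B)" for i by simp
      then show ?thesis using B by (intro exI[of _ "Max (range B)"]) (meson order_trans)
    qed
    show "\<exists>C. \<forall>i u. \<bar>\<alpha> i u\<bar> \<le> C \<and> \<bar>\<alpha>' i u\<bar> \<le> C" "\<exists>C. \<forall>i u. \<bar>\<beta> i u\<bar> \<le> C \<and> \<bar>\<beta>' i u\<bar> \<le> C"
      by (intro * \<alpha> \<beta>)+
  qed
  then obtain C1 C2 where C1: "\<And>i u. \<bar>\<alpha> i u\<bar> \<le> C1 \<and> \<bar>\<alpha>' i u\<bar> \<le> C1" and C2: "\<And>i u. \<bar>\<beta> i u\<bar> \<le> C2 \<and> \<bar>\<beta>' i u\<bar> \<le> C2"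
    by metis
  define C where "C = max C1 C2"
  have C: "\<bar>\<alpha> i u\<bar> \<le> C" "\<bar>\<beta> i u\<bar> \<le> C" "\<bar>\<alpha>' i u\<bar> \<le> C" "\<bar>\<beta>' i u\<bar> \<le> C" for i u
    using C1[of i u] C2[of i u] by (auto simp: C_def)
  have C0: "0 \<le> C" using C(1)[of undefined undefined] by simp
  define f where "f = test_fun E \<theta> \<alpha> \<beta>"
  define D where "D = (\<lambda>x. - (f x * clock_drift E \<alpha>' \<beta>' x))"
  define K where "K = exp (2 * (real CARD('d) * C)) * (1 + 2 * (real CARD('d) * C))"
  have fB: "\<bar>f x\<bar> \<le> exp (2 * (real CARD('d) * C))" for x unfolding f_def by (rule test_fun_bound) (rule \<theta> C)+
  have "(\<integral>x. D x \<partial>\<pi>) = 0"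
  proof (rule basic_adjoint_relation[OF st, where f=f and B=K])
    show "f \<in> borel_measurable state_algebra" unfolding f_def by (rule measurable_test_fun; rule m)
    moreover have "clock_drift E \<alpha>' \<beta>' \<in> borel_measurable state_algebra" by (rule measurable_clock_drift; rule m)
    ultimately show "D \<in> borel_measurable state_algebra" unfolding D_def by measurable
    show "\<bar>f y\<bar> \<le> K" for y
      using fB[of y] C0 by (auto simp: K_def distrib_left intro!: order_trans[OF fB] add_increasing2 mult_nonneg_nonneg)
    show "\<bar>D y\<bar> \<le> K" for y
    proof -
      have "\<bar>D y\<bar> \<le> exp (2 * (real CARD('d) * C)) * (2 * (real CARD('d) * C))"
        unfolding D_def abs_minus abs_mult by (rule mult_mono[OF fB clock_drift_bound]) (auto intro: C)
      also have "\<dots> \<le> K" by (simp add: K_def distrib_left)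
      finally show ?thesis .
    qed
  next
    fix y assume y: "y \<in> state_space E"
    define h where "h = time_to_event E y"
    have u: "s \<le> fst (snd y) $ i" if "s \<le> h" "i \<in> E" for s i
      using time_to_event_le_arrival[of i E y] that by (simp add: h_def)
    have v: "s \<le> snd (snd y) $ i" if "s \<le> h" "0 < fst y $ i" for s i
      using time_to_event_le_service[OF E_nonempty that(2)] that by (simp add: h_def)
    have v0: "0 \<le> snd (snd y) $ i" for i by (rule state_spaceD[OF y])
    have ca: "continuous_on {0..} (\<alpha> i)" and cb: "continuous_on {0..} (\<beta> i)" for i
      using \<alpha> \<beta> by (auto simp: clock_fun_def)
    have fr: "f (run_clocks E s y) = exp ((\<Sum>k\<in>UNIV. \<theta> $ k * real (fst y $ k)) + (\<Sum>i\<in>E. \<alpha> i (fst (snd y) $ i - s))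
     + (\<Sum>j\<in>UNIV. \<beta> j (snd (snd y) $ j - (if 0 < fst y $ j then s else 0))))" for s
      by (simp add: f_def test_fun_def run_clocks_eq)
    show "continuous_on {0..time_to_event E y} (\<lambda>s. f (run_clocks E s y))"
      unfolding fr
    proof (intro continuous_intros)
      fix i assume "i \<in> E"
      then show "continuous_on {0..time_to_event E y} (\<lambda>s. \<alpha> i (fst (snd y) $ i - s))"
        using u by (intro continuous_on_compose2[OF ca]) (auto intro!: continuous_intros simp: h_def)
    next
      fix i
      show "continuous_on {0..time_to_event E y} (\<lambda>s. \<beta> i (snd (snd y) $ i - (if 0 < fst y $ i then s else 0)))"
        using v v0[of i] by (cases "0 < fst y $ i"; intro continuous_on_compose2[OF cb]) (auto intro!: continuous_intros simp: h_def)
    qed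
    have "\<forall>i. \<exists>F. finite F \<and> (\<forall>u. 0 < u \<longrightarrow> u \<notin> F \<longrightarrow> (\<alpha> i has_real_derivative \<alpha>' i u) (at u))"
      "\<forall>i. \<exists>F. finite F \<and> (\<forall>u. 0 < u \<longrightarrow> u \<notin> F \<longrightarrow> (\<beta> i has_real_derivative \<beta>' i u) (at u))"
      using \<alpha> \<beta> by (auto simp: clock_fun_def)
    then obtain F G where F: "\<And>i. finite (F i)" "\<And>i u. 0 < u \<Longrightarrow> u \<notin> F i \<Longrightarrow> (\<alpha> i has_real_derivative \<alpha>' i u) (at u)"
      and G: "\<And>i. finite (G i)" "\<And>i u. 0 < u \<Longrightarrow> u \<notin> G i \<Longrightarrow> (\<beta> i has_real_derivative \<beta>' i u) (at u)"
      by metis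
    \<comment> \<open>The times at which some clock passes an exceptional point of its clock
      function.\<close>
    define Z where "Z = (\<Union>i. (\<lambda>p. fst (snd y) $ i - p) ` F i) \<union> (\<Union>i. (\<lambda>p. snd (snd y) $ i - p) ` G i)"
    have "finite Z" unfolding Z_def using F(1) G(1) by auto
    moreover have "((\<lambda>s. f (run_clocks E s y)) has_real_derivative D (run_clocks E s y)) (at s)" if s: "s \<in> {0<..<h} - Z" for s
    proof -
      have a: "((\<lambda>s. \<alpha> i (fst (snd y) $ i - s)) has_real_derivative - \<alpha>' i (fst (snd y) $ i - s)) (at s)" if i: "i \<in> E" for i
      proof -
        have "fst (snd y) $ i - s \<notin> F i"
        proof
          assume "fst (snd y) $ i - s \<in> F i"
          then have "fst (snd y) $ i - (fst (snd y) $ i - s) \<in> Z" unfolding Z_def by blast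
          then show False using s by simp
        qed
        moreover have "0 < fst (snd y) $ i - s" using u[OF order_refl i] s by auto
        ultimately have "(\<alpha> i has_real_derivative \<alpha>' i (fst (snd y) $ i - s)) (at (fst (snd y) $ i - s))" by (intro F(2))
        moreover have "((\<lambda>s. fst (snd y) $ i - s) has_real_derivative -1) (at s)" by (auto intro!: derivative_eq_intros)
        ultimately show ?thesis using DERIV_chain2[where f="\<alpha> i" and g="\<lambda>s. fst (snd y) $ i - s"] by fastforce
      qed
      have b: "((\<lambda>s. \<beta> i (snd (snd y) $ i - (if 0 < fst y $ i then s else 0))) has_real_derivative
          - (if 0 < fst y $ i then \<beta>' i (snd (snd y) $ i - s) else 0)) (at s)" for i
      proof (cases "0 < fst y $ i")
        case True
        have "snd (snd y) $ i - s \<notin> G i"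
        proof
          assume "snd (snd y) $ i - s \<in> G i"
          then have "snd (snd y) $ i - (snd (snd y) $ i - s) \<in> Z" unfolding Z_def by blast
          then show False using s by simp
        qed
        moreover have "0 < snd (snd y) $ i - s" using v[OF order_refl True] s by auto
        ultimately have "(\<beta> i has_real_derivative \<beta>' i (snd (snd y) $ i - s)) (at (snd (snd y) $ i - s))" by (intro G(2))
        moreover have "((\<lambda>s. snd (snd y) $ i - s) has_real_derivative -1) (at s)" by (auto intro!: derivative_eq_intros)
        ultimately show ?thesis using DERIV_chain2[where f="\<beta> i" and g="\<lambda>s. snd (snd y) $ i - s"] True by fastforce
      qed simp
      have "((\<lambda>s. (\<Sum>k\<in>UNIV. \<theta> $ k * real (fst y $ k)) + (\<Sum>i\<in>E. \<alpha> i (fst (snd y) $ i - s))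
         + (\<Sum>j\<in>UNIV. \<beta> j (snd (snd y) $ j - (if 0 < fst y $ j then s else 0)))) has_real_derivative
         0 + (\<Sum>i\<in>E. - \<alpha>' i (fst (snd y) $ i - s)) + (\<Sum>j\<in>UNIV. - (if 0 < fst y $ j then \<beta>' j (snd (snd y) $ j - s) else 0))) (at s)"
        by (intro DERIV_add DERIV_sum DERIV_const a b)
      from DERIV_chain2[OF DERIV_exp this]
      have "((\<lambda>s. f (run_clocks E s y)) has_real_derivative
        f (run_clocks E s y) * (0 + (\<Sum>i\<in>E. - \<alpha>' i (fst (snd y) $ i - s)) + (\<Sum>j\<in>UNIV. - (if 0 < fst y $ j then \<beta>' j (snd (snd y) $ j - s) else 0)))) (at s)"
        unfolding fr .
      moreover have "0 + (\<Sum>i\<in>E. - \<alpha>' i (fst (snd y) $ i - s)) + (\<Sum>j\<in>UNIV. - (if 0 < fst y $ j then \<beta>' j (snd (snd y) $ j - s) else 0))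
        = - clock_drift E \<alpha>' \<beta>' (run_clocks E s y)"
      proof -
        have "(\<Sum>j\<in>UNIV. if 0 < fst y $ j then \<beta>' j (snd (snd y) $ j - s) else 0)
          = (\<Sum>j\<in>UNIV. if 0 < fst y $ j then \<beta>' j (snd (snd y) $ j - (if 0 < fst y $ j then s else 0)) else 0)"
          by (rule sum.cong) auto
        then show ?thesis unfolding clock_drift_def run_clocks_eq fst_conv snd_conv vec_lambda_beta
          by (simp add: sum_negf)
      qed
      ultimately show ?thesis unfolding D_def by simp
    qed
    ultimately show "\<exists>F. finite F \<and> (\<forall>s\<in>{0<..<time_to_event E y} - F.
        ((\<lambda>s. f (run_clocks E s y)) has_real_derivative D (run_clocks E s y)) (at s))"
      unfolding h_def by blast
  next
    fix z
    show "(\<integral>\<omega>'. f (fst (snd (event_step E \<omega>' z))) \<partial>\<mu>) = f (run_clocks E (time_to_event E (fst (snd z))) (fst (snd z)))"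
      unfolding f_def by (rule integral_test_fun_event_step[OF \<theta> refl m(1,2) C(1,2) ja js])
  qed
  then show ?thesis by (simp add: D_def f_def)
qed

end

section \<open>Idle stations\<close>

definition set_service :: "'d::finite \<Rightarrow> real \<Rightarrow> 'd state \<Rightarrow> 'd state" where
  "set_service k y x = (fst x, fst (snd x), \<chi> i. if i = k then y else snd (snd x) $ i)"

lemma set_service_simps[simp]:
  "fst (set_service k y x) = fst x" "fst (snd (set_service k y x)) = fst (snd x)"
  "snd (snd (set_service k y x)) $ i = (if i = k then y else snd (snd x) $ i)"
  by (simp_all add: set_service_def)

lemma set_service_idle:
  assumes "fst x $ k = 0"
  shows "time_to_event E (set_service k y x) = time_to_event E x"
    and "arrival_due E (set_service k y x) = arrival_due E x"
    and "service_due E (set_service k y x) = service_due E x"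
    and "run_clocks E h (set_service k y x) = set_service k y (run_clocks E h x)"
proof -
  have rc: "running_clocks E z = {fst (snd z) $ i | i. i \<in> E} \<union> {snd (snd z) $ i | i. 0 < fst z $ i}" for z :: "'a state"
    by (cases z rule: prod_cases3) simp
  have "{snd (snd (set_service k y x)) $ i | i. 0 < fst x $ i} = {snd (snd x) $ i | i. 0 < fst x $ i}"
    using assms by (intro Collect_cong ex_cong1) auto
  then have "running_clocks E (set_service k y x) = running_clocks E x"
    unfolding rc set_service_simps(1,2) by simp
  then show t: "time_to_event E (set_service k y x) = time_to_event E x"
    by (simp add: time_to_event_def)
  show "arrival_due E (set_service k y x) = arrival_due E x"
    by (simp add: arrival_due_def t)
  show "service_due E (set_service k y x) = service_due E x"
    using assms by (auto simp: service_due_def t)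
  show "run_clocks E h (set_service k y x) = set_service k y (run_clocks E h x)"
    using assms by (simp add: run_clocks_eq set_service_def vec_eq_iff)
qed

text \<open>While a station idles after its \<open>n\<close>-th departure, the service time recorded then influences
  nothing but its own clock.\<close>

lemma event_config_idle:
  assumes "departures E \<omega> x m k = Suc n" "fst (event_state E \<omega> x m) $ k = 0"
  shows "event_config E (fst \<omega>, (fst (snd \<omega>))((k, n) := y), snd (snd \<omega>)) x m =
     (event_time E \<omega> x m, set_service k y (event_state E \<omega> x m), arrivals E \<omega> x m, departures E \<omega> x m)"
  using assms
proof (induction m)
  case (Suc m)
  let ?\<omega> = "(fst \<omega>, (fst (snd \<omega>))((k, n) := y), snd (snd \<omega>))"
  define Y where "Y = event_state E \<omega> x m"
  have s: "event_time E \<omega> x (Suc m) = event_time E \<omega> x m + time_to_event E Y"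
    "arrivals E \<omega> x (Suc m) = (\<lambda>i. if i \<in> arrival_due E Y then Suc (arrivals E \<omega> x m i) else arrivals E \<omega> x m i)"
    "departures E \<omega> x (Suc m) = (\<lambda>i. if i \<in> service_due E Y then Suc (departures E \<omega> x m i) else departures E \<omega> x m i)"
    by (auto simp: event_time_Suc arrivals_Suc departures_Suc Y_def fun_eq_iff)
  show ?case
  proof (cases "k \<in> service_due E Y")
    case True
    then have c: "departures E \<omega> x m k = n" using Suc.prems by (simp add: departures_Suc Y_def)
    have "event_config E ?\<omega> x m = event_config E \<omega> x m"
      by (rule event_config_local) (use c in auto)
    then have IH: "event_config E ?\<omega> x m = (event_time E \<omega> x m, Y, arrivals E \<omega> x m, departures E \<omega> x m)"
      by (simp add: event_config_split Y_def)
    have f: "fire (arrival_due E Y) (service_due E Y) (\<lambda>i. fst \<omega> (i, arrivals E \<omega> x m i))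
        (\<lambda>j. ((fst (snd \<omega>))((k, n) := y)) (j, departures E \<omega> x m j)) (\<lambda>j. snd (snd \<omega>) (j, departures E \<omega> x m j))
        (run_clocks E (time_to_event E Y) Y)
      = set_service k y (event_state E \<omega> x (Suc m))"
      unfolding event_state_Suc Y_def[symmetric] using True c
      by (auto simp: fire_def set_service_def vec_eq_iff)
    show ?thesis
      unfolding event_config_Suc IH event_step_eq Let_def fst_conv snd_conv
      using f by (simp add: s)
  next
    case False
    then have c: "departures E \<omega> x m k = Suc n" using Suc.prems by (simp add: departures_Suc Y_def)
    have l: "fst Y $ k = 0"
      using Suc.prems(2) False unfolding event_state_Suc by (auto simp: fire_def run_clocks_eq Y_def)
    have IH: "event_config E ?\<omega> x m =
       (event_time E \<omega> x m, set_service k y Y, arrivals E \<omega> x m, departures E \<omega> x m)"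
      using Suc.IH[OF c] l unfolding Y_def by blast
    have f: "fire (arrival_due E Y) (service_due E Y) (\<lambda>i. fst \<omega> (i, arrivals E \<omega> x m i))
        (\<lambda>j. ((fst (snd \<omega>))((k, n) := y)) (j, departures E \<omega> x m j)) (\<lambda>j. snd (snd \<omega>) (j, departures E \<omega> x m j))
        (set_service k y (run_clocks E (time_to_event E Y) Y))
      = set_service k y (event_state E \<omega> x (Suc m))"
      unfolding event_state_Suc Y_def[symmetric] using False
      by (auto simp: fire_def set_service_def vec_eq_iff)
    show ?thesis
      unfolding event_config_Suc IH event_step_eq Let_def fst_conv snd_conv
      using f by (simp add: set_service_idle[OF l] s)
  qed
qed simp

context jackson
begin

lemma integral_sample_V:
  fixes g :: "real \<Rightarrow> real"
  assumes g: "g \<in> borel_measurable borel" and B: "\<And>x. \<bar>g x\<bar> \<le> B"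
  shows "(\<integral>\<omega>. g (fst (snd \<omega>) (k, n)) \<partial>\<mu>) = (\<integral>x. g x \<partial>Ts k)"
proof -
  have "\<bar>g x\<bar> \<le> max B 1" for x using B[of x] by simp
  then show ?thesis
    using integral_sample_prod[of "{}" "\<lambda>_ _. 1" "\<lambda>_. g" "max B 1" "\<lambda>_ _. 1" "\<lambda>_. 0" "\<lambda>_. n" "{k}"] g
    by simp
qed

text \<open>Resample the service time with index n, the one drawn at the latest departure. As the
  station idles, the event in question is unaffected and the clock simply shows the new value, so
  the mean of g factors out.\<close>

lemma integral_idle_zero:
  fixes g :: "real \<Rightarrow> real"
  assumes g[measurable]: "g \<in> borel_measurable borel" and B: "\<And>y. \<bar>g y\<bar> \<le> B" and g0: "(\<integral>y. g y \<partial>Ts k) = 0"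
  shows "(\<integral>\<omega>. of_bool (event_time E \<omega> x m \<le> t \<and> t < event_time E \<omega> x m + time_to_event E (event_state E \<omega> x m)
      \<and> fst (event_state E \<omega> x m) $ k = 0 \<and> departures E \<omega> x m k = Suc n) * g (snd (snd (event_state E \<omega> x m)) $ k) \<partial>\<mu>) = 0"
proof -
  define R where "R \<omega> \<longleftrightarrow> event_time E \<omega> x m \<le> t \<and> t < event_time E \<omega> x m + time_to_event E (event_state E \<omega> x m)
      \<and> fst (event_state E \<omega> x m) $ k = 0 \<and> departures E \<omega> x m k = Suc n" for \<omega>
  define Q where "Q \<omega> = of_bool (R \<omega>) * g (snd (snd (event_state E \<omega> x m)) $ k)" for \<omega>
  define \<rho> where "\<rho> \<omega> y = (fst \<omega>, (fst (snd \<omega>))((k, n) := y), snd (snd \<omega>))" for \<omega> :: "'d sample" and y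
  have conf: "event_time E (\<rho> \<omega> y) x m = event_time E \<omega> x m \<and> event_state E (\<rho> \<omega> y) x m = set_service k y (event_state E \<omega> x m)
     \<and> departures E (\<rho> \<omega> y) x m = departures E \<omega> x m" if "R \<omega>" for \<omega> y
    using event_config_idle[of E \<omega> x m k n y] that
    by (simp add: R_def \<rho>_def event_time_def event_state_def departures_def)
  have R1: "R (\<rho> \<omega> y)" if "R \<omega>" for \<omega> y
    using conf[OF that, of y] that unfolding R_def by (simp add: set_service_idle)
  \<comment> \<open>\<open>\<rho>\<close> can be undone by putting the old entry back, so the
    implication reverses.\<close>
  have R2: "R \<omega>" if "R (\<rho> \<omega> y)" for \<omega> y
  proof -
    have "\<rho> (\<rho> \<omega> y) (fst (snd \<omega>) (k, n)) = \<omega>" by (simp add: \<rho>_def)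
    with R1[OF that, of "fst (snd \<omega>) (k, n)"] show ?thesis by simp
  qed
  have Q: "Q (\<rho> \<omega> y) = of_bool (R \<omega>) * g y" for \<omega> y
  proof (cases "R \<omega>")
    case True
    then show ?thesis using conf[OF True, of y] R1[OF True, of y] by (simp add: Q_def)
  next
    case False
    then show ?thesis using R2[of \<omega> y] by (auto simp: Q_def)
  qed
  have res: "resample {} {(k, n)} {} \<omega> \<omega>' = \<rho> \<omega> (fst (snd \<omega>') (k, n))" for \<omega> \<omega>'
    by (auto simp: resample_def \<rho>_def fun_eq_iff)
  have c[measurable]: "(\<lambda>\<omega>. event_config E \<omega> x m) \<in> \<mu> \<rightarrow>\<^sub>M config_algebra" for m
    by (rule measurable_event_config) auto
  have Qm: "Q \<in> borel_measurable \<mu>"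
    unfolding Q_def[abs_def] R_def event_time_def event_state_def departures_def by measurable
  have QB: "\<bar>Q \<omega>\<bar> \<le> B" for \<omega>
    using B[of "snd (snd (event_state E \<omega> x m)) $ k"] by (auto simp: Q_def intro: order_trans[OF abs_ge_zero])
  have "(\<integral>\<omega>. Q \<omega> \<partial>\<mu>) = (\<integral>\<omega>. \<integral>\<omega>'. Q (resample {} {(k, n)} {} \<omega> \<omega>') \<partial>\<mu> \<partial>\<mu>)"
    by (rule integral_resample[OF Qm QB])
  also have "\<dots> = 0"
    unfolding res Q by (simp add: integral_sample_V[OF g B] g0)
  finally show ?thesis by (simp add: Q_def R_def)
qed

lemma integral_idle_service:
  fixes g :: "real \<Rightarrow> real"
  assumes st: "stationary E P Te Ts \<pi>"
    and connected: "\<And>G. E \<subseteq> G \<Longrightarrow> (\<And>j k. j \<in> G \<Longrightarrow> 0 < P $ j $ k \<Longrightarrow> k \<in> G) \<Longrightarrow> G = UNIV"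
    and g[measurable]: "g \<in> borel_measurable borel" and B: "\<And>y. \<bar>g y\<bar> \<le> B" and g0: "(\<integral>y. g y \<partial>Ts k) = 0"
  shows "(\<integral>x. of_bool (fst x $ k = 0) * g (snd (snd x) $ k) \<partial>\<pi>) = 0"
proof -
  note sf[measurable_cong] = stationary_facts(2)[OF st]
  interpret \<pi>: prob_space \<pi> by (rule stationary_facts(1)[OF st])
  have B0: "0 \<le> B" using B[of 0] by simp
  define f where "f x = of_bool (fst x $ k = 0) * g (snd (snd x) $ k)" for x :: "'d state"
  have id: "(\<lambda>x. x) \<in> state_algebra \<rightarrow>\<^sub>M (state_algebra :: 'd state measure)" by simp
  note [measurable] = measurable_state_queue[OF id] measurable_state_service[OF id]
  have f[measurable]: "f \<in> borel_measurable state_algebra" unfolding f_def[abs_def] by measurable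
  have fB: "\<bar>f x\<bar> \<le> B" for x using B[of "snd (snd x) $ k"] B0 by (simp add: f_def)
  \<comment> \<open>The contribution of paths for which t lies between events m and m + 1 and
    station k has already had a departure.\<close>
  define Q where "Q x t m \<omega> = of_bool (event_time E \<omega> x m \<le> t \<and> t < event_time E \<omega> x m + time_to_event E (event_state E \<omega> x m)
      \<and> departures E \<omega> x m k \<noteq> 0) * f (event_state E \<omega> x m)" for x t m \<omega>
  have c[measurable]: "(\<lambda>\<omega>. event_config E \<omega> x m) \<in> \<mu> \<rightarrow>\<^sub>M config_algebra" for x m
    by (rule measurable_event_config) auto
  have Qm[measurable]: "Q x t m \<in> borel_measurable \<mu>" for x t m
    unfolding Q_def[abs_def] event_time_def event_state_def departures_def by measurable
  have QB: "\<bar>Q x t m \<omega>\<bar> \<le> B" for x t m \<omega>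
    using fB[of "event_state E \<omega> x m"] B0 by (simp add: Q_def)
  have Q0: "(\<integral>\<omega>. Q x t m \<omega> \<partial>\<mu>) = 0" for x t m
  proof -
    \<comment> \<open>Splits by the exact number \<open>Suc n\<close> of departures, which fixes the
      entry shown by the clock and is at most m.\<close>
    define q where "q n \<omega> = of_bool (event_time E \<omega> x m \<le> t \<and> t < event_time E \<omega> x m + time_to_event E (event_state E \<omega> x m)
      \<and> fst (event_state E \<omega> x m) $ k = 0 \<and> departures E \<omega> x m k = Suc n) * g (snd (snd (event_state E \<omega> x m)) $ k)" for n \<omega>
    have [measurable]: "q n \<in> borel_measurable \<mu>" for n
      unfolding q_def[abs_def] event_time_def event_state_def departures_def by measurable
    have qB: "\<bar>q n \<omega>\<bar> \<le> B" for n \<omega>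
      using B[of "snd (snd (event_state E \<omega> x m)) $ k"] B0 by (simp add: q_def)
    have "Q x t m \<omega> = (\<Sum>n<m. q n \<omega>)" for \<omega>
    proof (cases "departures E \<omega> x m k")
      case (Suc n)
      then have n: "n < m" using departures_le[of E \<omega> x m k] by simp
      have "q n' \<omega> = (if n' = n then Q x t m \<omega> else 0)" for n'
        using Suc by (auto simp: q_def Q_def f_def)
      then show ?thesis using n by simp
    qed (simp add: q_def Q_def)
    then have "(\<integral>\<omega>. Q x t m \<omega> \<partial>\<mu>) = (\<Sum>n<m. \<integral>\<omega>. q n \<omega> \<partial>\<mu>)"
      by (simp add: Bochner_Integration.integral_sum integrable_bounded[OF prob_space_\<mu> _ qB])
    then show ?thesis unfolding q_def by (simp add: integral_idle_zero[OF g B g0])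
  qed
  have tends: "(\<lambda>n. \<integral>\<omega>. f (process E x (real n) \<omega>) \<partial>\<mu>) \<longlonglongrightarrow> 0" if x: "x \<in> state_space E" for x
  proof -
    \<comment> \<open>The contribution of paths on which k has not yet had a departure at time n; it
      vanishes once n is large, for each regular path.\<close>
    define Z where "Z n \<omega> = f (process E x (real n) \<omega>) - (\<Sum>m. Q x (real n) m \<omega>)" for n \<omega>
    have reg: "AE \<omega> in \<mu>. regular_path E P \<omega> x"
      using AE_regular_sample by eventually_elim (rule regular_pathI[OF _ x])
    have mp[measurable]: "(\<lambda>\<omega>. process E x t \<omega>) \<in> \<mu> \<rightarrow>\<^sub>M state_algebra" for t
      by (rule measurable_process) auto
    \<comment> \<open>Exactly one interval between successive event times contains t; intervals of
      length 0 contain nothing. Hence the series over m has a single nonzero term at most. The value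
      of f does not change inside the interval, because f reads the clock only while it is
      frozen.\<close>
    have key: "\<exists>m. event_time E \<omega> x m \<le> t \<and> t < event_time E \<omega> x (Suc m) \<and> f (process E x t \<omega>) = f (event_state E \<omega> x m) \<and>
        (\<forall>m'. Q x t m' \<omega> = (if m' = m then of_bool (departures E \<omega> x m k \<noteq> 0) * f (event_state E \<omega> x m) else 0))"
      if "regular_path E P \<omega> x" "0 \<le> t" for \<omega> t
    proof -
      interpret regular_path E P \<omega> x by fact
      obtain m where m: "S m \<le> t" "t < S (Suc m)" using event_index[OF \<open>0 \<le> t\<close>] by blast
      have "f (process E x t \<omega>) = f (Y m)" by (simp add: process_eq[OF m] f_def run_clocks_eq)
      moreover have "S m' \<le> t \<and> t < S m' + h m' \<longleftrightarrow> m' = m" for m'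
      proof
        assume "S m' \<le> t \<and> t < S m' + h m'"
        then have "S m' \<le> t" "t < S (Suc m')" by (simp_all add: event_time_Suc)
        with m S_mono[of "Suc m" m'] S_mono[of "Suc m'" m] show "m' = m" by (cases m m' rule: linorder_cases) auto
      qed (use m in \<open>auto simp: event_time_Suc\<close>)
      ultimately show ?thesis using m by (intro exI[of _ m]) (auto simp: Q_def)
    qed
    have part: "AE \<omega> in \<mu>. \<bar>\<Sum>m<N. Q x (real n) m \<omega>\<bar> \<le> B" and sumsQ: "AE \<omega> in \<mu>. (\<lambda>N. \<Sum>m<N. Q x (real n) m \<omega>) \<longlonglongrightarrow> (\<Sum>m. Q x (real n) m \<omega>)"
      and ZB: "AE \<omega> in \<mu>. \<bar>Z n \<omega>\<bar> \<le> B" for n N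
    proof -
      show "AE \<omega> in \<mu>. \<bar>\<Sum>m<N. Q x (real n) m \<omega>\<bar> \<le> B"
        using reg
      proof eventually_elim
        case (elim \<omega>)
        from key[OF elim, of "real n"] obtain m where "\<And>m'. Q x (real n) m' \<omega> = (if m' = m then of_bool (departures E \<omega> x m k \<noteq> 0) * f (event_state E \<omega> x m) else 0)"
          by auto
        then show ?case using fB[of "event_state E \<omega> x m"] B0 by simp
      qed
      show "AE \<omega> in \<mu>. (\<lambda>N. \<Sum>m<N. Q x (real n) m \<omega>) \<longlonglongrightarrow> (\<Sum>m. Q x (real n) m \<omega>)"
        using reg
      proof eventually_elim
        case (elim \<omega>)
        from key[OF elim, of "real n"] obtain m where m: "\<And>m'. Q x (real n) m' \<omega> = (if m' = m then of_bool (departures E \<omega> x m k \<noteq> 0) * f (event_state E \<omega> x m) else 0)"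
          by auto
        have "summable (\<lambda>m'. Q x (real n) m' \<omega>)"
          by (rule summable_finite[of "{m}"]) (auto simp: m)
        then show ?case by (rule summable_LIMSEQ)
      qed
      show "AE \<omega> in \<mu>. \<bar>Z n \<omega>\<bar> \<le> B"
        using reg
      proof eventually_elim
        case (elim \<omega>)
        from key[OF elim, of "real n"] obtain m where m: "f (process E x (real n) \<omega>) = f (event_state E \<omega> x m)"
          "\<And>m'. Q x (real n) m' \<omega> = (if m' = m then of_bool (departures E \<omega> x m k \<noteq> 0) * f (event_state E \<omega> x m) else 0)"
          by auto
        have "(\<Sum>m'. Q x (real n) m' \<omega>) = of_bool (departures E \<omega> x m k \<noteq> 0) * f (event_state E \<omega> x m)"
          by (subst suminf_finite[of "{m}"]) (auto simp: m(2))
        then show ?case using fB[of "event_state E \<omega> x m"] B0 by (simp add: Z_def m(1))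
      qed
    qed
    have Zm[measurable]: "Z n \<in> borel_measurable \<mu>" for n unfolding Z_def[abs_def] by measurable
    have "(\<integral>\<omega>. f (process E x (real n) \<omega>) \<partial>\<mu>) = (\<integral>\<omega>. Z n \<omega> \<partial>\<mu>)" for n
    proof -
      have sm: "(\<lambda>\<omega>. \<Sum>m. Q x (real n) m \<omega>) \<in> borel_measurable \<mu>" by measurable
      have "(\<lambda>N. \<integral>\<omega>. (\<Sum>m<N. Q x (real n) m \<omega>) \<partial>\<mu>) \<longlonglongrightarrow> (\<integral>\<omega>. (\<Sum>m. Q x (real n) m \<omega>) \<partial>\<mu>)"
        by (rule bounded_convergence[OF prob_space_\<mu> _ sm sumsQ part]) measurable
      then have "(\<lambda>N::nat. 0) \<longlonglongrightarrow> (\<integral>\<omega>. (\<Sum>m. Q x (real n) m \<omega>) \<partial>\<mu>)"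
        by (simp add: Bochner_Integration.integral_sum integrable_bounded[OF prob_space_\<mu> Qm QB] Q0)
      from LIMSEQ_unique[OF this tendsto_const] have z: "(\<integral>\<omega>. (\<Sum>m. Q x (real n) m \<omega>) \<partial>\<mu>) = 0" .
      have "AE \<omega> in \<mu>. norm (\<Sum>m. Q x (real n) m \<omega>) \<le> 2 * B"
        using ZB[of n]
      proof eventually_elim
        case (elim \<omega>)
        then show ?case using fB[of "process E x (real n) \<omega>"] by (simp add: Z_def)
      qed
      then have "integrable \<mu> (\<lambda>\<omega>. \<Sum>m. Q x (real n) m \<omega>)" by (rule \<mu>.integrable_const_bound[OF _ sm])
      moreover have "integrable \<mu> (\<lambda>\<omega>. f (process E x (real n) \<omega>))"
        by (rule integrable_bounded[OF prob_space_\<mu> _ fB]) measurable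
      ultimately show ?thesis unfolding Z_def by (simp add: z)
    qed
    moreover have "(\<lambda>n. \<integral>\<omega>. Z n \<omega> \<partial>\<mu>) \<longlonglongrightarrow> (\<integral>\<omega>. 0 \<partial>\<mu>)"
    proof (rule bounded_convergence[OF prob_space_\<mu> Zm _ _ ZB])
      show "AE \<omega> in \<mu>. (\<lambda>n. Z n \<omega>) \<longlonglongrightarrow> 0"
        using reg
      proof eventually_elim
        case (elim \<omega>)
        then interpret regular_path E P \<omega> x .
        obtain M where M: "1 \<le> c M k" using departures_unbounded[OF connected] by blast
        have "Z n \<omega> = 0" if n: "S M \<le> real n" for n
        proof -
          from key[OF elim, of "real n"] obtain m where m: "S m \<le> real n" "real n < S (Suc m)" "f (process E x (real n) \<omega>) = f (Y m)"
            "\<And>m'. Q x (real n) m' \<omega> = (if m' = m then of_bool (c m k \<noteq> 0) * f (Y m) else 0)"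
            by auto
          have "M \<le> m" using m(2) n S_mono[of "Suc m" M] by (cases "M \<le> m") auto
          then have "1 \<le> c m k" using M departures_mono[of M m E \<omega> x k] by simp
          then have "(\<Sum>m'. Q x (real n) m' \<omega>) = f (Y m)"
            by (subst suminf_finite[of "{m}"]) (auto simp: m(4))
          then show ?thesis by (simp add: Z_def m(3))
        qed
        moreover have "\<forall>\<^sub>F n in sequentially. S M \<le> real n"
          using filterlim_real_sequentially by (simp add: filterlim_at_top)
        ultimately have "\<forall>\<^sub>F n in sequentially. Z n \<omega> = 0" by (auto elim: eventually_mono)
        then show ?case by (rule tendsto_eventually)
      qed
    qed simp
    ultimately show ?thesis by simp
  qed
  have m2: "(\<lambda>z. process E (fst z) t (snd z)) \<in> \<pi> \<Otimes>\<^sub>M \<mu> \<rightarrow>\<^sub>M state_algebra" for t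
    by (rule measurable_process) measurable
  have "(\<lambda>n. \<integral>x. \<integral>\<omega>. f (process E x (real n) \<omega>) \<partial>\<mu> \<partial>\<pi>) \<longlonglongrightarrow> (\<integral>x. 0 \<partial>\<pi>)"
  proof (rule bounded_convergence[OF \<pi>.prob_space_axioms])
    show "(\<lambda>x. \<integral>\<omega>. f (process E x (real n) \<omega>) \<partial>\<mu>) \<in> borel_measurable \<pi>" for n
      by (rule \<mu>.borel_measurable_lebesgue_integral) (use measurable_compose[OF m2 f] in \<open>simp add: split_beta'\<close>)
    show "AE x in \<pi>. (\<lambda>n. \<integral>\<omega>. f (process E x (real n) \<omega>) \<partial>\<mu>) \<longlonglongrightarrow> 0"
      using stationary_facts(3)[OF st] by eventually_elim (rule tends)
    show "AE x in \<pi>. \<bar>\<integral>\<omega>. f (process E x (real n) \<omega>) \<partial>\<mu>\<bar> \<le> B" for n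
      by (rule AE_I2) (rule abs_integral_le_bound[OF prob_space_\<mu> fB])
  qed simp
  then have "(\<lambda>n::nat. \<integral>x. f x \<partial>\<pi>) \<longlonglongrightarrow> 0"
    using integral_stationary[OF st _ f fB] by simp
  from LIMSEQ_unique[OF this tendsto_const] show ?thesis by (simp add: f_def)
qed

end

section \<open>Stationary clocks and utilizations\<close>

text \<open>Equals the minimum of v and C for nonnegative times, and is bounded on the negative axis
  as well, as \<open>clock_fun\<close> demands.\<close>

definition cutoff :: "real \<Rightarrow> real \<Rightarrow> real" where
  "cutoff C v = max 0 (min v C)"

lemma measurable_cutoff[measurable]: "cutoff C \<in> borel_measurable borel"
  unfolding cutoff_def[abs_def] by measurable

lemma cutoff_bounds: "0 \<le> C \<Longrightarrow> 0 \<le> cutoff C v" "0 \<le> C \<Longrightarrow> cutoff C v \<le> C"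
  by (auto simp: cutoff_def)

lemma cutoff_eq: "0 \<le> v \<Longrightarrow> v \<le> C \<Longrightarrow> cutoff C v = v"
  by (auto simp: cutoff_def)

lemma cutoff_0[simp]: "0 \<le> C \<Longrightarrow> cutoff C 0 = 0"
  by (simp add: cutoff_def)

lemma clock_fun_cutoff:
  assumes C: "0 < C" and g: "continuous_on {0..C} g" and g': "continuous_on {0..C} g'" and F: "finite F"
    and d: "\<And>w. 0 < w \<Longrightarrow> w < C \<Longrightarrow> w \<notin> F \<Longrightarrow> (g has_real_derivative g' w) (at w)"
  shows "clock_fun (\<lambda>v. g (cutoff C v)) (\<lambda>v. indicator {0..<C} v * g' v)"
proof -
  have cc: "continuous_on A (cutoff C)" for A unfolding cutoff_def[abs_def] by (intro continuous_intros)
  have c: "continuous_on A (\<lambda>v. g (cutoff C v))" for A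
    by (rule continuous_on_compose2[OF g cc]) (use C in \<open>auto simp: cutoff_bounds\<close>)
  have bd: "\<exists>B. \<forall>w\<in>{0..C}. \<bar>f w\<bar> \<le> B" if "continuous_on {0..C} f" for f :: "real \<Rightarrow> real"
  proof -
    have "bounded (f ` {0..C})" using that by (intro compact_imp_bounded compact_continuous_image) auto
    then show ?thesis unfolding bounded_real by blast
  qed
  obtain B1 B2 where B: "\<And>w. w \<in> {0..C} \<Longrightarrow> \<bar>g w\<bar> \<le> B1" "\<And>w. w \<in> {0..C} \<Longrightarrow> \<bar>g' w\<bar> \<le> B2"
    using bd[OF g] bd[OF g'] by blast
  have B2: "0 \<le> B2" using B(2)[of 0] C by simp
  have "\<bar>g (cutoff C u)\<bar> \<le> max B1 B2 \<and> \<bar>indicator {0..<C} u * g' u\<bar> \<le> max B1 B2" for u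
    using B(1)[of "cutoff C u"] B(2)[of u] B2 C by (auto simp: cutoff_bounds indicator_def)
  moreover have "((\<lambda>v. g (cutoff C v)) has_real_derivative indicator {0..<C} u * g' u) (at u)"
    if u: "0 < u" "u \<notin> insert C F" for u
  proof (cases "u < C")
    case True
    have "((\<lambda>v. g (cutoff C v)) has_real_derivative g' u) (at u)"
      by (rule has_field_derivative_transform_within_open[OF d, of _ "{0<..<C}"])
        (use True u in \<open>auto simp: cutoff_def\<close>)
    then show ?thesis using True u by simp
  next
    case False
    then have "C < u" using u by auto
    have "((\<lambda>v. g (cutoff C v)) has_real_derivative 0) (at u)"
      by (rule has_field_derivative_transform_within_open[where f="\<lambda>_. g C" and S="{C<..}"])
        (use \<open>C < u\<close> C in \<open>auto simp: cutoff_def\<close>)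
    then show ?thesis using \<open>C < u\<close> by simp
  qed
  moreover have "(\<lambda>v. indicator {0..<C} v * g' v) \<in> borel_measurable borel"
    using borel_measurable_continuous_on_indicator[OF _ continuous_on_subset[OF g'], of "{0..<C}"]
    by (simp add: atLeastLessThan_subseteq_atLeastAtMost_iff)
  moreover have "(\<lambda>v. g (cutoff C v)) \<in> borel_measurable borel"
    by (rule borel_measurable_continuous_onI[OF c])
  moreover have "finite (insert C F)" using F by simp
  ultimately show ?thesis
    unfolding clock_fun_def using c by blast
qed

context
  fixes \<nu> :: "real measure"
  assumes \<nu>: "time_law \<nu>"
begin

lemma time_law_facts:
  "prob_space \<nu>" "sets \<nu> = sets borel" "AE x in \<nu>. 0 \<le> x" "integrable \<nu> (\<lambda>x. x)" "integrable \<nu> (\<lambda>x. x\<^sup>2)" "0 < (\<integral>x. x \<partial>\<nu>)"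
  using \<nu> by (auto simp: time_law_def)

lemma measurable_time_law:
  "(\<lambda>x. x) \<in> borel_measurable \<nu>" "cutoff C \<in> borel_measurable \<nu>"
proof -
  show "(\<lambda>x. x) \<in> borel_measurable \<nu>"
    by (rule borel_measurable_integrable[OF time_law_facts(4)])
  from measurable_compose[OF this measurable_cutoff] show "cutoff C \<in> borel_measurable \<nu>" .
qed

lemma cutoff_tendsto:
  assumes c: "filterlim c at_top sequentially"
  shows "(\<lambda>n. \<integral>x. cutoff (c n) x \<partial>\<nu>) \<longlonglongrightarrow> (\<integral>x. x \<partial>\<nu>)"
proof (rule integral_dominated_convergence[OF measurable_time_law(1) measurable_time_law(2) time_law_facts(4)])
  show "AE x in \<nu>. (\<lambda>n. cutoff (c n) x) \<longlonglongrightarrow> x"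
    using time_law_facts(3)
  proof eventually_elim
    case (elim x)
    have "\<forall>\<^sub>F n in sequentially. x \<le> c n" using c by (simp add: filterlim_at_top)
    then have "\<forall>\<^sub>F n in sequentially. cutoff (c n) x = x" by eventually_elim (use elim in \<open>simp add: cutoff_eq\<close>)
    then show ?case by (rule tendsto_eventually)
  qed
  show "AE x in \<nu>. norm (cutoff (c n) x) \<le> x" for n
    using time_law_facts(3) by eventually_elim (auto simp: cutoff_def)
qed

lemma cutoff_integrable: "integrable \<nu> (cutoff C)"
proof (rule Bochner_Integration.integrable_bound[OF time_law_facts(4)])
  show "cutoff C \<in> borel_measurable \<nu>" by (rule measurable_time_law)
  show "AE x in \<nu>. norm (cutoff C x) \<le> norm x" using time_law_facts(3) by eventually_elim (auto simp: cutoff_def)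
qed

lemma cutoff_integral_pos:
  assumes C: "0 < C"
  shows "0 < (\<integral>x. cutoff C x \<partial>\<nu>)"
proof -
  have "(\<integral>x. cutoff C x \<partial>\<nu>) \<noteq> 0"
  proof
    assume "(\<integral>x. cutoff C x \<partial>\<nu>) = 0"
    then have "AE x in \<nu>. cutoff C x = 0"
      by (subst (asm) integral_nonneg_eq_0_iff_AE[OF cutoff_integrable]) (use C in \<open>auto simp: cutoff_bounds\<close>)
    with time_law_facts(3) have "AE x in \<nu>. x = 0"
      by eventually_elim (use C in \<open>auto simp: cutoff_def min_def max_def split: if_splits\<close>)
    with time_law_not_AE_0[OF \<nu>] show False by simp
  qed
  moreover have "0 \<le> (\<integral>x. cutoff C x \<partial>\<nu>)"
    by (rule Bochner_Integration.integral_nonneg) (use C in \<open>simp add: cutoff_bounds\<close>)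
  ultimately show ?thesis by simp
qed

lemma square_tail_integrable: "integrable \<nu> (\<lambda>x. x\<^sup>2 * of_bool (K \<le> x))"
proof (rule Bochner_Integration.integrable_bound[OF time_law_facts(5)])
  note [measurable_cong] = time_law_facts(2)
  show "(\<lambda>x. x\<^sup>2 * of_bool (K \<le> x)) \<in> borel_measurable \<nu>" by measurable
qed auto

text \<open>The test function is \<open>1 + \<kappa> C + max (w - K) 0 ^ 2 / 2 - \<kappa> w\<close> at \<open>w = cutoff C v\<close>, and the
  constant \<open>\<kappa>\<close> makes its mean equal to its value at 0.\<close>

lemma moment_clock_fun:
  assumes K: "0 \<le> K" and C: "0 < C"
  obtains a a' \<kappa> where "clock_fun a a'" "\<And>v. exp (a v) * a' v = indicator {0..<C} v * (max 0 (v - K) - \<kappa>)"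
    "(\<integral>v. exp (a v) \<partial>\<nu>) = exp (a 0)" "0 \<le> \<kappa>" "\<kappa> \<le> (\<integral>x. x\<^sup>2 * of_bool (K \<le> x) \<partial>\<nu>) / (\<integral>x. cutoff C x \<partial>\<nu>)"
proof -
  note [measurable_cong] = time_law_facts(2)
  interpret prob_space \<nu> by (rule time_law_facts)
  define G where "G w = (max 0 (w - K))\<^sup>2 / 2" for w
  define m where "m = (\<integral>x. cutoff C x \<partial>\<nu>)"
  define \<kappa> where "\<kappa> = (\<integral>x. G (cutoff C x) \<partial>\<nu>) / m"
  define b where "b w = 1 + \<kappa> * C + G w - \<kappa> * w" for w
  have m: "0 < m" unfolding m_def by (rule cutoff_integral_pos[OF C])
  have G0: "0 \<le> G w" for w by (simp add: G_def)
  have k0: "0 \<le> \<kappa>" unfolding \<kappa>_def using m by (auto intro!: divide_nonneg_pos simp: G0)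
  have [measurable]: "G \<in> borel_measurable borel" unfolding G_def[abs_def] by measurable
  have GC: "G (cutoff C x) \<le> x\<^sup>2 * of_bool (K \<le> x)" if "0 \<le> x" for x
  proof (cases "K \<le> x")
    case True
    then have "max 0 (cutoff C x - K) \<le> x" "0 \<le> max 0 (cutoff C x - K)" using that K by (auto simp: cutoff_def)
    then have "(max 0 (cutoff C x - K))\<^sup>2 \<le> x\<^sup>2" by (rule power_mono)
    then show ?thesis using True by (simp add: G_def) (use zero_le_power2[of x] in linarith)
  next
    case False
    then have "max 0 (cutoff C x - K) = 0" using K by (auto simp: cutoff_def)
    then show ?thesis by (simp add: G_def)
  qed
  have Gi: "integrable \<nu> (\<lambda>x. G (cutoff C x))"
  proof (rule Bochner_Integration.integrable_bound[OF square_tail_integrable[of K]])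
    show "AE x in \<nu>. norm (G (cutoff C x)) \<le> norm (x\<^sup>2 * of_bool (K \<le> x))"
      using time_law_facts(3) by eventually_elim (use GC in \<open>auto simp: G0\<close>)
  qed measurable
  have kle: "\<kappa> \<le> (\<integral>x. x\<^sup>2 * of_bool (K \<le> x) \<partial>\<nu>) / m"
    unfolding \<kappa>_def
  proof (rule divide_right_mono)
    show "(\<integral>x. G (cutoff C x) \<partial>\<nu>) \<le> (\<integral>x. x\<^sup>2 * of_bool (K \<le> x) \<partial>\<nu>)"
    proof (rule integral_mono_AE[OF Gi square_tail_integrable])
      show "AE x in \<nu>. G (cutoff C x) \<le> x\<^sup>2 * of_bool (K \<le> x)"
        using time_law_facts(3) by eventually_elim (rule GC)
    qed
  qed (use m in simp)
  \<comment> \<open>The reason for the constant \<open>1 + \<kappa> * C\<close>: on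
    \<open>{0..C}\<close> the linear term is compensated, so b stays above 1 and its logarithm is a
    bounded clock function.\<close>
  have b1: "1 \<le> b w" if "w \<in> {0..C}" for w
    using mult_left_mono[OF _ k0, of w C] that G0[of w] by (simp add: b_def)
  have Gd: "(G has_real_derivative max 0 (w - K)) (at w)" if "w \<noteq> K" for w
  proof (cases "w < K")
    case True
    have "(G has_real_derivative 0) (at w)"
      by (rule has_field_derivative_transform_within_open[where f="\<lambda>_. 0" and S="{..<K}"])
        (use True in \<open>auto simp: G_def\<close>)
    then show ?thesis using True by simp
  next
    case False
    then have "K < w" using that by simp
    have "((\<lambda>w. (w - K)\<^sup>2 / 2) has_real_derivative (w - K)) (at w)"
      by (auto intro!: derivative_eq_intros)
    then have "(G has_real_derivative (w - K)) (at w)"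
      by (rule has_field_derivative_transform_within_open[where S="{K<..}"]) (use \<open>K < w\<close> in \<open>auto simp: G_def\<close>)
    then show ?thesis using \<open>K < w\<close> by simp
  qed
  have bc: "continuous_on {0..C} b" unfolding b_def G_def by (intro continuous_intros) auto
  define a where "a v = ln (b (cutoff C v))" for v
  define a' where "a' v = indicator {0..<C} v * ((max 0 (v - K) - \<kappa>) / b v)" for v
  have "clock_fun a a'"
    unfolding a_def[abs_def] a'_def[abs_def]
  proof (rule clock_fun_cutoff[OF C, where F="{K}" and g="\<lambda>w. ln (b w)"])
    show "continuous_on {0..C} (\<lambda>w. ln (b w))" by (intro continuous_intros bc) (auto dest!: b1)
    show "continuous_on {0..C} (\<lambda>w. (max 0 (w - K) - \<kappa>) / b w)"
      by (intro continuous_intros bc) (auto dest!: b1)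
    fix w assume w: "0 < w" "w < C" "w \<notin> {K}"
    have "(b has_real_derivative max 0 (w - K) - \<kappa>) (at w)"
      unfolding b_def[abs_def] using w by (auto intro!: derivative_eq_intros Gd)
    moreover have "0 < b w" using b1[of w] w by simp
    ultimately show "((\<lambda>w. ln (b w)) has_real_derivative (max 0 (w - K) - \<kappa>) / b w) (at w)"
      by (auto intro!: derivative_eq_intros)
  qed simp
  moreover have ea: "exp (a v) = b (cutoff C v)" for v
    unfolding a_def using b1[of "cutoff C v"] C by (simp add: cutoff_bounds)
  moreover have "exp (a v) * a' v = indicator {0..<C} v * (max 0 (v - K) - \<kappa>)" for v
    using b1[of v] unfolding ea by (auto simp: a'_def indicator_def cutoff_eq)
  moreover have "(\<integral>v. exp (a v) \<partial>\<nu>) = exp (a 0)"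
  proof -
    have "(\<integral>v. exp (a v) \<partial>\<nu>) = (\<integral>v. (1 + \<kappa> * C) + G (cutoff C v) - \<kappa> * cutoff C v \<partial>\<nu>)"
      by (simp add: ea b_def)
    also have "\<dots> = 1 + \<kappa> * C + (\<integral>v. G (cutoff C v) \<partial>\<nu>) - \<kappa> * m"
      using Gi cutoff_integrable[of C] by (simp add: m_def prob_space)
    also have "\<dots> = 1 + \<kappa> * C" using m by (simp add: \<kappa>_def)
    finally show ?thesis using C K by (simp add: ea b_def G_def)
  qed
  ultimately show ?thesis by (intro that[of a a' \<kappa>] k0 kle[unfolded m_def])
qed

end

text \<open>Monotone convergence along integer truncation levels; the convergent bounds keep the
  truncated integrals bounded.\<close>

lemma integrable_truncated_limit:
  fixes w z :: "'a \<Rightarrow> real"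
  assumes "prob_space M" and [measurable]: "w \<in> borel_measurable M" "z \<in> borel_measurable M" and w: "\<And>x. 0 \<le> w x"
    and i: "\<And>C. 0 < C \<Longrightarrow> integrable M (\<lambda>x. of_bool (z x < C) * w x)"
    and b: "\<And>C. 0 < C \<Longrightarrow> (\<integral>x. of_bool (z x < C) * w x \<partial>M) \<le> b C" and L: "(\<lambda>n. b (real (Suc n))) \<longlonglongrightarrow> L"
  shows "integrable M w" "(\<integral>x. w x \<partial>M) \<le> L"
proof -
  define I where "I n = (\<integral>x. of_bool (z x < real (Suc n)) * w x \<partial>M)" for n
  have mono: "of_bool (z x < real (Suc n)) * w x \<le> of_bool (z x < real (Suc m)) * w x" if "n \<le> m" for n m x
    using that w[of x] by auto
  have "incseq I" unfolding I_def by (intro incseq_SucI integral_mono i mono) auto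
  moreover obtain B where "\<And>n. b (real (Suc n)) \<le> B"
    using convergent_imp_Bseq[OF convergentI[OF L]] by (auto simp: Bseq_def abs_le_iff)
  then have "I n \<le> B" for n using b[of "real (Suc n)"] by (simp add: I_def) (meson order_trans)
  ultimately obtain l where l: "I \<longlonglongrightarrow> l" using incseq_convergent[of I B] by blast
  have lim: "(\<lambda>n. of_bool (z x < real (Suc n)) * w x) \<longlonglongrightarrow> w x" for x
  proof (rule tendsto_eventually)
    obtain N :: nat where "z x < real N" using reals_Archimedean2 by blast
    then show "\<forall>\<^sub>F n in sequentially. of_bool (z x < real (Suc n)) * w x = w x"
      by (intro eventually_sequentiallyI[of N]) auto
  qed
  have "has_bochner_integral M w l"
    by (rule has_bochner_integral_monotone_convergence[where f="\<lambda>n x. of_bool (z x < real (Suc n)) * w x"])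
      (use i w l[unfolded I_def] mono lim in \<open>auto simp: I_def[symmetric] intro!: incseq_SucI\<close>)
  then show "integrable M w" "(\<integral>x. w x \<partial>M) \<le> L"
    using LIMSEQ_le[OF l L] b by (auto simp: has_bochner_integral_iff I_def)
qed

lemma cutoff_Suc_tendsto: "time_law \<nu> \<Longrightarrow> (\<lambda>n. \<integral>x. cutoff (real (Suc n)) x \<partial>\<nu>) \<longlonglongrightarrow> (\<integral>x. x \<partial>\<nu>)"
  using cutoff_tendsto[of \<nu> "\<lambda>n. real (Suc n)"] filterlim_compose[OF filterlim_real_sequentially filterlim_Suc] by simp

lemma t_fun_eq: "t_fun P j \<theta> = exp (- \<theta> $ j) * (1 + (\<Sum>k\<in>UNIV. P $ j $ k * (exp (\<theta> $ k) - 1)))"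
  by (simp add: t_fun_def exit_prob_def right_diff_distrib sum_subtractf)

lemma clock_fun_0: "clock_fun (\<lambda>_. 0) (\<lambda>_. 0)"
  by (auto simp: clock_fun_def)

section \<open>Residual times under the stationary law\<close>

context jackson
begin

context
  fixes \<pi> :: "'d state measure"
  assumes st: "stationary E P Te Ts \<pi>"
begin

lemma stationary_nonneg:
  "AE x in \<pi>. \<forall>i. 0 \<le> fst (snd x) $ i \<and> 0 \<le> snd (snd x) $ i"
  using stationary_facts(3)[OF st] by eventually_elim (auto intro: state_spaceD)

text \<open>Take \<theta> = 0 and let only clock i carry a function. The adjoint relation then says
  that the excess over K minus \<kappa> has mean zero on the event that the clock is below C, so the
  truncated excess is at most \<kappa>.\<close>

lemma arrival_excess_truncated:
  assumes i: "i \<in> E" and K: "0 \<le> K" and C: "0 < C"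
  shows "(\<integral>x. of_bool (fst (snd x) $ i < C) * max 0 (fst (snd x) $ i - K) \<partial>\<pi>)
     \<le> (\<integral>x. x\<^sup>2 * of_bool (K \<le> x) \<partial>Te i) / (\<integral>x. cutoff C x \<partial>Te i)" (is "?I \<le> ?R")
    and "integrable \<pi> (\<lambda>x. of_bool (fst (snd x) $ i < C) * max 0 (fst (snd x) $ i - K))"
proof -
  note sf[measurable_cong] = stationary_facts(2)[OF st]
  interpret \<pi>: prob_space \<pi> by (rule stationary_facts(1)[OF st])
  have id: "(\<lambda>x. x) \<in> \<pi> \<rightarrow>\<^sub>M state_algebra" by measurable
  note [measurable] = measurable_state_arrival[OF id]
  obtain a a' \<kappa> where a: "clock_fun a a'" "\<And>v. exp (a v) * a' v = indicator {0..<C} v * (max 0 (v - K) - \<kappa>)"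
    "(\<integral>v. exp (a v) \<partial>Te i) = exp (a 0)" "0 \<le> \<kappa>" "\<kappa> \<le> ?R"
    by (rule moment_clock_fun[OF Te[OF i] K C]) (rule that; assumption)
  show int: "integrable \<pi> (\<lambda>x. of_bool (fst (snd x) $ i < C) * max 0 (fst (snd x) $ i - K))"
    by (rule integrable_bounded[OF \<pi>.prob_space_axioms, where B=C]) (use C K in auto)
  have "(\<integral>x. test_fun E 0 (\<lambda>i'. if i' = i then a else (\<lambda>_. 0)) (\<lambda>_ _. 0) x *
      clock_drift E (\<lambda>i'. if i' = i then a' else (\<lambda>_. 0)) (\<lambda>_ _. 0) x \<partial>\<pi>) = 0"
    by (rule exponential_adjoint_relation[OF st])
      (use a(1,3) Te_prob Ts_prob in \<open>auto simp: clock_fun_0 t_fun_eq prob_space.prob_space\<close>)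
  moreover have "test_fun E 0 (\<lambda>i'. if i' = i then a else (\<lambda>_. 0)) (\<lambda>_ _. 0) x *
      clock_drift E (\<lambda>i'. if i' = i then a' else (\<lambda>_. 0)) (\<lambda>_ _. 0) x
      = indicator {0..<C} (fst (snd x) $ i) * (max 0 (fst (snd x) $ i - K) - \<kappa>)" for x
  proof -
    have s: "(\<Sum>i'\<in>E. (if i' = i then h else (\<lambda>_. 0)) (fst (snd x) $ i')) = h (fst (snd x) $ i)" for h :: "real \<Rightarrow> real"
      using i by (subst sum.remove[of E i]) (auto intro!: sum.neutral)
    show ?thesis unfolding test_fun_def clock_drift_def s using a(2) by simp
  qed
  ultimately have "(\<integral>x. indicator {0..<C} (fst (snd x) $ i) * (max 0 (fst (snd x) $ i - K) - \<kappa>) \<partial>\<pi>) = 0" by simp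
  also have "(\<integral>x. indicator {0..<C} (fst (snd x) $ i) * (max 0 (fst (snd x) $ i - K) - \<kappa>) \<partial>\<pi>)
    = (\<integral>x. of_bool (fst (snd x) $ i < C) * max 0 (fst (snd x) $ i - K) - \<kappa> * of_bool (fst (snd x) $ i < C) \<partial>\<pi>)"
  proof (rule integral_cong_AE)
    show "AE x in \<pi>. indicator {0..<C} (fst (snd x) $ i) * (max 0 (fst (snd x) $ i - K) - \<kappa>)
       = of_bool (fst (snd x) $ i < C) * max 0 (fst (snd x) $ i - K) - \<kappa> * of_bool (fst (snd x) $ i < C)"
      using stationary_nonneg by eventually_elim (auto simp: indicator_def)
  qed measurable
  also have "\<dots> = ?I - \<kappa> * (\<integral>x. of_bool (fst (snd x) $ i < C) \<partial>\<pi>)"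
    by (subst Bochner_Integration.integral_diff[OF int])
      (auto intro!: integrable_bounded[OF \<pi>.prob_space_axioms, where B=1])
  finally have "?I = \<kappa> * (\<integral>x. of_bool (fst (snd x) $ i < C) \<partial>\<pi>)" by simp
  also have "\<dots> \<le> \<kappa> * 1"
    using abs_integral_le_bound[OF \<pi>.prob_space_axioms, of "\<lambda>x. of_bool (fst (snd x) $ i < C)" 1] a(4)
    by (intro mult_left_mono) auto
  finally show "?I \<le> ?R" using a(5) by simp
qed

text \<open>As for arrivals, but the service clock drifts only while its station is busy, so the
  adjoint relation controls it on that event alone.\<close>

lemma service_excess_truncated:
  assumes K: "0 \<le> K" and C: "0 < C"
  shows "(\<integral>x. of_bool (snd (snd x) $ j < C) * (of_bool (0 < fst x $ j) * max 0 (snd (snd x) $ j - K)) \<partial>\<pi>)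
     \<le> (\<integral>x. x\<^sup>2 * of_bool (K \<le> x) \<partial>Ts j) / (\<integral>x. cutoff C x \<partial>Ts j)" (is "?I \<le> ?R")
    and "integrable \<pi> (\<lambda>x. of_bool (snd (snd x) $ j < C) * (of_bool (0 < fst x $ j) * max 0 (snd (snd x) $ j - K)))"
proof -
  note sf[measurable_cong] = stationary_facts(2)[OF st]
  interpret \<pi>: prob_space \<pi> by (rule stationary_facts(1)[OF st])
  have id: "(\<lambda>x. x) \<in> \<pi> \<rightarrow>\<^sub>M state_algebra" by measurable
  note [measurable] = measurable_state_service[OF id] measurable_state_queue[OF id]
  obtain a a' \<kappa> where a: "clock_fun a a'" "\<And>v. exp (a v) * a' v = indicator {0..<C} v * (max 0 (v - K) - \<kappa>)"
    "(\<integral>v. exp (a v) \<partial>Ts j) = exp (a 0)" "0 \<le> \<kappa>" "\<kappa> \<le> ?R"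
    by (rule moment_clock_fun[OF Ts[of j] K C]) (rule that; assumption)
  show int: "integrable \<pi> (\<lambda>x. of_bool (snd (snd x) $ j < C) * (of_bool (0 < fst x $ j) * max 0 (snd (snd x) $ j - K)))"
    by (rule integrable_bounded[OF \<pi>.prob_space_axioms, where B=C]) (use C K in auto)
  have "(\<integral>x. test_fun E 0 (\<lambda>_ _. 0) (\<lambda>i'. if i' = j then a else (\<lambda>_. 0)) x *
      clock_drift E (\<lambda>_ _. 0) (\<lambda>i'. if i' = j then a' else (\<lambda>_. 0)) x \<partial>\<pi>) = 0"
    by (rule exponential_adjoint_relation[OF st])
      (use a(1,3) Te_prob Ts_prob in \<open>auto simp: clock_fun_0 t_fun_eq prob_space.prob_space\<close>)
  moreover have "test_fun E 0 (\<lambda>_ _. 0) (\<lambda>i'. if i' = j then a else (\<lambda>_. 0)) x *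
      clock_drift E (\<lambda>_ _. 0) (\<lambda>i'. if i' = j then a' else (\<lambda>_. 0)) x
      = of_bool (0 < fst x $ j) * (indicator {0..<C} (snd (snd x) $ j) * (max 0 (snd (snd x) $ j - K) - \<kappa>))" for x
  proof -
    have s: "(\<Sum>i'\<in>UNIV. (if i' = j then a else (\<lambda>_. 0)) (snd (snd x) $ i')) = a (snd (snd x) $ j)"
      by (subst sum.remove[of UNIV j]) (auto intro!: sum.neutral)
    have s': "(\<Sum>i'\<in>UNIV. if 0 < fst x $ i' then (if i' = j then a' else (\<lambda>_. 0)) (snd (snd x) $ i') else 0)
        = (if 0 < fst x $ j then a' (snd (snd x) $ j) else 0)"
      by (subst sum.remove[of UNIV j]) (auto intro!: sum.neutral split: if_splits)
    show ?thesis unfolding test_fun_def clock_drift_def s s' using a(2) by simp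
  qed
  ultimately have "(\<integral>x. of_bool (0 < fst x $ j) * (indicator {0..<C} (snd (snd x) $ j) * (max 0 (snd (snd x) $ j - K) - \<kappa>)) \<partial>\<pi>) = 0" by simp
  also have "(\<integral>x. of_bool (0 < fst x $ j) * (indicator {0..<C} (snd (snd x) $ j) * (max 0 (snd (snd x) $ j - K) - \<kappa>)) \<partial>\<pi>)
    = (\<integral>x. of_bool (snd (snd x) $ j < C) * (of_bool (0 < fst x $ j) * max 0 (snd (snd x) $ j - K))
      - \<kappa> * of_bool (0 < fst x $ j \<and> snd (snd x) $ j < C) \<partial>\<pi>)"
  proof (rule integral_cong_AE)
    show "AE x in \<pi>. of_bool (0 < fst x $ j) * (indicator {0..<C} (snd (snd x) $ j) * (max 0 (snd (snd x) $ j - K) - \<kappa>))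
       = of_bool (snd (snd x) $ j < C) * (of_bool (0 < fst x $ j) * max 0 (snd (snd x) $ j - K))
      - \<kappa> * of_bool (0 < fst x $ j \<and> snd (snd x) $ j < C)"
      using stationary_nonneg by eventually_elim (auto simp: indicator_def)
  qed measurable
  also have "\<dots> = ?I - \<kappa> * (\<integral>x. of_bool (0 < fst x $ j \<and> snd (snd x) $ j < C) \<partial>\<pi>)"
    by (subst Bochner_Integration.integral_diff[OF int])
      (auto intro!: integrable_bounded[OF \<pi>.prob_space_axioms, where B=1])
  finally have "?I = \<kappa> * (\<integral>x. of_bool (0 < fst x $ j \<and> snd (snd x) $ j < C) \<partial>\<pi>)" by simp
  also have "\<dots> \<le> \<kappa> * 1"
    using abs_integral_le_bound[OF \<pi>.prob_space_axioms, of "\<lambda>x. of_bool (0 < fst x $ j \<and> snd (snd x) $ j < C)" 1] a(4)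
    by (intro mult_left_mono) auto
  finally show "?I \<le> ?R" using a(5) by simp
qed

text \<open>The limit of large truncation level. The bound has the form known from the equilibrium
  law of a renewal process: uniform integrability of the squared times becomes uniform integrability
  of the residual times.\<close>

lemma arrival_excess:
  assumes i: "i \<in> E" and K: "0 \<le> K"
  shows "integrable \<pi> (\<lambda>x. max 0 (fst (snd x) $ i - K))"
    and "(\<integral>x. max 0 (fst (snd x) $ i - K) \<partial>\<pi>) \<le> (\<integral>x. x\<^sup>2 * of_bool (K \<le> x) \<partial>Te i) * law_rate (Te i)"
proof -
  note sf[measurable_cong] = stationary_facts(2)[OF st]
  have id: "(\<lambda>x. x) \<in> \<pi> \<rightarrow>\<^sub>M state_algebra" by measurable
  note [measurable] = measurable_state_arrival[OF id]
  have L: "(\<lambda>n. (\<integral>x. x\<^sup>2 * of_bool (K \<le> x) \<partial>Te i) / (\<integral>x. cutoff (real (Suc n)) x \<partial>Te i)) \<longlonglongrightarrow>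
      (\<integral>x. x\<^sup>2 * of_bool (K \<le> x) \<partial>Te i) / (\<integral>x. x \<partial>Te i)"
    using time_law_facts(6)[OF Te[OF i]] by (intro tendsto_intros cutoff_Suc_tendsto Te i) auto
  note * = integrable_truncated_limit[where z="\<lambda>x. fst (snd x) $ i" and w="\<lambda>x. max 0 (fst (snd x) $ i - K)",
      OF stationary_facts(1)[OF st] _ _ _ arrival_excess_truncated(2)[OF i K] arrival_excess_truncated(1)[OF i K] L]
  show "integrable \<pi> (\<lambda>x. max 0 (fst (snd x) $ i - K))" by (rule *) auto
  show "(\<integral>x. max 0 (fst (snd x) $ i - K) \<partial>\<pi>) \<le> (\<integral>x. x\<^sup>2 * of_bool (K \<le> x) \<partial>Te i) * law_rate (Te i)"
    unfolding law_rate_def by (simp, rule *) auto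
qed

lemma service_excess:
  assumes K: "0 \<le> K"
  shows "integrable \<pi> (\<lambda>x. of_bool (0 < fst x $ j) * max 0 (snd (snd x) $ j - K))"
    and "(\<integral>x. of_bool (0 < fst x $ j) * max 0 (snd (snd x) $ j - K) \<partial>\<pi>) \<le> (\<integral>x. x\<^sup>2 * of_bool (K \<le> x) \<partial>Ts j) * law_rate (Ts j)"
proof -
  note sf[measurable_cong] = stationary_facts(2)[OF st]
  have id: "(\<lambda>x. x) \<in> \<pi> \<rightarrow>\<^sub>M state_algebra" by measurable
  note [measurable] = measurable_state_service[OF id] measurable_state_queue[OF id]
  have L: "(\<lambda>n. (\<integral>x. x\<^sup>2 * of_bool (K \<le> x) \<partial>Ts j) / (\<integral>x. cutoff (real (Suc n)) x \<partial>Ts j)) \<longlonglongrightarrow>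
      (\<integral>x. x\<^sup>2 * of_bool (K \<le> x) \<partial>Ts j) / (\<integral>x. x \<partial>Ts j)"
    using time_law_facts(6)[OF Ts[of j]] by (intro tendsto_intros cutoff_Suc_tendsto Ts) auto
  note * = integrable_truncated_limit[where z="\<lambda>x. snd (snd x) $ j" and w="\<lambda>x. of_bool (0 < fst x $ j) * max 0 (snd (snd x) $ j - K)",
      OF stationary_facts(1)[OF st] _ _ _ service_excess_truncated(2)[OF K] service_excess_truncated(1)[OF K] L]
  show "integrable \<pi> (\<lambda>x. of_bool (0 < fst x $ j) * max 0 (snd (snd x) $ j - K))" by (rule *) auto
  show "(\<integral>x. of_bool (0 < fst x $ j) * max 0 (snd (snd x) $ j - K) \<partial>\<pi>) \<le> (\<integral>x. x\<^sup>2 * of_bool (K \<le> x) \<partial>Ts j) * law_rate (Ts j)"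
    unfolding law_rate_def by (simp, rule *) auto
qed

end

end

section \<open>Flow balance and utilizations\<close>

lemma clock_fun_ln_affine:
  assumes C: "0 < C" and k: "\<bar>\<kappa>\<bar> * C \<le> 1 / 2"
  shows "clock_fun (\<lambda>v. ln (1 + \<kappa> * cutoff C v)) (\<lambda>v. indicator {0..<C} v * (\<kappa> / (1 + \<kappa> * v)))"
    and "\<bar>\<kappa> * cutoff C v\<bar> \<le> 1 / 2"
    and "\<bar>indicator {0..<C} v * (\<kappa> / (1 + \<kappa> * v))\<bar> \<le> 2 * \<bar>\<kappa>\<bar>"
proof -
  have b: "\<bar>\<kappa> * w\<bar> \<le> 1 / 2" if "w \<in> {0..C}" for w
  proof -
    have "\<bar>\<kappa> * w\<bar> \<le> \<bar>\<kappa>\<bar> * C" unfolding abs_mult using that by (intro mult_left_mono) auto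
    then show ?thesis using k by simp
  qed
  then have pos: "1 / 2 \<le> 1 + \<kappa> * w" if "w \<in> {0..C}" for w using that by (fastforce simp: abs_le_iff)
  show "clock_fun (\<lambda>v. ln (1 + \<kappa> * cutoff C v)) (\<lambda>v. indicator {0..<C} v * (\<kappa> / (1 + \<kappa> * v)))"
  proof (rule clock_fun_cutoff[OF C, where F="{}" and g="\<lambda>w. ln (1 + \<kappa> * w)"])
    show "continuous_on {0..C} (\<lambda>w. ln (1 + \<kappa> * w))" by (intro continuous_intros) (auto dest!: pos)
    show "continuous_on {0..C} (\<lambda>w. \<kappa> / (1 + \<kappa> * w))" by (intro continuous_intros) (auto dest!: pos)
    fix w assume "0 < w" "w < C"
    then have "0 < 1 + \<kappa> * w" using pos[of w] by simp
    then show "((\<lambda>w. ln (1 + \<kappa> * w)) has_real_derivative \<kappa> / (1 + \<kappa> * w)) (at w)"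
      by (auto intro!: derivative_eq_intros)
  qed simp
  show "\<bar>\<kappa> * cutoff C v\<bar> \<le> 1 / 2" by (rule b) (use C in \<open>auto simp: cutoff_bounds\<close>)
  show "\<bar>indicator {0..<C} v * (\<kappa> / (1 + \<kappa> * v))\<bar> \<le> 2 * \<bar>\<kappa>\<bar>"
  proof (cases "v \<in> {0..<C}")
    case True
    then have p: "1 / 2 \<le> 1 + \<kappa> * v" by (intro pos) auto
    then have "\<bar>\<kappa>\<bar> / (1 + \<kappa> * v) \<le> \<bar>\<kappa>\<bar> / (1 / 2)" by (intro divide_left_mono) auto
    then show ?thesis using True p by (simp add: abs_divide)
  qed simp
qed

lemma integral_affine_cutoff:
  assumes "time_law \<nu>"
  shows "(\<integral>x. 1 + \<kappa> * cutoff C x \<partial>\<nu>) = 1 + \<kappa> * (\<integral>x. cutoff C x \<partial>\<nu>)"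
proof -
  interpret prob_space \<nu> by (rule time_law_facts(1)[OF assms])
  show ?thesis using cutoff_integrable[OF assms, of C] by (simp add: prob_space)
qed

lemma abs_ln_1_plus_le:
  assumes "\<bar>y\<bar> \<le> 1 / 2"
  shows "\<bar>ln (1 + y :: real)\<bar> \<le> ln 2"
proof -
  have "ln (1 / 2) \<le> ln (1 + y)" "ln (1 + y) \<le> ln 2" using assms by (auto simp: abs_le_iff)
  moreover have "ln (1 / 2) = - ln (2 :: real)" by (simp add: ln_div)
  ultimately show ?thesis by (simp add: abs_le_iff)
qed

lemma matrix_inv_inverse:
  assumes "invertible A"
  shows "matrix_inv A ** A = mat 1" "A ** matrix_inv A = mat 1"
  using someI_ex[OF assms[unfolded invertible_def]] by (simp_all add: matrix_inv_def)

lemma matrix_inv_1_minus_transpose: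
  fixes P :: "real^'d::finite^'d"
  assumes "routing_matrix P"
  shows "matrix_inv (mat 1 - transpose P) = transpose (matrix_inv (mat 1 - P))"
    and "matrix_inv (mat 1 - transpose P) ** (mat 1 - transpose P) = mat 1"
proof -
  have inv: "invertible (mat 1 - P)" using assms by (simp add: routing_matrix_def)
  have tr: "transpose (mat 1 - P) = mat 1 - transpose P"
    by (simp add: transpose_def mat_def vec_eq_iff)
  have l: "matrix_inv (mat 1 - P) ** (mat 1 - P) = mat 1" "(mat 1 - P) ** matrix_inv (mat 1 - P) = mat 1"
    by (rule matrix_inv_inverse[OF inv])+
  have 1: "(mat 1 - transpose P) ** transpose (matrix_inv (mat 1 - P)) = mat 1"
    "transpose (matrix_inv (mat 1 - P)) ** (mat 1 - transpose P) = mat 1"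
    unfolding tr[symmetric] matrix_transpose_mul[symmetric] l by (simp_all add: transpose_mat)
  then have i: "invertible (mat 1 - transpose P)" unfolding invertible_def by blast
  show "matrix_inv (mat 1 - transpose P) = transpose (matrix_inv (mat 1 - P))"
    using 1 matrix_inv_inverse(1)[OF i] by (metis matrix_mul_assoc matrix_mul_lid matrix_mul_rid)
  show "matrix_inv (mat 1 - transpose P) ** (mat 1 - transpose P) = mat 1"
    by (rule matrix_inv_inverse(1)[OF i])
qed

context jackson
begin

context
  fixes \<pi> :: "'d state measure"
  assumes st: "stationary E P Te Ts \<pi>"
begin

text \<open>The linear balance equation is the derivative at \<open>\<epsilon> = 0\<close> of the adjoint relation for test
  functions with \<open>\<theta> = - \<epsilon> e\<^sub>k\<close>.\<close>

lemma flow_balance_truncated: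
  assumes C: "0 < C"
  shows "(if k \<in> E then (\<integral>x. of_bool (fst (snd x) $ k < C) \<partial>\<pi>) / (\<integral>x. cutoff C x \<partial>Te k) else 0)
     + (\<Sum>j\<in>UNIV. (P $ j $ k - kdelta j k) / (\<integral>x. cutoff C x \<partial>Ts j) * (\<integral>x. of_bool (0 < fst x $ j \<and> snd (snd x) $ j < C) \<partial>\<pi>)) = 0"
proof -
  note sf[measurable_cong] = stationary_facts(2)[OF st]
  interpret \<pi>: prob_space \<pi> by (rule stationary_facts(1)[OF st])
  have id: "(\<lambda>x. x) \<in> \<pi> \<rightarrow>\<^sub>M state_algebra" by measurable
  note [measurable] = measurable_state_service[OF id] measurable_state_queue[OF id] measurable_state_arrival[OF id]
  define me where "me i = (\<integral>x. cutoff C x \<partial>Te i)" for i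
  define ms where "ms j = (\<integral>x. cutoff C x \<partial>Ts j)" for j
  have me: "0 < me i" if "i \<in> E" for i unfolding me_def by (rule cutoff_integral_pos[OF Te[OF that] C])
  have ms: "0 < ms j" for j unfolding ms_def by (rule cutoff_integral_pos[OF Ts C])
  define p where "p j = P $ j $ k" for j
  have p01: "0 \<le> p j" "p j \<le> 1" for j
  proof -
    show "0 \<le> p j" using routing by (simp add: p_def routing_matrix_def)
    have "p j \<le> (\<Sum>k\<in>UNIV. P $ j $ k)" unfolding p_def
      by (rule member_le_sum) (use routing in \<open>auto simp: routing_matrix_def\<close>)
    also have "\<dots> \<le> 1" using routing by (simp add: routing_matrix_def)
    finally show "p j \<le> 1" .
  qed
  \<comment> \<open>The reciprocal of \<open>t_fun P j\<close> at \<theta> = - \<epsilon> e_k, that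
    is, the mean which the jump condition prescribes for the exponential of the service clock
    function.\<close>
  define H where "H j \<epsilon> = exp (- \<epsilon> * kdelta j k) / (1 + p j * (exp (- \<epsilon>) - 1))" for j \<epsilon>
  define \<epsilon> where "\<epsilon> n = inverse (real (Suc n))" for n
  have e0: "0 < \<epsilon> n" for n by (simp add: \<epsilon>_def)
  have elim0: "\<epsilon> \<longlonglongrightarrow> 0" unfolding \<epsilon>_def by (rule LIMSEQ_inverse_real_of_nat)
  then have eat: "filterlim \<epsilon> (at 0) sequentially"
    using e0 by (auto simp: filterlim_at intro!: always_eventually) (metis less_irrefl)
  \<comment> \<open>The slopes for which 1 + \<kappa> times the truncated clock has the prescribed
    mean: \<open>exp (\<epsilon> n)\<close> for arrivals at k, 1 for other arrivals, and
    \<open>H j (\<epsilon> n)\<close> for services.\<close>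
  define \<kappa>e where "\<kappa>e n i = (if i = k then (exp (\<epsilon> n) - 1) / me k else 0)" for n i
  define \<kappa>s where "\<kappa>s n j = (H j (\<epsilon> n) - 1) / ms j" for n j
  define le where "le i = (if i = k then 1 / me k else 0)" for i
  define ls where "ls j = (p j - kdelta j k) / ms j" for j
  have limE: "(\<lambda>n. \<kappa>e n i / \<epsilon> n) \<longlonglongrightarrow> le i" for i
  proof -
    have "(exp has_real_derivative 1) (at (0::real))" by (auto intro!: derivative_eq_intros)
    then have "((\<lambda>h. (exp h - 1) / h) \<longlongrightarrow> (1::real)) (at 0)" by (simp add: DERIV_def)
    from filterlim_compose[OF this eat] have "(\<lambda>n. (exp (\<epsilon> n) - 1) / \<epsilon> n / me k) \<longlonglongrightarrow> 1 / me k"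
      unfolding divide_inverse[of _ "me k"] by (rule tendsto_mult_right)
    then show ?thesis by (simp add: \<kappa>e_def le_def divide_divide_eq_left mult.commute)
  qed
  have limS: "(\<lambda>n. \<kappa>s n j / \<epsilon> n) \<longlonglongrightarrow> ls j" for j
  proof -
    have "(H j has_real_derivative (p j - kdelta j k)) (at 0)"
      unfolding H_def[abs_def] by (auto intro!: derivative_eq_intros)
    then have "((\<lambda>h. (H j h - 1) / h) \<longlongrightarrow> p j - kdelta j k) (at 0)" by (simp add: DERIV_def H_def)
    from filterlim_compose[OF this eat] have "(\<lambda>n. (H j (\<epsilon> n) - 1) / \<epsilon> n / ms j) \<longlonglongrightarrow> (p j - kdelta j k) / ms j"
      unfolding divide_inverse[of _ "ms j"] by (rule tendsto_mult_right)
    then show ?thesis by (simp add: \<kappa>s_def ls_def divide_divide_eq_left mult.commute)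
  qed
  have zeroE: "(\<lambda>n. \<kappa>e n i) \<longlonglongrightarrow> 0" and zeroS: "(\<lambda>n. \<kappa>s n i) \<longlonglongrightarrow> 0" for i
    using tendsto_mult[OF limE[of i] elim0] tendsto_mult[OF limS[of i] elim0] e0 by (simp_all add: less_imp_neq[symmetric])
  have half: "\<forall>\<^sub>F n in sequentially. \<bar>f n\<bar> * C \<le> 1 / 2" if "f \<longlonglongrightarrow> 0" for f :: "nat \<Rightarrow> real"
  proof -
    have "(\<lambda>n. \<bar>f n\<bar> * C) \<longlonglongrightarrow> 0 * C" using tendsto_rabs_zero[OF that] by (intro tendsto_mult tendsto_const)
    then have "\<forall>\<^sub>F n in sequentially. \<bar>f n\<bar> * C < 1 / 2" by (rule order_tendstoD(2)) simp
    then show ?thesis by eventually_elim simp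
  qed
  have "\<forall>\<^sub>F n in sequentially. \<forall>i. \<bar>\<kappa>e n i\<bar> * C \<le> 1 / 2 \<and> \<bar>\<kappa>s n i\<bar> * C \<le> 1 / 2"
    by (intro eventually_all_finite eventually_conj half zeroE zeroS)
  \<comment> \<open>From N on the slopes are so small that the affine functions stay between 1/2 and
    3/2 and their logarithms are admissible; the limit is taken along n + N.\<close>
  then obtain N where N: "\<And>n i. N \<le> n \<Longrightarrow> \<bar>\<kappa>e n i\<bar> * C \<le> 1 / 2" "\<And>n i. N \<le> n \<Longrightarrow> \<bar>\<kappa>s n i\<bar> * C \<le> 1 / 2"
    unfolding eventually_sequentially by blast
  have "\<exists>B. \<forall>n i. \<bar>\<kappa>e n i / \<epsilon> n\<bar> \<le> B \<and> \<bar>\<kappa>s n i / \<epsilon> n\<bar> \<le> B"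
  proof -
    have bd: "\<exists>B. \<forall>n. \<bar>f n\<bar> \<le> B" if "f \<longlonglongrightarrow> l" for f :: "nat \<Rightarrow> real" and l
      using convergent_imp_Bseq[OF convergentI[OF that]] by (auto simp: Bseq_def)
    have "\<forall>i. \<exists>B. \<forall>n. \<bar>\<kappa>e n i / \<epsilon> n\<bar> \<le> B" "\<forall>i. \<exists>B. \<forall>n. \<bar>\<kappa>s n i / \<epsilon> n\<bar> \<le> B"
      using bd[OF limE] bd[OF limS] by blast+
    then obtain B1 B2 where B: "\<And>n i. \<bar>\<kappa>e n i / \<epsilon> n\<bar> \<le> B1 i" "\<And>n i. \<bar>\<kappa>s n i / \<epsilon> n\<bar> \<le> B2 i" by metis
    have "B1 i \<le> max (Max (range B1)) (Max (range B2))" "B2 i \<le> max (Max (range B1)) (Max (range B2))" for i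
      by (auto simp: le_max_iff_disj)
    then show ?thesis using B by (intro exI[of _ "max (Max (range B1)) (Max (range B2))"]) (meson order_trans)
  qed
  then obtain B where B: "\<And>n i. \<bar>\<kappa>e n i / \<epsilon> n\<bar> \<le> B" "\<And>n i. \<bar>\<kappa>s n i / \<epsilon> n\<bar> \<le> B" by blast
  define \<theta> :: "nat \<Rightarrow> real^'d" where "\<theta> n = (\<chi> i. if i = k then - \<epsilon> n else 0)" for n
  define \<alpha> where "\<alpha> n i v = ln (1 + \<kappa>e n i * cutoff C v)" for n i v
  define \<beta> where "\<beta> n i v = ln (1 + \<kappa>s n i * cutoff C v)" for n i v
  define \<alpha>' where "\<alpha>' n i v = indicator {0..<C} v * (\<kappa>e n i / (1 + \<kappa>e n i * v))" for n i v
  define \<beta>' where "\<beta>' n i v = indicator {0..<C} v * (\<kappa>s n i / (1 + \<kappa>s n i * v))" for n i v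
  \<comment> \<open>The drift is of first order in \<epsilon>; divided by \<epsilon> it stays
    bounded and converges pointwise to \<open>L\<close>, while the test function tends to 1.\<close>
  define T where "T n x = test_fun E (\<theta> n) (\<alpha> n) (\<beta> n) x * (clock_drift E (\<alpha>' n) (\<beta>' n) x / \<epsilon> n)" for n x
  define L where "L = clock_drift E (\<lambda>i v. indicator {0..<C} v * le i) (\<lambda>j v. indicator {0..<C} v * ls j)"
  have cf: "clock_fun (\<alpha> n i) (\<alpha>' n i)" "clock_fun (\<beta> n i) (\<beta>' n i)" if "N \<le> n" for n i
    unfolding \<alpha>_def[abs_def] \<beta>_def[abs_def] \<alpha>'_def[abs_def] \<beta>'_def[abs_def]
    by (rule clock_fun_ln_affine(1)[OF C N(1)[OF that]] clock_fun_ln_affine(1)[OF C N(2)[OF that]])+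
  have T0: "(\<integral>x. T n x \<partial>\<pi>) = 0" if n: "N \<le> n" for n
  proof -
    have e: "exp (\<alpha> n i v) = 1 + \<kappa>e n i * cutoff C v" "exp (\<beta> n i v) = 1 + \<kappa>s n i * cutoff C v" for i v
      using clock_fun_ln_affine(2)[OF C N(1)[OF n], of i v] clock_fun_ln_affine(2)[OF C N(2)[OF n], of i v]
      unfolding \<alpha>_def \<beta>_def by (auto simp: abs_le_iff)
    have "(\<integral>x. test_fun E (\<theta> n) (\<alpha> n) (\<beta> n) x * clock_drift E (\<alpha>' n) (\<beta>' n) x \<partial>\<pi>) = 0"
    proof (rule exponential_adjoint_relation[OF st _ cf[OF n]])
      show "\<theta> n $ i \<le> 0" for i using e0[of n] by (simp add: \<theta>_def)
      show "exp (\<theta> n $ i) * (\<integral>u. exp (\<alpha> n i u) \<partial>Te i) = exp (\<alpha> n i 0)" if i: "i \<in> E" for i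
      proof -
        have "(\<integral>u. 1 + \<kappa>e n i * cutoff C u \<partial>Te i) = 1 + \<kappa>e n i * me i"
          unfolding me_def by (rule integral_affine_cutoff[OF Te[OF i]])
        then show ?thesis unfolding e using me[OF i] C by (auto simp: \<theta>_def \<kappa>e_def exp_minus)
      qed
      show "t_fun P j (\<theta> n) * (\<integral>u. exp (\<beta> n j u) \<partial>Ts j) = exp (\<beta> n j 0)" for j
      proof -
        have "(\<integral>u. 1 + \<kappa>s n j * cutoff C u \<partial>Ts j) = 1 + \<kappa>s n j * ms j"
          unfolding ms_def by (rule integral_affine_cutoff[OF Ts])
        also have "\<dots> = H j (\<epsilon> n)" using ms[of j] by (simp add: \<kappa>s_def)
        finally have 1: "(\<integral>u. 1 + \<kappa>s n j * cutoff C u \<partial>Ts j) = H j (\<epsilon> n)" .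
        have "(\<Sum>i\<in>UNIV. P $ j $ i * (exp (\<theta> n $ i) - 1)) = p j * (exp (- \<epsilon> n) - 1)"
          by (subst sum.remove[of UNIV k]) (auto simp: \<theta>_def p_def intro!: sum.neutral)
        then have 2: "t_fun P j (\<theta> n) = exp (\<epsilon> n * kdelta j k) * (1 + p j * (exp (- \<epsilon> n) - 1))"
          by (simp add: t_fun_eq \<theta>_def kdelta_def)
        have "0 < 1 + p j * (exp (- \<epsilon> n) - 1)"
        proof -
          have "p j * (1 - exp (- \<epsilon> n)) \<le> 1 * (1 - exp (- \<epsilon> n))"
            by (rule mult_right_mono) (use p01 e0[of n] in auto)
          moreover have "0 < exp (- \<epsilon> n)" by simp
          ultimately show ?thesis unfolding right_diff_distrib by linarith
        qed
        then have "exp (\<epsilon> n * kdelta j k) * (1 + p j * (exp (- \<epsilon> n) - 1)) * H j (\<epsilon> n)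
            = exp (\<epsilon> n * kdelta j k) * exp (- \<epsilon> n * kdelta j k)"
          unfolding H_def by simp
        also have "\<dots> = 1" by (simp add: exp_add[symmetric])
        finally show ?thesis unfolding e 1 2 using C by simp
      qed
    qed
    then show ?thesis unfolding T_def using e0[of n] by simp
  qed
  have Tm: "T n \<in> borel_measurable \<pi>" if n: "N \<le> n" for n
  proof -
    have "\<alpha> n i \<in> borel_measurable borel" "\<beta> n i \<in> borel_measurable borel" "\<alpha>' n i \<in> borel_measurable borel"
      "\<beta>' n i \<in> borel_measurable borel" for i using cf[OF n, of i] by (auto simp: clock_fun_def)
    then have "test_fun E (\<theta> n) (\<alpha> n) (\<beta> n) \<in> borel_measurable state_algebra" "clock_drift E (\<alpha>' n) (\<beta>' n) \<in> borel_measurable state_algebra"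
      by (intro measurable_test_fun measurable_clock_drift; simp)+
    note [measurable] = this
    show ?thesis unfolding T_def[abs_def] by measurable
  qed
  have Lm: "L \<in> borel_measurable \<pi>"
  proof -
    have "L \<in> borel_measurable state_algebra" unfolding L_def by (rule measurable_clock_drift; measurable)
    then show ?thesis by measurable
  qed
  have drift: "clock_drift E (\<alpha>' n) (\<beta>' n) x / \<epsilon> n = clock_drift E (\<lambda>i v. \<alpha>' n i v / \<epsilon> n) (\<lambda>i v. \<beta>' n i v / \<epsilon> n) x" for n x
    by (auto simp: clock_drift_def add_divide_distrib sum_divide_distrib intro!: sum.cong)
  have TB: "\<bar>T n x\<bar> \<le> exp (2 * (real CARD('d) * ln 2)) * (2 * (real CARD('d) * (2 * B)))" if n: "N \<le> n" for n x
    unfolding T_def drift abs_mult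
  proof (rule mult_mono)
    show "\<bar>test_fun E (\<theta> n) (\<alpha> n) (\<beta> n) x\<bar> \<le> exp (2 * (real CARD('d) * ln 2))"
      by (rule test_fun_bound) (use e0[of n] in \<open>auto simp: \<theta>_def \<alpha>_def \<beta>_def intro!: abs_ln_1_plus_le
          clock_fun_ln_affine(2)[OF C N(1)[OF n]] clock_fun_ln_affine(2)[OF C N(2)[OF n]]\<close>)
    have "\<bar>\<alpha>' n i v / \<epsilon> n\<bar> \<le> 2 * B" "\<bar>\<beta>' n i v / \<epsilon> n\<bar> \<le> 2 * B" for i v
    proof -
      have "\<bar>\<alpha>' n i v\<bar> / \<epsilon> n \<le> 2 * \<bar>\<kappa>e n i\<bar> / \<epsilon> n" "\<bar>\<beta>' n i v\<bar> / \<epsilon> n \<le> 2 * \<bar>\<kappa>s n i\<bar> / \<epsilon> n"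
        unfolding \<alpha>'_def \<beta>'_def
        by (intro divide_right_mono clock_fun_ln_affine(3)[OF C N(1)[OF n]] clock_fun_ln_affine(3)[OF C N(2)[OF n]] less_imp_le e0)+
      then show "\<bar>\<alpha>' n i v / \<epsilon> n\<bar> \<le> 2 * B" "\<bar>\<beta>' n i v / \<epsilon> n\<bar> \<le> 2 * B"
        using B(1)[of n i] B(2)[of n i] e0[of n] by (auto simp: abs_divide)
    qed
    then show "\<bar>clock_drift E (\<lambda>i v. \<alpha>' n i v / \<epsilon> n) (\<lambda>i v. \<beta>' n i v / \<epsilon> n) x\<bar> \<le> 2 * (real CARD('d) * (2 * B))"
      by (rule clock_drift_bound)
  qed auto
  have Tlim: "(\<lambda>n. T n x) \<longlonglongrightarrow> L x" for x
  proof -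
    have th: "(\<lambda>n. \<theta> n $ i) \<longlonglongrightarrow> 0" for i
      using tendsto_minus[OF elim0] by (cases "i = k") (simp_all add: \<theta>_def)
    have al: "(\<lambda>n. \<alpha> n i v) \<longlonglongrightarrow> 0" "(\<lambda>n. \<beta> n i v) \<longlonglongrightarrow> 0" for i v
    proof -
      have "(\<lambda>n. ln (1 + \<kappa>e n i * cutoff C v)) \<longlonglongrightarrow> ln (1 + 0 * cutoff C v)"
        "(\<lambda>n. ln (1 + \<kappa>s n i * cutoff C v)) \<longlonglongrightarrow> ln (1 + 0 * cutoff C v)"
        by (intro tendsto_intros zeroE zeroS; simp)+
      then show "(\<lambda>n. \<alpha> n i v) \<longlonglongrightarrow> 0" "(\<lambda>n. \<beta> n i v) \<longlonglongrightarrow> 0" by (simp_all add: \<alpha>_def \<beta>_def)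
    qed
    have "(\<lambda>n. test_fun E (\<theta> n) (\<alpha> n) (\<beta> n) x) \<longlonglongrightarrow> exp ((\<Sum>k\<in>UNIV. 0 * real (fst x $ k)) + (\<Sum>i\<in>E. 0) + (\<Sum>j\<in>(UNIV :: 'd set). 0))"
      unfolding test_fun_def by (intro tendsto_intros th al)
    then have 1: "(\<lambda>n. test_fun E (\<theta> n) (\<alpha> n) (\<beta> n) x) \<longlonglongrightarrow> 1" by simp
    have q: "(\<lambda>n. indicator {0..<C} v * (\<kappa> n / (1 + \<kappa> n * v)) / \<epsilon> n) \<longlonglongrightarrow> indicator {0..<C} v * l"
      if "\<kappa> \<longlonglongrightarrow> 0" "(\<lambda>n. \<kappa> n / \<epsilon> n) \<longlonglongrightarrow> l" for \<kappa> l and v :: real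
    proof -
      have "(\<lambda>n. indicator {0..<C} v * ((\<kappa> n / \<epsilon> n) / (1 + \<kappa> n * v))) \<longlonglongrightarrow> indicator {0..<C} v * (l / (1 + 0 * v))"
        by (intro tendsto_intros that) simp
      then show ?thesis by (simp add: divide_divide_eq_left mult.commute)
    qed
    have "(\<lambda>n. clock_drift E (\<lambda>i v. \<alpha>' n i v / \<epsilon> n) (\<lambda>i v. \<beta>' n i v / \<epsilon> n) x) \<longlonglongrightarrow> L x"
      unfolding clock_drift_def L_def \<alpha>'_def \<beta>'_def
    proof (intro tendsto_add tendsto_sum)
      fix i
      show "(\<lambda>n. indicator {0..<C} (fst (snd x) $ i) * (\<kappa>e n i / (1 + \<kappa>e n i * fst (snd x) $ i)) / \<epsilon> n) \<longlonglongrightarrow> indicator {0..<C} (fst (snd x) $ i) * le i"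
        by (rule q[OF zeroE limE])
      have "(\<lambda>n. indicator {0..<C} (snd (snd x) $ i) * (\<kappa>s n i / (1 + \<kappa>s n i * snd (snd x) $ i)) / \<epsilon> n)
          \<longlonglongrightarrow> indicator {0..<C} (snd (snd x) $ i) * ls i"
        by (rule q[OF zeroS limS])
      then show "(\<lambda>n. if 0 < fst x $ i then indicator {0..<C} (snd (snd x) $ i) * (\<kappa>s n i / (1 + \<kappa>s n i * snd (snd x) $ i)) / \<epsilon> n else 0)
          \<longlonglongrightarrow> (if 0 < fst x $ i then indicator {0..<C} (snd (snd x) $ i) * ls i else 0)"
        by (cases "0 < fst x $ i") simp_all
    qed
    from tendsto_mult[OF 1 this] show ?thesis unfolding T_def drift by simp
  qed
  have "(\<lambda>n. \<integral>x. T (n + N) x \<partial>\<pi>) \<longlonglongrightarrow> (\<integral>x. L x \<partial>\<pi>)"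
    by (rule bounded_convergence[OF \<pi>.prob_space_axioms Tm Lm _ AE_I2[OF TB]]) (use LIMSEQ_ignore_initial_segment[OF Tlim] in auto)
  then have "(\<lambda>n::nat. 0) \<longlonglongrightarrow> (\<integral>x. L x \<partial>\<pi>)" by (simp add: T0)
  from LIMSEQ_unique[OF this tendsto_const] have L0: "(\<integral>x. L x \<partial>\<pi>) = 0" .
  have "(\<integral>x. L x \<partial>\<pi>) = (\<integral>x. (if k \<in> E then 1 / me k * of_bool (fst (snd x) $ k < C) else 0)
      + (\<Sum>j\<in>UNIV. ls j * of_bool (0 < fst x $ j \<and> snd (snd x) $ j < C)) \<partial>\<pi>)"
  proof (rule integral_cong_AE[OF Lm])
    show "AE x in \<pi>. L x = (if k \<in> E then 1 / me k * of_bool (fst (snd x) $ k < C) else 0)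
      + (\<Sum>j\<in>UNIV. ls j * of_bool (0 < fst x $ j \<and> snd (snd x) $ j < C))"
      using stationary_nonneg[OF st]
    proof eventually_elim
      case (elim x)
      have "(\<Sum>i\<in>E. indicator {0..<C} (fst (snd x) $ i) * le i) = (\<Sum>i\<in>E. if i = k then 1 / me k * of_bool (fst (snd x) $ k < C) else 0)"
        by (rule sum.cong) (use elim in \<open>auto simp: le_def indicator_def\<close>)
      moreover have "(\<Sum>j\<in>UNIV. if 0 < fst x $ j then indicator {0..<C} (snd (snd x) $ j) * ls j else 0)
         = (\<Sum>j\<in>UNIV. ls j * of_bool (0 < fst x $ j \<and> snd (snd x) $ j < C))"
        by (rule sum.cong) (use elim in \<open>auto simp: indicator_def\<close>)
      ultimately show ?case by (simp add: L_def clock_drift_def)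
    qed
  qed measurable
  also have "\<dots> = (if k \<in> E then 1 / me k * (\<integral>x. of_bool (fst (snd x) $ k < C) \<partial>\<pi>) else 0)
      + (\<Sum>j\<in>UNIV. ls j * (\<integral>x. of_bool (0 < fst x $ j \<and> snd (snd x) $ j < C) \<partial>\<pi>))"
  proof -
    have i: "integrable \<pi> (\<lambda>x. c * of_bool (Q x))" if [measurable]: "Measurable.pred \<pi> Q" for c :: real and Q
      by (intro integrable_mult_right integrable_bounded[OF \<pi>.prob_space_axioms, where B=1]) auto
    have i1: "integrable \<pi> (\<lambda>x. if k \<in> E then 1 / me k * of_bool (fst (snd x) $ k < C) else 0)"
      using i[of "\<lambda>x. fst (snd x) $ k < C" "1 / me k"] by (cases "k \<in> E") simp_all
    have i2: "integrable \<pi> (\<lambda>x. ls j * of_bool (0 < fst x $ j \<and> snd (snd x) $ j < C))" for j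
      by (rule i) measurable
    have i3: "(\<integral>x. (if k \<in> E then 1 / me k * of_bool (fst (snd x) $ k < C) else 0) \<partial>\<pi>)
       = (if k \<in> E then 1 / me k * (\<integral>x. of_bool (fst (snd x) $ k < C) \<partial>\<pi>) else 0)"
      by (cases "k \<in> E") simp_all
    show ?thesis
      unfolding Bochner_Integration.integral_add[OF i1 Bochner_Integration.integrable_sum[OF i2]]
        Bochner_Integration.integral_sum[OF i2] integral_mult_right_zero i3 ..
  qed
  finally show ?thesis unfolding L0 by (auto simp: me_def ms_def ls_def p_def)
qed

text \<open>For large C the flow balance becomes the traffic equation for the throughputs y, the
  service rates times the probabilities of being busy. As \<open>mat 1 - transpose P\<close> is
  invertible, y is the vector of total arrival rates.\<close>

lemma utilization:
  "law_rate (Ts j) * (\<integral>x. of_bool (0 < fst x $ j) \<partial>\<pi>) = total_rate E P Te $ j"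
proof -
  note sf[measurable_cong] = stationary_facts(2)[OF st]
  interpret \<pi>: prob_space \<pi> by (rule stationary_facts(1)[OF st])
  have id: "(\<lambda>x. x) \<in> \<pi> \<rightarrow>\<^sub>M state_algebra" by measurable
  note [measurable] = measurable_state_service[OF id] measurable_state_queue[OF id] measurable_state_arrival[OF id]
  define y :: "real^'d" where "y = (\<chi> j. law_rate (Ts j) * (\<integral>x. of_bool (0 < fst x $ j) \<partial>\<pi>))"
  have lim: "(\<lambda>n. \<integral>x. (of_bool (Q x \<and> f x < real (Suc n)) :: real) \<partial>\<pi>) \<longlonglongrightarrow> (\<integral>x. of_bool (Q x) \<partial>\<pi>)"
    if [measurable]: "Measurable.pred \<pi> Q" "f \<in> borel_measurable \<pi>" for Q f
  proof (rule bounded_convergence[OF \<pi>.prob_space_axioms, where B=1])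
    show "AE x in \<pi>. (\<lambda>n. of_bool (Q x \<and> f x < real (Suc n)) :: real) \<longlonglongrightarrow> of_bool (Q x)"
    proof (rule AE_I2, rule tendsto_eventually)
      fix x
      obtain N :: nat where "f x < real N" using reals_Archimedean2 by blast
      then show "\<forall>\<^sub>F n in sequentially. (of_bool (Q x \<and> f x < real (Suc n)) :: real) = of_bool (Q x)"
        by (intro eventually_sequentiallyI[of N]) auto
    qed
  qed auto
  have bal: "(if k \<in> E then law_rate (Te k) else 0) + (\<Sum>j\<in>UNIV. (P $ j $ k - kdelta j k) * y $ j) = 0" for k
  proof -
    have a: "(\<lambda>n. if k \<in> E then (\<integral>x. of_bool (fst (snd x) $ k < real (Suc n)) \<partial>\<pi>) / (\<integral>x. cutoff (real (Suc n)) x \<partial>Te k) else 0)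
      \<longlonglongrightarrow> (if k \<in> E then law_rate (Te k) else 0)"
    proof (cases "k \<in> E")
      case True
      have "(\<lambda>n. (\<integral>x. of_bool (fst (snd x) $ k < real (Suc n)) \<partial>\<pi>) / (\<integral>x. cutoff (real (Suc n)) x \<partial>Te k))
          \<longlonglongrightarrow> 1 / (\<integral>x. x \<partial>Te k)"
        using lim[of "\<lambda>_. True" "\<lambda>x. fst (snd x) $ k"] time_law_facts(6)[OF Te[OF True]]
        by (intro tendsto_intros cutoff_Suc_tendsto Te True) (auto simp: \<pi>.prob_space)
      then show ?thesis using True by (simp add: law_rate_def)
    qed simp
    have s: "(\<lambda>n. \<Sum>j\<in>UNIV. (P $ j $ k - kdelta j k) / (\<integral>x. cutoff (real (Suc n)) x \<partial>Ts j) * (\<integral>x. of_bool (0 < fst x $ j \<and> snd (snd x) $ j < real (Suc n)) \<partial>\<pi>))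
       \<longlonglongrightarrow> (\<Sum>j\<in>UNIV. (P $ j $ k - kdelta j k) / (\<integral>x. x \<partial>Ts j) * (\<integral>x. of_bool (0 < fst x $ j) \<partial>\<pi>))"
      using time_law_facts(6)[OF Ts] by (intro tendsto_intros cutoff_Suc_tendsto Ts lim) (auto simp: less_imp_neq[symmetric])
    from tendsto_add[OF a s] flow_balance_truncated[of "real (Suc n)" k for n]
    have "(\<lambda>n::nat. 0) \<longlonglongrightarrow> (if k \<in> E then law_rate (Te k) else 0) + (\<Sum>j\<in>UNIV. (P $ j $ k - kdelta j k) / (\<integral>x. x \<partial>Ts j) * (\<integral>x. of_bool (0 < fst x $ j) \<partial>\<pi>))"
      by simp
    from LIMSEQ_unique[OF this tendsto_const] show ?thesis by (simp add: y_def law_rate_def)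
  qed
  have "(mat 1 - transpose P) *v y = ext_rate E Te"
  proof (simp only: vec_eq_iff, rule allI)
    fix k
    have "((mat 1 - transpose P) *v y) $ k = (\<Sum>j\<in>UNIV. - ((P $ j $ k - kdelta j k) * y $ j))"
      unfolding matrix_vector_mult_def by (auto simp: mat_def transpose_def kdelta_def algebra_simps intro!: sum.cong)
    then show "((mat 1 - transpose P) *v y) $ k = ext_rate E Te $ k"
      using bal[of k] by (simp add: ext_rate_def sum_negf)
  qed
  then have "total_rate E P Te = matrix_inv (mat 1 - transpose P) *v ((mat 1 - transpose P) *v y)"
    by (simp add: total_rate_def)
  also have "\<dots> = y"
    unfolding matrix_vector_mul_assoc matrix_inv_1_minus_transpose(2)[OF routing] by simp
  finally show ?thesis by (simp add: y_def)
qed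

end

end

section \<open>Expansion of the roots\<close>

lemma exp_quadratic_bound:
  fixes y :: real
  shows "\<bar>exp y - 1 - y - y\<^sup>2 / 2\<bar> \<le> exp \<bar>y\<bar> * \<bar>y\<bar> ^ 3"
proof -
  obtain t where t: "\<bar>t\<bar> \<le> \<bar>y\<bar>" "exp y = (\<Sum>m<3. y ^ m / fact m) + exp t / fact 3 * y ^ 3"
    using Maclaurin_exp_le[of y 3] by blast
  have "exp y - 1 - y - y\<^sup>2 / 2 = exp t / fact 3 * y ^ 3"
    using t(2) by (simp add: eval_nat_numeral)
  then have "\<bar>exp y - 1 - y - y\<^sup>2 / 2\<bar> = exp t / fact 3 * \<bar>y\<bar> ^ 3" by (simp add: abs_mult power_abs)
  also have "\<dots> \<le> exp \<bar>y\<bar> * \<bar>y\<bar> ^ 3"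
  proof (rule mult_right_mono)
    have "exp t / fact 3 \<le> exp t / 1" by (rule divide_left_mono) (auto simp: fact_numeral)
    also have "\<dots> \<le> exp \<bar>y\<bar>" using t(1) by simp
    finally show "exp t / fact 3 \<le> exp \<bar>y\<bar>" .
  qed simp
  finally show ?thesis .
qed

lemma exp_neg_quadratic_le:
  fixes y :: real
  assumes "y \<le> 0"
  shows "exp y \<le> 1 + y + y\<^sup>2 / 2"
proof -
  obtain t where t: "exp y = (\<Sum>m<3. y ^ m / fact m) + exp t / fact 3 * y ^ 3"
    using Maclaurin_exp_le[of y 3] by blast
  have "y ^ 3 \<le> 0" using assms by (simp add: power_le_zero_eq)
  then have "exp t / fact 3 * y ^ 3 \<le> 0" by (intro mult_nonneg_nonpos) auto
  then show ?thesis using t by (simp add: eval_nat_numeral)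
qed

locale light_laws =
  fixes \<nu> :: "nat \<Rightarrow> real measure" and r :: "nat \<Rightarrow> real" and lam sig :: real
  assumes law: "\<And>n. time_law (\<nu> n)" and ui: "unif_integrable \<nu> (\<lambda>x. x\<^sup>2)"
    and rate: "(\<lambda>n. law_rate (\<nu> n)) \<longlonglongrightarrow> lam" and lam: "0 < lam" and sd: "(\<lambda>n. law_sd (\<nu> n)) \<longlonglongrightarrow> sig"
    and r_pos: "\<And>n. 0 < r n" and r_lim: "r \<longlonglongrightarrow> 0"
begin

definition "Q K n = (\<integral>x. x\<^sup>2 * of_bool (K \<le> x) \<partial>\<nu> n)"
definition "mean n = (\<integral>x. x \<partial>\<nu> n)"
definition "m1 n = (\<integral>x. cutoff (1 / r n) x \<partial>\<nu> n)"
definition "m2 n = (\<integral>x. (cutoff (1 / r n) x)\<^sup>2 \<partial>\<nu> n)"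
definition "m3 n = (\<integral>x. (cutoff (1 / r n) x) ^ 3 \<partial>\<nu> n)"

lemma prob: "prob_space (\<nu> n)" and nonneg: "AE x in \<nu> n. 0 \<le> x"
  and int1: "integrable (\<nu> n) (\<lambda>x. x)" and int2: "integrable (\<nu> n) (\<lambda>x. x\<^sup>2)" and mean_pos: "0 < mean n"
  using time_law_facts[OF law] by (auto simp: mean_def)

lemma sets_law[measurable_cong]: "sets (\<nu> n) = sets borel"
  by (rule time_law_facts(2)[OF law])

lemma cut_pos: "0 < 1 / r n" using r_pos by simp

lemma cut_bounds: "0 \<le> cutoff (1 / r n) x" "cutoff (1 / r n) x \<le> 1 / r n"
  using cutoff_bounds[of "1 / r n" x] cut_pos[of n] by auto

lemma int_cut_pow: "integrable (\<nu> n) (\<lambda>x. cutoff (1 / r n) x ^ k)"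
proof (rule integrable_bounded[OF prob, where B="(1 / r n) ^ k"])
  show "\<bar>cutoff (1 / r n) x ^ k\<bar> \<le> (1 / r n) ^ k" for x
    using power_mono[OF cut_bounds(2) cut_bounds(1), of n x k] cut_bounds(1)[of n x] by simp
qed measurable

lemma Q_nonneg: "0 \<le> Q K n" unfolding Q_def by (rule Bochner_Integration.integral_nonneg) simp

lemma Q_antimono: "K \<le> K' \<Longrightarrow> Q K' n \<le> Q K n"
  unfolding Q_def by (intro integral_mono square_tail_integrable[OF law]) auto

lemma Q_uniform:
  assumes e: "0 < e"
  obtains K where "0 < K" "\<And>n. Q K n \<le> e"
proof -
  let ?S = "\<lambda>K. SUP n. \<integral>\<^sup>+x. ennreal \<bar>x\<^sup>2\<bar> * indicator {x. K \<le> \<bar>x\<^sup>2\<bar>} x \<partial>\<nu> n"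
  have "(?S \<longlongrightarrow> 0) at_top" using ui by (simp add: unif_integrable_def)
  then have "\<forall>\<^sub>F K in at_top. ?S K < ennreal e" by (rule order_tendstoD(2)) (use e in simp)
  moreover have "\<forall>\<^sub>F K in at_top. (1::real) \<le> K" by (rule eventually_ge_at_top)
  ultimately have "\<forall>\<^sub>F K in at_top. ?S K < ennreal e \<and> (1::real) \<le> K" by eventually_elim simp
  then obtain K0 where K0: "?S K0 < ennreal e" "1 \<le> K0" by (auto simp: eventually_at_top_linorder)
  \<comment> \<open>Uniform integrability of the squares cuts off where the square is large,
    \<open>Q\<close> where the time itself is.\<close>
  have "Q (sqrt K0) n \<le> e" for n
  proof -
    have "ennreal (Q (sqrt K0) n) = (\<integral>\<^sup>+x. ennreal (x\<^sup>2 * of_bool (sqrt K0 \<le> x)) \<partial>\<nu> n)"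
      unfolding Q_def by (rule nn_integral_eq_integral[symmetric, OF square_tail_integrable[OF law]]) simp
    also have "\<dots> \<le> (\<integral>\<^sup>+x. ennreal \<bar>x\<^sup>2\<bar> * indicator {x. K0 \<le> \<bar>x\<^sup>2\<bar>} x \<partial>\<nu> n)"
    proof (rule nn_integral_mono)
      fix x
      show "ennreal (x\<^sup>2 * of_bool (sqrt K0 \<le> x)) \<le> ennreal \<bar>x\<^sup>2\<bar> * indicator {x. K0 \<le> \<bar>x\<^sup>2\<bar>} x"
        using K0(2) by (auto simp: indicator_def real_le_lsqrt sqrt_le_D)
    qed
    also have "\<dots> \<le> ?S K0" by (rule SUP_upper) simp
    finally have "ennreal (Q (sqrt K0) n) \<le> ennreal e" using K0(1) by (meson less_imp_le order_trans)
    then show ?thesis using e by (simp add: ennreal_le_iff)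
  qed
  then show ?thesis using that[of "sqrt K0"] K0(2) by simp
qed

lemma Q_tendsto:
  assumes "filterlim a at_top sequentially"
  shows "(\<lambda>n. Q (a n) n) \<longlonglongrightarrow> 0"
proof (rule order_tendstoI)
  fix e :: real assume "e < 0"
  then show "\<forall>\<^sub>F n in sequentially. e < Q (a n) n" by (intro always_eventually allI) (rule less_le_trans[OF _ Q_nonneg])
next
  fix e :: real assume "0 < e"
  then obtain K where K: "\<And>n. Q K n \<le> e / 2" using Q_uniform[of "e / 2"] by auto
  have "\<forall>\<^sub>F n in sequentially. K \<le> a n" using assms by (simp add: filterlim_at_top)
  then show "\<forall>\<^sub>F n in sequentially. Q (a n) n < e"
  proof eventually_elim
    case (elim n)
    then show ?case using Q_antimono[OF elim, of n] K[of n] \<open>0 < e\<close> by simp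
  qed
qed

lemma inverse_r_at_top: "0 < c \<Longrightarrow> filterlim (\<lambda>n. c / r n) at_top sequentially"
proof -
  assume c: "0 < c"
  have "filterlim (\<lambda>n. inverse (r n)) at_top sequentially"
    by (rule filterlim_inverse_at_top[OF r_lim]) (simp add: r_pos)
  then have "filterlim (\<lambda>n. c * inverse (r n)) at_top sequentially"
    by (rule filterlim_tendsto_pos_mult_at_top[OF tendsto_const c])
  then show ?thesis by (simp add: divide_inverse)
qed

lemma Qr_tendsto: "(\<lambda>n. Q (1 / r n) n) \<longlonglongrightarrow> 0" "(\<lambda>n. Q (1 / (2 * r n)) n) \<longlonglongrightarrow> 0"
  using Q_tendsto[OF inverse_r_at_top[of 1]] Q_tendsto[OF inverse_r_at_top[of "1 / 2"]] by simp_all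

lemma second_moment_bounded: obtains B where "\<And>n. (\<integral>x. x\<^sup>2 \<partial>\<nu> n) \<le> B" "0 < B"
proof -
  obtain K where K: "0 < K" "\<And>n. Q K n \<le> 1" using Q_uniform[of 1] by auto
  have "(\<integral>x. x\<^sup>2 \<partial>\<nu> n) \<le> K\<^sup>2 + 1" for n
  proof -
    interpret prob_space "\<nu> n" by (rule prob)
    have "(\<integral>x. x\<^sup>2 \<partial>\<nu> n) \<le> (\<integral>x. K\<^sup>2 + x\<^sup>2 * of_bool (K \<le> x) \<partial>\<nu> n)"
    proof (rule integral_mono_AE[OF int2])
      show "integrable (\<nu> n) (\<lambda>x. K\<^sup>2 + x\<^sup>2 * of_bool (K \<le> x))" using square_tail_integrable[OF law] by simp
      show "AE x in \<nu> n. x\<^sup>2 \<le> K\<^sup>2 + x\<^sup>2 * of_bool (K \<le> x)"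
        using nonneg[of n] by eventually_elim (auto intro!: power_mono)
    qed
    also have "\<dots> = K\<^sup>2 + Q K n" using square_tail_integrable[OF law, of n K] by (simp add: Q_def prob_space)
    finally show ?thesis using K(2)[of n] by simp
  qed
  moreover have "0 < K\<^sup>2 + 1" by (simp add: add_nonneg_pos)
  ultimately show ?thesis using that by blast
qed

lemma mean_tendsto: "mean \<longlonglongrightarrow> 1 / lam"
proof -
  have "(\<lambda>n. inverse (law_rate (\<nu> n))) \<longlonglongrightarrow> inverse lam" using rate lam by (intro tendsto_inverse) auto
  then show ?thesis by (simp add: law_rate_def mean_def[abs_def] inverse_eq_divide)
qed

text \<open>Truncation acts only where x is at least 1 / r, and there x is at most r times its
  square. So it perturbs the mean by o(r), which first-order terms of size r |theta| can
  absorb.\<close>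

lemma mean_m1: "0 \<le> mean n - m1 n" "mean n - m1 n \<le> r n * Q (1 / r n) n"
proof -
  have eq: "mean n - m1 n = (\<integral>x. x - cutoff (1 / r n) x \<partial>\<nu> n)"
    unfolding mean_def m1_def by (rule Bochner_Integration.integral_diff[symmetric, OF int1 cutoff_integrable[OF law]])
  show "0 \<le> mean n - m1 n" unfolding eq
  proof (rule integral_nonneg_AE)
    show "AE x in \<nu> n. 0 \<le> x - cutoff (1 / r n) x"
      using nonneg[of n] by eventually_elim (simp add: cutoff_def)
  qed
  have "mean n - m1 n \<le> (\<integral>x. r n * (x\<^sup>2 * of_bool (1 / r n \<le> x)) \<partial>\<nu> n)" unfolding eq
  proof (rule integral_mono_AE)
    show "integrable (\<nu> n) (\<lambda>x. x - cutoff (1 / r n) x)" using int1 cutoff_integrable[OF law] by simp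
    show "integrable (\<nu> n) (\<lambda>x. r n * (x\<^sup>2 * of_bool (1 / r n \<le> x)))" using square_tail_integrable[OF law] by simp
    show "AE x in \<nu> n. x - cutoff (1 / r n) x \<le> r n * (x\<^sup>2 * of_bool (1 / r n \<le> x))"
      using nonneg[of n]
    proof eventually_elim
      case (elim x)
      show ?case
      proof (cases "1 / r n \<le> x")
        case True
        then have "1 \<le> r n * x" using r_pos[of n] by (simp add: field_simps)
        then have "1 * x \<le> (r n * x) * x" using elim by (intro mult_right_mono)
        then show ?thesis using True cut_bounds(1)[of n x] by (simp add: power2_eq_square mult.assoc)
      qed (use elim in \<open>simp add: cutoff_eq\<close>)
    qed
  qed
  then show "mean n - m1 n \<le> r n * Q (1 / r n) n" by (simp add: Q_def)
qed

lemma mean_m1_smallo: "(\<lambda>n. mean n - m1 n) \<in> o(r)"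
proof (rule smalloI_tendsto)
  show "((\<lambda>n. (mean n - m1 n) / r n) \<longlongrightarrow> 0) sequentially"
  proof (rule tendsto_sandwich[OF _ _ tendsto_const Qr_tendsto(1)])
    show "\<forall>\<^sub>F n in sequentially. 0 \<le> (mean n - m1 n) / r n" using mean_m1(1) r_pos by (auto intro!: always_eventually divide_nonneg_pos)
    show "\<forall>\<^sub>F n in sequentially. (mean n - m1 n) / r n \<le> Q (1 / r n) n"
      using mean_m1(2) r_pos by (auto intro!: always_eventually simp: pos_divide_le_eq mult.commute)
  qed
  show "\<forall>\<^sub>F n in sequentially. r n \<noteq> 0" using r_pos by (auto intro!: always_eventually simp: less_imp_neq[symmetric])
qed

lemma m1_tendsto: "m1 \<longlonglongrightarrow> 1 / lam"
proof -
  have "(\<lambda>n. (mean n - m1 n) / r n * r n) \<longlonglongrightarrow> 0 * 0"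
    by (intro tendsto_mult smalloD_tendsto[OF mean_m1_smallo] r_lim)
  then have "(\<lambda>n. mean n - m1 n) \<longlonglongrightarrow> 0" using r_pos by (simp add: less_imp_neq[symmetric])
  from tendsto_diff[OF mean_tendsto this] show ?thesis by simp
qed

lemma m1_pos: "0 < m1 n"
  unfolding m1_def by (rule cutoff_integral_pos[OF law cut_pos])

lemma m2_tendsto: "(\<lambda>n. m2 n - (m1 n)\<^sup>2) \<longlonglongrightarrow> sig\<^sup>2"
proof -
  have var: "(law_sd (\<nu> n))\<^sup>2 = (\<integral>x. x\<^sup>2 \<partial>\<nu> n) - (mean n)\<^sup>2" for n
  proof -
    interpret prob_space "\<nu> n" by (rule prob)
    have "(law_sd (\<nu> n))\<^sup>2 = (\<integral>x. (x - mean n)\<^sup>2 \<partial>\<nu> n)"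
      unfolding law_sd_def mean_def by (rule real_sqrt_pow2) (rule Bochner_Integration.integral_nonneg, simp)
    also have "\<dots> = (\<integral>x. x\<^sup>2 - 2 * mean n * x + (mean n)\<^sup>2 \<partial>\<nu> n)" by (simp add: power2_diff algebra_simps)
    also have "\<dots> = (\<integral>x. x\<^sup>2 \<partial>\<nu> n) - 2 * mean n * mean n + (mean n)\<^sup>2"
      using int1[of n] int2[of n] by (simp add: prob_space mean_def)
    finally show ?thesis by (simp add: power2_eq_square)
  qed
  have b: "0 \<le> (\<integral>x. x\<^sup>2 \<partial>\<nu> n) - m2 n" "(\<integral>x. x\<^sup>2 \<partial>\<nu> n) - m2 n \<le> Q (1 / r n) n" for n
  proof -
    have eq: "(\<integral>x. x\<^sup>2 \<partial>\<nu> n) - m2 n = (\<integral>x. x\<^sup>2 - (cutoff (1 / r n) x)\<^sup>2 \<partial>\<nu> n)"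
      unfolding m2_def by (rule Bochner_Integration.integral_diff[symmetric, OF int2 int_cut_pow])
    show "0 \<le> (\<integral>x. x\<^sup>2 \<partial>\<nu> n) - m2 n" unfolding eq
    proof (rule integral_nonneg_AE)
      show "AE x in \<nu> n. 0 \<le> x\<^sup>2 - (cutoff (1 / r n) x)\<^sup>2"
        using nonneg[of n]
      proof eventually_elim
        case (elim x)
        have "cutoff (1 / r n) x \<le> x" using elim by (auto simp: cutoff_def)
        from power_mono[OF this cut_bounds(1), of 2] show ?case by simp
      qed
    qed
    show "(\<integral>x. x\<^sup>2 \<partial>\<nu> n) - m2 n \<le> Q (1 / r n) n" unfolding eq Q_def
    proof (rule integral_mono_AE[OF _ square_tail_integrable[OF law]])
      show "integrable (\<nu> n) (\<lambda>x. x\<^sup>2 - (cutoff (1 / r n) x)\<^sup>2)" using int2 int_cut_pow by simp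
      show "AE x in \<nu> n. x\<^sup>2 - (cutoff (1 / r n) x)\<^sup>2 \<le> x\<^sup>2 * of_bool (1 / r n \<le> x)"
        using nonneg[of n] by eventually_elim (auto simp: cutoff_eq)
    qed
  qed
  have "(\<lambda>n. (\<integral>x. x\<^sup>2 \<partial>\<nu> n) - m2 n) \<longlonglongrightarrow> 0"
    by (rule tendsto_sandwich[OF _ _ tendsto_const Qr_tendsto(1)]) (use b in auto)
  from tendsto_diff[OF tendsto_add[OF tendsto_power[OF sd, of 2] tendsto_power[OF mean_tendsto, of 2]]
      tendsto_add[OF this tendsto_power[OF m1_tendsto, of 2]]]
  show ?thesis by (simp add: var)
qed

text \<open>Third moments of the original times may be infinite. For the truncated variable c, split
  at a fixed K: below it, r c^3 is at most r K x^2; above it, r c is at most 1, so r c^3 is bounded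
  by the square over the tail.\<close>

lemma rm3_tendsto: "(\<lambda>n. r n * m3 n) \<longlonglongrightarrow> 0"
proof -
  obtain B where B: "\<And>n. (\<integral>x. x\<^sup>2 \<partial>\<nu> n) \<le> B" "0 < B" using second_moment_bounded by blast
  have m30: "0 \<le> r n * m3 n" for n
    unfolding m3_def using r_pos[of n] cut_bounds(1) by (intro mult_nonneg_nonneg Bochner_Integration.integral_nonneg) auto
  have le: "r n * m3 n \<le> r n * (K * B) + Q K n" if K: "0 < K" for n K
  proof -
    have "r n * m3 n = (\<integral>x. r n * cutoff (1 / r n) x ^ 3 \<partial>\<nu> n)" by (simp add: m3_def)
    also have "\<dots> \<le> (\<integral>x. r n * K * x\<^sup>2 + x\<^sup>2 * of_bool (K \<le> x) \<partial>\<nu> n)"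
    proof (rule integral_mono_AE)
      show "integrable (\<nu> n) (\<lambda>x. r n * cutoff (1 / r n) x ^ 3)" using int_cut_pow by simp
      show "integrable (\<nu> n) (\<lambda>x. r n * K * x\<^sup>2 + x\<^sup>2 * of_bool (K \<le> x))" using int2 square_tail_integrable[OF law] by simp
      show "AE x in \<nu> n. r n * cutoff (1 / r n) x ^ 3 \<le> r n * K * x\<^sup>2 + x\<^sup>2 * of_bool (K \<le> x)"
        using nonneg[of n]
      proof eventually_elim
        case (elim x)
        define c where "c = cutoff (1 / r n) x"
        have c: "0 \<le> c" "c \<le> x" using elim r_pos[of n] by (auto simp: c_def cutoff_def)
        have cr: "c * r n \<le> 1" using cut_bounds(2)[of n x] r_pos[of n] by (simp add: c_def pos_le_divide_eq)
        have c2: "c\<^sup>2 \<le> x\<^sup>2" using c by (intro power_mono)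
        show ?case
        proof (cases "K \<le> x")
          case True
          have "r n * c ^ 3 = (c * r n) * c\<^sup>2" by (simp add: power2_eq_square power3_eq_cube)
          also have "\<dots> \<le> 1 * x\<^sup>2" using c cr c2 r_pos[of n] by (intro mult_mono) auto
          finally show ?thesis using True K r_pos[of n] by (simp add: c_def add_increasing)
        next
          case False
          have "r n * c ^ 3 = (r n * c) * c\<^sup>2" by (simp add: power2_eq_square power3_eq_cube)
          also have "\<dots> \<le> (r n * K) * x\<^sup>2" using c c2 r_pos[of n] False K by (intro mult_mono mult_left_mono) auto
          finally show ?thesis using False by (simp add: c_def)
        qed
      qed
    qed
    also have "\<dots> = r n * K * (\<integral>x. x\<^sup>2 \<partial>\<nu> n) + Q K n" using int2[of n] square_tail_integrable[OF law, of n K] by (simp add: Q_def)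
    also have "\<dots> \<le> r n * K * B + Q K n" using B(1)[of n] K r_pos[of n] by (intro add_right_mono mult_left_mono) auto
    finally show ?thesis by (simp add: mult.assoc)
  qed
  show ?thesis
  proof (rule order_tendstoI)
    fix e :: real assume "e < 0"
    then show "\<forall>\<^sub>F n in sequentially. e < r n * m3 n" by (intro always_eventually allI) (rule less_le_trans[OF _ m30])
  next
    fix e :: real assume e: "0 < e"
    then obtain K where K: "0 < K" "\<And>n. Q K n \<le> e / 2" using Q_uniform[of "e / 2"] by auto
    have "(\<lambda>n. r n * (K * B)) \<longlonglongrightarrow> 0 * (K * B)" by (intro tendsto_mult r_lim tendsto_const)
    then have "\<forall>\<^sub>F n in sequentially. r n * (K * B) < e / 2" by (rule order_tendstoD(2)) (use e in simp)
    then show "\<forall>\<^sub>F n in sequentially. r n * m3 n < e"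
    proof eventually_elim
      case (elim n)
      then show ?case using le[OF K(1), of n] K(2)[of n] by simp
    qed
  qed
qed

section \<open>Roots of the exponential moment equation\<close>

context
  fixes \<rho> \<eta> q :: "nat \<Rightarrow> real"
  assumes \<rho>: "\<And>n. 0 < \<rho> n" "\<rho> \<in> O(r)" and q: "q \<in> O(\<rho>)"
    and root: "\<And>n. (\<integral>x. exp (\<eta> n * cutoff (1 / r n) x) \<partial>\<nu> n) = 1 + q n"
begin

lemma \<rho>_lim: "\<rho> \<longlonglongrightarrow> 0" and q_lim: "q \<longlonglongrightarrow> 0"
proof -
  have r1: "r \<in> o(\<lambda>_. 1)" by (rule smalloI_tendsto) (use r_lim in auto)
  then have "\<rho> \<in> o(\<lambda>_. 1)" using \<rho>(2) by (rule landau_o.big_small_trans[rotated])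
  moreover from this have "q \<in> o(\<lambda>_. 1)" using q by (rule landau_o.big_small_trans[rotated])
  ultimately show "\<rho> \<longlonglongrightarrow> 0" "q \<longlonglongrightarrow> 0" by (auto dest!: smalloD_tendsto)
qed

lemma int_exp_root: "integrable (\<nu> n) (\<lambda>x. exp (c * cutoff (1 / r n) x))"
proof (rule integrable_bounded[OF prob, where B="exp (\<bar>c\<bar> * (1 / r n))"])
  show "\<bar>exp (c * cutoff (1 / r n) x)\<bar> \<le> exp (\<bar>c\<bar> * (1 / r n))" for x
  proof -
    have "c * cutoff (1 / r n) x \<le> \<bar>c\<bar> * cutoff (1 / r n) x" using cut_bounds(1)[of n x] by (intro mult_right_mono) auto
    also have "\<dots> \<le> \<bar>c\<bar> * (1 / r n)" using cut_bounds(2)[of n x] by (intro mult_left_mono) auto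
    finally show ?thesis by simp
  qed
qed measurable

lemma root_upper: "\<eta> n * m1 n \<le> q n"
proof -
  interpret prob_space "\<nu> n" by (rule prob)
  have "(\<integral>x. 1 + \<eta> n * cutoff (1 / r n) x \<partial>\<nu> n) \<le> (\<integral>x. exp (\<eta> n * cutoff (1 / r n) x) \<partial>\<nu> n)"
    by (rule integral_mono[OF _ int_exp_root]) (use cutoff_integrable[OF law] exp_ge_add_one_self in auto)
  then show ?thesis unfolding root integral_affine_cutoff[OF law] by (simp add: m1_def)
qed

lemma quadratic_upper:
  assumes a: "0 \<le> a"
  shows "(\<integral>x. exp (- a * cutoff (1 / r n) x) \<partial>\<nu> n) \<le> 1 - a * m1 n + a\<^sup>2 * m2 n / 2"
proof -
  interpret prob_space "\<nu> n" by (rule prob)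
  have i: "integrable (\<nu> n) (cutoff (1 / r n))" "integrable (\<nu> n) (\<lambda>x. (cutoff (1 / r n) x)\<^sup>2)"
    using cutoff_integrable[OF law] int_cut_pow by auto
  have "(\<integral>x. exp (- a * cutoff (1 / r n) x) \<partial>\<nu> n) \<le> (\<integral>x. 1 - a * cutoff (1 / r n) x + a\<^sup>2 / 2 * (cutoff (1 / r n) x)\<^sup>2 \<partial>\<nu> n)"
  proof (rule integral_mono[OF int_exp_root])
    show "integrable (\<nu> n) (\<lambda>x. 1 - a * cutoff (1 / r n) x + a\<^sup>2 / 2 * (cutoff (1 / r n) x)\<^sup>2)" using i by simp
    show "exp (- a * cutoff (1 / r n) x) \<le> 1 - a * cutoff (1 / r n) x + a\<^sup>2 / 2 * (cutoff (1 / r n) x)\<^sup>2" for x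
      using exp_neg_quadratic_le[of "- a * cutoff (1 / r n) x"] a cut_bounds(1)[of n x] by (simp add: power_mult_distrib)
  qed
  also have "\<dots> = 1 - a * m1 n + a\<^sup>2 / 2 * m2 n" using i by (simp add: prob_space m1_def m2_def)
  finally show ?thesis by simp
qed

text \<open>The bound from convexity in \<open>root_upper\<close> settles nonnegative roots. For a
  root -a with a > 0, let a0 = m1 / m2 minimise the quadratic upper bound of the mean of exp (- a
  X). If a exceeded a0, monotonicity would push the mean below 1 - m1^2 / (2 m2), against the
  smallness of q. For a up to a0 the quadratic term is at most half of the linear one.\<close>

lemma root_lower:
  assumes m2: "0 < m2 n" and q2: "\<bar>q n\<bar> < (m1 n)\<^sup>2 / (2 * m2 n)" and neg: "\<eta> n < 0"
  shows "- \<eta> n * m1 n \<le> 2 * \<bar>q n\<bar>"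
proof -
  define a where "a = - \<eta> n"
  define a0 where "a0 = m1 n / m2 n"
  have a: "0 < a" "\<eta> n = - a" using neg by (auto simp: a_def)
  have a0: "0 < a0" using m2 m1_pos by (simp add: a0_def)
  have "a \<le> a0"
  proof (rule ccontr)
    assume "\<not> a \<le> a0"
    then have "(\<integral>x. exp (- a * cutoff (1 / r n) x) \<partial>\<nu> n) \<le> (\<integral>x. exp (- a0 * cutoff (1 / r n) x) \<partial>\<nu> n)"
      by (intro integral_mono int_exp_root) (use cut_bounds(1) in \<open>auto intro!: mult_right_mono\<close>)
    also have "\<dots> \<le> 1 - a0 * m1 n + a0\<^sup>2 * m2 n / 2" using a0 by (intro quadratic_upper) simp
    also have "\<dots> = 1 - (m1 n)\<^sup>2 / (2 * m2 n)" using m2 by (simp add: a0_def power2_eq_square field_simps)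
    finally show False using root[of n] q2 by (simp add: a(2))
  qed
  then have "a * (a * m2 n) \<le> a * m1 n" using a m2 by (intro mult_left_mono) (auto simp: a0_def field_simps)
  then have "a\<^sup>2 * m2 n / 2 \<le> a * m1 n / 2" by (simp add: power2_eq_square mult.assoc)
  then show ?thesis using quadratic_upper[of a n] root[of n] a by simp
qed

lemma root_bigo: "\<eta> \<in> O(\<rho>)"
proof -
  obtain B where B: "\<And>n. (\<integral>x. x\<^sup>2 \<partial>\<nu> n) \<le> B" "0 < B" using second_moment_bounded by blast
  have m2B: "m2 n \<le> B" for n
  proof -
    have "m2 n \<le> (\<integral>x. x\<^sup>2 \<partial>\<nu> n)" unfolding m2_def
    proof (rule integral_mono_AE[OF int_cut_pow int2])
      show "AE x in \<nu> n. (cutoff (1 / r n) x)\<^sup>2 \<le> x\<^sup>2"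
        using nonneg[of n] by eventually_elim (rule power_mono, auto simp: cutoff_def cut_bounds)
    qed
    then show ?thesis using B(1)[of n] by simp
  qed
  have m2p: "(m1 n)\<^sup>2 \<le> m2 n" for n
  proof -
    interpret prob_space "\<nu> n" by (rule prob)
    have i: "integrable (\<nu> n) (cutoff (1 / r n))" "integrable (\<nu> n) (\<lambda>x. (cutoff (1 / r n) x)\<^sup>2)"
      using cutoff_integrable[OF law] int_cut_pow by auto
    have "0 \<le> (\<integral>x. (cutoff (1 / r n) x - m1 n)\<^sup>2 \<partial>\<nu> n)" by simp
    also have "\<dots> = (\<integral>x. (cutoff (1 / r n) x)\<^sup>2 - 2 * m1 n * cutoff (1 / r n) x + (m1 n)\<^sup>2 \<partial>\<nu> n)"
      by (simp add: power2_diff algebra_simps)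
    also have "\<dots> = m2 n - 2 * m1 n * m1 n + (m1 n)\<^sup>2" using i by (simp add: prob_space m1_def m2_def)
    finally show ?thesis by (simp add: power2_eq_square)
  qed
  \<comment> \<open>Half the limiting mean as a lower bound for \<open>m1\<close>, and B as an upper
    bound for \<open>m2\<close>, turn the condition of \<open>root_lower\<close> into smallness of q
    with a fixed threshold.\<close>
  have "\<forall>\<^sub>F n in sequentially. 1 / (2 * lam) < m1 n"
    using m1_tendsto by (rule order_tendstoD(1)) (use lam in \<open>simp add: field_simps\<close>)
  moreover have "\<forall>\<^sub>F n in sequentially. \<bar>q n\<bar> < (1 / (2 * lam))\<^sup>2 / (2 * B)"
    using tendsto_rabs_zero[OF q_lim] by (rule order_tendstoD(2)) (use lam B in simp)
  ultimately have "\<forall>\<^sub>F n in sequentially. norm (\<eta> n) \<le> 4 * lam * norm (q n)"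
  proof eventually_elim
    case (elim n)
    have l: "0 < 1 / (2 * lam)" using lam by simp
    have "(1 / (2 * lam))\<^sup>2 \<le> (m1 n)\<^sup>2" using elim l by (intro power_mono) auto
    moreover have m2: "0 < m2 n" using m2p[of n] zero_less_power[OF m1_pos[of n], of 2] by linarith
    ultimately have "(1 / (2 * lam))\<^sup>2 / (2 * B) \<le> (m1 n)\<^sup>2 / (2 * m2 n)"
      using m2B[of n] by (intro frac_le) auto
    then have q2: "\<bar>q n\<bar> < (m1 n)\<^sup>2 / (2 * m2 n)" using elim by simp
    have "\<bar>\<eta> n\<bar> * m1 n \<le> 2 * \<bar>q n\<bar>"
      using root_lower[OF m2 q2] root_upper[of n] by (cases "\<eta> n < 0") auto
    moreover have "\<bar>\<eta> n\<bar> * (1 / (2 * lam)) \<le> \<bar>\<eta> n\<bar> * m1 n" using elim by (intro mult_left_mono) auto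
    ultimately have "\<bar>\<eta> n\<bar> * (1 / (2 * lam)) \<le> 2 * \<bar>q n\<bar>" by simp
    then show ?case using lam by (simp add: field_simps)
  qed
  then have "\<eta> \<in> O(q)" by (rule bigoI)
  then show ?thesis using q by (rule landau_o.big_trans)
qed

lemma \<rho>2: "(\<lambda>n. \<rho> n * \<rho> n) \<in> O(\<lambda>n. r n * \<rho> n)"
  by (rule landau_o.big.mult[OF \<rho>(2) landau_o.big_refl])

text \<open>A root is O(r) and the truncated time at most 1 / r, so the exponent is bounded and the
  Taylor remainder is O(|\<eta>|^3 m3). Written as \<eta>^2 times |\<eta>| / r times r m3, this is
  O(r \<rho>) times a bounded and a vanishing factor.\<close>

lemma root_quadratic: "(\<lambda>n. \<eta> n * m1 n + (\<eta> n)\<^sup>2 * m2 n / 2 - q n) \<in> o(\<lambda>n. r n * \<rho> n)"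
proof -
  have er: "\<eta> \<in> O(r)" using root_bigo \<rho>(2) by (rule landau_o.big_trans)
  then obtain Y where Y: "0 < Y" "\<forall>\<^sub>F n in sequentially. norm (\<eta> n) \<le> Y * norm (r n)" by (elim landau_o.bigE)
  have bound: "\<forall>\<^sub>F n in sequentially. norm (\<eta> n * m1 n + (\<eta> n)\<^sup>2 * m2 n / 2 - q n) \<le> exp Y * norm (\<bar>\<eta> n\<bar> ^ 3 * m3 n)"
    using Y(2)
  proof eventually_elim
    case (elim n)
    interpret prob_space "\<nu> n" by (rule prob)
    let ?X = "cutoff (1 / r n)"
    have i: "integrable (\<nu> n) ?X" "integrable (\<nu> n) (\<lambda>x. (?X x)\<^sup>2)" "integrable (\<nu> n) (\<lambda>x. (?X x) ^ 3)"
      using cutoff_integrable[OF law] int_cut_pow by auto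
    let ?g = "\<lambda>x. exp (\<eta> n * ?X x) - 1 - \<eta> n * ?X x - (\<eta> n)\<^sup>2 / 2 * (?X x)\<^sup>2"
    have gi: "integrable (\<nu> n) ?g" using i int_exp_root by simp
    have e: "q n - \<eta> n * m1 n - (\<eta> n)\<^sup>2 / 2 * m2 n = (\<integral>x. ?g x \<partial>\<nu> n)"
      using i int_exp_root[of n "\<eta> n"] root[of n] by (simp add: prob_space m1_def m2_def)
    have "\<bar>q n - \<eta> n * m1 n - (\<eta> n)\<^sup>2 / 2 * m2 n\<bar> \<le> (\<integral>x. \<bar>?g x\<bar> \<partial>\<nu> n)"
      unfolding e by (rule integral_abs_bound)
    also have "\<dots> \<le> (\<integral>x. exp Y * \<bar>\<eta> n\<bar> ^ 3 * (?X x) ^ 3 \<partial>\<nu> n)"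
    proof (rule integral_mono)
      show "integrable (\<nu> n) (\<lambda>x. \<bar>?g x\<bar>)" using gi by simp
      show "integrable (\<nu> n) (\<lambda>x. exp Y * \<bar>\<eta> n\<bar> ^ 3 * (?X x) ^ 3)" using i by simp
      fix x
      have X: "0 \<le> ?X x" "?X x \<le> 1 / r n" by (rule cut_bounds)+
      have "\<bar>\<eta> n * ?X x\<bar> = \<bar>\<eta> n\<bar> * ?X x" using X by (simp add: abs_mult)
      also have "\<dots> \<le> (Y * r n) * (1 / r n)" using elim r_pos[of n] X by (intro mult_mono) auto
      also have "\<dots> = Y" using r_pos[of n] by simp
      finally have y: "\<bar>\<eta> n * ?X x\<bar> \<le> Y" .
      have "\<bar>?g x\<bar> = \<bar>exp (\<eta> n * ?X x) - 1 - \<eta> n * ?X x - (\<eta> n * ?X x)\<^sup>2 / 2\<bar>" by (simp add: power_mult_distrib)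
      also have "\<dots> \<le> exp \<bar>\<eta> n * ?X x\<bar> * \<bar>\<eta> n * ?X x\<bar> ^ 3" by (rule exp_quadratic_bound)
      also have "\<dots> \<le> exp Y * \<bar>\<eta> n * ?X x\<bar> ^ 3" using y by (intro mult_right_mono) auto
      also have "\<dots> = exp Y * \<bar>\<eta> n\<bar> ^ 3 * (?X x) ^ 3" using X by (simp add: abs_mult power_mult_distrib)
      finally show "\<bar>?g x\<bar> \<le> exp Y * \<bar>\<eta> n\<bar> ^ 3 * (?X x) ^ 3" .
    qed
    also have "\<dots> = exp Y * (\<bar>\<eta> n\<bar> ^ 3 * m3 n)" by (simp add: m3_def)
    also have "\<dots> \<le> exp Y * norm (\<bar>\<eta> n\<bar> ^ 3 * m3 n)" by (intro mult_left_mono) auto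
    finally have b: "\<bar>q n - \<eta> n * m1 n - (\<eta> n)\<^sup>2 / 2 * m2 n\<bar> \<le> exp Y * norm (\<bar>\<eta> n\<bar> ^ 3 * m3 n)" .
    have "\<bar>\<eta> n * m1 n + (\<eta> n)\<^sup>2 * m2 n / 2 - q n\<bar> = \<bar>q n - \<eta> n * m1 n - (\<eta> n)\<^sup>2 / 2 * m2 n\<bar>"
      by (subst abs_minus_cancel[symmetric]) (rule arg_cong[where f=abs], simp)
    with b show ?case by (simp only: real_norm_def)
  qed
  have "(\<lambda>n. \<eta> n * m1 n + (\<eta> n)\<^sup>2 * m2 n / 2 - q n) \<in> O(\<lambda>n. \<bar>\<eta> n\<bar> ^ 3 * m3 n)"
    by (rule bigoI[OF bound])
  also have "(\<lambda>n. \<bar>\<eta> n\<bar> ^ 3 * m3 n) \<in> o(\<lambda>n. r n * \<rho> n)"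
  proof -
    have rm3: "(\<lambda>n. r n * m3 n) \<in> o(\<lambda>_. 1)" by (rule smalloI_tendsto) (use rm3_tendsto in auto)
    have "(\<lambda>n. \<bar>\<eta> n\<bar> / r n) \<in> O(\<lambda>_. 1)"
    proof (rule bigoI[where c=Y])
      show "\<forall>\<^sub>F n in sequentially. norm (\<bar>\<eta> n\<bar> / r n) \<le> Y * norm (1 :: real)"
        using Y(2) by eventually_elim (simp add: pos_divide_le_eq r_pos abs_of_pos[OF r_pos])
    qed
    moreover have "(\<lambda>n. \<bar>\<eta> n\<bar>) \<in> O(r)" "(\<lambda>n. \<bar>\<eta> n\<bar>) \<in> O(\<rho>)" using er root_bigo by simp_all
    ultimately have "(\<lambda>n. (\<bar>\<eta> n\<bar> * \<bar>\<eta> n\<bar>) * (\<bar>\<eta> n\<bar> / r n) * (r n * m3 n)) \<in> o(\<lambda>n. (r n * \<rho> n) * 1 * 1)"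
      by (intro landau_o.big_small_mult[OF landau_o.big.mult[OF landau_o.big.mult]] rm3)
    moreover have "(\<bar>\<eta> n\<bar> * \<bar>\<eta> n\<bar>) * (\<bar>\<eta> n\<bar> / r n) * (r n * m3 n) = \<bar>\<eta> n\<bar> ^ 3 * m3 n" for n
      using r_pos[of n] by (simp add: power3_eq_cube)
    ultimately show ?thesis by simp
  qed
  finally show ?thesis .
qed

text \<open>Solve the quadratic equation by inserting q / m1 for the root in the square. The linear
  coefficient remains the prelimit rate: its distance from \<open>lam\<close> has no known speed and
  would cost o(\<rho>) only, whereas passing from the truncated to the true mean costs o(r) per unit
  of q.\<close>

lemma root_expansion:
  "(\<lambda>n. \<eta> n - (law_rate (\<nu> n) * q n - (lam / 2 + lam ^ 3 * sig\<^sup>2 / 2) * (q n)\<^sup>2)) \<in> o(\<lambda>n. r n * \<rho> n)"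
proof -
  let ?s = "o(\<lambda>n. r n * \<rho> n)"
  have one: "f \<in> O(\<lambda>_. 1)" if "f \<longlonglongrightarrow> l" for f :: "nat \<Rightarrow> real" and l
    by (rule bigoI_tendsto[where c=l]) (use that in auto)
  have zero: "f \<in> o(\<lambda>_. 1)" if "f \<longlonglongrightarrow> 0" for f :: "nat \<Rightarrow> real"
    by (rule smalloI_tendsto) (use that in auto)
  have mn: "m1 n \<noteq> 0" "mean n \<noteq> 0" for n using m1_pos[of n] mean_pos[of n] by auto
  have im1: "(\<lambda>n. 1 / m1 n) \<longlonglongrightarrow> lam"
    using tendsto_divide[OF tendsto_const m1_tendsto, of 1] lam by simp
  have m2l: "m2 \<longlonglongrightarrow> sig\<^sup>2 + (1 / lam)\<^sup>2"
    using tendsto_add[OF m2_tendsto tendsto_power[OF m1_tendsto, of 2]] by simp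
  define D where "D n = \<eta> n * m1 n + (\<eta> n)\<^sup>2 * m2 n / 2 - q n" for n
  have D: "D \<in> ?s" unfolding D_def by (rule root_quadratic)
  have eta: "\<eta> \<in> O(\<rho>)" by (rule root_bigo)
  have e2: "(\<lambda>n. (\<eta> n)\<^sup>2) \<in> O(\<lambda>n. \<rho> n * \<rho> n)" unfolding power2_eq_square by (intro landau_o.big.mult eta)
  have q2: "(\<lambda>n. (q n)\<^sup>2) \<in> O(\<lambda>n. \<rho> n * \<rho> n)" unfolding power2_eq_square by (intro landau_o.big.mult q)
  define F where "F n = \<eta> n * m1 n - q n" for n
  have em: "(\<lambda>n. \<eta> n * m1 n) \<in> O(\<rho>)" using landau_o.big.mult[OF eta one[OF m1_tendsto]] by simp
  text \<open>\<open>F = D - \<eta>\<^sup>2 m\<^sub>2 / 2\<close> is only known to be \<open>O(r \<rho>)\<close>, which suffices after multiplication by a \<open>O(\<rho>)\<close> term.\<close>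
  have F: "F \<in> O(\<lambda>n. r n * \<rho> n)"
  proof -
    have "(\<lambda>n. (\<eta> n)\<^sup>2 * (m2 n / 2)) \<in> O(\<lambda>n. \<rho> n * \<rho> n * 1)"
      by (rule landau_o.big.mult[OF e2 one[OF tendsto_divide[OF m2l tendsto_const]]]) simp
    then have "(\<lambda>n. (\<eta> n)\<^sup>2 * (m2 n / 2)) \<in> O(\<lambda>n. r n * \<rho> n)" using \<rho>2 by (simp add: landau_o.big_trans)
    from sum_in_bigo(2)[OF landau_o.small_imp_big[OF D] this] show ?thesis
      by (simp add: D_def F_def[abs_def])
  qed
  have G: "(\<lambda>n. F n * (\<eta> n * m1 n + q n)) \<in> ?s"
  proof -
    have "(\<lambda>n. \<eta> n * m1 n + q n) \<in> O(\<rho>)" by (rule sum_in_bigo(1)[OF em q])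
    moreover have "\<rho> \<in> o(\<lambda>_. 1)" by (rule zero[OF \<rho>_lim])
    ultimately have "(\<lambda>n. \<eta> n * m1 n + q n) \<in> o(\<lambda>_. 1)" by (rule landau_o.big_small_trans)
    from landau_o.big_small_mult[OF F this] show ?thesis by simp
  qed
  \<comment> \<open>The coefficient m2 / (2 m1^3) of q^2 after the substitution; its limit gives the
    constant of the expansion.\<close>
  define w where "w n = (m2 n / (2 * (m1 n)\<^sup>2)) * (1 / m1 n)" for n
  have wl: "w \<longlonglongrightarrow> (sig\<^sup>2 + (1 / lam)\<^sup>2) / (2 * (1 / lam)\<^sup>2) * lam"
    unfolding w_def[abs_def] using lam by (intro tendsto_mult tendsto_divide m2l tendsto_power m1_tendsto im1 tendsto_const) auto
  also have "(sig\<^sup>2 + (1 / lam)\<^sup>2) / (2 * (1 / lam)\<^sup>2) * lam = lam / 2 + lam ^ 3 * sig\<^sup>2 / 2"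
    using lam by (simp add: power2_eq_square power3_eq_cube field_simps)
  finally have wl: "w \<longlonglongrightarrow> lam / 2 + lam ^ 3 * sig\<^sup>2 / 2" .
  have t1: "(\<lambda>n. D n * (1 / m1 n)) \<in> ?s"
    using landau_o.small_big_mult[OF D one[OF im1]] by simp
  have t2: "(\<lambda>n. F n * (\<eta> n * m1 n + q n) * w n) \<in> ?s"
    using landau_o.small_big_mult[OF G one[OF wl]] by simp
  have t3: "(\<lambda>n. (q n)\<^sup>2 * (w n - (lam / 2 + lam ^ 3 * sig\<^sup>2 / 2))) \<in> ?s"
  proof -
    have "(\<lambda>n. w n - (lam / 2 + lam ^ 3 * sig\<^sup>2 / 2)) \<in> o(\<lambda>_. 1)" using wl by (intro zero) (simp add: LIM_zero)
    from landau_o.big_small_mult[OF landau_o.big_trans[OF q2 \<rho>2] this] show ?thesis by simp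
  qed
  have t4: "(\<lambda>n. q n * (mean n - m1 n) * (1 / (m1 n * mean n))) \<in> ?s"
  proof -
    have "(\<lambda>n. 1 / (m1 n * mean n)) \<longlonglongrightarrow> 1 / (1 / lam * (1 / lam))"
      using lam by (intro tendsto_divide tendsto_const tendsto_mult m1_tendsto mean_tendsto) auto
    then have "(\<lambda>n. q n * (mean n - m1 n) * (1 / (m1 n * mean n))) \<in> o(\<lambda>n. \<rho> n * r n * 1)"
      by (intro landau_o.small_big_mult landau_o.big_small_mult q mean_m1_smallo one)
    then show ?thesis by (simp add: mult.commute)
  qed
  \<comment> \<open>The four terms are: the cubic remainder, the replacement of (\<eta> m1)^2 by
    q^2, the limit of the quadratic coefficient, and the truncation of the mean.\<close>
  have "\<eta> n - (law_rate (\<nu> n) * q n - (lam / 2 + lam ^ 3 * sig\<^sup>2 / 2) * (q n)\<^sup>2)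
    = D n * (1 / m1 n) - F n * (\<eta> n * m1 n + q n) * w n - (q n)\<^sup>2 * (w n - (lam / 2 + lam ^ 3 * sig\<^sup>2 / 2))
      + q n * (mean n - m1 n) * (1 / (m1 n * mean n))" for n
  proof -
    define c where "c = lam / 2 + lam ^ 3 * sig\<^sup>2 / 2"
    have 1: "F n * (\<eta> n * m1 n + q n) * w n = (\<eta> n)\<^sup>2 * m2 n / 2 * (1 / m1 n) - (q n)\<^sup>2 * w n"
      using mn[of n] by (simp add: F_def w_def power2_eq_square field_simps)
    have 2: "D n * (1 / m1 n) = \<eta> n + (\<eta> n)\<^sup>2 * m2 n / 2 * (1 / m1 n) - q n / m1 n"
      using mn[of n] by (simp add: D_def field_simps)
    have 3: "q n * (mean n - m1 n) * (1 / (m1 n * mean n)) = q n / m1 n - q n / mean n"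
      using mn[of n] by (simp add: field_simps)
    show ?thesis unfolding 1 2 3 c_def[symmetric] by (simp add: law_rate_def mean_def algebra_simps)
  qed
  then show ?thesis using sum_in_smallo(1)[OF sum_in_smallo(2)[OF sum_in_smallo(2)[OF t1 t2] t3] t4] by simp
qed

end

end

section \<open>The adjoint relation at the roots\<close>

lemma abs_exp_minus_1_le: "\<bar>exp y - 1\<bar> \<le> \<bar>y\<bar> * exp \<bar>y :: real\<bar>"
proof -
  obtain t where t: "\<bar>t\<bar> \<le> \<bar>y\<bar>" "exp y = (\<Sum>m<1. y ^ m / fact m) + exp t / fact 1 * y ^ 1"
    using Maclaurin_exp_le[of y 1] by blast
  then have "\<bar>exp y - 1\<bar> = \<bar>y\<bar> * exp t" by (simp add: abs_mult mult.commute)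
  also have "\<dots> \<le> \<bar>y\<bar> * exp \<bar>y\<bar>" using t(1) by (intro mult_left_mono) auto
  finally show ?thesis .
qed

definition queue_exp :: "real^'d \<Rightarrow> 'd::finite state \<Rightarrow> real" where
  "queue_exp \<tau> x = exp (\<Sum>k\<in>UNIV. \<tau> $ k * real (fst x $ k))"

definition root_fun :: "'d::finite set \<Rightarrow> real^'d \<Rightarrow> real \<Rightarrow> ('d \<Rightarrow> real) \<Rightarrow> ('d \<Rightarrow> real) \<Rightarrow> 'd state \<Rightarrow> real" where
  "root_fun E \<tau> c \<eta> \<zeta> = test_fun E \<tau> (\<lambda>i v. \<eta> i * cutoff c v) (\<lambda>j v. \<zeta> j * cutoff c v)"

lemma queue_exp_bound: "(\<And>k. \<tau> $ k \<le> 0) \<Longrightarrow> \<bar>queue_exp \<tau> x\<bar> \<le> 1"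
  unfolding queue_exp_def by (auto intro!: sum_nonpos mult_nonpos_nonneg)

context jackson
begin

context
  fixes \<pi> :: "'d state measure" and c A :: real and \<tau> :: "real^'d" and \<eta> \<zeta> :: "'d \<Rightarrow> real"
  assumes st: "stationary E P Te Ts \<pi>" and c: "0 < c" and \<tau>: "\<And>k. \<tau> $ k \<le> 0"
    and A: "\<And>i. \<bar>\<eta> i\<bar> \<le> A" "\<And>j. \<bar>\<zeta> j\<bar> \<le> A"
begin

lemma A_nonneg: "0 \<le> A"
  using A(1)[of undefined] by simp

lemma root_term_bound: "\<bar>\<eta> i * cutoff c v\<bar> \<le> A * c" "\<bar>\<zeta> i * cutoff c v\<bar> \<le> A * c"
  unfolding abs_mult using A A_nonneg c cutoff_bounds[of c v] by (auto intro!: mult_mono)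

lemma root_fun_bound: "\<bar>root_fun E \<tau> c \<eta> \<zeta> x\<bar> \<le> exp (2 * (real CARD('d) * (A * c)))"
  unfolding root_fun_def by (rule test_fun_bound) (auto intro: \<tau> root_term_bound)

lemma prob_\<pi>: "prob_space \<pi>" and sets_\<pi>: "sets \<pi> = sets state_algebra"
  using stationary_facts[OF st] by auto

lemma id_\<pi>: "(\<lambda>x. x) \<in> \<pi> \<rightarrow>\<^sub>M state_algebra"
  using measurable_ident_sets[OF sets_\<pi>] by simp

lemma root_fun_measurable: "root_fun E \<tau> c \<eta> \<zeta> \<in> borel_measurable \<pi>"
proof -
  have "root_fun E \<tau> c \<eta> \<zeta> \<in> borel_measurable state_algebra" unfolding root_fun_def by (rule measurable_test_fun; measurable)
  then show ?thesis by (simp add: measurable_cong_sets[OF sets_\<pi> refl])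
qed

lemma queue_exp_measurable: "queue_exp \<tau> \<in> borel_measurable \<pi>"
proof -
  note [measurable] = measurable_state_queue[OF id_\<pi>]
  show ?thesis unfolding queue_exp_def[abs_def] by measurable
qed

lemma integrable_\<pi>:
  assumes "f \<in> borel_measurable \<pi>" "\<And>x. \<bar>f x\<bar> \<le> (B::real)"
  shows "integrable \<pi> f"
  by (rule integrable_bounded[OF prob_\<pi> assms])

text \<open>Truncated clocks are constant from level c on, so the drift lacks the roots of running
  clocks that stand at c or above; these make up the error. It also lacks the roots of frozen
  service clocks; these make up the boundary terms.\<close>

lemma adjoint_roots:
  assumes re: "\<And>i. i \<in> E \<Longrightarrow> exp (\<tau> $ i) * (\<integral>x. exp (\<eta> i * cutoff c x) \<partial>Te i) = 1"
    and rs: "\<And>j. t_fun P j \<tau> * (\<integral>x. exp (\<zeta> j * cutoff c x) \<partial>Ts j) = 1"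
  shows "\<bar>((\<Sum>i\<in>E. \<eta> i) + (\<Sum>j\<in>UNIV. \<zeta> j)) * (\<integral>x. root_fun E \<tau> c \<eta> \<zeta> x \<partial>\<pi>) - (\<Sum>j\<in>UNIV. \<zeta> j * (\<integral>x. root_fun E \<tau> c \<eta> \<zeta> x * of_bool (fst x $ j = 0) \<partial>\<pi>))\<bar>
    \<le> A * exp (2 * (real CARD('d) * (A * c))) * ((\<Sum>i\<in>E. \<integral>x. of_bool (c \<le> fst (snd x) $ i) \<partial>\<pi>) + (\<Sum>j\<in>UNIV. \<integral>x. of_bool (0 < fst x $ j \<and> c \<le> snd (snd x) $ j) \<partial>\<pi>))"
proof -
  note [measurable] = measurable_state_service[OF id_\<pi>] measurable_state_queue[OF id_\<pi>] measurable_state_arrival[OF id_\<pi>] root_fun_measurable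
  define te where "te i x = \<eta> i * (root_fun E \<tau> c \<eta> \<zeta> x * of_bool (c \<le> fst (snd x) $ i))" for i and x :: "'d state"
  define ts where "ts j x = \<zeta> j * (root_fun E \<tau> c \<eta> \<zeta> x * of_bool (0 < fst x $ j \<and> c \<le> snd (snd x) $ j))" for j and x :: "'d state"
  define ti where "ti j x = \<zeta> j * (root_fun E \<tau> c \<eta> \<zeta> x * of_bool (fst x $ j = 0))" for j and x :: "'d state"
  have fb: "\<bar>root_fun E \<tau> c \<eta> \<zeta> x * of_bool b\<bar> \<le> exp (2 * (real CARD('d) * (A * c)))" for x b using root_fun_bound[of x] by (cases b) auto
  have cf: "clock_fun (\<lambda>v. h * cutoff c v) (\<lambda>v. indicator {0..<c} v * h)" for h :: real
    by (rule clock_fun_cutoff[OF c, where F="{}" and g="\<lambda>w. h * w"]) (auto intro!: continuous_intros derivative_eq_intros)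
  have "(\<integral>x. root_fun E \<tau> c \<eta> \<zeta> x * clock_drift E (\<lambda>i v. indicator {0..<c} v * \<eta> i) (\<lambda>j v. indicator {0..<c} v * \<zeta> j) x \<partial>\<pi>) = 0"
    unfolding root_fun_def by (rule exponential_adjoint_relation[OF st \<tau> cf cf]) (use re rs c in auto)
  also have "(\<integral>x. root_fun E \<tau> c \<eta> \<zeta> x * clock_drift E (\<lambda>i v. indicator {0..<c} v * \<eta> i) (\<lambda>j v. indicator {0..<c} v * \<zeta> j) x \<partial>\<pi>)
     = (\<integral>x. ((\<Sum>i\<in>E. \<eta> i) + (\<Sum>j\<in>UNIV. \<zeta> j)) * root_fun E \<tau> c \<eta> \<zeta> x - (\<Sum>j\<in>UNIV. ti j x) - ((\<Sum>i\<in>E. te i x) + (\<Sum>j\<in>UNIV. ts j x)) \<partial>\<pi>)"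
  proof (rule integral_cong_AE)
    have "clock_drift E (\<lambda>i v. indicator {0..<c} v * \<eta> i) (\<lambda>j v. indicator {0..<c} v * \<zeta> j) \<in> borel_measurable state_algebra"
      by (rule measurable_clock_drift; measurable)
    then have [measurable]: "clock_drift E (\<lambda>i v. indicator {0..<c} v * \<eta> i) (\<lambda>j v. indicator {0..<c} v * \<zeta> j) \<in> borel_measurable \<pi>"
      by (simp add: measurable_cong_sets[OF sets_\<pi> refl])
    show "(\<lambda>x. root_fun E \<tau> c \<eta> \<zeta> x * clock_drift E (\<lambda>i v. indicator {0..<c} v * \<eta> i) (\<lambda>j v. indicator {0..<c} v * \<zeta> j) x) \<in> borel_measurable \<pi>"
      by measurable
    show "(\<lambda>x. ((\<Sum>i\<in>E. \<eta> i) + (\<Sum>j\<in>UNIV. \<zeta> j)) * root_fun E \<tau> c \<eta> \<zeta> x - (\<Sum>j\<in>UNIV. ti j x) - ((\<Sum>i\<in>E. te i x) + (\<Sum>j\<in>UNIV. ts j x))) \<in> borel_measurable \<pi>"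
      unfolding te_def ts_def ti_def by measurable
    show "AE x in \<pi>. root_fun E \<tau> c \<eta> \<zeta> x * clock_drift E (\<lambda>i v. indicator {0..<c} v * \<eta> i) (\<lambda>j v. indicator {0..<c} v * \<zeta> j) x
      = ((\<Sum>i\<in>E. \<eta> i) + (\<Sum>j\<in>UNIV. \<zeta> j)) * root_fun E \<tau> c \<eta> \<zeta> x - (\<Sum>j\<in>UNIV. ti j x) - ((\<Sum>i\<in>E. te i x) + (\<Sum>j\<in>UNIV. ts j x))"
      using stationary_nonneg[OF st]
    proof eventually_elim
      case (elim x)
      have 1: "(\<Sum>i\<in>E. indicator {0..<c} (fst (snd x) $ i) * \<eta> i) = (\<Sum>i\<in>E. \<eta> i) - (\<Sum>i\<in>E. \<eta> i * of_bool (c \<le> fst (snd x) $ i))"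
        unfolding sum_subtractf[symmetric] by (rule sum.cong) (use elim in \<open>auto simp: indicator_def\<close>)
      have 2: "(\<Sum>j\<in>UNIV. if 0 < fst x $ j then indicator {0..<c} (snd (snd x) $ j) * \<zeta> j else 0)
        = (\<Sum>j\<in>UNIV. \<zeta> j) - (\<Sum>j\<in>UNIV. \<zeta> j * of_bool (fst x $ j = 0)) - (\<Sum>j\<in>UNIV. \<zeta> j * of_bool (0 < fst x $ j \<and> c \<le> snd (snd x) $ j))"
        unfolding sum_subtractf[symmetric] by (rule sum.cong) (use elim in \<open>auto simp: indicator_def\<close>)
      have 3: "(\<Sum>i\<in>X. h i * (root_fun E \<tau> c \<eta> \<zeta> x * g i)) = root_fun E \<tau> c \<eta> \<zeta> x * (\<Sum>i\<in>X. h i * g i)" for h g and X :: "'d set"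
        by (simp add: sum_distrib_left mult.left_commute)
      show ?case unfolding clock_drift_def 1 2 te_def ts_def ti_def 3 by (simp add: algebra_simps)
    qed
  qed
  also have "\<dots> = ((\<Sum>i\<in>E. \<eta> i) + (\<Sum>j\<in>UNIV. \<zeta> j)) * (\<integral>x. root_fun E \<tau> c \<eta> \<zeta> x \<partial>\<pi>) - (\<Sum>j\<in>UNIV. \<integral>x. ti j x \<partial>\<pi>) - ((\<Sum>i\<in>E. \<integral>x. te i x \<partial>\<pi>) + (\<Sum>j\<in>UNIV. \<integral>x. ts j x \<partial>\<pi>))"
  proof -
    have i0: "integrable \<pi> (\<lambda>x. ((\<Sum>i\<in>E. \<eta> i) + (\<Sum>j\<in>UNIV. \<zeta> j)) * root_fun E \<tau> c \<eta> \<zeta> x)"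
      by (intro integrable_mult_right integrable_\<pi>[OF _ root_fun_bound]) measurable
    have i1: "integrable \<pi> (te i)" "integrable \<pi> (ts i)" "integrable \<pi> (ti i)" for i
      unfolding te_def[abs_def] ts_def[abs_def] ti_def[abs_def]
      by (intro integrable_mult_right integrable_\<pi>[OF _ fb]; measurable)+
    show ?thesis
      using i0 i1 by (simp add: Bochner_Integration.integral_diff Bochner_Integration.integral_add Bochner_Integration.integral_sum)
  qed
  finally have eq: "((\<Sum>i\<in>E. \<eta> i) + (\<Sum>j\<in>UNIV. \<zeta> j)) * (\<integral>x. root_fun E \<tau> c \<eta> \<zeta> x \<partial>\<pi>) - (\<Sum>j\<in>UNIV. \<integral>x. ti j x \<partial>\<pi>)
      = (\<Sum>i\<in>E. \<integral>x. te i x \<partial>\<pi>) + (\<Sum>j\<in>UNIV. \<integral>x. ts j x \<partial>\<pi>)" by simp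
  have le: "\<bar>\<integral>x. h * (root_fun E \<tau> c \<eta> \<zeta> x * of_bool (B x)) \<partial>\<pi>\<bar> \<le> A * exp (2 * (real CARD('d) * (A * c))) * (\<integral>x. of_bool (B x) \<partial>\<pi>)"
    if h: "\<bar>h\<bar> \<le> A" and [measurable]: "Measurable.pred \<pi> B" for h B
  proof -
    have "\<bar>\<integral>x. root_fun E \<tau> c \<eta> \<zeta> x * of_bool (B x) \<partial>\<pi>\<bar> \<le> (\<integral>x. \<bar>root_fun E \<tau> c \<eta> \<zeta> x * of_bool (B x)\<bar> \<partial>\<pi>)" by (rule integral_abs_bound)
    also have "\<dots> \<le> (\<integral>x. exp (2 * (real CARD('d) * (A * c))) * of_bool (B x) \<partial>\<pi>)"
    proof (rule integral_mono)
      show "integrable \<pi> (\<lambda>x. \<bar>root_fun E \<tau> c \<eta> \<zeta> x * of_bool (B x)\<bar>)"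
        by (intro integrable_abs integrable_\<pi>[OF _ fb]) measurable
      show "integrable \<pi> (\<lambda>x. exp (2 * (real CARD('d) * (A * c))) * of_bool (B x))"
        by (intro integrable_mult_right integrable_\<pi>[where B=1]) auto
      show "\<bar>root_fun E \<tau> c \<eta> \<zeta> x * of_bool (B x)\<bar> \<le> exp (2 * (real CARD('d) * (A * c))) * of_bool (B x)" for x using root_fun_bound[of x] by auto
    qed
    finally have "\<bar>\<integral>x. root_fun E \<tau> c \<eta> \<zeta> x * of_bool (B x) \<partial>\<pi>\<bar> \<le> exp (2 * (real CARD('d) * (A * c))) * (\<integral>x. of_bool (B x) \<partial>\<pi>)" by simp
    then have "\<bar>h\<bar> * \<bar>\<integral>x. root_fun E \<tau> c \<eta> \<zeta> x * of_bool (B x) \<partial>\<pi>\<bar> \<le> A * (exp (2 * (real CARD('d) * (A * c))) * (\<integral>x. of_bool (B x) \<partial>\<pi>))"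
      using h A_nonneg by (intro mult_mono) auto
    then show ?thesis by (simp add: abs_mult mult.assoc)
  qed
  have "\<bar>(\<Sum>i\<in>E. \<integral>x. te i x \<partial>\<pi>) + (\<Sum>j\<in>UNIV. \<integral>x. ts j x \<partial>\<pi>)\<bar>
     \<le> (\<Sum>i\<in>E. \<bar>\<integral>x. te i x \<partial>\<pi>\<bar>) + (\<Sum>j\<in>UNIV. \<bar>\<integral>x. ts j x \<partial>\<pi>\<bar>)"
    by (intro order_trans[OF abs_triangle_ineq] add_mono sum_abs)
  also have "\<dots> \<le> (\<Sum>i\<in>E. A * exp (2 * (real CARD('d) * (A * c))) * (\<integral>x. of_bool (c \<le> fst (snd x) $ i) \<partial>\<pi>)) + (\<Sum>j\<in>UNIV. A * exp (2 * (real CARD('d) * (A * c))) * (\<integral>x. of_bool (0 < fst x $ j \<and> c \<le> snd (snd x) $ j) \<partial>\<pi>))"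
    unfolding te_def ts_def by (intro add_mono sum_mono le A) measurable
  finally show ?thesis using eq by (simp add: ti_def sum_distrib_left distrib_left)
qed

text \<open>The quotient of the two functions is exp y with |y| at most A times the sum of the
  truncated clocks. Then |exp y - 1| is at most |y| exp |y|, where the exponential is bounded since
  every clock is at most c.\<close>

lemma root_fun_near_queue_exp:
  assumes w[measurable]: "Measurable.pred \<pi> W"
  shows "\<bar>(\<integral>x. root_fun E \<tau> c \<eta> \<zeta> x * of_bool (W x) \<partial>\<pi>) - (\<integral>x. queue_exp \<tau> x * of_bool (W x) \<partial>\<pi>)\<bar>
    \<le> A * exp (2 * (real CARD('d) * (A * c))) * ((\<Sum>i\<in>E. \<integral>x. cutoff c (fst (snd x) $ i) * of_bool (W x) \<partial>\<pi>) + (\<Sum>j\<in>UNIV. \<integral>x. cutoff c (snd (snd x) $ j) * of_bool (W x) \<partial>\<pi>))"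
proof -
  note [measurable] = measurable_state_service[OF id_\<pi>] measurable_state_arrival[OF id_\<pi>] root_fun_measurable queue_exp_measurable
  have b1: "\<bar>root_fun E \<tau> c \<eta> \<zeta> x * of_bool b\<bar> \<le> exp (2 * (real CARD('d) * (A * c)))" for x b using root_fun_bound[of x] by (cases b) auto
  have b2: "\<bar>queue_exp \<tau> x * of_bool b\<bar> \<le> 1" for x b using queue_exp_bound[OF \<tau>, of x] by (cases b) auto
  have b3: "\<bar>cutoff c v * of_bool b\<bar> \<le> c" for v b using cutoff_bounds[of c v] c by auto
  have i1: "integrable \<pi> (\<lambda>x. root_fun E \<tau> c \<eta> \<zeta> x * of_bool (W x))" by (rule integrable_\<pi>[OF _ b1]) measurable
  have i2: "integrable \<pi> (\<lambda>x. queue_exp \<tau> x * of_bool (W x))" by (rule integrable_\<pi>[OF _ b2]) measurable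
  have i3: "integrable \<pi> (\<lambda>x. cutoff c (fst (snd x) $ i) * of_bool (W x))" "integrable \<pi> (\<lambda>x. cutoff c (snd (snd x) $ i) * of_bool (W x))" for i
    by (rule integrable_\<pi>[OF _ b3]; measurable)+
  have d: "\<bar>root_fun E \<tau> c \<eta> \<zeta> x * of_bool (W x) - queue_exp \<tau> x * of_bool (W x)\<bar>
     \<le> A * exp (2 * (real CARD('d) * (A * c))) * ((\<Sum>i\<in>E. cutoff c (fst (snd x) $ i) * of_bool (W x)) + (\<Sum>j\<in>UNIV. cutoff c (snd (snd x) $ j) * of_bool (W x)))" for x
  proof (cases "W x")
    case True
    define y where "y = (\<Sum>i\<in>E. \<eta> i * cutoff c (fst (snd x) $ i)) + (\<Sum>j\<in>UNIV. \<zeta> j * cutoff c (snd (snd x) $ j))"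
    define s where "s = (\<Sum>i\<in>E. cutoff c (fst (snd x) $ i)) + (\<Sum>j\<in>UNIV. cutoff c (snd (snd x) $ j))"
    have t: "\<bar>h * cutoff c v\<bar> \<le> A * cutoff c v" if "\<bar>h\<bar> \<le> A" for h v
      unfolding abs_mult using that c cutoff_bounds(1)[of c v] by (auto intro!: mult_right_mono)
    have ys: "\<bar>y\<bar> \<le> A * s" unfolding y_def s_def distrib_left sum_distrib_left
      by (intro order_trans[OF abs_triangle_ineq] add_mono order_trans[OF sum_abs] sum_mono t A)
    have s0: "0 \<le> s" unfolding s_def using c by (intro add_nonneg_nonneg sum_nonneg cutoff_bounds) auto
    have "s \<le> (\<Sum>i\<in>E. c) + (\<Sum>j\<in>(UNIV::'d set). c)"
      unfolding s_def using c by (intro add_mono sum_mono cutoff_bounds) auto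
    also have "(\<Sum>i\<in>E. c) \<le> real CARD('d) * c" using c by (simp add: card_mono mult_right_mono)
    finally have "s \<le> 2 * (real CARD('d) * c)" by (simp add: mult.commute)
    then have "A * s \<le> A * (2 * (real CARD('d) * c))" by (rule mult_left_mono[OF _ A_nonneg])
    also have "\<dots> = 2 * (real CARD('d) * (A * c))" by (simp only: mult_ac)
    finally have "\<bar>y\<bar> \<le> 2 * (real CARD('d) * (A * c))" using ys by linarith
    then have yk: "exp \<bar>y\<bar> \<le> exp (2 * (real CARD('d) * (A * c)))" by (simp only: exp_le_cancel_iff)
    have "root_fun E \<tau> c \<eta> \<zeta> x = queue_exp \<tau> x * exp y" by (simp add: root_fun_def test_fun_def queue_exp_def y_def exp_add add.assoc)
    then have "\<bar>root_fun E \<tau> c \<eta> \<zeta> x - queue_exp \<tau> x\<bar> = \<bar>queue_exp \<tau> x\<bar> * \<bar>exp y - 1\<bar>"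
      by (simp add: abs_mult[symmetric] right_diff_distrib)
    also have "\<dots> \<le> 1 * (\<bar>y\<bar> * exp \<bar>y\<bar>)"
      using queue_exp_bound[OF \<tau>, of x] abs_exp_minus_1_le[of y] by (intro mult_mono) auto
    also have "\<dots> \<le> 1 * ((A * s) * exp (2 * (real CARD('d) * (A * c))))" using ys yk s0 A_nonneg by (intro mult_mono mult_nonneg_nonneg) auto
    finally show ?thesis using True by (simp add: s_def mult.commute mult.left_commute)
  qed simp
  have i4: "integrable \<pi> (\<lambda>x. A * exp (2 * (real CARD('d) * (A * c))) * ((\<Sum>i\<in>E. cutoff c (fst (snd x) $ i) * of_bool (W x)) + (\<Sum>j\<in>UNIV. cutoff c (snd (snd x) $ j) * of_bool (W x))))"
    by (intro integrable_mult_right Bochner_Integration.integrable_add Bochner_Integration.integrable_sum i3)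
  have "\<bar>(\<integral>x. root_fun E \<tau> c \<eta> \<zeta> x * of_bool (W x) \<partial>\<pi>) - (\<integral>x. queue_exp \<tau> x * of_bool (W x) \<partial>\<pi>)\<bar>
     = \<bar>\<integral>x. root_fun E \<tau> c \<eta> \<zeta> x * of_bool (W x) - queue_exp \<tau> x * of_bool (W x) \<partial>\<pi>\<bar>"
    by (simp only: Bochner_Integration.integral_diff[OF i1 i2])
  also have "\<dots> \<le> (\<integral>x. \<bar>root_fun E \<tau> c \<eta> \<zeta> x * of_bool (W x) - queue_exp \<tau> x * of_bool (W x)\<bar> \<partial>\<pi>)" by (rule integral_abs_bound)
  also have "\<dots> \<le> (\<integral>x. A * exp (2 * (real CARD('d) * (A * c))) * ((\<Sum>i\<in>E. cutoff c (fst (snd x) $ i) * of_bool (W x)) + (\<Sum>j\<in>UNIV. cutoff c (snd (snd x) $ j) * of_bool (W x))) \<partial>\<pi>)"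
    by (rule integral_mono[OF _ i4 d]) (intro integrable_abs Bochner_Integration.integrable_diff i1 i2)
  also have "\<dots> = A * exp (2 * (real CARD('d) * (A * c))) * ((\<Sum>i\<in>E. \<integral>x. cutoff c (fst (snd x) $ i) * of_bool (W x) \<partial>\<pi>) + (\<Sum>j\<in>UNIV. \<integral>x. cutoff c (snd (snd x) $ j) * of_bool (W x) \<partial>\<pi>))"
    unfolding integral_mult_right_zero
      Bochner_Integration.integral_add[OF Bochner_Integration.integrable_sum[OF i3(1)] Bochner_Integration.integrable_sum[OF i3(2)]]
      Bochner_Integration.integral_sum[OF i3(1)] Bochner_Integration.integral_sum[OF i3(2)] ..
  finally show ?thesis .
qed

text \<open>On this event the excess over c / 2 is at least c / 2, which explains the factor
  \<open>2 / c\<close>. With c = 1 / r the tail probability becomes o(r).\<close>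

lemma arrival_tail:
  assumes i: "i \<in> E"
  shows "(\<integral>x. of_bool (c \<le> fst (snd x) $ i) \<partial>\<pi>) \<le> 2 / c * ((\<integral>x. x\<^sup>2 * of_bool (c / 2 \<le> x) \<partial>Te i) * law_rate (Te i))"
proof -
  note [measurable] = measurable_state_arrival[OF id_\<pi>]
  have "(\<integral>x. of_bool (c \<le> fst (snd x) $ i) \<partial>\<pi>) \<le> (\<integral>x. 2 / c * max 0 (fst (snd x) $ i - c / 2) \<partial>\<pi>)"
  proof (rule integral_mono)
    show "integrable \<pi> (\<lambda>x. of_bool (c \<le> fst (snd x) $ i) :: real)" by (rule integrable_\<pi>[where B=1]) auto
    show "integrable \<pi> (\<lambda>x. 2 / c * max 0 (fst (snd x) $ i - c / 2))"
      using c by (intro integrable_mult_right arrival_excess(1)[OF st i]) simp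
    show "of_bool (c \<le> fst (snd x) $ i) \<le> 2 / c * max 0 (fst (snd x) $ i - c / 2)" for x
      using c by (auto simp: field_simps)
  qed
  also have "\<dots> = 2 / c * (\<integral>x. max 0 (fst (snd x) $ i - c / 2) \<partial>\<pi>)" by (rule integral_mult_right_zero)
  also have "\<dots> \<le> 2 / c * ((\<integral>x. x\<^sup>2 * of_bool (c / 2 \<le> x) \<partial>Te i) * law_rate (Te i))"
    using c by (intro mult_left_mono arrival_excess(2)[OF st i]) auto
  finally show ?thesis .
qed

lemma service_tail:
  "(\<integral>x. of_bool (0 < fst x $ j \<and> c \<le> snd (snd x) $ j) \<partial>\<pi>) \<le> 2 / c * ((\<integral>x. x\<^sup>2 * of_bool (c / 2 \<le> x) \<partial>Ts j) * law_rate (Ts j))"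
proof -
  note [measurable] = measurable_state_service[OF id_\<pi>] measurable_state_queue[OF id_\<pi>]
  have "(\<integral>x. of_bool (0 < fst x $ j \<and> c \<le> snd (snd x) $ j) \<partial>\<pi>) \<le> (\<integral>x. 2 / c * (of_bool (0 < fst x $ j) * max 0 (snd (snd x) $ j - c / 2)) \<partial>\<pi>)"
  proof (rule integral_mono)
    show "integrable \<pi> (\<lambda>x. of_bool (0 < fst x $ j \<and> c \<le> snd (snd x) $ j) :: real)" by (rule integrable_\<pi>[where B=1]) auto
    show "integrable \<pi> (\<lambda>x. 2 / c * (of_bool (0 < fst x $ j) * max 0 (snd (snd x) $ j - c / 2)))"
      using c by (intro integrable_mult_right service_excess(1)[OF st]) simp
    show "of_bool (0 < fst x $ j \<and> c \<le> snd (snd x) $ j) \<le> 2 / c * (of_bool (0 < fst x $ j) * max 0 (snd (snd x) $ j - c / 2))" for x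
      using c by (auto simp: field_simps)
  qed
  also have "\<dots> = 2 / c * (\<integral>x. of_bool (0 < fst x $ j) * max 0 (snd (snd x) $ j - c / 2) \<partial>\<pi>)" by (rule integral_mult_right_zero)
  also have "\<dots> \<le> 2 / c * ((\<integral>x. x\<^sup>2 * of_bool (c / 2 \<le> x) \<partial>Ts j) * law_rate (Ts j))"
    using c by (intro mult_left_mono service_excess(2)[OF st]) auto
  finally show ?thesis .
qed

text \<open>Splits the clock at a level k, to be chosen as 1 / sqrt r: up to k it is paid for by the
  probability of W, beyond k by the excess without regard to W.\<close>

lemma arrival_clock_mean:
  assumes i: "i \<in> E" and k: "0 \<le> k" and [measurable]: "Measurable.pred \<pi> W"
  shows "(\<integral>x. cutoff c (fst (snd x) $ i) * of_bool (W x) \<partial>\<pi>) \<le> k * (\<integral>x. of_bool (W x) \<partial>\<pi>) + (\<integral>x. x\<^sup>2 * of_bool (k \<le> x) \<partial>Te i) * law_rate (Te i)"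
proof -
  note [measurable] = measurable_state_arrival[OF id_\<pi>]
  have iw: "integrable \<pi> (\<lambda>x. of_bool (W x) :: real)" by (rule integrable_\<pi>[where B=1]) auto
  have "(\<integral>x. cutoff c (fst (snd x) $ i) * of_bool (W x) \<partial>\<pi>) \<le> (\<integral>x. k * of_bool (W x) + max 0 (fst (snd x) $ i - k) \<partial>\<pi>)"
  proof (rule integral_mono)
    show "integrable \<pi> (\<lambda>x. cutoff c (fst (snd x) $ i) * of_bool (W x))" by (rule integrable_\<pi>[where B=c]) (use c in \<open>auto simp: cutoff_bounds\<close>)
    show "integrable \<pi> (\<lambda>x. k * of_bool (W x) + max 0 (fst (snd x) $ i - k))"
      by (intro Bochner_Integration.integrable_add integrable_mult_right iw arrival_excess(1)[OF st i k])
    show "cutoff c (fst (snd x) $ i) * of_bool (W x) \<le> k * of_bool (W x) + max 0 (fst (snd x) $ i - k)" for x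
      using k by (auto simp: cutoff_def)
  qed
  also have "\<dots> = k * (\<integral>x. of_bool (W x) \<partial>\<pi>) + (\<integral>x. max 0 (fst (snd x) $ i - k) \<partial>\<pi>)"
    by (subst Bochner_Integration.integral_add[OF integrable_mult_right[OF iw] arrival_excess(1)[OF st i k]]) simp
  finally show ?thesis using arrival_excess(2)[OF st i k] by simp
qed

lemma service_clock_mean:
  assumes k: "0 \<le> k" and [measurable]: "Measurable.pred \<pi> W"
    and connected: "\<And>G. E \<subseteq> G \<Longrightarrow> (\<And>j k. j \<in> G \<Longrightarrow> 0 < P $ j $ k \<Longrightarrow> k \<in> G) \<Longrightarrow> G = UNIV"
  shows "(\<integral>x. cutoff c (snd (snd x) $ j) * of_bool (W x) \<partial>\<pi>) \<le> k * (\<integral>x. of_bool (W x) \<partial>\<pi>) + (\<integral>x. x\<^sup>2 * of_bool (k \<le> x) \<partial>Ts j) * law_rate (Ts j)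
     + (\<integral>x. of_bool (fst x $ j = 0) \<partial>\<pi>) * (\<integral>x. cutoff c x \<partial>Ts j)"
proof -
  note [measurable] = measurable_state_service[OF id_\<pi>] measurable_state_queue[OF id_\<pi>]
  have iw: "integrable \<pi> (\<lambda>x. of_bool (W x) :: real)" by (rule integrable_\<pi>[where B=1]) auto
  define m where "m = (\<integral>x. cutoff c x \<partial>Ts j)"
  have ic: "integrable \<pi> (\<lambda>x. of_bool (fst x $ j = 0) * cutoff c (snd (snd x) $ j))" by (rule integrable_\<pi>[where B=c]) (use c in \<open>auto simp: cutoff_bounds\<close>)
  have iz: "integrable \<pi> (\<lambda>x. of_bool (fst x $ j = 0) :: real)" by (rule integrable_\<pi>[where B=1]) auto
  have idle: "(\<integral>x. of_bool (fst x $ j = 0) * cutoff c (snd (snd x) $ j) \<partial>\<pi>) = (\<integral>x. of_bool (fst x $ j = 0) \<partial>\<pi>) * m"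
  proof -
    interpret prob_space "Ts j" by (rule Ts_prob)
    have "(\<integral>x. of_bool (fst x $ j = 0) * (cutoff c (snd (snd x) $ j) - m) \<partial>\<pi>) = 0"
    proof (rule integral_idle_service[OF st connected])
      show "(\<lambda>y. cutoff c y - m) \<in> borel_measurable borel" by measurable
      show "\<bar>cutoff c y - m\<bar> \<le> c + \<bar>m\<bar>" for y using cutoff_bounds[of c y] c by auto
      show "(\<integral>y. cutoff c y - m \<partial>Ts j) = 0"
        using cutoff_integrable[OF Ts[of j], of c] by (simp add: m_def prob_space)
    qed
    then have "(\<integral>x. of_bool (fst x $ j = 0) * cutoff c (snd (snd x) $ j) - of_bool (fst x $ j = 0) * m \<partial>\<pi>) = 0"
      by (simp only: right_diff_distrib)
    then show ?thesis by (subst (asm) Bochner_Integration.integral_diff[OF ic integrable_mult_left[OF iz]]) simp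
  qed
  have "(\<integral>x. cutoff c (snd (snd x) $ j) * of_bool (W x) \<partial>\<pi>)
      \<le> (\<integral>x. k * of_bool (W x) + of_bool (0 < fst x $ j) * max 0 (snd (snd x) $ j - k) + of_bool (fst x $ j = 0) * cutoff c (snd (snd x) $ j) \<partial>\<pi>)"
  proof (rule integral_mono)
    show "integrable \<pi> (\<lambda>x. cutoff c (snd (snd x) $ j) * of_bool (W x))" by (rule integrable_\<pi>[where B=c]) (use c in \<open>auto simp: cutoff_bounds\<close>)
    show "integrable \<pi> (\<lambda>x. k * of_bool (W x) + of_bool (0 < fst x $ j) * max 0 (snd (snd x) $ j - k) + of_bool (fst x $ j = 0) * cutoff c (snd (snd x) $ j))"
      by (intro Bochner_Integration.integrable_add integrable_mult_right iw service_excess(1)[OF st k] ic)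
    show "cutoff c (snd (snd x) $ j) * of_bool (W x) \<le> k * of_bool (W x) + of_bool (0 < fst x $ j) * max 0 (snd (snd x) $ j - k) + of_bool (fst x $ j = 0) * cutoff c (snd (snd x) $ j)" for x
      using k c by (cases "fst x $ j = 0") (auto simp: cutoff_def)
  qed
  also have "\<dots> = k * (\<integral>x. of_bool (W x) \<partial>\<pi>) + (\<integral>x. of_bool (0 < fst x $ j) * max 0 (snd (snd x) $ j - k) \<partial>\<pi>) + (\<integral>x. of_bool (fst x $ j = 0) \<partial>\<pi>) * m"
    unfolding Bochner_Integration.integral_add[OF Bochner_Integration.integrable_add[OF integrable_mult_right[OF iw] service_excess(1)[OF st k]] ic]
      Bochner_Integration.integral_add[OF integrable_mult_right[OF iw] service_excess(1)[OF st k]] idle by simp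
  finally show ?thesis using service_excess(2)[OF st k, of j] by (simp add: m_def)
qed

lemma idle_probability:
  "law_rate (Ts j) * (\<integral>x. of_bool (fst x $ j = 0) \<partial>\<pi>) = law_rate (Ts j) - total_rate E P Te $ j"
proof -
  interpret prob_space \<pi> by (rule prob_\<pi>)
  note [measurable] = measurable_state_queue[OF id_\<pi>]
  have i: "integrable \<pi> (\<lambda>x. of_bool (0 < fst x $ j) :: real)" by (rule integrable_\<pi>[where B=1]) auto
  have "(\<integral>x. of_bool (fst x $ j = 0) \<partial>\<pi>) = (\<integral>x. (1 - of_bool (0 < fst x $ j) :: real) \<partial>\<pi>)"
    by (rule Bochner_Integration.integral_cong) auto
  also have "\<dots> = 1 - (\<integral>x. of_bool (0 < fst x $ j) \<partial>\<pi>)" using i by (simp add: prob_space)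
  finally have e: "(\<integral>x. of_bool (fst x $ j = 0) \<partial>\<pi>) = (1 - (\<integral>x. of_bool (0 < fst x $ j) \<partial>\<pi>) :: real)" .
  show ?thesis unfolding e right_diff_distrib utilization[OF st] by simp
qed

end

end

section \<open>The covariance matrix\<close>

text \<open>Sorted by stations, the form matches the second-order terms of the roots. The part made
  of P alone is the variance of \<tau> at a random destination, with value 0 for leaving the
  network.\<close>

lemma covariance_quadratic_form:
  fixes P :: "real^'d::finite^'d"
  shows "\<tau> \<bullet> (covariance P lamE sigE lamS sigS *v \<tau>) =
    (\<Sum>k\<in>UNIV. lamS $ k * ((\<Sum>i\<in>UNIV. P $ k $ i * (\<tau> $ i)\<^sup>2) - (\<Sum>i\<in>UNIV. P $ k $ i * \<tau> $ i)\<^sup>2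
        + (lamS $ k)\<^sup>2 * (sigS $ k)\<^sup>2 * (\<tau> $ k - (\<Sum>i\<in>UNIV. P $ k $ i * \<tau> $ i))\<^sup>2))
    + (\<Sum>i\<in>UNIV. (lamE $ i) ^ 3 * (sigE $ i)\<^sup>2 * (\<tau> $ i)\<^sup>2)"
proof -
  have del: "(\<Sum>j\<in>UNIV. f j * kdelta i j) = f i" for f :: "'d \<Rightarrow> real" and i
    by (simp add: kdelta_def if_distrib cong: if_cong)
  define W where "W k i j = P $ k $ i * (kdelta i j - P $ k $ j) + (lamS $ k)\<^sup>2 * (sigS $ k)\<^sup>2 * (P $ k $ i - kdelta k i) * (P $ k $ j - kdelta k j)" for k i j
  have "\<tau> \<bullet> (covariance P lamE sigE lamS sigS *v \<tau>)
    = (\<Sum>i\<in>UNIV. \<Sum>j\<in>UNIV. \<tau> $ i * ((\<Sum>k\<in>UNIV. lamS $ k * W k i j) + (lamE $ i) ^ 3 * (sigE $ i)\<^sup>2 * kdelta i j) * \<tau> $ j)"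
    by (simp add: inner_vec_def matrix_vector_mult_def covariance_def W_def sum_distrib_left mult.assoc)
  also have "\<dots> = (\<Sum>i\<in>UNIV. \<Sum>j\<in>UNIV. (\<Sum>k\<in>UNIV. lamS $ k * (\<tau> $ i * W k i j * \<tau> $ j)))
     + (\<Sum>i\<in>UNIV. \<Sum>j\<in>UNIV. (\<tau> $ i * (lamE $ i) ^ 3 * (sigE $ i)\<^sup>2 * \<tau> $ j) * kdelta i j)"
    unfolding sum.distrib[symmetric]
    by (intro sum.cong refl) (simp add: distrib_left distrib_right sum_distrib_left sum_distrib_right mult_ac)
  also have "(\<Sum>i\<in>UNIV. \<Sum>j\<in>UNIV. (\<tau> $ i * (lamE $ i) ^ 3 * (sigE $ i)\<^sup>2 * \<tau> $ j) * kdelta i j) = (\<Sum>i\<in>UNIV. (lamE $ i) ^ 3 * (sigE $ i)\<^sup>2 * (\<tau> $ i)\<^sup>2)"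
    unfolding del by (simp add: power2_eq_square mult_ac)
  also have "(\<Sum>i\<in>UNIV. \<Sum>j\<in>UNIV. (\<Sum>k\<in>UNIV. lamS $ k * (\<tau> $ i * W k i j * \<tau> $ j))) = (\<Sum>i\<in>UNIV. \<Sum>k\<in>UNIV. \<Sum>j\<in>UNIV. lamS $ k * (\<tau> $ i * W k i j * \<tau> $ j))"
    by (rule sum.cong[OF refl], rule sum.swap)
  also have "\<dots> = (\<Sum>k\<in>UNIV. \<Sum>i\<in>UNIV. \<Sum>j\<in>UNIV. lamS $ k * (\<tau> $ i * W k i j * \<tau> $ j))"
    by (rule sum.swap)
  also have "\<dots> = (\<Sum>k\<in>UNIV. lamS $ k * ((\<Sum>i\<in>UNIV. P $ k $ i * (\<tau> $ i)\<^sup>2) - (\<Sum>i\<in>UNIV. P $ k $ i * \<tau> $ i)\<^sup>2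
        + (lamS $ k)\<^sup>2 * (sigS $ k)\<^sup>2 * (\<tau> $ k - (\<Sum>i\<in>UNIV. P $ k $ i * \<tau> $ i))\<^sup>2))"
  proof (rule sum.cong[OF refl])
    fix k
    define p where "p = (\<Sum>i\<in>UNIV. P $ k $ i * \<tau> $ i)"
    define s where "s = (lamS $ k)\<^sup>2 * (sigS $ k)\<^sup>2"
    have d: "(\<Sum>i\<in>UNIV. \<tau> $ i * (P $ k $ i - kdelta k i)) = p - \<tau> $ k"
      using del[of "\<lambda>i. \<tau> $ i" k] by (simp add: p_def right_diff_distrib sum_subtractf mult.commute)
    have "(\<Sum>i\<in>UNIV. \<Sum>j\<in>UNIV. \<tau> $ i * W k i j * \<tau> $ j)
      = (\<Sum>i\<in>UNIV. \<Sum>j\<in>UNIV. (P $ k $ i * \<tau> $ i * \<tau> $ j) * kdelta i j - (P $ k $ i * \<tau> $ i) * (P $ k $ j * \<tau> $ j)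
          + s * ((\<tau> $ i * (P $ k $ i - kdelta k i)) * (\<tau> $ j * (P $ k $ j - kdelta k j))))"
      by (intro sum.cong refl) (simp add: W_def s_def algebra_simps)
    also have "\<dots> = (\<Sum>i\<in>UNIV. P $ k $ i * \<tau> $ i * \<tau> $ i) - p * p + s * ((p - \<tau> $ k) * (p - \<tau> $ k))"
      unfolding sum.distrib sum_subtractf del sum_distrib_left[symmetric] sum_distrib_right[symmetric] d p_def[symmetric] ..
    finally have "(\<Sum>i\<in>UNIV. \<Sum>j\<in>UNIV. \<tau> $ i * W k i j * \<tau> $ j)
      = (\<Sum>i\<in>UNIV. P $ k $ i * (\<tau> $ i)\<^sup>2) - p\<^sup>2 + s * (\<tau> $ k - p)\<^sup>2"
      by (simp add: power2_eq_square mult.assoc algebra_simps)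
    then show "(\<Sum>i\<in>UNIV. \<Sum>j\<in>UNIV. lamS $ k * (\<tau> $ i * W k i j * \<tau> $ j)) = lamS $ k * ((\<Sum>i\<in>UNIV. P $ k $ i * (\<tau> $ i)\<^sup>2) - (\<Sum>i\<in>UNIV. P $ k $ i * \<tau> $ i)\<^sup>2
        + (lamS $ k)\<^sup>2 * (sigS $ k)\<^sup>2 * (\<tau> $ k - (\<Sum>i\<in>UNIV. P $ k $ i * \<tau> $ i))\<^sup>2)"
      unfolding sum_distrib_left[symmetric] p_def s_def by simp
  qed
  finally show ?thesis .
qed

lemma covariance_diagonal_zero:
  fixes P :: "real^'d::finite^'d"
  assumes "\<And>i. lamS $ i * P $ i $ k = 0" "lamS $ k = 0" "lamE $ k = 0"
  shows "axis k 1 \<bullet> (covariance P lamE sigE lamS sigS *v axis k 1) = 0"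
proof -
  have s1: "(\<Sum>i\<in>UNIV. f i * axis k 1 $ i) = f k" for f :: "'d \<Rightarrow> real"
    by (simp add: axis_def if_distrib cong: if_cong)
  have sq: "(axis k 1 $ i :: real)\<^sup>2 = axis k 1 $ i" for i by (simp add: axis_def)
  have s: "(\<Sum>i\<in>UNIV. f i * axis k 1 $ i) = f k" "(\<Sum>i\<in>UNIV. f i * (axis k 1 $ i)\<^sup>2) = f k" for f :: "'d \<Rightarrow> real"
    unfolding sq by (rule s1)+
  have "lamS $ i * (P $ i $ k - (P $ i $ k)\<^sup>2 + (lamS $ i)\<^sup>2 * (sigS $ i)\<^sup>2 * (axis k 1 $ i - P $ i $ k)\<^sup>2) = 0" for i
    using assms(1)[of i] assms(2) by (cases "lamS $ i = 0") (auto simp: axis_def)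
  then have z: "(\<Sum>i\<in>UNIV. lamS $ i * (P $ i $ k - (P $ i $ k)\<^sup>2 + (lamS $ i)\<^sup>2 * (sigS $ i)\<^sup>2 * (axis k 1 $ i - P $ i $ k)\<^sup>2)) = 0"
    by (intro sum.neutral ballI)
  show ?thesis unfolding covariance_quadratic_form s z using assms(3) by simp
qed

context
  fixes P :: "real^'d::finite^'d" and E :: "'d set" and lamE sigE lamS sigS :: "real^'d"
  assumes routing: "routing_matrix P" and lamE0: "\<And>i. i \<notin> E \<Longrightarrow> lamE $ i = 0"
    and lamS: "lamS = matrix_inv (mat 1 - transpose P) *v lamE"
    and pos_def: "\<And>\<theta>. \<theta> \<noteq> 0 \<Longrightarrow> 0 < \<theta> \<bullet> (covariance P lamE sigE lamS sigS *v \<theta>)"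
begin

text \<open>By the Neumann series, no flow reaches a station outside a closed set of stations containing
  \<open>E\<close>, which would make the covariance matrix degenerate.\<close>

lemma connected_if_pos_def:
  assumes G: "E \<subseteq> G" "\<And>j k. j \<in> G \<Longrightarrow> 0 < P $ j $ k \<Longrightarrow> k \<in> G"
  shows "G = UNIV"
proof (rule ccontr)
  assume "G \<noteq> UNIV"
  then obtain k where k: "k \<notin> G" by blast
  have P0: "P $ i $ j = 0" if "i \<in> G" "j \<notin> G" for i j
    using G(2)[of i j] that routing by (force simp: routing_matrix_def order.order_iff_strict)
  have pow: "(((**) P) ^^ n) (mat 1) $ i $ j = 0" if "i \<in> G" "j \<notin> G" for n i j
    using that
  proof (induction n arbitrary: i)
    case 0
    then show ?case by (auto simp: mat_def)
  next
    case (Suc n)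
    have "P $ i $ m * (((**) P) ^^ n) (mat 1) $ m $ j = 0" for m
      using Suc.IH[of m] Suc.prems P0[of i m] by (cases "m \<in> G") auto
    then have z: "(\<Sum>m\<in>UNIV. P $ i $ m * (((**) P) ^^ n) (mat 1) $ m $ j) = 0" by (intro sum.neutral ballI)
    have "(P ** X) $ i $ j = (\<Sum>m\<in>UNIV. P $ i $ m * X $ m $ j)" for X :: "real^'d^'d" by (simp add: matrix_matrix_mult_def)
    from this[of "(((**) P) ^^ n) (mat 1)"] z show ?case by simp
  qed
  have inv: "matrix_inv (mat 1 - P) $ i $ j = 0" if "i \<in> G" "j \<notin> G" for i j
  proof -
    have "(\<lambda>n. \<Sum>m<n. (((**) P) ^^ m) (mat 1)) \<longlonglongrightarrow> matrix_inv (mat 1 - P)"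
      using routing by (simp add: routing_matrix_def sums_def)
    then have "(\<lambda>n. (\<Sum>m<n. (((**) P) ^^ m) (mat 1)) $ i $ j) \<longlonglongrightarrow> matrix_inv (mat 1 - P) $ i $ j"
      by (intro tendsto_vec_nth)
    moreover have "(\<Sum>m<n. (((**) P) ^^ m) (mat 1)) $ i $ j = 0" for n
      using pow[OF that] by (simp add: sum_component)
    ultimately show ?thesis using LIMSEQ_unique[OF _ tendsto_const] by simp
  qed
  have lam0: "lamS $ j = 0" if j: "j \<notin> G" for j
  proof -
    have "matrix_inv (mat 1 - P) $ i $ j * lamE $ i = 0" for i
      using inv[of i j] j lamE0[of i] G(1) by (cases "i \<in> G") auto
    then have "(\<Sum>i\<in>UNIV. matrix_inv (mat 1 - P) $ i $ j * lamE $ i) = 0" by (intro sum.neutral ballI)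
    then show ?thesis
      unfolding lamS matrix_inv_1_minus_transpose(1)[OF routing] by (simp add: matrix_vector_mult_def transpose_def)
  qed
  have "axis k 1 \<bullet> (covariance P lamE sigE lamS sigS *v axis k 1) = 0"
  proof (rule covariance_diagonal_zero)
    show "lamS $ i * P $ i $ k = 0" for i using P0[of i k] lam0[of i] k by (cases "i \<in> G") auto
    show "lamE $ k = 0" using lamE0[of k] k G(1) by auto
  qed (rule lam0[OF k])
  with pos_def[of "axis k 1"] show False by (simp add: axis_eq_0_iff)
qed

text \<open>At a station without throughput the traffic equation has only nonnegative inflows
  summing to zero. All of them vanish, and the covariance matrix degenerates in the direction of
  that station.\<close>

lemma rate_pos_if_pos_def:
  assumes lamE_nn: "\<And>i. 0 \<le> lamE $ i" and nn: "\<And>i. 0 \<le> lamS $ i"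
  shows "0 < lamS $ k"
proof (rule ccontr)
  assume "\<not> 0 < lamS $ k"
  then have k: "lamS $ k = 0" using nn[of k] by simp
  have inv: "invertible (mat 1 - transpose P)"
    using matrix_inv_1_minus_transpose(2)[OF routing] matrix_left_right_inverse unfolding invertible_def by blast
  have "(mat 1 - transpose P) *v lamS = lamE"
    unfolding lamS matrix_vector_mul_assoc matrix_inv_inverse(2)[OF inv] by simp
  then have "((mat 1 - transpose P) *v lamS) $ k = lamE $ k" by simp
  moreover have "((mat 1 - transpose P) *v lamS) $ k = lamS $ k - (\<Sum>i\<in>UNIV. P $ i $ k * lamS $ i)"
    unfolding matrix_vector_mult_diff_rdistrib matrix_vector_mul_lid by (simp add: matrix_vector_mult_def transpose_def)
  ultimately have e: "(\<Sum>i\<in>UNIV. P $ i $ k * lamS $ i) + lamE $ k = 0" using k by simp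
  have t: "0 \<le> P $ i $ k * lamS $ i" for i using nn[of i] routing by (simp add: routing_matrix_def)
  then have s: "0 \<le> (\<Sum>i\<in>UNIV. P $ i $ k * lamS $ i)" by (intro sum_nonneg) auto
  then have "(\<Sum>i\<in>UNIV. P $ i $ k * lamS $ i) = 0" and lk: "lamE $ k = 0" using e lamE_nn[of k] by linarith+
  then have "P $ i $ k * lamS $ i = 0" for i using t by (simp add: sum_nonneg_eq_0_iff)
  then have "axis k 1 \<bullet> (covariance P lamE sigE lamS sigS *v axis k 1) = 0"
    by (intro covariance_diagonal_zero k lk) (simp add: mult.commute)
  with pos_def[of "axis k 1"] show False by (simp add: axis_eq_0_iff)
qed

end

section \<open>Heavy traffic asymptotics\<close>

lemma tendsto_imp_bigo_1: "f \<longlonglongrightarrow> l \<Longrightarrow> f \<in> O(\<lambda>_. 1)" for f :: "nat \<Rightarrow> real"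
  by (rule bigoI_tendsto[where c=l]) auto

lemma tendsto_0_imp_smallo_1: "f \<longlonglongrightarrow> 0 \<Longrightarrow> f \<in> o(\<lambda>_. 1)" for f :: "nat \<Rightarrow> real"
  by (rule smalloI_tendsto) auto

lemma bounded_imp_bigo_1: "(\<And>n. \<bar>f n\<bar> \<le> B) \<Longrightarrow> f \<in> O(\<lambda>_. 1)" for f :: "nat \<Rightarrow> real"
  by (rule bigoI[where c=B]) auto

text \<open>\<open>\<rho>\<close> will be r |theta|. As theta may tend to 0, it can be much smaller
  than r, and the target precision is o(r \<rho>), that is o(r^2 |theta|).\<close>

locale small_scale =
  fixes r \<rho> :: "nat \<Rightarrow> real"
  assumes r_pos: "\<And>n. 0 < r n" and r_lim: "r \<longlonglongrightarrow> 0" and \<rho>_pos: "\<And>n. 0 < \<rho> n" and \<rho>_r: "\<rho> \<in> O(r)"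
begin

lemma r_small: "r \<in> o(\<lambda>_. 1)" and \<rho>_small: "\<rho> \<in> o(\<lambda>_. 1)"
proof -
  show "r \<in> o(\<lambda>_. 1)" by (rule tendsto_0_imp_smallo_1[OF r_lim])
  with \<rho>_r show "\<rho> \<in> o(\<lambda>_. 1)" by (rule landau_o.big_small_trans)
qed

lemma bigo_scale: "f \<in> O(\<lambda>n. r n * \<rho> n) \<Longrightarrow> f \<in> O(\<rho>)"
proof -
  assume "f \<in> O(\<lambda>n. r n * \<rho> n)"
  moreover have "(\<lambda>n. r n * \<rho> n) \<in> O(\<lambda>n. 1 * \<rho> n)"
    by (rule landau_o.big.mult[OF landau_o.small_imp_big[OF r_small] landau_o.big_refl])
  ultimately show ?thesis by (simp add: landau_o.big_trans)
qed

lemma mult_OO: "f \<in> O(\<rho>) \<Longrightarrow> g \<in> O(\<rho>) \<Longrightarrow> (\<lambda>n. f n * g n) \<in> O(\<lambda>n. r n * \<rho> n)"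
  by (rule landau_o.big.mult[OF landau_o.big_trans[OF _ \<rho>_r]])

lemma mult_O_zero: "f \<in> O(\<lambda>n. r n * \<rho> n) \<Longrightarrow> g \<in> o(\<lambda>_. 1) \<Longrightarrow> (\<lambda>n. f n * g n) \<in> o(\<lambda>n. r n * \<rho> n)"
  using landau_o.big_small_mult[of f sequentially "\<lambda>n. r n * \<rho> n" g "\<lambda>_. 1"] by simp

lemma mult_O_O: "f \<in> O(\<lambda>n. r n * \<rho> n) \<Longrightarrow> g \<in> O(\<rho>) \<Longrightarrow> (\<lambda>n. f n * g n) \<in> o(\<lambda>n. r n * \<rho> n)"
  by (rule mult_O_zero[OF _ landau_o.big_small_trans[OF _ \<rho>_small]])

lemma mult_o_one: "f \<in> o(\<lambda>n. r n * \<rho> n) \<Longrightarrow> g \<in> O(\<lambda>_. 1) \<Longrightarrow> (\<lambda>n. f n * g n) \<in> o(\<lambda>n. r n * \<rho> n)"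
  using landau_o.small_big_mult[of f sequentially "\<lambda>n. r n * \<rho> n" g "\<lambda>_. 1"] by simp

lemma exp_expansion:
  assumes y: "y \<in> O(\<rho>)"
  shows "(\<lambda>n. exp (y n) - 1 - y n - (y n)\<^sup>2 / 2) \<in> o(\<lambda>n. r n * \<rho> n)"
proof -
  have "y \<in> o(\<lambda>_. 1)" by (rule landau_o.big_small_trans[OF y \<rho>_small])
  then have "y \<longlonglongrightarrow> 0" by (auto dest: smalloD_tendsto)
  then have "(\<lambda>n. exp \<bar>y n\<bar>) \<longlonglongrightarrow> exp \<bar>0\<bar>" by (intro tendsto_intros)
  then have e: "(\<lambda>n. exp \<bar>y n\<bar>) \<in> O(\<lambda>_. 1)" by (rule tendsto_imp_bigo_1)
  have a: "(\<lambda>n. \<bar>y n\<bar>) \<in> O(\<rho>)" using y by simp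
  have "(\<lambda>n. exp (y n) - 1 - y n - (y n)\<^sup>2 / 2) \<in> O(\<lambda>n. exp \<bar>y n\<bar> * \<bar>y n\<bar> ^ 3)"
    by (rule bigoI[where c=1]) (auto intro!: always_eventually exp_quadratic_bound)
  moreover have "(\<lambda>n. \<bar>y n\<bar> * \<bar>y n\<bar> * \<bar>y n\<bar> * exp \<bar>y n\<bar>) \<in> o(\<lambda>n. r n * \<rho> n)"
    by (rule mult_o_one[OF mult_O_O[OF mult_OO[OF a a] a] e])
  then have "(\<lambda>n. exp \<bar>y n\<bar> * \<bar>y n\<bar> ^ 3) \<in> o(\<lambda>n. r n * \<rho> n)" by (simp add: power3_eq_cube mult_ac)
  ultimately show ?thesis by (rule landau_o.big_small_trans)
qed

end

text \<open>Here y is the first-order and w the second-order part of the prescribed mean minus 1.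
  The term y keeps its prelimit rate; w has already order r \<rho>, so the limit rate may be used
  there.\<close>

lemma (in light_laws) root_second_order:
  assumes \<rho>: "\<And>n. 0 < \<rho> n" "\<rho> \<in> O(r)" and y: "y \<in> O(\<rho>)" and w: "w \<in> O(\<lambda>n. r n * \<rho> n)"
    and q: "(\<lambda>n. (\<integral>x. exp (\<eta> n * cutoff (1 / r n) x) \<partial>\<nu> n) - 1 - (y n + w n)) \<in> o(\<lambda>n. r n * \<rho> n)"
  shows "\<eta> \<in> O(\<rho>)"
    and "(\<lambda>n. \<eta> n - (law_rate (\<nu> n) * y n + lam * w n - (lam / 2 + lam ^ 3 * sig\<^sup>2 / 2) * (y n)\<^sup>2)) \<in> o(\<lambda>n. r n * \<rho> n)"
proof -
  interpret small_scale r \<rho> by unfold_locales (rule r_pos r_lim \<rho>)+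
  define Q where "Q n = (\<integral>x. exp (\<eta> n * cutoff (1 / r n) x) \<partial>\<nu> n) - 1" for n
  define d where "d n = Q n - (y n + w n)" for n
  have d: "d \<in> o(\<lambda>n. r n * \<rho> n)" unfolding d_def[abs_def] Q_def using q .
  have wd: "(\<lambda>n. w n + d n) \<in> O(\<lambda>n. r n * \<rho> n)" by (rule sum_in_bigo(1)[OF w landau_o.small_imp_big[OF d]])
  have Qe: "Q n = y n + (w n + d n)" for n by (simp add: d_def)
  have QO: "Q \<in> O(\<rho>)" unfolding Qe[abs_def] by (rule sum_in_bigo(1)[OF y bigo_scale[OF wd]])
  have root: "(\<integral>x. exp (\<eta> n * cutoff (1 / r n) x) \<partial>\<nu> n) = 1 + Q n" for n by (simp add: Q_def)
  show "\<eta> \<in> O(\<rho>)" by (rule root_bigo[OF \<rho> QO root])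
  define c where "c = lam / 2 + lam ^ 3 * sig\<^sup>2 / 2"
  have t1: "(\<lambda>n. \<eta> n - (law_rate (\<nu> n) * Q n - c * (Q n)\<^sup>2)) \<in> o(\<lambda>n. r n * \<rho> n)"
    unfolding c_def by (rule root_expansion[OF \<rho> QO root])
  have t2: "(\<lambda>n. d n * law_rate (\<nu> n)) \<in> o(\<lambda>n. r n * \<rho> n)"
    by (rule mult_o_one[OF d tendsto_imp_bigo_1[OF rate]])
  have t3: "(\<lambda>n. w n * (law_rate (\<nu> n) - lam)) \<in> o(\<lambda>n. r n * \<rho> n)"
    by (rule mult_O_zero[OF w tendsto_0_imp_smallo_1]) (use rate in \<open>simp add: LIM_zero\<close>)
  have t4: "(\<lambda>n. (w n + d n) * (Q n + y n) * c) \<in> o(\<lambda>n. r n * \<rho> n)"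
    by (rule mult_o_one[OF mult_O_O[OF wd sum_in_bigo(1)[OF QO y]]]) simp
  have h: "\<eta> n - (law_rate (\<nu> n) * y n + lam * w n - c * (y n)\<^sup>2)
    = (\<eta> n - (law_rate (\<nu> n) * Q n - c * (Q n)\<^sup>2)) + d n * law_rate (\<nu> n) + w n * (law_rate (\<nu> n) - lam)
      - (w n + d n) * (Q n + y n) * c" for n
    unfolding Qe by (simp add: power2_eq_square algebra_simps)
  show "(\<lambda>n. \<eta> n - (law_rate (\<nu> n) * y n + lam * w n - (lam / 2 + lam ^ 3 * sig\<^sup>2 / 2) * (y n)\<^sup>2)) \<in> o(\<lambda>n. r n * \<rho> n)"
    unfolding c_def[symmetric] h
    by (rule sum_in_smallo(2)[OF sum_in_smallo(1)[OF sum_in_smallo(1)[OF t1 t2] t3] t4])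
qed

locale heavy_traffic =
  fixes E :: "'d::finite set" and P :: "real^'d^'d" and Te Ts :: "nat \<Rightarrow> 'd \<Rightarrow> real measure"
    and r :: "nat \<Rightarrow> real" and b lamE sigE lamS sigS :: "real^'d" and \<pi> :: "nat \<Rightarrow> 'd state measure" and M :: real
  assumes routing: "routing_matrix P"
    and Te: "\<And>n i. i \<in> E \<Longrightarrow> time_law (Te n i)" and Ts: "\<And>n j. time_law (Ts n j)"
    and b_pos: "\<And>j. 0 < b $ j" and r_pos: "\<And>n. 0 < r n" and r_lim: "r \<longlonglongrightarrow> 0"
    and traffic: "\<And>n. svc_rate (Ts n) - total_rate E P (Te n) = r n *\<^sub>R b"
    and sigE_lim: "(\<lambda>n. ext_sd E (Te n)) \<longlonglongrightarrow> sigE" and lamE_lim: "(\<lambda>n. ext_rate E (Te n)) \<longlonglongrightarrow> lamE"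
    and lamE_pos: "\<And>i. i \<in> E \<Longrightarrow> 0 < lamE $ i" and sigS_lim: "(\<lambda>n. svc_sd (Ts n)) \<longlonglongrightarrow> sigS"
    and Te_ui: "\<And>i. i \<in> E \<Longrightarrow> unif_integrable (\<lambda>n. Te n i) (\<lambda>x. x\<^sup>2)"
    and Ts_ui: "\<And>j. unif_integrable (\<lambda>n. Ts n j) (\<lambda>x. x\<^sup>2)"
    and lamS_eq: "lamS = matrix_inv (mat 1 - transpose P) *v lamE"
    and pos_def: "\<And>\<theta>. \<theta> \<noteq> 0 \<Longrightarrow> 0 < \<theta> \<bullet> (covariance P lamE sigE lamS sigS *v \<theta>)"
    and st: "\<And>n. stationary E P (Te n) (Ts n) (\<pi> n)" and M_pos: "0 < M"
    and eta_ex: "\<And>\<theta> n i. norm \<theta> \<le> M \<Longrightarrow> i \<in> E \<Longrightarrow> \<exists>\<eta>. exp (\<theta> $ i) * (\<integral>x. exp (\<eta> * min x (1 / r n)) \<partial>Te n i) = 1"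
    and zeta_ex: "\<And>\<theta> n j. norm \<theta> \<le> M \<Longrightarrow> \<exists>\<zeta>. t_fun P j \<theta> * (\<integral>x. exp (\<zeta> * min x (1 / r n)) \<partial>Ts n j) = 1"
begin

lemma lamE0: "i \<notin> E \<Longrightarrow> lamE $ i = 0"
  using tendsto_vec_nth[OF lamE_lim, of i] LIMSEQ_unique[OF _ tendsto_const] by (fastforce simp: ext_rate_def)

lemma lamE_nonneg: "0 \<le> lamE $ i"
  using lamE_pos[of i] lamE0[of i] by (cases "i \<in> E") auto

lemma law_rate_pos: "time_law \<nu> \<Longrightarrow> 0 < law_rate \<nu>"
  using time_law_facts(6)[of \<nu>] by (simp add: law_rate_def)

lemma svc_rate_lim: "(\<lambda>n. svc_rate (Ts n)) \<longlonglongrightarrow> lamS"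
proof -
  have e: "svc_rate (Ts n) = total_rate E P (Te n) + r n *\<^sub>R b" for n using traffic[of n] by (simp add: algebra_simps)
  have "(\<lambda>n. total_rate E P (Te n)) \<longlonglongrightarrow> lamS"
    unfolding total_rate_def lamS_eq by (rule bounded_linear.tendsto[OF matrix_vector_mul_bounded_linear lamE_lim])
  moreover have "(\<lambda>n. r n *\<^sub>R b) \<longlonglongrightarrow> 0 *\<^sub>R b" by (intro tendsto_intros r_lim)
  ultimately have "(\<lambda>n. total_rate E P (Te n) + r n *\<^sub>R b) \<longlonglongrightarrow> lamS + 0 *\<^sub>R b" by (rule tendsto_add)
  then show ?thesis by (simp add: e)
qed

lemma rateS: "(\<lambda>n. law_rate (Ts n j)) \<longlonglongrightarrow> lamS $ j"
  using tendsto_vec_nth[OF svc_rate_lim, of j] by (simp add: svc_rate_def)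

lemma lamS_pos: "0 < lamS $ j"
proof (rule rate_pos_if_pos_def[OF routing lamE0 lamS_eq pos_def lamE_nonneg])
  show "0 \<le> lamS $ i" for i
    by (rule LIMSEQ_le_const[OF rateS]) (use law_rate_pos[OF Ts] in \<open>auto intro: less_imp_le\<close>)
qed

lemma connected: "E \<subseteq> G \<Longrightarrow> (\<And>j k. j \<in> G \<Longrightarrow> 0 < P $ j $ k \<Longrightarrow> k \<in> G) \<Longrightarrow> G = UNIV"
  by (rule connected_if_pos_def[OF routing lamE0 lamS_eq pos_def])

lemma jack: "jackson E P (Te n) (Ts n)"
  by unfold_locales (use routing Te Ts connected[of "{}"] in auto)

lemma light_E: "i \<in> E \<Longrightarrow> light_laws (\<lambda>n. Te n i) r (lamE $ i) (sigE $ i)"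
  using tendsto_vec_nth[OF lamE_lim, of i] tendsto_vec_nth[OF sigE_lim, of i] lamE_pos[of i]
  by unfold_locales (auto simp: Te Te_ui r_pos r_lim ext_rate_def ext_sd_def)

lemma light_S: "light_laws (\<lambda>n. Ts n j) r (lamS $ j) (sigS $ j)"
  using rateS[of j] tendsto_vec_nth[OF sigS_lim, of j] lamS_pos[of j]
  by unfold_locales (auto simp: Ts Ts_ui r_pos r_lim svc_sd_def)

lemma integral_min_cutoff:
  assumes "time_law \<nu>"
  shows "(\<integral>x. exp (h * min x (1 / r n)) \<partial>\<nu>) = (\<integral>x. exp (h * cutoff (1 / r n) x) \<partial>\<nu>)"
proof (rule integral_cong_AE)
  note [measurable_cong] = time_law_facts(2)[OF assms]
  show "(\<lambda>x. exp (h * min x (1 / r n))) \<in> borel_measurable \<nu>" "(\<lambda>x. exp (h * cutoff (1 / r n) x)) \<in> borel_measurable \<nu>"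
    by measurable
  show "AE x in \<nu>. exp (h * min x (1 / r n)) = exp (h * cutoff (1 / r n) x)"
    using time_law_facts(3)[OF assms] by eventually_elim (use r_pos[of n] in \<open>simp add: cutoff_def\<close>)
qed

lemma idle_prob: "(\<integral>x. of_bool (fst x $ j = 0) \<partial>\<pi> n) = r n * (b $ j / law_rate (Ts n j))"
proof -
  have "law_rate (Ts n j) * (\<integral>x. of_bool (fst x $ j = 0) \<partial>\<pi> n) = law_rate (Ts n j) - total_rate E P (Te n) $ j"
    by (rule jackson.idle_probability[OF jack st, where c=1 and A=0 and \<tau>=0 and \<eta>="\<lambda>_. 0" and \<zeta>="\<lambda>_. 0"]) auto
  also have "\<dots> = r n * b $ j" using arg_cong[OF traffic[of n], of "\<lambda>v. v $ j"] by (simp add: svc_rate_def)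
  finally show ?thesis using law_rate_pos[OF Ts, of n j] by (simp add: field_simps)
qed

end

locale heavy_traffic_sequence = heavy_traffic E P Te Ts r b lamE sigE lamS sigS \<pi> M
  for E :: "'d::finite set" and P :: "real^'d^'d" and Te Ts :: "nat \<Rightarrow> 'd \<Rightarrow> real measure"
    and r :: "nat \<Rightarrow> real" and b lamE sigE lamS sigS :: "real^'d" and \<pi> :: "nat \<Rightarrow> 'd state measure" and M :: real +
  fixes \<theta> :: "nat \<Rightarrow> real^'d"
  assumes \<theta>: "\<And>n i. \<theta> n $ i < 0" "\<And>n. 0 < norm (\<theta> n)" "\<And>n. norm (\<theta> n) \<le> M"
begin

definition "\<rho> n = r n * norm (\<theta> n)"
definition "\<tau> n = r n *\<^sub>R \<theta> n"
text \<open>Roots are guaranteed for arguments of norm at most M. The argument r theta satisfies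
  this as soon as r is at most 1, hence for all large n; the remaining indices get 0.\<close>

definition "\<eta> n i = (if r n \<le> 1 \<and> i \<in> E then SOME h. exp (\<tau> n $ i) * (\<integral>x. exp (h * min x (1 / r n)) \<partial>Te n i) = 1 else 0)"
definition "\<zeta> n j = (if r n \<le> 1 then SOME h. t_fun P j (\<tau> n) * (\<integral>x. exp (h * min x (1 / r n)) \<partial>Ts n j) = 1 else 0)"
definition "p n j = (\<Sum>k\<in>UNIV. P $ j $ k * \<tau> n $ k)"
definition "p2 n j = (\<Sum>k\<in>UNIV. P $ j $ k * (\<tau> n $ k)\<^sup>2)"

lemma scale: "small_scale r \<rho>"
proof
  show "0 < r n" "r \<longlonglongrightarrow> 0" "0 < \<rho> n" for n using r_pos r_lim \<theta> by (auto simp: \<rho>_def)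
  show "\<rho> \<in> O(r)"
  proof (rule bigoI[where c=M], rule always_eventually, rule allI)
    show "norm (\<rho> n) \<le> M * norm (r n)" for n
      using mult_left_mono[OF \<theta>(3) less_imp_le[OF r_pos], of n n] r_pos[of n] by (simp add: \<rho>_def abs_mult mult.commute)
  qed
qed

lemmas \<rho>_pos = small_scale.\<rho>_pos[OF scale]
lemmas \<rho>_r = small_scale.\<rho>_r[OF scale]
lemmas bigo_scale = small_scale.bigo_scale[OF scale]
lemmas mult_OO = small_scale.mult_OO[OF scale]
lemmas mult_O_zero = small_scale.mult_O_zero[OF scale]
lemmas mult_O_O = small_scale.mult_O_O[OF scale]
lemmas mult_o_one = small_scale.mult_o_one[OF scale]

lemma \<tau>_neg: "\<tau> n $ i \<le> 0"
  using \<theta>(1)[of n i] r_pos[of n] by (simp add: \<tau>_def mult_le_0_iff less_imp_le)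

lemma norm_\<tau>: "norm (\<tau> n) = \<rho> n"
  using r_pos[of n] by (simp add: \<tau>_def \<rho>_def)

lemma \<tau>_O: "(\<lambda>n. \<tau> n $ k) \<in> O(\<rho>)"
proof (rule bigoI[where c=1], rule always_eventually, rule allI)
  show "norm (\<tau> n $ k) \<le> 1 * norm (\<rho> n)" for n
    using component_le_norm_cart[of "\<tau> n" k] \<rho>_pos[of n] by (simp add: norm_\<tau>)
qed

lemma p_O: "(\<lambda>n. p n j) \<in> O(\<rho>)"
  unfolding p_def by (rule big_sum_in_bigo) (use \<tau>_O in simp)

lemma p2_O: "(\<lambda>n. p2 n j) \<in> O(\<lambda>n. r n * \<rho> n)"
  unfolding p2_def power2_eq_square by (rule big_sum_in_bigo) (use mult_OO[OF \<tau>_O \<tau>_O] in simp)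

lemma eventually_r: "\<forall>\<^sub>F n in sequentially. r n \<le> 1"
proof -
  have "\<forall>\<^sub>F n in sequentially. r n < 1" by (rule order_tendstoD(2)[OF r_lim]) simp
  then show ?thesis by eventually_elim simp
qed

lemma \<tau>_M: "r n \<le> 1 \<Longrightarrow> norm (\<tau> n) \<le> M"
  unfolding norm_\<tau> \<rho>_def using \<theta>(3)[of n] r_pos[of n] mult_mono[of "r n" 1 "norm (\<theta> n)" M] by simp

lemma \<eta>_root: "r n \<le> 1 \<Longrightarrow> i \<in> E \<Longrightarrow> exp (\<tau> n $ i) * (\<integral>x. exp (\<eta> n i * cutoff (1 / r n) x) \<partial>Te n i) = 1"
  using someI_ex[OF eta_ex[OF \<tau>_M, of n i n]] by (simp add: \<eta>_def integral_min_cutoff[OF Te, symmetric])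

lemma \<zeta>_root: "r n \<le> 1 \<Longrightarrow> t_fun P j (\<tau> n) * (\<integral>x. exp (\<zeta> n j * cutoff (1 / r n) x) \<partial>Ts n j) = 1"
  using someI_ex[OF zeta_ex[OF \<tau>_M, of n j n]] by (simp add: \<zeta>_def integral_min_cutoff[OF Ts, symmetric])

text \<open>The prescribed mean is exp (- \<tau>), so the first-order part is - \<tau> and the
  second-order part \<tau>^2 / 2. The latter cancels the part lam / 2 of the quadratic coefficient
  and leaves the variance term.\<close>

lemma \<eta>_expansion:
  assumes i: "i \<in> E"
  shows "(\<lambda>n. \<eta> n i) \<in> O(\<rho>)"
    and "(\<lambda>n. \<eta> n i - (- law_rate (Te n i) * \<tau> n $ i - (lamE $ i) ^ 3 * (sigE $ i)\<^sup>2 / 2 * (\<tau> n $ i)\<^sup>2)) \<in> o(\<lambda>n. r n * \<rho> n)"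
proof -
  have y: "(\<lambda>n. - \<tau> n $ i) \<in> O(\<rho>)" using \<tau>_O by simp
  have w: "(\<lambda>n. (\<tau> n $ i)\<^sup>2 / 2) \<in> O(\<lambda>n. r n * \<rho> n)" using mult_OO[OF \<tau>_O[of i] \<tau>_O[of i]] by (simp add: power2_eq_square)
  have ex: "(\<lambda>n. exp (- \<tau> n $ i) - 1 - - \<tau> n $ i - (- \<tau> n $ i)\<^sup>2 / 2) \<in> o(\<lambda>n. r n * \<rho> n)"
    by (rule small_scale.exp_expansion[OF scale y])
  have "\<forall>\<^sub>F n in sequentially. (\<integral>x. exp (\<eta> n i * cutoff (1 / r n) x) \<partial>Te n i) - 1 - (- \<tau> n $ i + (\<tau> n $ i)\<^sup>2 / 2)
     = exp (- \<tau> n $ i) - 1 - - \<tau> n $ i - (- \<tau> n $ i)\<^sup>2 / 2"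
    using eventually_r
  proof eventually_elim
    case (elim n)
    then show ?case using \<eta>_root[OF elim i] by (simp add: exp_minus field_simps)
  qed
  from landau_o.small.in_cong[OF this] ex
  have q: "(\<lambda>n. (\<integral>x. exp (\<eta> n i * cutoff (1 / r n) x) \<partial>Te n i) - 1 - (- \<tau> n $ i + (\<tau> n $ i)\<^sup>2 / 2)) \<in> o(\<lambda>n. r n * \<rho> n)"
    by blast
  show "(\<lambda>n. \<eta> n i) \<in> O(\<rho>)"
    by (rule light_laws.root_second_order(1)[OF light_E[OF i] \<rho>_pos \<rho>_r y w q])
  show "(\<lambda>n. \<eta> n i - (- law_rate (Te n i) * \<tau> n $ i - (lamE $ i) ^ 3 * (sigE $ i)\<^sup>2 / 2 * (\<tau> n $ i)\<^sup>2)) \<in> o(\<lambda>n. r n * \<rho> n)"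
    using light_laws.root_second_order(2)[OF light_E[OF i] \<rho>_pos \<rho>_r y w q] by (simp add: algebra_simps)
qed

lemma \<zeta>_expansion:
  shows "(\<lambda>n. \<zeta> n j) \<in> O(\<rho>)"
    and "(\<lambda>n. \<zeta> n j - (law_rate (Ts n j) * (\<tau> n $ j - p n j) + lamS $ j / 2 * ((p n j)\<^sup>2 - p2 n j)
       - (lamS $ j) ^ 3 * (sigS $ j)\<^sup>2 / 2 * (\<tau> n $ j - p n j)\<^sup>2)) \<in> o(\<lambda>n. r n * \<rho> n)"
proof -
  define d where "d n = \<tau> n $ j - p n j" for n
  \<comment> \<open>The prescribed mean is \<open>exp (\<tau> n $ j) / (1 + x n)\<close>. Minus 1 it
    equals A / (1 + x), with A = d + (\<tau>^2 - p2) / 2 up to smaller terms; multiplying by 1 - x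
    adds - d p at second order.\<close>
  define w where "w n = (\<tau> n $ j)\<^sup>2 / 2 - p2 n j / 2 - d n * p n j" for n
  define e where "e k n = exp (\<tau> n $ k) - 1 - \<tau> n $ k - (\<tau> n $ k)\<^sup>2 / 2" for k n
  define ex where "ex n = (\<Sum>k\<in>UNIV. P $ j $ k * e k n)" for n
  define x where "x n = (\<Sum>k\<in>UNIV. P $ j $ k * (exp (\<tau> n $ k) - 1))" for n
  define A where "A n = exp (\<tau> n $ j) - 1 - x n" for n
  have d: "d \<in> O(\<rho>)" unfolding d_def[abs_def] by (rule sum_in_bigo(2)[OF \<tau>_O p_O])
  have tt: "(\<lambda>n. (\<tau> n $ j)\<^sup>2 / 2) \<in> O(\<lambda>n. r n * \<rho> n)" using mult_OO[OF \<tau>_O[of j] \<tau>_O[of j]] by (simp add: power2_eq_square)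
  have pp: "(\<lambda>n. p2 n j / 2) \<in> O(\<lambda>n. r n * \<rho> n)" using p2_O by simp
  have w: "w \<in> O(\<lambda>n. r n * \<rho> n)"
    unfolding w_def[abs_def] by (rule sum_in_bigo(2)[OF sum_in_bigo(2)[OF tt pp] mult_OO[OF d p_O]])
  have e: "e k \<in> o(\<lambda>n. r n * \<rho> n)" for k unfolding e_def[abs_def] by (rule small_scale.exp_expansion[OF scale \<tau>_O])
  have exs: "ex \<in> o(\<lambda>n. r n * \<rho> n)" unfolding ex_def[abs_def] by (rule big_sum_in_smallo) (use e in simp)
  have xe: "x n = p n j + p2 n j / 2 + ex n" for n
    unfolding x_def p_def p2_def ex_def e_def sum_divide_distrib sum.distrib[symmetric] by (rule sum.cong) (auto simp: algebra_simps)
  have xp: "(\<lambda>n. p2 n j / 2 + ex n) \<in> O(\<lambda>n. r n * \<rho> n)" by (rule sum_in_bigo(1)[OF pp landau_o.small_imp_big[OF exs]])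
  have xO: "x \<in> O(\<rho>)" unfolding xe[abs_def] add.assoc by (rule sum_in_bigo(1)[OF p_O bigo_scale[OF xp]])
  have Ae: "A n = d n + ((\<tau> n $ j)\<^sup>2 / 2 + e j n - (p2 n j / 2 + ex n))" for n
    unfolding A_def xe d_def e_def by simp
  have Ad: "(\<lambda>n. (\<tau> n $ j)\<^sup>2 / 2 + e j n - (p2 n j / 2 + ex n)) \<in> O(\<lambda>n. r n * \<rho> n)"
    by (rule sum_in_bigo(2)[OF sum_in_bigo(1)[OF tt landau_o.small_imp_big[OF e]] xp])
  have AO: "A \<in> O(\<rho>)" unfolding Ae[abs_def] by (rule sum_in_bigo(1)[OF d bigo_scale[OF Ad]])
  have "x \<longlonglongrightarrow> 0" using landau_o.big_small_trans[OF xO small_scale.\<rho>_small[OF scale]] by (auto dest: smalloD_tendsto)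
  then have "(\<lambda>n. 1 / (1 + x n)) \<longlonglongrightarrow> 1 / (1 + 0)" by (intro tendsto_intros) auto
  then have i1: "(\<lambda>n. 1 / (1 + x n)) \<in> O(\<lambda>_. 1)" by (rule tendsto_imp_bigo_1)
  have x1: "\<forall>\<^sub>F n in sequentially. 0 < 1 + x n"
  proof -
    have "\<forall>\<^sub>F n in sequentially. - 1 < x n" using \<open>x \<longlonglongrightarrow> 0\<close> by (rule order_tendstoD(1)) simp
    then show ?thesis by eventually_elim simp
  qed
  have t1: "(\<lambda>n. ((\<tau> n $ j)\<^sup>2 / 2 + e j n - (p2 n j / 2 + ex n)) * x n) \<in> o(\<lambda>n. r n * \<rho> n)" by (rule mult_O_O[OF Ad xO])
  have t2: "(\<lambda>n. (p2 n j / 2 + ex n) * d n) \<in> o(\<lambda>n. r n * \<rho> n)" by (rule mult_O_O[OF xp d])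
  have t3: "(\<lambda>n. A n * x n * x n * (1 / (1 + x n))) \<in> o(\<lambda>n. r n * \<rho> n)" by (rule mult_o_one[OF mult_O_O[OF mult_OO[OF AO xO] xO] i1])
  have sm: "(\<lambda>n. e j n - ex n - ((\<tau> n $ j)\<^sup>2 / 2 + e j n - (p2 n j / 2 + ex n)) * x n - (p2 n j / 2 + ex n) * d n + A n * x n * x n * (1 / (1 + x n)))
     \<in> o(\<lambda>n. r n * \<rho> n)"
    by (rule sum_in_smallo(1)[OF sum_in_smallo(2)[OF sum_in_smallo(2)[OF sum_in_smallo(2)[OF e exs] t1] t2] t3])
  have "\<forall>\<^sub>F n in sequentially. (\<integral>v. exp (\<zeta> n j * cutoff (1 / r n) v) \<partial>Ts n j) - 1 - (d n + w n)
     = e j n - ex n - ((\<tau> n $ j)\<^sup>2 / 2 + e j n - (p2 n j / 2 + ex n)) * x n - (p2 n j / 2 + ex n) * d n + A n * x n * x n * (1 / (1 + x n))"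
    using eventually_r x1
  proof eventually_elim
    case (elim n)
    define I where "I = (\<integral>v. exp (\<zeta> n j * cutoff (1 / r n) v) \<partial>Ts n j)"
    have "exp (- \<tau> n $ j) * (1 + x n) * I = 1"
      using \<zeta>_root[OF elim(1), of j] by (simp add: t_fun_eq x_def I_def)
    then have "exp (\<tau> n $ j) * (exp (- \<tau> n $ j) * ((1 + x n) * I)) = exp (\<tau> n $ j)" by (simp add: mult.assoc)
    then have "(1 + x n) * I = exp (\<tau> n $ j)" by (simp only: mult.assoc[symmetric] exp_minus_inverse mult_1_left)
    then have "(I - 1) * (1 + x n) = A n" by (simp add: A_def algebra_simps)
    then have I: "I - 1 = A n * (1 / (1 + x n))" using elim(2) by (simp add: field_simps)
    have g: "1 / (1 + x n) = 1 - x n + x n * x n * (1 / (1 + x n))" using elim(2) by (simp add: field_simps)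
    have "I - 1 = A n - A n * x n + A n * x n * x n * (1 / (1 + x n))" unfolding I by (subst g) (simp add: algebra_simps)
    then have "I - 1 - (d n + w n) = A n - A n * x n - (d n + w n) + A n * x n * x n * (1 / (1 + x n))" by simp
    also have "A n - A n * x n - (d n + w n)
      = e j n - ex n - ((\<tau> n $ j)\<^sup>2 / 2 + e j n - (p2 n j / 2 + ex n)) * x n - (p2 n j / 2 + ex n) * d n"
      unfolding Ae w_def xe by (simp add: algebra_simps)
    finally show ?case unfolding I_def .
  qed
  from landau_o.small.in_cong[OF this] sm
  have q: "(\<lambda>n. (\<integral>v. exp (\<zeta> n j * cutoff (1 / r n) v) \<partial>Ts n j) - 1 - (d n + w n)) \<in> o(\<lambda>n. r n * \<rho> n)" by blast
  show "(\<lambda>n. \<zeta> n j) \<in> O(\<rho>)"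
    by (rule light_laws.root_second_order(1)[OF light_S \<rho>_pos \<rho>_r d w q])
  have eq: "law_rate (Ts n j) * d n + lamS $ j * w n - (lamS $ j / 2 + (lamS $ j) ^ 3 * (sigS $ j)\<^sup>2 / 2) * (d n)\<^sup>2
    = law_rate (Ts n j) * d n + lamS $ j / 2 * ((p n j)\<^sup>2 - p2 n j) - (lamS $ j) ^ 3 * (sigS $ j)\<^sup>2 / 2 * (d n)\<^sup>2" for n
  proof -
    \<comment> \<open>All terms with \<open>\<tau> n $ j\<close> cancel, leaving minus half the
      routing variance; the variance of the service times enters separately through d^2.\<close>
    have "w n - (d n)\<^sup>2 / 2 = ((p n j)\<^sup>2 - p2 n j) / 2" unfolding w_def d_def by (simp add: power2_eq_square field_simps)
    then have "lamS $ j * (w n - (d n)\<^sup>2 / 2) = lamS $ j * (((p n j)\<^sup>2 - p2 n j) / 2)" by simp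
    then have "lamS $ j * w n = lamS $ j / 2 * ((p n j)\<^sup>2 - p2 n j) + lamS $ j / 2 * (d n)\<^sup>2" by (simp add: algebra_simps)
    then show ?thesis by (simp add: distrib_right)
  qed
  show "(\<lambda>n. \<zeta> n j - (law_rate (Ts n j) * (\<tau> n $ j - p n j) + lamS $ j / 2 * ((p n j)\<^sup>2 - p2 n j)
       - (lamS $ j) ^ 3 * (sigS $ j)\<^sup>2 / 2 * (\<tau> n $ j - p n j)\<^sup>2)) \<in> o(\<lambda>n. r n * \<rho> n)"
    using light_laws.root_second_order(2)[OF light_S \<rho>_pos \<rho>_r d w q] unfolding eq unfolding d_def .
qed

end

lemma bigo_cmult: "f \<in> O(g) \<Longrightarrow> (\<lambda>n. c * f n) \<in> O(g)" for f g :: "nat \<Rightarrow> real"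
  by (cases "c = 0") simp_all

lemma reflection_inner:
  fixes P :: "real^'d::finite^'d"
  shows "(reflection P *v x) \<bullet> y = (\<Sum>j\<in>UNIV. x $ j * (y $ j - (\<Sum>k\<in>UNIV. P $ j $ k * y $ k)))"
proof -
  have "(reflection P *v x) \<bullet> y = x \<bullet> (y - P *v y)"
    unfolding reflection_def matrix_vector_mult_diff_rdistrib matrix_vector_mul_lid transpose_matrix_vector
    by (simp add: inner_diff_left inner_diff_right dot_lmul_matrix)
  then show ?thesis by (simp add: inner_vec_def matrix_vector_mult_def)
qed

lemma gamma_bdry_reflection: "gamma_bdry (reflection P) j y = y $ j - (\<Sum>k\<in>UNIV. P $ j $ k * y $ k)"
  unfolding gamma_bdry_def matrix_vector_mult_basis[symmetric] reflection_inner
  by (simp add: axis_def if_distrib[of "\<lambda>x. x * _"] cong: if_cong)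

text \<open>Conditioning in product form, which includes the case of a null event.\<close>

lemma integral_uniform_measure:
  fixes f :: "'a \<Rightarrow> real"
  assumes "prob_space M" "{x \<in> space M. W x} \<in> sets M" "f \<in> borel_measurable M"
  shows "(\<integral>x. of_bool (W x) \<partial>M) * (\<integral>x. f x \<partial>uniform_measure M {x \<in> space M. W x}) = (\<integral>x. f x * of_bool (W x) \<partial>M)"
proof -
  interpret prob_space M by fact
  define A where "A = {x \<in> space M. W x}"
  have A[measurable]: "A \<in> sets M" using assms(2) by (simp add: A_def)
  have W: "(\<integral>x. h x * of_bool (W x) \<partial>M) = (\<integral>x. h x * indicator A x \<partial>M)" for h :: "'a \<Rightarrow> real"
    by (rule Bochner_Integration.integral_cong) (auto simp: A_def indicator_def)
  have P: "(\<integral>x. of_bool (W x) \<partial>M) = prob A" using W[of "\<lambda>_. 1"] by simp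
  show ?thesis
  proof (cases "prob A = 0")
    case True
    then have "AE x in M. x \<notin> A" by (simp add: prob_eq_0)
    then have "AE x in M. f x * indicator A x = 0" by eventually_elim simp
    then have "(\<integral>x. f x * indicator A x \<partial>M) = 0" by (rule integral_eq_zero_AE)
    then show ?thesis using True by (simp add: P W)
  next
    case False
    then have "0 < prob A" by (simp add: zero_less_measure_iff)
    have "uniform_measure M A = density M (\<lambda>x. ennreal (indicator A x / prob A))"
      unfolding uniform_measure_def using \<open>0 < prob A\<close>
      by (intro arg_cong[where f="density M"] ext) (auto simp: indicator_def emeasure_eq_measure divide_ennreal[symmetric])
    then have "(\<integral>x. f x \<partial>uniform_measure M A) = (\<integral>x. (indicator A x / prob A) *\<^sub>R f x \<partial>M)"
      using assms(3) by (simp add: integral_density)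
    also have "\<dots> = (\<integral>x. (f x * indicator A x) / prob A \<partial>M)" by (simp add: mult.commute)
    also have "\<dots> = (\<integral>x. f x * indicator A x \<partial>M) / prob A" by (rule integral_divide_zero)
    finally show ?thesis using \<open>0 < prob A\<close> unfolding A_def[symmetric] P W by simp
  qed
qed

context light_laws
begin

lemma tail_smallo: "(\<lambda>n. 2 / (1 / r n) * ((\<integral>x. x\<^sup>2 * of_bool (1 / r n / 2 \<le> x) \<partial>\<nu> n) * law_rate (\<nu> n))) \<in> o(r)"
proof -
  have "(\<lambda>n. 2 * (Q (1 / (2 * r n)) n * law_rate (\<nu> n))) \<longlonglongrightarrow> 2 * (0 * lam)"
    by (intro tendsto_intros Qr_tendsto rate)
  then have "(\<lambda>n. 2 * (Q (1 / (2 * r n)) n * law_rate (\<nu> n))) \<in> o(\<lambda>_. 1)" by (intro tendsto_0_imp_smallo_1) simp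
  from landau_o.big_small_mult[OF landau_o.big_refl this, of r] show ?thesis
    by (simp add: Q_def mult_ac)
qed

text \<open>The level for splitting the clocks: high enough for the excess beyond it to vanish, low
  enough that its product with an idle probability, which is of order r, vanishes as well.\<close>

lemma sqrt_r: "filterlim (\<lambda>n. 1 / sqrt (r n)) at_top sequentially" "(\<lambda>n. r n * (1 / sqrt (r n))) \<longlonglongrightarrow> 0"
proof -
  have s: "(\<lambda>n. sqrt (r n)) \<longlonglongrightarrow> 0" using tendsto_real_sqrt[OF r_lim] by simp
  have "filterlim (\<lambda>n. inverse (sqrt (r n))) at_top sequentially"
    by (rule filterlim_inverse_at_top[OF s]) (simp add: r_pos)
  then show "filterlim (\<lambda>n. 1 / sqrt (r n)) at_top sequentially" by (simp add: inverse_eq_divide)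
  show "(\<lambda>n. r n * (1 / sqrt (r n))) \<longlonglongrightarrow> 0" using s r_pos by (simp add: real_div_sqrt less_imp_le)
qed

lemma tail_rate_tendsto: "(\<lambda>n. (\<integral>x. x\<^sup>2 * of_bool (1 / sqrt (r n) \<le> x) \<partial>\<nu> n) * law_rate (\<nu> n)) \<longlonglongrightarrow> 0"
  using tendsto_mult[OF Q_tendsto[OF sqrt_r(1)] rate] by (simp add: Q_def)

end

section \<open>From the adjoint relation to the limit\<close>

context heavy_traffic_sequence
begin

definition "S = covariance P lamE sigE lamS sigS"
definition "H n = (\<Sum>i\<in>E. \<eta> n i) + (\<Sum>j\<in>UNIV. \<zeta> n j)"
definition "sE n i = (lamE $ i) ^ 3 * (sigE $ i)\<^sup>2 / 2 * (\<tau> n $ i)\<^sup>2"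
definition "sS n j = lamS $ j / 2 * ((p n j)\<^sup>2 - p2 n j) - (lamS $ j) ^ 3 * (sigS $ j)\<^sup>2 / 2 * (\<tau> n $ j - p n j)\<^sup>2"
definition "A n = (\<Sum>i\<in>UNIV. \<bar>\<eta> n i\<bar>) + (\<Sum>j\<in>UNIV. \<bar>\<zeta> n j\<bar>)"
definition "K n = exp (2 * (real CARD('d) * (A n * (1 / r n))))"

text \<open>Each linear term of a root is only O(\<rho>), too large for the target. With the
  prelimit rates the traffic equation cancels them exactly, except for the gap r b between service
  and total arrival rates.\<close>

lemma first_order:
  "(\<Sum>j\<in>UNIV. law_rate (Ts n j) * (\<tau> n $ j - p n j)) - (\<Sum>i\<in>E. law_rate (Te n i) * \<tau> n $ i) = r n * ((reflection P *v b) \<bullet> \<tau> n)"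
proof -
  have inv: "invertible (mat 1 - transpose P)"
    using matrix_inv_1_minus_transpose(2)[OF routing] matrix_left_right_inverse unfolding invertible_def by blast
  have t: "reflection P *v total_rate E P (Te n) = ext_rate E (Te n)"
    unfolding total_rate_def reflection_def matrix_vector_mul_assoc matrix_inv_inverse(2)[OF inv] by simp
  have s: "svc_rate (Ts n) = total_rate E P (Te n) + r n *\<^sub>R b" using traffic[of n] by (simp add: algebra_simps)
  have "(\<Sum>j\<in>UNIV. law_rate (Ts n j) * (\<tau> n $ j - p n j)) = (reflection P *v svc_rate (Ts n)) \<bullet> \<tau> n"
    unfolding reflection_inner by (simp add: svc_rate_def p_def)
  also have "\<dots> = ext_rate E (Te n) \<bullet> \<tau> n + r n * ((reflection P *v b) \<bullet> \<tau> n)"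
    unfolding s matrix_vector_right_distrib t matrix_vector_mult_scaleR by (simp add: inner_add_left)
  also have "ext_rate E (Te n) \<bullet> \<tau> n = (\<Sum>i\<in>E. law_rate (Te n i) * \<tau> n $ i)"
    by (simp add: inner_vec_def ext_rate_def if_distrib[of "\<lambda>x. x * _"] sum.If_cases cong: if_cong)
  finally show ?thesis by simp
qed

lemma scaled_gamma:
  "(r n)\<^sup>2 * gamma S (reflection P) b (\<theta> n) = (\<Sum>i\<in>E. sE n i) - (\<Sum>j\<in>UNIV. sS n j) - r n * ((reflection P *v b) \<bullet> \<tau> n)"
proof -
  have e: "(\<Sum>i\<in>UNIV. (lamE $ i) ^ 3 * (sigE $ i)\<^sup>2 * (\<tau> n $ i)\<^sup>2) = 2 * (\<Sum>i\<in>E. sE n i)"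
    unfolding sum_distrib_left sE_def by (rule sum.mono_neutral_cong_right) (auto simp: lamE0)
  have s: "(\<Sum>k\<in>UNIV. lamS $ k * (p2 n k - (p n k)\<^sup>2 + (lamS $ k)\<^sup>2 * (sigS $ k)\<^sup>2 * (\<tau> n $ k - p n k)\<^sup>2)) = - 2 * (\<Sum>j\<in>UNIV. sS n j)"
    unfolding sum_distrib_left sS_def by (rule sum.cong) (auto simp: power3_eq_cube power2_eq_square field_simps)
  have "\<tau> n \<bullet> (S *v \<tau> n) = - 2 * (\<Sum>j\<in>UNIV. sS n j) + 2 * (\<Sum>i\<in>E. sE n i)"
    unfolding S_def covariance_quadratic_form e p_def[symmetric] p2_def[symmetric] s ..
  moreover have "(r n)\<^sup>2 * gamma S (reflection P) b (\<theta> n) = 1 / 2 * (\<tau> n \<bullet> (S *v \<tau> n)) - r n * ((reflection P *v b) \<bullet> \<tau> n)"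
    unfolding gamma_def \<tau>_def matrix_vector_mult_scaleR by (simp add: power2_eq_square algebra_simps)
  ultimately show ?thesis by simp
qed

text \<open>The linear parts of the roots add up to the drift of \<open>gamma\<close>, the quadratic
  parts to its covariance form, with opposite sign.\<close>

lemma H_expansion: "(\<lambda>n. H n + (r n)\<^sup>2 * gamma S (reflection P) b (\<theta> n)) \<in> o(\<lambda>n. r n * \<rho> n)"
proof -
  have "H n + (r n)\<^sup>2 * gamma S (reflection P) b (\<theta> n)
    = (\<Sum>i\<in>E. \<eta> n i - (- law_rate (Te n i) * \<tau> n $ i - (lamE $ i) ^ 3 * (sigE $ i)\<^sup>2 / 2 * (\<tau> n $ i)\<^sup>2))
     + (\<Sum>j\<in>UNIV. \<zeta> n j - (law_rate (Ts n j) * (\<tau> n $ j - p n j) + lamS $ j / 2 * ((p n j)\<^sup>2 - p2 n j)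
       - (lamS $ j) ^ 3 * (sigS $ j)\<^sup>2 / 2 * (\<tau> n $ j - p n j)\<^sup>2))" for n
    unfolding scaled_gamma first_order[symmetric] H_def sE_def sS_def
    by (simp add: sum.distrib sum_subtractf sum_negf)
  then show ?thesis
    by (simp only:) (intro sum_in_smallo(1) big_sum_in_smallo \<eta>_expansion(2) \<zeta>_expansion(2))
qed

lemma sS_O: "(\<lambda>n. sS n j) \<in> O(\<lambda>n. r n * \<rho> n)"
proof -
  have d: "(\<lambda>n. \<tau> n $ j - p n j) \<in> O(\<rho>)" by (rule sum_in_bigo(2)[OF \<tau>_O p_O])
  have "(\<lambda>n. lamS $ j / 2 * ((p n j)\<^sup>2 - p2 n j)) \<in> O(\<lambda>n. r n * \<rho> n)"
    unfolding power2_eq_square by (rule bigo_cmult[OF sum_in_bigo(2)[OF mult_OO[OF p_O p_O] p2_O]])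
  moreover have "(\<lambda>n. (lamS $ j) ^ 3 * (sigS $ j)\<^sup>2 / 2 * (\<tau> n $ j - p n j)\<^sup>2) \<in> O(\<lambda>n. r n * \<rho> n)"
    unfolding power2_eq_square by (rule bigo_cmult[OF mult_OO[OF d d]])
  ultimately show ?thesis unfolding sS_def by (rule sum_in_bigo(2))
qed

text \<open>The sum of the roots is one order smaller than the single roots. In the interior term it
  therefore suffices to replace the test function up to o(1), while the boundary terms, with single
  roots in front, require o(r).\<close>

lemma H_O: "H \<in> O(\<lambda>n. r n * \<rho> n)"
proof -
  have 1: "(\<lambda>n. \<Sum>i\<in>E. sE n i) \<in> O(\<lambda>n. r n * \<rho> n)"
    unfolding sE_def power2_eq_square by (rule big_sum_in_bigo) (rule bigo_cmult[OF mult_OO[OF \<tau>_O \<tau>_O]])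
  have 2: "(\<lambda>n. \<Sum>j\<in>UNIV. sS n j) \<in> O(\<lambda>n. r n * \<rho> n)" by (rule big_sum_in_bigo) (rule sS_O)
  have 3: "(\<lambda>n. (reflection P *v b) \<bullet> \<tau> n) \<in> O(\<rho>)"
    unfolding inner_vec_def by (rule big_sum_in_bigo) (use \<tau>_O in simp)
  have "(\<lambda>n. r n * ((reflection P *v b) \<bullet> \<tau> n)) \<in> O(\<lambda>n. r n * \<rho> n)" by (rule landau_o.big.mult[OF landau_o.big_refl 3])
  with 1 2 have "(\<lambda>n. (r n)\<^sup>2 * gamma S (reflection P) b (\<theta> n)) \<in> O(\<lambda>n. r n * \<rho> n)"
    unfolding scaled_gamma by (intro sum_in_bigo(2))
  from sum_in_bigo(2)[OF landau_o.small_imp_big[OF H_expansion] this] show ?thesis by simp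
qed

lemma A_O: "A \<in> O(\<rho>)"
proof -
  have e: "(\<lambda>n. \<eta> n i) \<in> O(\<rho>)" for i
  proof (cases "i \<in> E")
    case False
    then show ?thesis by (simp add: \<eta>_def)
  qed (rule \<eta>_expansion(1))
  show ?thesis unfolding A_def[abs_def]
    by (intro sum_in_bigo(1) big_sum_in_bigo) (use e \<zeta>_expansion(1) in simp_all)
qed

lemma \<eta>_A: "\<bar>\<eta> n i\<bar> \<le> A n" and \<zeta>_A: "\<bar>\<zeta> n i\<bar> \<le> A n"
proof -
  have "\<bar>\<eta> n i\<bar> \<le> (\<Sum>i\<in>UNIV. \<bar>\<eta> n i\<bar>)" "\<bar>\<zeta> n i\<bar> \<le> (\<Sum>i\<in>UNIV. \<bar>\<zeta> n i\<bar>)"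
    by (rule member_le_sum[where f="\<lambda>i. \<bar>\<eta> n i\<bar>"] member_le_sum[where f="\<lambda>i. \<bar>\<zeta> n i\<bar>"]; simp)+
  moreover have "0 \<le> (\<Sum>i\<in>UNIV. \<bar>\<eta> n i\<bar>)" "0 \<le> (\<Sum>i\<in>UNIV. \<bar>\<zeta> n i\<bar>)" by (auto intro: sum_nonneg)
  ultimately show "\<bar>\<eta> n i\<bar> \<le> A n" "\<bar>\<zeta> n i\<bar> \<le> A n" by (simp_all add: A_def)
qed

lemma A_nonneg: "0 \<le> A n" and K_pos: "0 < K n"
  using \<eta>_A[of n undefined] by (simp_all add: K_def)

lemma K_O: "K \<in> O(\<lambda>_. 1)"
proof -
  obtain Y where Y: "0 < Y" "\<forall>\<^sub>F n in sequentially. norm (A n) \<le> Y * norm (r n)"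
    using landau_o.big_trans[OF A_O \<rho>_r] by (elim landau_o.bigE)
  show ?thesis
  proof (rule bigoI[where c="exp (2 * (real CARD('d) * Y))"])
    show "\<forall>\<^sub>F n in sequentially. norm (K n) \<le> exp (2 * (real CARD('d) * Y)) * norm (1::real)"
      using Y(2)
    proof eventually_elim
      case (elim n)
      then have "A n * (1 / r n) \<le> Y" using r_pos[of n] A_nonneg[of n] by (simp add: field_simps)
      then have "2 * (real CARD('d) * (A n * (1 / r n))) \<le> 2 * (real CARD('d) * Y)" by (intro mult_left_mono) auto
      then have "K n \<le> exp (2 * (real CARD('d) * Y))" unfolding K_def by (rule exp_le_cancel_iff[THEN iffD2])
      then show ?case using K_pos[of n] by simp
    qed
  qed
qed

lemma AK_O: "(\<lambda>n. A n * K n) \<in> O(\<rho>)"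
  using landau_o.big.mult[OF A_O K_O] by simp

lemma cut_pos: "0 < 1 / r n"
  using r_pos by simp

lemma prob_\<pi>: "prob_space (\<pi> n)" and sets_\<pi>: "sets (\<pi> n) = sets state_algebra"
  using st[of n] by (auto simp: stationary_def)

definition "F n W = (\<integral>x. root_fun E (\<tau> n) (1 / r n) (\<eta> n) (\<zeta> n) x * of_bool (W x) \<partial>\<pi> n)"
definition "G n W = (\<integral>x. queue_exp (\<tau> n) x * of_bool (W x) \<partial>\<pi> n)"

lemma adjoint_roots_small: "(\<lambda>n. H n * F n (\<lambda>_. True) - (\<Sum>j\<in>UNIV. \<zeta> n j * F n (\<lambda>x. fst x $ j = 0))) \<in> o(\<lambda>n. r n * \<rho> n)"
proof -
  define T where "T n = (\<Sum>i\<in>E. 2 / (1 / r n) * ((\<integral>x. x\<^sup>2 * of_bool (1 / r n / 2 \<le> x) \<partial>Te n i) * law_rate (Te n i)))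
    + (\<Sum>j\<in>UNIV. 2 / (1 / r n) * ((\<integral>x. x\<^sup>2 * of_bool (1 / r n / 2 \<le> x) \<partial>Ts n j) * law_rate (Ts n j)))" for n
  have "T \<in> o(r)" unfolding T_def[abs_def]
    by (intro sum_in_smallo(1) big_sum_in_smallo) (rule light_laws.tail_smallo light_E light_S; assumption?)+
  from landau_o.big_small_mult[OF AK_O this] have T: "(\<lambda>n. A n * K n * T n) \<in> o(\<lambda>n. r n * \<rho> n)" by (simp add: mult.commute)
  \<comment> \<open>The roots contribute A K = O(\<rho>), the tail probabilities in T contribute
    o(r).\<close>
  have "\<forall>\<^sub>F n in sequentially. norm (H n * F n (\<lambda>_. True) - (\<Sum>j\<in>UNIV. \<zeta> n j * F n (\<lambda>x. fst x $ j = 0))) \<le> 1 * norm (A n * K n * T n)"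
    using eventually_r
  proof eventually_elim
    case (elim n)
    have "\<bar>H n * F n (\<lambda>_. True) - (\<Sum>j\<in>UNIV. \<zeta> n j * F n (\<lambda>x. fst x $ j = 0))\<bar>
      \<le> A n * K n * ((\<Sum>i\<in>E. \<integral>x. of_bool (1 / r n \<le> fst (snd x) $ i) \<partial>\<pi> n) + (\<Sum>j\<in>UNIV. \<integral>x. of_bool (0 < fst x $ j \<and> 1 / r n \<le> snd (snd x) $ j) \<partial>\<pi> n))"
      using jackson.adjoint_roots[OF jack[of n] st[of n] cut_pos[of n] \<tau>_neg[of n] \<eta>_A[of n] \<zeta>_A[of n] \<eta>_root[OF elim] \<zeta>_root[OF elim]]
      by (simp add: H_def F_def K_def)
    also have "\<dots> \<le> A n * K n * T n"
      unfolding T_def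
      by (intro mult_left_mono add_mono sum_mono mult_nonneg_nonneg A_nonneg less_imp_le[OF K_pos]
          jackson.arrival_tail[OF jack[of n] st[of n] cut_pos[of n] \<tau>_neg[of n] \<eta>_A[of n] \<zeta>_A[of n]]
          jackson.service_tail[OF jack[of n] st[of n] cut_pos[of n] \<tau>_neg[of n] \<eta>_A[of n] \<zeta>_A[of n]])
    finally show ?case by simp
  qed
  then show ?thesis by (rule landau_o.big_small_trans[OF bigoI T])
qed

text \<open>The part of the clock means that does not depend on the event W: excesses beyond the
  level 1 / sqrt r and the fresh service times at idle stations.\<close>

definition "V n = (\<Sum>i\<in>E. (\<integral>x. x\<^sup>2 * of_bool (1 / sqrt (r n) \<le> x) \<partial>Te n i) * law_rate (Te n i))
  + (\<Sum>j\<in>UNIV. (\<integral>x. x\<^sup>2 * of_bool (1 / sqrt (r n) \<le> x) \<partial>Ts n j) * law_rate (Ts n j)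
       + (\<integral>x. of_bool (fst x $ j = 0) \<partial>\<pi> n) * (\<integral>x. cutoff (1 / r n) x \<partial>Ts n j))"

lemma idle_tendsto: "(\<lambda>n. \<integral>x. of_bool (fst x $ j = 0) \<partial>\<pi> n) \<longlonglongrightarrow> (0::real)"
proof -
  have "(\<lambda>n. r n * (b $ j / law_rate (Ts n j))) \<longlonglongrightarrow> 0 * (b $ j / lamS $ j)"
    using lamS_pos[of j] by (intro tendsto_intros r_lim rateS) auto
  then show ?thesis unfolding idle_prob by simp
qed

lemma V_tendsto: "V \<longlonglongrightarrow> 0"
proof -
  have m: "(\<lambda>n. \<integral>x. cutoff (1 / r n) x \<partial>Ts n j) \<longlonglongrightarrow> 1 / lamS $ j" for j
    using light_laws.m1_tendsto[OF light_S, of j] by (simp add: light_laws.m1_def[OF light_S, abs_def])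
  have "V \<longlonglongrightarrow> (\<Sum>i\<in>E. 0) + (\<Sum>j\<in>UNIV. 0 + 0 * (1 / lamS $ j))"
    unfolding V_def[abs_def]
    by (intro tendsto_add tendsto_sum tendsto_mult[OF idle_tendsto m] light_laws.tail_rate_tendsto[OF light_E] light_laws.tail_rate_tendsto[OF light_S])
  then show ?thesis by simp
qed

lemma root_gap:
  assumes W: "Measurable.pred (\<pi> n) W"
  shows "\<bar>F n W - G n W\<bar> \<le> A n * K n * ((real (card E) + real CARD('d)) * (1 / sqrt (r n) * (\<integral>x. of_bool (W x) \<partial>\<pi> n)) + V n)"
proof -
  note J = jack[of n] st[of n] cut_pos[of n] \<tau>_neg[of n] \<eta>_A[of n] \<zeta>_A[of n]
  have k: "0 \<le> 1 / sqrt (r n)" using r_pos[of n] by simp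
  let ?u = "1 / sqrt (r n) * (\<integral>x. of_bool (W x) \<partial>\<pi> n)"
  have "\<bar>F n W - G n W\<bar> \<le> A n * K n * ((\<Sum>i\<in>E. \<integral>x. cutoff (1 / r n) (fst (snd x) $ i) * of_bool (W x) \<partial>\<pi> n) + (\<Sum>j\<in>UNIV. \<integral>x. cutoff (1 / r n) (snd (snd x) $ j) * of_bool (W x) \<partial>\<pi> n))"
    unfolding F_def G_def K_def by (rule jackson.root_fun_near_queue_exp[OF J W])
  also have "\<dots> \<le> A n * K n * ((\<Sum>i\<in>E. ?u + (\<integral>x. x\<^sup>2 * of_bool (1 / sqrt (r n) \<le> x) \<partial>Te n i) * law_rate (Te n i))
     + (\<Sum>j\<in>UNIV. ?u + (\<integral>x. x\<^sup>2 * of_bool (1 / sqrt (r n) \<le> x) \<partial>Ts n j) * law_rate (Ts n j)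
       + (\<integral>x. of_bool (fst x $ j = 0) \<partial>\<pi> n) * (\<integral>x. cutoff (1 / r n) x \<partial>Ts n j)))"
    by (intro mult_left_mono add_mono[OF sum_mono sum_mono] mult_nonneg_nonneg A_nonneg less_imp_le[OF K_pos]
        jackson.arrival_clock_mean[OF J _ k W] jackson.service_clock_mean[OF J k W connected])
  also have "\<dots> = A n * K n * ((real (card E) + real CARD('d)) * ?u + V n)"
    unfolding V_def sum.distrib sum_constant by (simp add: distrib_right add_divide_distrib)
  finally show ?thesis .
qed

lemma root_gap_O:
  assumes W: "\<And>n. Measurable.pred (\<pi> n) W"
  shows "(\<lambda>n. F n W - G n W) \<in> O(\<lambda>n. r n * ((real (card E) + real CARD('d)) * (1 / sqrt (r n) * (\<integral>x. of_bool (W x) \<partial>\<pi> n)) + V n))"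
proof (rule landau_o.big_trans)
  show "(\<lambda>n. F n W - G n W) \<in> O(\<lambda>n. A n * K n * ((real (card E) + real CARD('d)) * (1 / sqrt (r n) * (\<integral>x. of_bool (W x) \<partial>\<pi> n)) + V n))"
  proof (rule bigoI[where c=1], rule always_eventually, rule allI)
    show "norm (F n W - G n W) \<le> 1 * norm (A n * K n * ((real (card E) + real CARD('d)) * (1 / sqrt (r n) * (\<integral>x. of_bool (W x) \<partial>\<pi> n)) + V n))" for n
      using root_gap[OF W, of n] by simp
  qed
  show "(\<lambda>n. A n * K n * ((real (card E) + real CARD('d)) * (1 / sqrt (r n) * (\<integral>x. of_bool (W x) \<partial>\<pi> n)) + V n))
     \<in> O(\<lambda>n. r n * ((real (card E) + real CARD('d)) * (1 / sqrt (r n) * (\<integral>x. of_bool (W x) \<partial>\<pi> n)) + V n))"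
    by (rule landau_o.big.mult[OF landau_o.big_trans[OF AK_O \<rho>_r] landau_o.big_refl])
qed

lemma sqrt_r: "(\<lambda>n. r n * (1 / sqrt (r n))) \<longlonglongrightarrow> 0"
  by (rule light_laws.sqrt_r(2)[OF light_S])

text \<open>Here W has probability 1, and the gap is O(r (1 / sqrt r + V)).\<close>

lemma root_gap_True: "(\<lambda>n. F n (\<lambda>_. True) - G n (\<lambda>_. True)) \<in> o(\<lambda>_. 1)"
proof -
  have 1: "(\<integral>x. of_bool True \<partial>\<pi> n) = (1::real)" for n
    using prob_space.prob_space[OF prob_\<pi>, of n] by simp
  have "(\<lambda>n. (real (card E) + real CARD('d)) * (r n * (1 / sqrt (r n))) + r n * V n) \<longlonglongrightarrow> (real (card E) + real CARD('d)) * 0 + 0 * 0"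
    by (intro tendsto_intros sqrt_r r_lim V_tendsto)
  then have "(\<lambda>n. r n * ((real (card E) + real CARD('d)) * (1 / sqrt (r n) * 1) + V n)) \<in> o(\<lambda>_. 1)"
    by (intro tendsto_0_imp_smallo_1) (simp add: algebra_simps)
  then have s: "(\<lambda>n. r n * ((real (card E) + real CARD('d)) * (1 / sqrt (r n) * (\<integral>x. of_bool True \<partial>\<pi> n)) + V n)) \<in> o(\<lambda>_. 1)" unfolding 1 .
  show ?thesis by (rule landau_o.big_small_trans[OF root_gap_O s]) simp
qed

lemma queue_measurable: "(\<lambda>x. fst x $ j) \<in> \<pi> n \<rightarrow>\<^sub>M count_space UNIV"
  by (rule measurable_state_queue[OF jackson.id_\<pi>[OF jack[of n] st[of n] cut_pos[of n] \<tau>_neg[of n] \<eta>_A[of n] \<zeta>_A[of n]]])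

text \<open>Idleness has probability of order r, so the bracket in the gap bound is O(sqrt r) + V
  and tends to 0; the factor r in front is kept.\<close>

lemma root_gap_idle: "(\<lambda>n. F n (\<lambda>x. fst x $ j = 0) - G n (\<lambda>x. fst x $ j = 0)) \<in> o(r)"
proof -
  note [measurable] = queue_measurable
  have "(\<lambda>n. (real (card E) + real CARD('d)) * (r n * (1 / sqrt (r n)) * (b $ j / law_rate (Ts n j))) + V n) \<longlonglongrightarrow> (real (card E) + real CARD('d)) * (0 * (b $ j / lamS $ j)) + 0"
    using lamS_pos[of j] by (intro tendsto_intros sqrt_r rateS V_tendsto) auto
  then have "(\<lambda>n. (real (card E) + real CARD('d)) * (1 / sqrt (r n) * (\<integral>x. of_bool (fst x $ j = 0) \<partial>\<pi> n)) + V n) \<in> o(\<lambda>_. 1)"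
    unfolding idle_prob by (intro tendsto_0_imp_smallo_1) (simp add: mult_ac)
  from landau_o.big_small_mult[OF landau_o.big_refl this, of r]
  have s: "(\<lambda>n. r n * ((real (card E) + real CARD('d)) * (1 / sqrt (r n) * (\<integral>x. of_bool (fst x $ j = 0) \<partial>\<pi> n)) + V n)) \<in> o(r)" by simp
  show ?thesis by (rule landau_o.big_small_trans[OF root_gap_O s]) measurable
qed

lemma G_bound: "\<bar>G n W\<bar> \<le> 1" and G_idle_bound: "\<bar>G n (\<lambda>x. fst x $ j = 0)\<bar> \<le> (\<integral>x. of_bool (fst x $ j = 0) \<partial>\<pi> n)"
proof -
  note [measurable] = queue_measurable jackson.queue_exp_measurable[OF jack[of n] st[of n] cut_pos[of n] \<tau>_neg[of n] \<eta>_A[of n] \<zeta>_A[of n]]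
  interpret prob_space "\<pi> n" by (rule prob_\<pi>)
  have q: "\<bar>queue_exp (\<tau> n) x\<bar> \<le> 1" for x by (rule queue_exp_bound) (rule \<tau>_neg)
  have q1: "\<bar>queue_exp (\<tau> n) x * of_bool c\<bar> \<le> 1" for x c using q[of x] by (cases c) auto
  have "\<bar>G n W\<bar> \<le> (\<integral>x. 1 \<partial>\<pi> n)"
  proof (cases "integrable (\<pi> n) (\<lambda>x. queue_exp (\<tau> n) x * of_bool (W x))")
    case True
    have "\<bar>G n W\<bar> \<le> (\<integral>x. \<bar>queue_exp (\<tau> n) x * of_bool (W x)\<bar> \<partial>\<pi> n)" unfolding G_def by (rule integral_abs_bound)
    also have "\<dots> \<le> (\<integral>x. 1 \<partial>\<pi> n)" using True by (intro integral_mono integrable_abs q1) auto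
    finally show ?thesis .
  qed (simp add: G_def not_integrable_integral_eq)
  then show "\<bar>G n W\<bar> \<le> 1" by (simp add: prob_space)
  have "\<bar>G n (\<lambda>x. fst x $ j = 0)\<bar> \<le> (\<integral>x. \<bar>queue_exp (\<tau> n) x * of_bool (fst x $ j = 0)\<bar> \<partial>\<pi> n)" unfolding G_def by (rule integral_abs_bound)
  also have "\<dots> \<le> (\<integral>x. of_bool (fst x $ j = 0) \<partial>\<pi> n)"
  proof (rule integral_mono)
    show "integrable (\<pi> n) (\<lambda>x. \<bar>queue_exp (\<tau> n) x * of_bool (fst x $ j = 0)\<bar>)"
      by (rule integrable_abs, rule integrable_bounded[OF prob_space_axioms _ q1]) measurable
    show "integrable (\<pi> n) (\<lambda>x. of_bool (fst x $ j = 0) :: real)"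
      by (rule integrable_bounded[OF prob_space_axioms, where B=1]) auto
    show "\<bar>queue_exp (\<tau> n) x * of_bool (fst x $ j = 0)\<bar> \<le> of_bool (fst x $ j = 0)" for x
      using q[of x] by simp
  qed
  finally show "\<bar>G n (\<lambda>x. fst x $ j = 0)\<bar> \<le> (\<integral>x. of_bool (fst x $ j = 0) \<partial>\<pi> n)" .
qed

lemma scaled_queue_exp: "exp (\<theta> n \<bullet> scaled_queue (r n) x) = queue_exp (\<tau> n) x"
  by (simp add: queue_exp_def inner_vec_def scaled_queue_def \<tau>_def mult_ac)

lemma phi_eq: "phi (r n) (\<pi> n) (\<theta> n) = G n (\<lambda>_. True)"
  by (simp add: phi_def scaled_queue_exp G_def)

text \<open>The idle probability is r b / lambda exactly, with lambda the prelimit service rate.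
  This turns integrals over idleness into conditional transforms weighted by b.\<close>

lemma phi_cond_eq:
  "law_rate (Ts n j) * G n (\<lambda>x. fst x $ j = 0) = r n * b $ j * phi_cond (r n) (\<pi> n) j (\<theta> n)"
proof -
  note [measurable] = queue_measurable
  have sp: "space (\<pi> n) = UNIV"
    using sets_eq_imp_space_eq[OF sets_\<pi>, of n] by (simp add: state_algebra_def space_pair_measure)
  have set: "{x. scaled_queue (r n) x $ j = 0} = {x \<in> space (\<pi> n). fst x $ j = 0}"
    using r_pos[of n] by (simp add: scaled_queue_def sp)
  have "G n (\<lambda>x. fst x $ j = 0) = (\<integral>x. of_bool (fst x $ j = 0) \<partial>\<pi> n) * phi_cond (r n) (\<pi> n) j (\<theta> n)"
    unfolding G_def phi_cond_def set scaled_queue_exp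
  proof (rule integral_uniform_measure[symmetric])
    show "prob_space (\<pi> n)" by (rule prob_\<pi>)
    show "queue_exp (\<tau> n) \<in> borel_measurable (\<pi> n)"
      by (rule jackson.queue_exp_measurable[OF jack[of n] st[of n] cut_pos[of n] \<tau>_neg[of n] \<eta>_A[of n] \<zeta>_A[of n]])
  qed measurable
  then show ?thesis unfolding idle_prob using law_rate_pos[OF Ts, of n j] by (simp add: field_simps)
qed

lemma scaled_boundary:
  "(r n)\<^sup>2 * (b $ j * gamma_bdry (reflection P) j (\<theta> n) * phi_cond (r n) (\<pi> n) j (\<theta> n))
    = law_rate (Ts n j) * (\<tau> n $ j - p n j) * G n (\<lambda>x. fst x $ j = 0)"
proof -
  have "\<tau> n $ j - p n j = r n * gamma_bdry (reflection P) j (\<theta> n)"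
    unfolding gamma_bdry_reflection p_def \<tau>_def by (simp add: right_diff_distrib sum_distrib_left mult_ac)
  then have "law_rate (Ts n j) * (\<tau> n $ j - p n j) * G n (\<lambda>x. fst x $ j = 0)
    = r n * gamma_bdry (reflection P) j (\<theta> n) * (law_rate (Ts n j) * G n (\<lambda>x. fst x $ j = 0))" by simp
  then show ?thesis unfolding phi_cond_eq by (simp add: power2_eq_square mult_ac)
qed

lemma eps_tendsto: "(\<lambda>n. eps S (reflection P) b (r n) (\<pi> n) (\<theta> n) / norm (\<theta> n)) \<longlonglongrightarrow> 0"
proof -
  let ?s = "o(\<lambda>n. r n * \<rho> n)" and ?I = "\<lambda>j x. fst x $ j = 0" and ?g = "\<lambda>n. gamma S (reflection P) b (\<theta> n)"
  have 1: "(\<lambda>n. H n * (F n (\<lambda>_. True) - G n (\<lambda>_. True))) \<in> ?s" by (rule mult_O_zero[OF H_O root_gap_True])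
  have G1: "(\<lambda>n. G n (\<lambda>_. True)) \<in> O(\<lambda>_. 1)" by (rule bounded_imp_bigo_1) (rule G_bound)
  have 2: "(\<lambda>n. (H n + (r n)\<^sup>2 * ?g n) * G n (\<lambda>_. True)) \<in> ?s" by (rule mult_o_one[OF H_expansion G1])
  have 3: "(\<lambda>n. \<Sum>j\<in>UNIV. \<zeta> n j * (F n (?I j) - G n (?I j))) \<in> ?s"
  proof (rule big_sum_in_smallo)
    fix j
    from landau_o.big_small_mult[OF \<zeta>_expansion(1)[of j] root_gap_idle[of j]]
    show "(\<lambda>n. \<zeta> n j * (F n (?I j) - G n (?I j))) \<in> ?s" by (simp add: mult.commute)
  qed
  have 4: "(\<lambda>n. \<Sum>j\<in>UNIV. (\<zeta> n j - law_rate (Ts n j) * (\<tau> n $ j - p n j)) * G n (?I j)) \<in> ?s"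
  proof (rule big_sum_in_smallo)
    fix j
    have "(\<lambda>n. \<zeta> n j - (law_rate (Ts n j) * (\<tau> n $ j - p n j) + sS n j)) \<in> ?s"
      using \<zeta>_expansion(2)[of j] by (simp add: sS_def add_diff_eq)
    from sum_in_bigo(1)[OF landau_o.small_imp_big[OF this] sS_O[of j]]
    have z: "(\<lambda>n. \<zeta> n j - law_rate (Ts n j) * (\<tau> n $ j - p n j)) \<in> O(\<lambda>n. r n * \<rho> n)" by simp
    \<comment> \<open>The second-order part of a service root is only O(r \<rho>); in the boundary
      term the vanishing idle probability makes up for it.\<close>
    have "(\<lambda>n. G n (?I j)) \<longlonglongrightarrow> 0"
      by (rule Lim_null_comparison[OF _ idle_tendsto[of j]]) (use G_idle_bound in simp)
    from mult_O_zero[OF z tendsto_0_imp_smallo_1[OF this]]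
    show "(\<lambda>n. (\<zeta> n j - law_rate (Ts n j) * (\<tau> n $ j - p n j)) * G n (?I j)) \<in> ?s" .
  qed
  \<comment> \<open>An exact identity: the adjoint relation at the roots, corrected by four
    replacements, namely F by G and H by - r^2 gamma in the interior, F by G and the service roots
    by their linear parts at the boundary.\<close>
  have "- ((r n)\<^sup>2 * eps S (reflection P) b (r n) (\<pi> n) (\<theta> n))
    = (H n * F n (\<lambda>_. True) - (\<Sum>j\<in>UNIV. \<zeta> n j * F n (?I j))) - H n * (F n (\<lambda>_. True) - G n (\<lambda>_. True))
      - (H n + (r n)\<^sup>2 * ?g n) * G n (\<lambda>_. True) + (\<Sum>j\<in>UNIV. \<zeta> n j * (F n (?I j) - G n (?I j)))
      + (\<Sum>j\<in>UNIV. (\<zeta> n j - law_rate (Ts n j) * (\<tau> n $ j - p n j)) * G n (?I j))" for n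
    unfolding eps_def phi_eq distrib_left sum_distrib_left scaled_boundary
    by (simp add: left_diff_distrib right_diff_distrib distrib_right sum_subtractf mult.assoc)
  moreover have "(\<lambda>n. (H n * F n (\<lambda>_. True) - (\<Sum>j\<in>UNIV. \<zeta> n j * F n (?I j))) - H n * (F n (\<lambda>_. True) - G n (\<lambda>_. True))
      - (H n + (r n)\<^sup>2 * ?g n) * G n (\<lambda>_. True) + (\<Sum>j\<in>UNIV. \<zeta> n j * (F n (?I j) - G n (?I j)))
      + (\<Sum>j\<in>UNIV. (\<zeta> n j - law_rate (Ts n j) * (\<tau> n $ j - p n j)) * G n (?I j))) \<in> ?s"
    by (rule sum_in_smallo(1)[OF sum_in_smallo(1)[OF sum_in_smallo(2)[OF sum_in_smallo(2)[OF adjoint_roots_small 1] 2] 3] 4])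
  ultimately have "(\<lambda>n. - ((r n)\<^sup>2 * eps S (reflection P) b (r n) (\<pi> n) (\<theta> n))) \<in> ?s" by simp
  then have "(\<lambda>n. - ((r n)\<^sup>2 * eps S (reflection P) b (r n) (\<pi> n) (\<theta> n)) / (r n * \<rho> n)) \<longlonglongrightarrow> 0" by (rule smalloD_tendsto)
  moreover have "- ((r n)\<^sup>2 * eps S (reflection P) b (r n) (\<pi> n) (\<theta> n)) / (r n * \<rho> n) = - (eps S (reflection P) b (r n) (\<pi> n) (\<theta> n) / norm (\<theta> n))" for n
    using r_pos[of n] \<theta>(2)[of n] by (simp add: \<rho>_def power2_eq_square)
  ultimately show ?thesis using tendsto_minus_cancel_left[of "\<lambda>n. eps S (reflection P) b (r n) (\<pi> n) (\<theta> n) / norm (\<theta> n)" 0] by simp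
qed

end

theorem proposition4p1:
  fixes E :: "'d::finite set"
    and P :: "real^'d^'d"
    and Te Ts :: "nat \<Rightarrow> 'd \<Rightarrow> real measure"
    and r :: "nat \<Rightarrow> real"
    and b lamE sigE lamS sigS :: "real^'d"
    and \<pi> :: "nat \<Rightarrow> 'd state measure"
    and M :: real
  assumes routing: "routing_matrix P"
    and interarrival_laws: "\<And>n i. i \<in> E \<Longrightarrow> time_law (Te n i)"
    and service_laws: "\<And>n j. time_law (Ts n j)"
    and b_pos: "\<And>j. 0 < b $ j"
    and r_pos: "\<And>n. 0 < r n"
    and r_lim: "r \<longlonglongrightarrow> 0"
    and heavy_traffic: "\<And>n. svc_rate (Ts n) - total_rate E P (Te n) = r n *\<^sub>R b"
    and harris: "\<And>n. positive_harris_recurrent E P (Te n) (Ts n)"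
    and sigE_lim: "(\<lambda>n. ext_sd E (Te n)) \<longlonglongrightarrow> sigE"
    and lamE_lim: "(\<lambda>n. ext_rate E (Te n)) \<longlonglongrightarrow> lamE"
    and lamE_pos: "\<And>i. i \<in> E \<Longrightarrow> 0 < lamE $ i"
    and sigS_lim: "(\<lambda>n. svc_sd (Ts n)) \<longlonglongrightarrow> sigS"
    and interarrival_ui: "\<And>i. i \<in> E \<Longrightarrow> unif_integrable (\<lambda>n. Te n i) (\<lambda>x. x\<^sup>2)"
    and service_ui: "\<And>j. unif_integrable (\<lambda>n. Ts n j) (\<lambda>x. x\<^sup>2)"
    and lamS_def: "lamS = matrix_inv (mat 1 - transpose P) *v lamE"
    and pos_def: "\<And>\<theta>. \<theta> \<noteq> 0 \<Longrightarrow> 0 < \<theta> \<bullet> (covariance P lamE sigE lamS sigS *v \<theta>)"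
    and stationary: "\<And>n. stationary E P (Te n) (Ts n) (\<pi> n)"
    and M_pos: "0 < M"
    and eta: "\<And>\<theta> n i. norm \<theta> \<le> M \<Longrightarrow> i \<in> E \<Longrightarrow>
      \<exists>\<eta>. exp (\<theta> $ i) * (\<integral>x. exp (\<eta> * min x (1 / r n)) \<partial>Te n i) = 1"
    and zeta: "\<And>\<theta> n j. norm \<theta> \<le> M \<Longrightarrow>
      \<exists>\<zeta>. t_fun P j \<theta> * (\<integral>x. exp (\<zeta> * min x (1 / r n)) \<partial>Ts n j) = 1"
  shows "(\<lambda>n. SUP \<theta>\<in>{\<theta>. (\<forall>i. \<theta> $ i < 0) \<and> 0 < norm \<theta> \<and> norm \<theta> \<le> M}.
      ereal (\<bar>eps (covariance P lamE sigE lamS sigS) (reflection P) b (r n) (\<pi> n) \<theta>\<bar> / norm \<theta>))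
    \<longlonglongrightarrow> 0"
proof -
  interpret heavy_traffic E P Te Ts r b lamE sigE lamS sigS \<pi> M
    by unfold_locales (fact assms)+
  define T where "T = {\<theta> :: real^'d. (\<forall>i. \<theta> $ i < 0) \<and> 0 < norm \<theta> \<and> norm \<theta> \<le> M}"
  define f where "f n \<theta> = \<bar>eps (covariance P lamE sigE lamS sigS) (reflection P) b (r n) (\<pi> n) \<theta>\<bar> / norm \<theta>" for n \<theta>
  \<comment> \<open>All coordinates are negative and the norm is M. This point shows that the set is
    nonempty, so its supremum is not minus infinity, and it serves as the default below.\<close>
  define \<theta>0 :: "real^'d" where "\<theta>0 = - (M / norm (vec 1 :: real^'d)) *\<^sub>R vec 1"
  have n1: "0 < norm (vec 1 :: real^'d)" by (simp add: vec_eq_iff)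
  then have t0: "\<theta>0 \<in> T" using M_pos by (simp add: T_def \<theta>0_def)
  have ev: "\<forall>\<^sub>F n in sequentially. \<forall>\<theta>\<in>T. f n \<theta> \<le> e" if e: "0 < e" for e :: real
  proof -
    \<comment> \<open>A violator of the bound e wherever one exists. Convergence along this single
      sequence means that from some index on there is none, which is the uniform bound.\<close>
    define \<theta> where "\<theta> n = (if \<exists>\<theta>\<in>T. e < f n \<theta> then SOME \<theta>. \<theta> \<in> T \<and> e < f n \<theta> else \<theta>0)" for n
    have \<theta>_T: "\<theta> n \<in> T" "(\<exists>\<theta>\<in>T. e < f n \<theta>) \<Longrightarrow> e < f n (\<theta> n)" for n
      using someI_ex[of "\<lambda>\<theta>. \<theta> \<in> T \<and> e < f n \<theta>"] t0 by (auto simp: \<theta>_def)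
    interpret heavy_traffic_sequence E P Te Ts r b lamE sigE lamS sigS \<pi> M \<theta>
      by unfold_locales (use \<theta>_T(1) in \<open>auto simp: T_def\<close>)
    have "(\<lambda>n. f n (\<theta> n)) \<longlonglongrightarrow> 0" using tendsto_rabs_zero[OF eps_tendsto] by (simp add: f_def S_def)
    then have "\<forall>\<^sub>F n in sequentially. f n (\<theta> n) < e" using e by (rule order_tendstoD(2))
    then show ?thesis
    proof eventually_elim
      case (elim n)
      show ?case
      proof (rule ballI, rule ccontr)
        fix \<theta>' assume "\<theta>' \<in> T" "\<not> f n \<theta>' \<le> e"
        then have "\<exists>\<theta>\<in>T. e < f n \<theta>" by (intro bexI[of _ \<theta>']) auto
        from \<theta>_T(2)[OF this] elim show False by simp
      qed
    qed
  qed
  have "(\<lambda>n. SUP \<theta>\<in>T. ereal (f n \<theta>)) \<longlonglongrightarrow> 0"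
  proof (rule order_tendstoI)
    fix a :: ereal assume "a < 0"
    moreover have "0 \<le> (SUP \<theta>\<in>T. ereal (f n \<theta>))" for n by (rule SUP_upper2[OF t0]) (simp add: f_def)
    ultimately show "\<forall>\<^sub>F n in sequentially. a < (SUP \<theta>\<in>T. ereal (f n \<theta>))" by (intro always_eventually allI) (rule order.strict_trans2)
  next
    fix a :: ereal assume "0 < a"
    then obtain e where e: "0 < ereal e" "ereal e < a" using ereal_dense2 by blast
    have "\<forall>\<^sub>F n in sequentially. \<forall>\<theta>\<in>T. f n \<theta> \<le> e" by (rule ev) (use e(1) in simp)
    then show "\<forall>\<^sub>F n in sequentially. (SUP \<theta>\<in>T. ereal (f n \<theta>)) < a"
    proof eventually_elim
      case (elim n)
      have "(SUP \<theta>\<in>T. ereal (f n \<theta>)) \<le> ereal e" by (rule SUP_least) (use elim in simp)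
      then show ?case using e(2) by (rule order.strict_trans1)
    qed
  qed
  then show ?thesis by (simp add: T_def f_def)
qed

end
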